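(* The assignments $(\mathcal D,\mathcal C;\Gamma)\mapsto(\mathcal G_\Gamma,\epsilon_\Gamma)$ on cross-connections and $m\mapsto m_{|\mathcal G_\Gamma}$ on morphisms of cross-connections constitute a functor $\mathbb I:\mathbf{CC}\to\mathbf{IG}$ from the category of cross-connections to the category of inductive groupoids.
   Context: All composition of maps and morphisms is written left to right. For a small category $\mathcal C$, $v\mathcal C$ is its object set, $\mathcal C$ also denotes its set of morphisms, $\mathcal C(c,d)$ is the set of morphisms from $c$ to $d$. PART 1: THE CATEGORY $\mathbf{IG}$. Biordered sets. Let $E$ be a set with a partial binary operation (juxtaposition, the basic product) with domain $D_E\subseteq E\times E$. Put $e\leqslant_\ell f$ iff $(e,f)\in D_E$ and $ef=e$; $e\leqslant_r f$ iff $(f,e)\in D_E$ and $fe=e$; $\mathscr L=\leqslant_\ell\cap(\leqslant_\ell)^{-1}$, $\mathscr R=\leqslant_r\cap(\leqslant_r)^{-1}$, $\leqslant=\leqslant_\ell\cap\leqslant_r$. $E$ is a biordered set if for all $e,f,g\in E$: (B1) $\leqslant_\ell,\leqslant_r$ are preorders and $D_E=\leqslant_\ell\cup\leqslant_r\cup(\leqslant_\ell\cup\leqslant_r)^{-1}$; (B2) $e\leqslant_\ell f$ implies $e\mathrel{\mathscr L}fe\leqslant f$, and $e\leqslant_r f$ implies $e\mathrel{\mathscr R}ef\leqslant f$; (B3) if $f,g\leqslant_r e$ and $f\leqslant_\ell g$ then $fe\leqslant_\ell ge$ and $(gf)e=(ge)(fe)$; if $f,g\leqslant_\ell e$ and $f\leqslant_r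 g$ then $ef\leqslant_r eg$ and $e(fg)=(ef)(eg)$; (B4) $e\leqslant_\ell f\leqslant_\ell g$ implies $f(ge)=fe$; $e\leqslant_r f\leqslant_r g$ implies $(eg)f=ef$; (B5) if $f,g\leqslant_\ell e$ and $ef\leqslant_r eg$, there is $f'\in E$ with $f'\leqslant_r g$, $f'\leqslant_\ell e$, $ef'=ef$; if $f,g\leqslant_r e$ and $fe\leqslant_\ell ge$, there is $f'\in E$ with $f'\leqslant_\ell g$, $f'\leqslant_r e$, $f'e=fe$. The sandwich set $\mathcal S(e,f)$ consists of all $h$ with $h\leqslant_\ell e$, $h\leqslant_r f$ such that every $g$ with $g\leqslant_\ell e$, $g\leqslant_r f$ satisfies $gf\leqslant_\ell hf$ and $eg\leqslant_r eh$. $E$ is regular if all $\mathcal S(e,f)$ are non-empty. A bimorphism $\theta:E\to E'$ is a map such that $(e,f)\in D_E$ implies $(e\theta,f\theta)\in D_{E'}$ and $(ef)\theta=(e\theta)(f\theta)$; it is regular (for $E$ regular) if $(\mathcal S(e,f))\theta\subseteq\mathcal S'(e\theta,f\theta)$ for all $e,f\in E$, where $\mathcal S'$ denotes sandwich sets in $E'$. Ordered groupoids. A groupoid $\mathcal G$ (domain and codomain maps $\mathbf d,\mathbf r$) with a partial order $\le$ on its morphisms is an ordered groupoid if: (OG1) $u\le x$, $v\le y$, $\mathbf r(u)=\mathbf d(v)$, $\mathbf r(x)=\mathbf d(y)$ imply $uv\le xy$; (OG2) $x\le y$ implies $x^{-1}\le y^{-1}$; (OG3) if $1_e\le 1_{\mathbf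 d(x)}$ there is a unique morphism $e{\downharpoonleft}x\le x$ with domain $e$; (OG3* ) if $1_f\le1_{\mathbf r(x)}$ there is a unique morphism $x{\downharpoonright}f\le x$ with codomain $f$. The order on identities gives an order on $v\mathcal G$. A $v$-isomorphism of ordered groupoids is an order preserving functor whose object map is an order isomorphism. $E$-chains. An $E$-path is a sequence $(e_1,\dots,e_n)$ in $E$ with $e_i\mathrel{(\mathscr R\cup\mathscr L)}e_{i+1}$; $e_i$ is inessential if $e_{i-1}\mathrel{\mathscr R}e_i\mathrel{\mathscr R}e_{i+1}$ or $e_{i-1}\mathrel{\mathscr L}e_i\mathrel{\mathscr L}e_{i+1}$. $E$-chains are classes of $E$-paths with the same endpoints modulo adding/removing inessential elements (and $(e,e)$ is identified with $(e)$). They form a groupoid $\mathcal G(E)$ with object set $E$: $(e_1,\dots,e_n)$ goes from $e_1$ to $e_n$, composition is concatenation. It is an ordered groupoid under: $(e_1,\dots,e_n)\le_E(f_1,\dots,f_m)$ iff $e_1\leqslant f_1$ and $(e_1,\dots,e_n)$ equals the chain $(h_1,\dots,h_m)$, with $h_1=e_1$, $h_i=(f_ih_{i-1})f_i$. An $E$-square $\left[\begin{smallmatrix} e & f \\ g & h \end{smallmatrix}\right]$ requires $e\mathrel{\mathscr R}f\mathrel{\mathscr L}h\mathrel{\mathscr R}g\mathrel{\mathscr L}e$. Singular squares: $\left[\begin{smallmatrix} g & h \\ eg & eh \end{smallmatrix}\right]$ with $g,h\leqslant_\ell e$, $g\mathrel{\mathscr R}h$ (row-singular), and $\left[\begin{smallmatrix}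 g & ge \\ h & he \end{smallmatrix}\right]$ with $g,h\leqslant_r e$, $g\mathrel{\mathscr L}h$ (column-singular). Inductive groupoids. Let $E$ be a regular biordered set, $\mathcal G$ an ordered groupoid and $\epsilon:\mathcal G(E)\to\mathcal G$ a $v$-isomorphism (evaluation functor); identify $v\mathcal G$ with $E$ via $v\epsilon$. $(\mathcal G,\epsilon)$ is an inductive groupoid if: (IG1) whenever $x\in\mathcal G$, $e_i,f_i\in E$ ($i=1,2$), $e_i\leqslant\mathbf d(x)$, $f_i=\mathbf r(e_i{\downharpoonleft}x)$: if $e_1\leqslant_r e_2$, then $f_1\leqslant_r f_2$ and $\epsilon(e_1,e_1e_2)\,(e_1e_2{\downharpoonleft}x)=(e_1{\downharpoonleft}x)\,\epsilon(f_1,f_1f_2)$; and dually if $e_1\leqslant_\ell e_2$, then $f_1\leqslant_\ell f_2$ and $\epsilon(e_1,e_2e_1)\,(e_2e_1{\downharpoonleft}x)=(e_1{\downharpoonleft}x)\,\epsilon(f_1,f_2f_1)$; (IG2) every singular $E$-square $\left[\begin{smallmatrix} e & f \\ g & h \end{smallmatrix}\right]$ satisfies $\epsilon(e,f)\epsilon(f,h)=\epsilon(e,g)\epsilon(g,h)$. An inductive functor $(\mathcal G,\epsilon)\to(\mathcal G',\epsilon')$ is an order preserving functor $F:\mathcal G\to\mathcal G'$ whose object map $vF:E\to E'$ is a regular bimorphism and such that $F(\epsilon(\mathfrak c))=\epsilon'(\mathcal G(vF)(\mathfrak c))$ for every $E$-chain $\mathfrak c$, where $\mathcal G(vF)(e_1,\dots,e_n)=(vF(e_1),\dots,vF(e_n))$.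 $\mathbf{IG}$ is the category of inductive groupoids and inductive functors. PART 2: THE CATEGORY $\mathbf{CC}$. Normal categories. A category with subobjects is a small category $\mathcal C$ with a subcategory $\mathcal P$, $v\mathcal P=v\mathcal C$, that is a strict preorder (at most one morphism between two objects, only identities are isomorphisms), such that every $f\in\mathcal P$ is a monomorphism of $\mathcal C$, and $f=hg$ with $f,g\in\mathcal P$, $h\in\mathcal C$ implies $h\in\mathcal P$. Morphisms of $\mathcal P$ are inclusions; $c'\subseteq c$ means there is an inclusion $j(c',c):c'\to c$; it splits if $j(c',c)q=1_{c'}$ for some $q$, then called a retraction. A normal factorization of $f:c\to d$ is $f=quj$ with $q:c\to c'$ a retraction ($c'\subseteq c$), $u:c'\to d'$ an isomorphism, $j=j(d',d)$ an inclusion; $f^\circ=qu$ is the epimorphic component (uniquely determined by $f$), and $\operatorname{im}f=d'$. A cone with apex $d\in v\mathcal C$ is a map $\gamma:v\mathcal C\to\mathcal C$ with $\gamma(c)\in\mathcal C(c,d)$ for all $c$, $j(c,c')\gamma(c')=\gamma(c)$ whenever $c\subseteq c'$, and $\gamma(c)$ an isomorphism for some $c$. The apex is denoted $c_\gamma$; $\gamma$ is idempotent if $\gamma(c_\gamma)=1_{c_\gamma}$. For an epimorphism $f:c_\gamma\to d$, $\gamma*f$ is the cone $a\mapsto\gamma(a)f$. Cones are multiplied by $\gamma\cdot\sigma=\gamma*(\sigma(c_\gamma))^\circ$. A category with subobjects is normal if every morphism has a normal factorization, every inclusion splits, and each object is the apex of an idempotent cone. Normal dual. For a cone $\gamma$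 in a normal category $\mathcal C$, the $H$-functor $H(\gamma;-):\mathcal C\to\mathbf{Set}$ is $H(\gamma;c)=\{\gamma*f^\circ: f\in\mathcal C(c_\gamma,c)\}$, and $H(\gamma;g):\gamma*f^\circ\mapsto\gamma*(fg)^\circ$ for $g\in\mathcal C(c,d)$. There is a natural isomorphism $\eta_\gamma:H(\gamma;-)\to\mathcal C(c_\gamma,-)$, $\gamma*f^\circ\mapsto f$. The normal dual $N^*\mathcal C$ is the full subcategory of the functor category from $\mathcal C$ to $\mathbf{Set}$ whose objects are the $H$-functors; its inclusions are the natural transformations all of whose components are set inclusions, and with these it is a normal category. The $M$-set is $MH(\gamma;-)=M\gamma=\{c\in v\mathcal C:\gamma(c)\text{ is an isomorphism}\}$ (it depends only on the functor). Cross-connections. The ideal $\langle c\rangle$ is the full subcategory of $\mathcal C$ on $\{d: d\subseteq c\}$. A functor $F$ between normal categories is a local isomorphism if it is inclusion preserving, fully faithful, and for each $c$ restricts to an isomorphism of $\langle c\rangle$ onto $\langle F(c)\rangle$. A cross-connection from $\mathcal D$ to $\mathcal C$ (normal categories) is a triple $(\mathcal D,\mathcal C;\Gamma)$ with $\Gamma:\mathcal D\to N^*\mathcal C$ a local isomorphism such that every $c\in v\mathcal C$ lies in $M\Gamma(d)$ for some $d\in v\mathcal D$. Put $E_\Gamma=\{(c,d)\in v\mathcal C\times v\mathcal D: c\in M\Gamma(d)\}$. For $(c,d)\in E_\Gamma$, $\gamma(c,d)$ is the unique idempotent cone in $\mathcal C$ with apex $c$ and $H(\gamma(c,d);-)=\Gamma(d)$.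 For $(c,d),(c',d')\in E_\Gamma$ and $f\in\mathcal C(c,c')$, the transpose of $f$ is the unique $f^*\in\mathcal D(d',d)$ with $\Gamma(f^* )=\eta_{\gamma(c',d')}\,\mathcal C(f,-)\,\eta_{\gamma(c,d)}^{-1}$, where $\mathcal C(f,-):\mathcal C(c',-)\to\mathcal C(c,-)$ is $h\mapsto fh$. For $(c,d)\in E_\Gamma$, $\delta(c,d)$ is the idempotent cone in $\mathcal D$ with apex $d$ whose component at $d'\in v\mathcal D$ is the transpose $d'\to d$ of $\gamma(c',d')(c):c\to c'$, for any $c'$ with $(c',d')\in E_\Gamma$ (independent of $c'$). A morphism of cross-connections $(\mathcal D,\mathcal C;\Gamma)\to(\mathcal D',\mathcal C';\Gamma')$ is a pair $m=(F_m,G_m)$ of inclusion preserving functors $F_m:\mathcal C\to\mathcal C'$, $G_m:\mathcal D\to\mathcal D'$ such that: (M1) if $(c,d)\in E_\Gamma$ then $(F_m(c),G_m(d))\in E_{\Gamma'}$ and $F_m(\gamma(c,d)(c'))=\gamma(F_m(c),G_m(d))(F_m(c'))$ for all $c'\in v\mathcal C$; (M2) if $(c,d),(c',d')\in E_\Gamma$ and $f^*:d'\to d$ is the transpose of $f:c\to c'$, then $G_m(f^* )$ is the transpose of $F_m(f)$. $\mathbf{CC}$ is the category of cross-connections with these morphisms, composed componentwise. PART 3: THE ASSIGNMENTS. Let $(\mathcal D,\mathcal C;\Gamma)$ be a cross-connection. $E_\Gamma$ is a regular biordered set with $(c,d)\leqslant_\ell(c',d')$ iff $c\subseteq c'$,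 $(c,d)\leqslant_r(c',d')$ iff $d\subseteq d'$, and basic products $(c,d)(c',d')$ equal to $(c,d)$ if $c\subseteq c'$; $(c',\operatorname{im}\delta(c,d)(d'))$ if $c'\subseteq c$; $(c',d')$ if $d'\subseteq d$; $(\operatorname{im}\gamma(c',d')(c),d)$ if $d\subseteq d'$. The groupoid $\mathcal G_\Gamma$ has object set $E_\Gamma$; a morphism from $(c,d)$ to $(c',d')$ is a pair $(f,g)$ where $f:c\to c'$ is an isomorphism in $\mathcal C$ and $g=(f^{-1})^*:d\to d'$ is the transpose of $f^{-1}$; composition is componentwise. It is ordered by: for $(f,g):(c,d)\to(c',d')$ and $(f_1,g_1):(c_1,d_1)\to(c_1',d_1')$, $(f,g)\le_\Gamma(f_1,g_1)$ iff $c\subseteq c_1$, $d\subseteq d_1$, $c'\subseteq c_1'$, $d'\subseteq d_1'$ and $(f,g)=((j(c,c_1)f_1)^\circ,(j(d,d_1)g_1)^\circ)$. The functor $\epsilon_\Gamma:\mathcal G(E_\Gamma)\to\mathcal G_\Gamma$ is the identity on objects and sends the chain $((c_1,d_1),\dots,(c_n,d_n))$ to $((\gamma_1\gamma_2\cdots\gamma_n)(c_1),(\delta_1\delta_2\cdots\delta_n)(d_1))$, where $\gamma_i=\gamma(c_i,d_i)$, $\delta_i=\delta(c_i,d_i)$ and cones (in $\mathcal C$, respectively in $\mathcal D$) are multiplied by the rule $\gamma\cdot\sigma=\gamma*(\sigma(c_\gamma))^\circ$. For a morphism $m=(F_m,G_m):\Gamma\to\Gamma'$ of cross-connections, $m_{|\mathcal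 G_\Gamma}:\mathcal G_\Gamma\to\mathcal G_{\Gamma'}$ is $(c,d)\mapsto(F_m(c),G_m(d))$, $(f,g)\mapsto(F_m(f),G_m(g))$. *)

theory Defs
  imports Main "HOL-Library.FuncSet"
begin

section \<open>Categories and functors\<close>

text \<open>
  Composition is written from left to right: \<open>f \<cdot>\<^bsub>C\<^esub> g\<close> is \<open>f\<close> followed by \<open>g\<close>.
  The values of the operations outside their domains are irrelevant.
\<close>

record ('o, 'm) cat =
  Obj :: "'o set"
  Mor :: "'m set"
  Dom :: "'m \<Rightarrow> 'o"
  Cod :: "'m \<Rightarrow> 'o"
  idm :: "'o \<Rightarrow> 'm"
  Comp :: "'m \<Rightarrow> 'm \<Rightarrow> 'm"  (infixl "\<cdot>\<index>" 70)

locale category =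
  fixes C :: "('o, 'm, 'z) cat_scheme" (structure)
  assumes Dom_in: "f \<in> Mor C \<Longrightarrow> Dom C f \<in> Obj C"
    and Cod_in: "f \<in> Mor C \<Longrightarrow> Cod C f \<in> Obj C"
    and idm_in: "c \<in> Obj C \<Longrightarrow> idm C c \<in> Mor C"
    and Dom_idm: "c \<in> Obj C \<Longrightarrow> Dom C (idm C c) = c"
    and Cod_idm: "c \<in> Obj C \<Longrightarrow> Cod C (idm C c) = c"
    and Comp_in: "\<lbrakk>f \<in> Mor C; g \<in> Mor C; Cod C f = Dom C g\<rbrakk> \<Longrightarrow> f \<cdot> g \<in> Mor C"
    and Dom_Comp: "\<lbrakk>f \<in> Mor C; g \<in> Mor C; Cod C f = Dom C g\<rbrakk> \<Longrightarrow> Dom C (f \<cdot> g) = Dom C f"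
    and Cod_Comp: "\<lbrakk>f \<in> Mor C; g \<in> Mor C; Cod C f = Dom C g\<rbrakk> \<Longrightarrow> Cod C (f \<cdot> g) = Cod C g"
    and idm_left: "f \<in> Mor C \<Longrightarrow> idm C (Dom C f) \<cdot> f = f"
    and idm_right: "f \<in> Mor C \<Longrightarrow> f \<cdot> idm C (Cod C f) = f"
    and Comp_assoc: "\<lbrakk>f \<in> Mor C; g \<in> Mor C; h \<in> Mor C; Cod C f = Dom C g; Cod C g = Dom C h\<rbrakk>
      \<Longrightarrow> (f \<cdot> g) \<cdot> h = f \<cdot> (g \<cdot> h)"

definition Hom :: "('o, 'm, 'z) cat_scheme \<Rightarrow> 'o \<Rightarrow> 'o \<Rightarrow> 'm set" where
  "Hom C c d = {f \<in> Mor C. Dom C f = c \<and> Cod C f = d}"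

definition inverses :: "('o, 'm, 'z) cat_scheme \<Rightarrow> 'm \<Rightarrow> 'm \<Rightarrow> bool" where
  "inverses C f g \<longleftrightarrow> f \<in> Mor C \<and> g \<in> Mor C \<and> Cod C f = Dom C g \<and> Cod C g = Dom C f \<and>
     f \<cdot>\<^bsub>C\<^esub> g = idm C (Dom C f) \<and> g \<cdot>\<^bsub>C\<^esub> f = idm C (Cod C f)"

definition is_iso :: "('o, 'm, 'z) cat_scheme \<Rightarrow> 'm \<Rightarrow> bool" where
  "is_iso C f \<longleftrightarrow> (\<exists>g. inverses C f g)"

definition inv_mor :: "('o, 'm, 'z) cat_scheme \<Rightarrow> 'm \<Rightarrow> 'm" where
  "inv_mor C f = (THE g. inverses C f g)"

definition is_mono :: "('o, 'm, 'z) cat_scheme \<Rightarrow> 'm \<Rightarrow> bool" where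
  "is_mono C f \<longleftrightarrow> f \<in> Mor C \<and>
     (\<forall>g\<in>Mor C. \<forall>h\<in>Mor C. Dom C g = Dom C h \<and> Cod C g = Dom C f \<and> Cod C h = Dom C f \<and>
        g \<cdot>\<^bsub>C\<^esub> f = h \<cdot>\<^bsub>C\<^esub> f \<longrightarrow> g = h)"

definition full_subcat :: "('o, 'm, 'z) cat_scheme \<Rightarrow> 'o set \<Rightarrow> ('o, 'm) cat" where
  "full_subcat C S = \<lparr>Obj = Obj C \<inter> S, Mor = {f \<in> Mor C. Dom C f \<in> S \<and> Cod C f \<in> S},
     Dom = Dom C, Cod = Cod C, idm = idm C, Comp = Comp C\<rparr>"

text \<open>
  Both maps of a functor are required to be extensional, so that two functors with the same domain
  are equal as soon as they agree on all objects and morphisms.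
\<close>

record ('o, 'm, 'p, 'n) ftor =
  fobj :: "'o \<Rightarrow> 'p"
  fmor :: "'m \<Rightarrow> 'n"

definition is_functor ::
  "('o, 'm, 'y) cat_scheme \<Rightarrow> ('p, 'n, 'z) cat_scheme \<Rightarrow> ('o, 'm, 'p, 'n) ftor \<Rightarrow> bool" where
  "is_functor A B F \<longleftrightarrow> category A \<and> category B \<and>
     fobj F \<in> Obj A \<rightarrow>\<^sub>E Obj B \<and> fmor F \<in> Mor A \<rightarrow>\<^sub>E Mor B \<and>
     (\<forall>f\<in>Mor A. Dom B (fmor F f) = fobj F (Dom A f) \<and> Cod B (fmor F f) = fobj F (Cod A f)) \<and>
     (\<forall>a\<in>Obj A. fmor F (idm A a) = idm B (fobj F a)) \<and>
     (\<forall>f\<in>Mor A. \<forall>g\<in>Mor A. Cod A f = Dom A g \<longrightarrow>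
        fmor F (f \<cdot>\<^bsub>A\<^esub> g) = fmor F f \<cdot>\<^bsub>B\<^esub> fmor F g)"

definition id_ftor :: "('o, 'm, 'z) cat_scheme \<Rightarrow> ('o, 'm, 'o, 'm) ftor" where
  "id_ftor A = \<lparr>fobj = (\<lambda>a\<in>Obj A. a), fmor = (\<lambda>f\<in>Mor A. f)\<rparr>"

text \<open>The functor \<open>F\<close> followed by the functor \<open>G\<close>, where \<open>A\<close> is the domain of \<open>F\<close>.\<close>

definition comp_ftor ::
  "('o, 'm, 'z) cat_scheme \<Rightarrow> ('o, 'm, 'p, 'n) ftor \<Rightarrow> ('p, 'n, 'q, 'k) ftor \<Rightarrow> ('o, 'm, 'q, 'k) ftor" where
  "comp_ftor A F G =
     \<lparr>fobj = (\<lambda>a\<in>Obj A. fobj G (fobj F a)), fmor = (\<lambda>f\<in>Mor A. fmor G (fmor F f))\<rparr>"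

definition restrict_ftor ::
  "('o, 'm, 'z) cat_scheme \<Rightarrow> ('o, 'm, 'p, 'n) ftor \<Rightarrow> ('o, 'm, 'p, 'n) ftor" where
  "restrict_ftor A F = \<lparr>fobj = restrict (fobj F) (Obj A), fmor = restrict (fmor F) (Mor A)\<rparr>"

definition cat_isomorphism ::
  "('o, 'm, 'y) cat_scheme \<Rightarrow> ('p, 'n, 'z) cat_scheme \<Rightarrow> ('o, 'm, 'p, 'n) ftor \<Rightarrow> bool" where
  "cat_isomorphism A B F \<longleftrightarrow> is_functor A B F \<and>
     bij_betw (fobj F) (Obj A) (Obj B) \<and> bij_betw (fmor F) (Mor A) (Mor B)"

definition fully_faithful ::
  "('o, 'm, 'y) cat_scheme \<Rightarrow> ('p, 'n, 'z) cat_scheme \<Rightarrow> ('o, 'm, 'p, 'n) ftor \<Rightarrow> bool" where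
  "fully_faithful A B F \<longleftrightarrow>
     (\<forall>a\<in>Obj A. \<forall>b\<in>Obj A. bij_betw (fmor F) (Hom A a b) (Hom B (fobj F a) (fobj F b)))"

definition nat_trans ::
  "('o, 'm, 'y) cat_scheme \<Rightarrow> ('p, 'n, 'z) cat_scheme \<Rightarrow> ('o, 'm, 'p, 'n) ftor \<Rightarrow> ('o, 'm, 'p, 'n) ftor \<Rightarrow>
     ('o \<Rightarrow> 'n) \<Rightarrow> bool" where
  "nat_trans A B F G \<eta> \<longleftrightarrow> is_functor A B F \<and> is_functor A B G \<and> \<eta> \<in> extensional (Obj A) \<and>
     (\<forall>a\<in>Obj A. \<eta> a \<in> Hom B (fobj F a) (fobj G a)) \<and>
     (\<forall>f\<in>Mor A. fmor F f \<cdot>\<^bsub>B\<^esub> \<eta> (Cod A f) = \<eta> (Dom A f) \<cdot>\<^bsub>B\<^esub> fmor G f)"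

definition functor_cat ::
  "('o, 'm, 'y) cat_scheme \<Rightarrow> ('p, 'n, 'z) cat_scheme \<Rightarrow>
     (('o, 'm, 'p, 'n) ftor, ('o, 'm, 'p, 'n) ftor \<times> ('o \<Rightarrow> 'n) \<times> ('o, 'm, 'p, 'n) ftor) cat" where
  "functor_cat A B = \<lparr>Obj = {F. is_functor A B F}, Mor = {(F, \<eta>, G). nat_trans A B F G \<eta>},
     Dom = (\<lambda>(F, \<eta>, G). F), Cod = (\<lambda>(F, \<eta>, G). G),
     idm = (\<lambda>F. (F, \<lambda>a\<in>Obj A. idm B (fobj F a), F)),
     Comp = (\<lambda>(F, \<eta>, G) (G', \<theta>, H). (F, \<lambda>a\<in>Obj A. \<eta> a \<cdot>\<^bsub>B\<^esub> \<theta> a, H))\<rparr>"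

text \<open>
  The category of sets with elements in a fixed type.  A morphism is a triple of domain, extensional
  function, codomain.
\<close>

type_synonym 'a set_mor = "'a set \<times> ('a \<Rightarrow> 'a) \<times> 'a set"

definition set_cat :: "('a set, 'a set_mor) cat" where
  "set_cat = \<lparr>Obj = UNIV, Mor = {(X, f, Y). f \<in> X \<rightarrow>\<^sub>E Y},
     Dom = (\<lambda>(X, f, Y). X), Cod = (\<lambda>(X, f, Y). Y),
     idm = (\<lambda>X. (X, \<lambda>x\<in>X. x, X)),
     Comp = (\<lambda>(X, f, Y) (Y', g, Z). (X, \<lambda>x\<in>X. g (f x), Z))\<rparr>"

definition set_inclusion :: "'a set_mor \<Rightarrow> bool" where
  "set_inclusion \<phi> \<longleftrightarrow> (\<exists>X Y. X \<subseteq> Y \<and> \<phi> = (X, \<lambda>x\<in>X. x, Y))"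


section \<open>Biordered sets\<close>

text \<open>\<open>bdom E\<close> is the domain of the partial binary operation \<open>bprod E\<close>.\<close>

record 'e biord =
  elems :: "'e set"
  bdom :: "('e \<times> 'e) set"
  bprod :: "'e \<Rightarrow> 'e \<Rightarrow> 'e"  (infixl "\<star>\<index>" 70)

definition lel :: "'e biord \<Rightarrow> 'e \<Rightarrow> 'e \<Rightarrow> bool" where
  "lel E e f \<longleftrightarrow> (e, f) \<in> bdom E \<and> e \<star>\<^bsub>E\<^esub> f = e"

definition ler :: "'e biord \<Rightarrow> 'e \<Rightarrow> 'e \<Rightarrow> bool" where
  "ler E e f \<longleftrightarrow> (f, e) \<in> bdom E \<and> f \<star>\<^bsub>E\<^esub> e = e"

definition Lrel :: "'e biord \<Rightarrow> 'e \<Rightarrow> 'e \<Rightarrow> bool" where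
  "Lrel E e f \<longleftrightarrow> lel E e f \<and> lel E f e"

definition Rrel :: "'e biord \<Rightarrow> 'e \<Rightarrow> 'e \<Rightarrow> bool" where
  "Rrel E e f \<longleftrightarrow> ler E e f \<and> ler E f e"

definition nle :: "'e biord \<Rightarrow> 'e \<Rightarrow> 'e \<Rightarrow> bool" where
  "nle E e f \<longleftrightarrow> lel E e f \<and> ler E e f"

text \<open>
  In (B2)--(B5) all products that occur are defined: each is either given by one of the displayed
  relations or follows from (B1) and the preceding conclusions.
\<close>

locale biordered_set =
  fixes E :: "'e biord" (structure)
  assumes bdom_subset: "bdom E \<subseteq> elems E \<times> elems E"
    and bprod_closed: "(e, f) \<in> bdom E \<Longrightarrow> e \<star> f \<in> elems E"
    and B1_refl_l: "e \<in> elems E \<Longrightarrow> lel E e e"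
    and B1_refl_r: "e \<in> elems E \<Longrightarrow> ler E e e"
    and B1_trans_l: "\<lbrakk>lel E e f; lel E f g\<rbrakk> \<Longrightarrow> lel E e g"
    and B1_trans_r: "\<lbrakk>ler E e f; ler E f g\<rbrakk> \<Longrightarrow> ler E e g"
    and B1_bdom: "bdom E = {(e, f). lel E e f \<or> ler E e f \<or> lel E f e \<or> ler E f e}"
    and B2_l: "lel E e f \<Longrightarrow> Lrel E e (f \<star> e) \<and> nle E (f \<star> e) f"
    and B2_r: "ler E e f \<Longrightarrow> Rrel E e (e \<star> f) \<and> nle E (e \<star> f) f"
    and B3_r: "\<lbrakk>ler E f e; ler E g e; lel E f g\<rbrakk>
      \<Longrightarrow> lel E (f \<star> e) (g \<star> e) \<and> (g \<star> f) \<star> e = (g \<star> e) \<star> (f \<star> e)"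
    and B3_l: "\<lbrakk>lel E f e; lel E g e; ler E f g\<rbrakk>
      \<Longrightarrow> ler E (e \<star> f) (e \<star> g) \<and> e \<star> (f \<star> g) = (e \<star> f) \<star> (e \<star> g)"
    and B4_l: "\<lbrakk>lel E e f; lel E f g\<rbrakk> \<Longrightarrow> f \<star> (g \<star> e) = f \<star> e"
    and B4_r: "\<lbrakk>ler E e f; ler E f g\<rbrakk> \<Longrightarrow> (e \<star> g) \<star> f = e \<star> f"
    and B5_l: "\<lbrakk>lel E f e; lel E g e; ler E (e \<star> f) (e \<star> g)\<rbrakk>
      \<Longrightarrow> \<exists>f'\<in>elems E. ler E f' g \<and> lel E f' e \<and> e \<star> f' = e \<star> f"
    and B5_r: "\<lbrakk>ler E f e; ler E g e; lel E (f \<star> e) (g \<star> e)\<rbrakk>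
      \<Longrightarrow> \<exists>f'\<in>elems E. lel E f' g \<and> ler E f' e \<and> f' \<star> e = f \<star> e"

definition sandwich :: "'e biord \<Rightarrow> 'e \<Rightarrow> 'e \<Rightarrow> 'e set" where
  "sandwich E e f = {h \<in> elems E. lel E h e \<and> ler E h f \<and>
     (\<forall>g\<in>elems E. lel E g e \<and> ler E g f \<longrightarrow>
        lel E (g \<star>\<^bsub>E\<^esub> f) (h \<star>\<^bsub>E\<^esub> f) \<and> ler E (e \<star>\<^bsub>E\<^esub> g) (e \<star>\<^bsub>E\<^esub> h))}"

definition regular_biordered_set :: "'e biord \<Rightarrow> bool" where
  "regular_biordered_set E \<longleftrightarrow>
     biordered_set E \<and> (\<forall>e\<in>elems E. \<forall>f\<in>elems E. sandwich E e f \<noteq> {})"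

definition bimorphism :: "'e biord \<Rightarrow> 'h biord \<Rightarrow> ('e \<Rightarrow> 'h) \<Rightarrow> bool" where
  "bimorphism E E' \<theta> \<longleftrightarrow> \<theta> ` elems E \<subseteq> elems E' \<and>
     (\<forall>(e, f)\<in>bdom E. (\<theta> e, \<theta> f) \<in> bdom E' \<and> \<theta> (e \<star>\<^bsub>E\<^esub> f) = \<theta> e \<star>\<^bsub>E'\<^esub> \<theta> f)"

definition regular_bimorphism :: "'e biord \<Rightarrow> 'h biord \<Rightarrow> ('e \<Rightarrow> 'h) \<Rightarrow> bool" where
  "regular_bimorphism E E' \<theta> \<longleftrightarrow> bimorphism E E' \<theta> \<and>
     (\<forall>e\<in>elems E. \<forall>f\<in>elems E. \<theta> ` sandwich E e f \<subseteq> sandwich E' (\<theta> e) (\<theta> f))"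


section \<open>Ordered groupoids\<close>

record ('o, 'm) ogpd = "('o, 'm) cat" +
  Ord :: "('m \<times> 'm) set"

locale ordered_groupoid = category G
  for G :: "('o, 'm) ogpd" (structure) +
  assumes all_iso: "x \<in> Mor G \<Longrightarrow> is_iso G x"
    and Ord_subset: "Ord G \<subseteq> Mor G \<times> Mor G"
    and Ord_refl: "x \<in> Mor G \<Longrightarrow> (x, x) \<in> Ord G"
    and Ord_antisym: "\<lbrakk>(x, y) \<in> Ord G; (y, x) \<in> Ord G\<rbrakk> \<Longrightarrow> x = y"
    and Ord_trans: "\<lbrakk>(x, y) \<in> Ord G; (y, z) \<in> Ord G\<rbrakk> \<Longrightarrow> (x, z) \<in> Ord G"
    and OG1: "\<lbrakk>(u, x) \<in> Ord G; (v, y) \<in> Ord G; Cod G u = Dom G v; Cod G x = Dom G y\<rbrakk>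
      \<Longrightarrow> (u \<cdot> v, x \<cdot> y) \<in> Ord G"
    and OG2: "(x, y) \<in> Ord G \<Longrightarrow> (inv_mor G x, inv_mor G y) \<in> Ord G"
    and OG3: "\<lbrakk>x \<in> Mor G; e \<in> Obj G; (idm G e, idm G (Dom G x)) \<in> Ord G\<rbrakk>
      \<Longrightarrow> \<exists>!y. (y, x) \<in> Ord G \<and> Dom G y = e"
    and OG3': "\<lbrakk>x \<in> Mor G; f \<in> Obj G; (idm G f, idm G (Cod G x)) \<in> Ord G\<rbrakk>
      \<Longrightarrow> \<exists>!y. (y, x) \<in> Ord G \<and> Cod G y = f"

definition grestrict :: "('o, 'm) ogpd \<Rightarrow> 'o \<Rightarrow> 'm \<Rightarrow> 'm" where
  "grestrict G e x = (THE y. (y, x) \<in> Ord G \<and> Dom G y = e)"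

definition vle :: "('o, 'm) ogpd \<Rightarrow> 'o \<Rightarrow> 'o \<Rightarrow> bool" where
  "vle G e f \<longleftrightarrow> (idm G e, idm G f) \<in> Ord G"

definition order_preserving :: "('o, 'm) ogpd \<Rightarrow> ('p, 'n) ogpd \<Rightarrow> ('o, 'm, 'p, 'n) ftor \<Rightarrow> bool" where
  "order_preserving G H F \<longleftrightarrow> (\<forall>(x, y)\<in>Ord G. (fmor F x, fmor F y) \<in> Ord H)"

definition v_isomorphism :: "('o, 'm) ogpd \<Rightarrow> ('p, 'n) ogpd \<Rightarrow> ('o, 'm, 'p, 'n) ftor \<Rightarrow> bool" where
  "v_isomorphism G H F \<longleftrightarrow> is_functor G H F \<and> order_preserving G H F \<and>
     bij_betw (fobj F) (Obj G) (Obj H) \<and>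
     (\<forall>e\<in>Obj G. \<forall>f\<in>Obj G. vle G e f \<longleftrightarrow> vle H (fobj F e) (fobj F f))"


section \<open>The groupoid of \<open>E\<close>-chains\<close>

definition epath :: "'e biord \<Rightarrow> 'e list \<Rightarrow> bool" where
  "epath E p \<longleftrightarrow> p \<noteq> [] \<and> set p \<subseteq> elems E \<and> successively (\<lambda>e f. Rrel E e f \<or> Lrel E e f) p"

inductive chain_step :: "'e biord \<Rightarrow> 'e list \<Rightarrow> 'e list \<Rightarrow> bool" for E where
  inessential: "\<lbrakk>epath E (xs @ [a, b, c] @ ys);
      (Rrel E a b \<and> Rrel E b c) \<or> (Lrel E a b \<and> Lrel E b c)\<rbrakk>
    \<Longrightarrow> chain_step E (xs @ [a, b, c] @ ys) (xs @ [a, c] @ ys)"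
| doubled: "e \<in> elems E \<Longrightarrow> chain_step E [e, e] [e]"

definition chain_of :: "'e biord \<Rightarrow> 'e list \<Rightarrow> 'e list set" where
  "chain_of E p = {q. equivclp (chain_step E) p q}"

definition chains :: "'e biord \<Rightarrow> 'e list set set" where
  "chains E = {chain_of E p | p. epath E p}"

text \<open>
  \<open>restrict_path E h [f\<^sub>1, \<dots>, f\<^sub>m]\<close> is the sequence \<open>[h\<^sub>1, \<dots>, h\<^sub>m]\<close> with \<open>h\<^sub>1 = h\<close>
  and \<open>h\<^sub>i = (f\<^sub>i h\<^sub>i\<^sub>-\<^sub>1) f\<^sub>i\<close>.
\<close>

fun restrict_path :: "'e biord \<Rightarrow> 'e \<Rightarrow> 'e list \<Rightarrow> 'e list" where
  "restrict_path E h [] = []"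
| "restrict_path E h [f] = [h]"
| "restrict_path E h (f # f' # fs) = h # restrict_path E ((f' \<star>\<^bsub>E\<^esub> h) \<star>\<^bsub>E\<^esub> f') (f' # fs)"

text \<open>
  All paths in a chain have the same endpoints.  In a composite the common endpoint of the two paths
  is written only once.
\<close>

definition chain_gpd :: "'e biord \<Rightarrow> ('e, 'e list set) ogpd" where
  "chain_gpd E = \<lparr>Obj = elems E, Mor = chains E,
     Dom = (\<lambda>X. hd (SOME p. p \<in> X)), Cod = (\<lambda>X. last (SOME p. p \<in> X)),
     idm = (\<lambda>e. chain_of E [e]),
     Comp = (\<lambda>X Y. \<Union>p\<in>X. \<Union>q\<in>Y. chain_of E (p @ tl q)),
     Ord = {(X, Y). X \<in> chains E \<and> Y \<in> chains E \<and>
       (\<exists>p\<in>X. \<exists>q\<in>Y. nle E (hd p) (hd q) \<and> X = chain_of E (restrict_path E (hd p) q))}\<rparr>"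

definition chain_map :: "'h biord \<Rightarrow> ('e \<Rightarrow> 'h) \<Rightarrow> 'e list set \<Rightarrow> 'h list set" where
  "chain_map E' \<theta> X = (\<Union>p\<in>X. chain_of E' (map \<theta> p))"

text \<open>The matrix \<open>[e f; g h]\<close> is passed row by row.\<close>

definition E_square :: "'e biord \<Rightarrow> 'e \<Rightarrow> 'e \<Rightarrow> 'e \<Rightarrow> 'e \<Rightarrow> bool" where
  "E_square E e f g h \<longleftrightarrow> Rrel E e f \<and> Lrel E f h \<and> Rrel E h g \<and> Lrel E g e"

definition row_singular :: "'e biord \<Rightarrow> 'e \<Rightarrow> 'e \<Rightarrow> 'e \<Rightarrow> 'e \<Rightarrow> bool" where
  "row_singular E g h g' h' \<longleftrightarrow> E_square E g h g' h' \<and>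
     (\<exists>e\<in>elems E. lel E g e \<and> lel E h e \<and> Rrel E g h \<and> g' = e \<star>\<^bsub>E\<^esub> g \<and> h' = e \<star>\<^bsub>E\<^esub> h)"

definition column_singular :: "'e biord \<Rightarrow> 'e \<Rightarrow> 'e \<Rightarrow> 'e \<Rightarrow> 'e \<Rightarrow> bool" where
  "column_singular E g g' h h' \<longleftrightarrow> E_square E g g' h h' \<and>
     (\<exists>e\<in>elems E. ler E g e \<and> ler E h e \<and> Lrel E g h \<and> g' = g \<star>\<^bsub>E\<^esub> e \<and> h' = h \<star>\<^bsub>E\<^esub> e)"


section \<open>Inductive groupoids and the category \<open>IG\<close>\<close>

text \<open>
  The biordered set \<open>E\<close> over which an inductive groupoid \<open>(G, \<epsilon>)\<close> lives is recorded as a separate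
  component.  The identification of the objects of \<open>G\<close> with \<open>E\<close> along the object map of \<open>\<epsilon>\<close> is made
  literally: the object set of \<open>G\<close> is \<open>E\<close> and \<open>\<epsilon>\<close> is the identity on objects.
\<close>

record ('e, 'm) igpd =
  ibi :: "'e biord"
  igp :: "('e, 'm) ogpd"
  iev :: "('e, 'e list set, 'e, 'm) ftor"

abbreviation ev :: "('e, 'm) igpd \<Rightarrow> 'e \<Rightarrow> 'e \<Rightarrow> 'm" where
  "ev I e f \<equiv> fmor (iev I) (chain_of (ibi I) [e, f])"

definition IG1 :: "('e, 'm) igpd \<Rightarrow> bool" where
  "IG1 I \<longleftrightarrow> (let E = ibi I; G = igp I in
     \<forall>x\<in>Mor G. \<forall>e1\<in>elems E. \<forall>e2\<in>elems E. \<forall>f1\<in>elems E. \<forall>f2\<in>elems E.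
       nle E e1 (Dom G x) \<and> nle E e2 (Dom G x) \<and>
       f1 = Cod G (grestrict G e1 x) \<and> f2 = Cod G (grestrict G e2 x) \<longrightarrow>
         (ler E e1 e2 \<longrightarrow> ler E f1 f2 \<and>
            ev I e1 (e1 \<star>\<^bsub>E\<^esub> e2) \<cdot>\<^bsub>G\<^esub> grestrict G (e1 \<star>\<^bsub>E\<^esub> e2) x =
            grestrict G e1 x \<cdot>\<^bsub>G\<^esub> ev I f1 (f1 \<star>\<^bsub>E\<^esub> f2)) \<and>
         (lel E e1 e2 \<longrightarrow> lel E f1 f2 \<and>
            ev I e1 (e2 \<star>\<^bsub>E\<^esub> e1) \<cdot>\<^bsub>G\<^esub> grestrict G (e2 \<star>\<^bsub>E\<^esub> e1) x =
            grestrict G e1 x \<cdot>\<^bsub>G\<^esub> ev I f1 (f2 \<star>\<^bsub>E\<^esub> f1)))"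

definition IG2 :: "('e, 'm) igpd \<Rightarrow> bool" where
  "IG2 I \<longleftrightarrow> (\<forall>e f g h. row_singular (ibi I) e f g h \<or> column_singular (ibi I) e f g h \<longrightarrow>
     ev I e f \<cdot>\<^bsub>igp I\<^esub> ev I f h = ev I e g \<cdot>\<^bsub>igp I\<^esub> ev I g h)"

definition inductive_groupoid :: "('e, 'm) igpd \<Rightarrow> bool" where
  "inductive_groupoid I \<longleftrightarrow>
     regular_biordered_set (ibi I) \<and> ordered_groupoid (igp I) \<and>
     v_isomorphism (chain_gpd (ibi I)) (igp I) (iev I) \<and>
     Obj (igp I) = elems (ibi I) \<and> (\<forall>e\<in>elems (ibi I). fobj (iev I) e = e) \<and>
     IG1 I \<and> IG2 I"

definition inductive_functor ::
  "('e, 'm) igpd \<Rightarrow> ('h, 'n) igpd \<Rightarrow> ('e, 'm, 'h, 'n) ftor \<Rightarrow> bool" where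
  "inductive_functor I I' F \<longleftrightarrow>
     is_functor (igp I) (igp I') F \<and> order_preserving (igp I) (igp I') F \<and>
     regular_bimorphism (ibi I) (ibi I') (fobj F) \<and>
     (\<forall>X\<in>chains (ibi I).
        fmor F (fmor (iev I) X) = fmor (iev I') (chain_map (ibi I') (fobj F) X))"

text \<open>
  \<open>IG\<close>, and \<open>CC\<close> below, consist of all inductive groupoids (cross-connections) whose elements are
  drawn from fixed types; the type variables play the role of a universe.  A morphism is a triple
  whose outer components are its domain and codomain.
\<close>

definition IG ::
  "(('e, 'm) igpd, ('e, 'm) igpd \<times> ('e, 'm, 'e, 'm) ftor \<times> ('e, 'm) igpd) cat" where
  "IG = \<lparr>Obj = {I. inductive_groupoid I},
     Mor = {(I, F, I'). inductive_groupoid I \<and> inductive_groupoid I' \<and> inductive_functor I I' F},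
     Dom = (\<lambda>(I, F, I'). I), Cod = (\<lambda>(I, F, I'). I'),
     idm = (\<lambda>I. (I, id_ftor (igp I), I)),
     Comp = (\<lambda>(I, F, I') (I'', F', I'''). (I, comp_ftor (igp I) F F', I'''))\<rparr>"


section \<open>Normal categories\<close>

text \<open>\<open>Incl C\<close> is the set of morphisms of the subcategory of inclusions.\<close>

record ('o, 'm) scat = "('o, 'm) cat" +
  Incl :: "'m set"

definition incl_cat :: "('o, 'm) scat \<Rightarrow> ('o, 'm) cat" where
  "incl_cat C = \<lparr>Obj = Obj C, Mor = Incl C, Dom = Dom C, Cod = Cod C, idm = idm C, Comp = Comp C\<rparr>"

locale category_with_subobjects = category C
  for C :: "('o, 'm) scat" (structure) +
  assumes Incl_subset: "Incl C \<subseteq> Mor C"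
    and incl_category: "category (incl_cat C)"
    and incl_unique: "\<lbrakk>j \<in> Incl C; k \<in> Incl C; Dom C j = Dom C k; Cod C j = Cod C k\<rbrakk> \<Longrightarrow> j = k"
    and incl_strict: "is_iso (incl_cat C) j \<Longrightarrow> j = idm C (Dom C j)"
    and incl_mono: "j \<in> Incl C \<Longrightarrow> is_mono C j"
    and incl_cancel: "\<lbrakk>f \<in> Incl C; g \<in> Incl C; h \<in> Mor C; Cod C h = Dom C g; f = h \<cdot> g\<rbrakk>
      \<Longrightarrow> h \<in> Incl C"

definition subobj :: "('o, 'm) scat \<Rightarrow> 'o \<Rightarrow> 'o \<Rightarrow> bool" where
  "subobj C c' c \<longleftrightarrow> (\<exists>j\<in>Incl C. Dom C j = c' \<and> Cod C j = c)"

definition incl :: "('o, 'm) scat \<Rightarrow> 'o \<Rightarrow> 'o \<Rightarrow> 'm" where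
  "incl C c' c = (THE j. j \<in> Incl C \<and> Dom C j = c' \<and> Cod C j = c)"

definition is_retraction :: "('o, 'm) scat \<Rightarrow> 'o \<Rightarrow> 'o \<Rightarrow> 'm \<Rightarrow> bool" where
  "is_retraction C c c' q \<longleftrightarrow> subobj C c' c \<and> q \<in> Hom C c c' \<and> incl C c' c \<cdot>\<^bsub>C\<^esub> q = idm C c'"

definition normal_factorization :: "('o, 'm) scat \<Rightarrow> 'm \<Rightarrow> 'm \<Rightarrow> 'm \<Rightarrow> 'm \<Rightarrow> bool" where
  "normal_factorization C f q u j \<longleftrightarrow>
     f = (q \<cdot>\<^bsub>C\<^esub> u) \<cdot>\<^bsub>C\<^esub> j \<and>
     is_retraction C (Dom C f) (Dom C u) q \<and> is_iso C u \<and>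
     j \<in> Incl C \<and> Dom C j = Cod C u \<and> Cod C j = Cod C f"

definition epi :: "('o, 'm) scat \<Rightarrow> 'm \<Rightarrow> 'm" where
  "epi C f = (THE p. \<exists>q u j. normal_factorization C f q u j \<and> p = q \<cdot>\<^bsub>C\<^esub> u)"

definition im :: "('o, 'm) scat \<Rightarrow> 'm \<Rightarrow> 'o" where
  "im C f = (THE d. \<exists>q u j. normal_factorization C f q u j \<and> d = Dom C j)"

type_synonym ('o, 'm) cone = "'o \<Rightarrow> 'm"

definition is_cone :: "('o, 'm) scat \<Rightarrow> 'o \<Rightarrow> ('o, 'm) cone \<Rightarrow> bool" where
  "is_cone C d \<gamma> \<longleftrightarrow> d \<in> Obj C \<and> \<gamma> \<in> extensional (Obj C) \<and>
     (\<forall>c\<in>Obj C. \<gamma> c \<in> Hom C c d) \<and>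
     (\<forall>c\<in>Obj C. \<forall>c'\<in>Obj C. subobj C c c' \<longrightarrow> incl C c c' \<cdot>\<^bsub>C\<^esub> \<gamma> c' = \<gamma> c) \<and>
     (\<exists>c\<in>Obj C. is_iso C (\<gamma> c))"

definition apex :: "('o, 'm) scat \<Rightarrow> ('o, 'm) cone \<Rightarrow> 'o" where
  "apex C \<gamma> = (THE d. is_cone C d \<gamma>)"

definition idempotent_cone :: "('o, 'm) scat \<Rightarrow> 'o \<Rightarrow> ('o, 'm) cone \<Rightarrow> bool" where
  "idempotent_cone C d \<gamma> \<longleftrightarrow> is_cone C d \<gamma> \<and> \<gamma> d = idm C d"

definition cone_star :: "('o, 'm) scat \<Rightarrow> ('o, 'm) cone \<Rightarrow> 'm \<Rightarrow> ('o, 'm) cone" where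
  "cone_star C \<gamma> f = (\<lambda>a\<in>Obj C. \<gamma> a \<cdot>\<^bsub>C\<^esub> f)"

definition cone_mult :: "('o, 'm) scat \<Rightarrow> ('o, 'm) cone \<Rightarrow> ('o, 'm) cone \<Rightarrow> ('o, 'm) cone" where
  "cone_mult C \<gamma> \<sigma> = cone_star C \<gamma> (epi C (\<sigma> (apex C \<gamma>)))"

locale normal_category = category_with_subobjects C
  for C :: "('o, 'm) scat" (structure) +
  assumes has_factorization: "f \<in> Mor C \<Longrightarrow> \<exists>q u j. normal_factorization C f q u j"
    and incl_splits: "subobj C c' c \<Longrightarrow> \<exists>q. is_retraction C c c' q"
    and has_idempotent_cone: "c \<in> Obj C \<Longrightarrow> \<exists>\<gamma>. idempotent_cone C c \<gamma>"

definition inclusion_preserving ::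
  "('o, 'm) scat \<Rightarrow> ('p, 'n) scat \<Rightarrow> ('o, 'm, 'p, 'n) ftor \<Rightarrow> bool" where
  "inclusion_preserving C D F \<longleftrightarrow> fmor F ` Incl C \<subseteq> Incl D"

definition ideal :: "('o, 'm) scat \<Rightarrow> 'o \<Rightarrow> ('o, 'm) cat" where
  "ideal C c = full_subcat C {d. subobj C d c}"

definition local_isomorphism ::
  "('o, 'm) scat \<Rightarrow> ('p, 'n) scat \<Rightarrow> ('o, 'm, 'p, 'n) ftor \<Rightarrow> bool" where
  "local_isomorphism C D F \<longleftrightarrow> is_functor C D F \<and> inclusion_preserving C D F \<and>
     fully_faithful C D F \<and>
     (\<forall>c\<in>Obj C. cat_isomorphism (ideal C c) (ideal D (fobj F c)) (restrict_ftor (ideal C c) F))"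


section \<open>The normal dual\<close>

type_synonym ('o, 'm) set_ftor = "('o, 'm, ('o, 'm) cone set, ('o, 'm) cone set_mor) ftor"

type_synonym ('o, 'm) set_nat =
  "('o, 'm) set_ftor \<times> ('o \<Rightarrow> ('o, 'm) cone set_mor) \<times> ('o, 'm) set_ftor"

definition eta_inv :: "('o, 'm) scat \<Rightarrow> ('o, 'm) cone \<Rightarrow> 'm \<Rightarrow> ('o, 'm) cone" where
  "eta_inv C \<gamma> f = cone_star C \<gamma> (epi C f)"

definition Hset :: "('o, 'm) scat \<Rightarrow> ('o, 'm) cone \<Rightarrow> 'o \<Rightarrow> ('o, 'm) cone set" where
  "Hset C \<gamma> c = eta_inv C \<gamma> ` Hom C (apex C \<gamma>) c"

text \<open>The component at \<open>c\<close> of \<open>\<eta>\<^sub>\<gamma>\<close>: it sends the cone \<open>\<gamma> * f\<degree>\<close> to the morphism \<open>f\<close> from the apex of \<open>\<gamma>\<close> to \<open>c\<close>.\<close>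

definition eta :: "('o, 'm) scat \<Rightarrow> ('o, 'm) cone \<Rightarrow> 'o \<Rightarrow> ('o, 'm) cone \<Rightarrow> 'm" where
  "eta C \<gamma> c = the_inv_into (Hom C (apex C \<gamma>) c) (eta_inv C \<gamma>)"

definition Hfun :: "('o, 'm) scat \<Rightarrow> ('o, 'm) cone \<Rightarrow> ('o, 'm) set_ftor" where
  "Hfun C \<gamma> =
     \<lparr>fobj = (\<lambda>c\<in>Obj C. Hset C \<gamma> c),
      fmor = (\<lambda>g\<in>Mor C. (Hset C \<gamma> (Dom C g),
         \<lambda>\<kappa>\<in>Hset C \<gamma> (Dom C g). eta_inv C \<gamma> (eta C \<gamma> (Dom C g) \<kappa> \<cdot>\<^bsub>C\<^esub> g),
         Hset C \<gamma> (Cod C g)))\<rparr>"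

definition normal_dual :: "('o, 'm) scat \<Rightarrow> (('o, 'm) set_ftor, ('o, 'm) set_nat) scat" where
  "normal_dual C =
     (let N = full_subcat (functor_cat C set_cat) {Hfun C \<gamma> | \<gamma> d. is_cone C d \<gamma>} in
      \<lparr>Obj = Obj N, Mor = Mor N, Dom = Dom N, Cod = Cod N, idm = idm N, Comp = Comp N,
       Incl = {(F, \<eta>, G). (F, \<eta>, G) \<in> Mor N \<and> (\<forall>c\<in>Obj C. set_inclusion (\<eta> c))}\<rparr>)"

text \<open>The \<open>M\<close>-set of an \<open>H\<close>-functor; it does not depend on the representing cone.\<close>

definition Mset :: "('o, 'm) scat \<Rightarrow> ('o, 'm) set_ftor \<Rightarrow> 'o set" where
  "Mset C F = {c \<in> Obj C. \<exists>\<gamma> d. is_cone C d \<gamma> \<and> F = Hfun C \<gamma> \<and> is_iso C (\<gamma> c)}"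


section \<open>Cross-connections and the category \<open>CC\<close>\<close>

record ('co, 'cm, 'do, 'dm) xconn =
  Dcat :: "('do, 'dm) scat"
  Ccat :: "('co, 'cm) scat"
  Gam :: "('do, 'dm, ('co, 'cm) set_ftor, ('co, 'cm) set_nat) ftor"

definition cross_connection :: "('co, 'cm, 'do, 'dm) xconn \<Rightarrow> bool" where
  "cross_connection X \<longleftrightarrow> normal_category (Dcat X) \<and> normal_category (Ccat X) \<and>
     local_isomorphism (Dcat X) (normal_dual (Ccat X)) (Gam X) \<and>
     (\<forall>c\<in>Obj (Ccat X). \<exists>d\<in>Obj (Dcat X). c \<in> Mset (Ccat X) (fobj (Gam X) d))"

definition Eset :: "('co, 'cm, 'do, 'dm) xconn \<Rightarrow> ('co \<times> 'do) set" where
  "Eset X = {(c, d). c \<in> Obj (Ccat X) \<and> d \<in> Obj (Dcat X) \<and> c \<in> Mset (Ccat X) (fobj (Gam X) d)}"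

definition gam_cone :: "('co, 'cm, 'do, 'dm) xconn \<Rightarrow> 'co \<times> 'do \<Rightarrow> ('co, 'cm) cone" where
  "gam_cone X = (\<lambda>(c, d). THE \<gamma>. idempotent_cone (Ccat X) c \<gamma> \<and> Hfun (Ccat X) \<gamma> = fobj (Gam X) d)"

text \<open>
  For \<open>e = (c, d)\<close>, \<open>e' = (c', d')\<close> and \<open>f : c \<rightarrow> c'\<close>, \<open>transpose_nat X e e' f\<close> is the natural
  transformation \<open>\<Gamma>(d') \<rightarrow> \<Gamma>(d)\<close> obtained by composing \<open>\<eta>\<close> for \<open>e'\<close>, the natural transformation
  \<open>h \<mapsto> f h\<close> of hom-functors and the inverse of \<open>\<eta>\<close> for \<open>e\<close>.
\<close>

definition transpose_nat ::
  "('co, 'cm, 'do, 'dm) xconn \<Rightarrow> 'co \<times> 'do \<Rightarrow> 'co \<times> 'do \<Rightarrow> 'cm \<Rightarrow> ('co, 'cm) set_nat" where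
  "transpose_nat X e e' f =
     (let C = Ccat X; \<gamma> = gam_cone X e; \<gamma>' = gam_cone X e' in
      (fobj (Gam X) (snd e'),
       \<lambda>x\<in>Obj C. (Hset C \<gamma>' x,
          \<lambda>\<kappa>\<in>Hset C \<gamma>' x. eta_inv C \<gamma> (f \<cdot>\<^bsub>C\<^esub> eta C \<gamma>' x \<kappa>),
          Hset C \<gamma> x),
       fobj (Gam X) (snd e)))"

definition transpose ::
  "('co, 'cm, 'do, 'dm) xconn \<Rightarrow> 'co \<times> 'do \<Rightarrow> 'co \<times> 'do \<Rightarrow> 'cm \<Rightarrow> 'dm" where
  "transpose X e e' f =
     (THE g. g \<in> Hom (Dcat X) (snd e') (snd e) \<and> fmor (Gam X) g = transpose_nat X e e' f)"

definition del_cone :: "('co, 'cm, 'do, 'dm) xconn \<Rightarrow> 'co \<times> 'do \<Rightarrow> ('do, 'dm) cone" where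
  "del_cone X e = (\<lambda>d'\<in>Obj (Dcat X).
     let e' = (SOME c'. (c', d') \<in> Eset X, d') in transpose X e e' (gam_cone X e' (fst e)))"

definition xconn_morphism ::
  "('co, 'cm, 'do, 'dm) xconn \<Rightarrow> ('co', 'cm', 'do', 'dm') xconn \<Rightarrow>
     ('co, 'cm, 'co', 'cm') ftor \<Rightarrow> ('do, 'dm, 'do', 'dm') ftor \<Rightarrow> bool" where
  "xconn_morphism X X' F G \<longleftrightarrow>
     is_functor (Ccat X) (Ccat X') F \<and> inclusion_preserving (Ccat X) (Ccat X') F \<and>
     is_functor (Dcat X) (Dcat X') G \<and> inclusion_preserving (Dcat X) (Dcat X') G \<and>
     (\<forall>(c, d)\<in>Eset X. (fobj F c, fobj G d) \<in> Eset X' \<and>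
        (\<forall>c'\<in>Obj (Ccat X).
           fmor F (gam_cone X (c, d) c') = gam_cone X' (fobj F c, fobj G d) (fobj F c'))) \<and>
     (\<forall>(c, d)\<in>Eset X. \<forall>(c', d')\<in>Eset X. \<forall>f\<in>Hom (Ccat X) c c'.
        fmor G (transpose X (c, d) (c', d') f) =
        transpose X' (fobj F c, fobj G d) (fobj F c', fobj G d') (fmor F f))"

definition CC ::
  "(('co, 'cm, 'do, 'dm) xconn,
    ('co, 'cm, 'do, 'dm) xconn \<times> (('co, 'cm, 'co, 'cm) ftor \<times> ('do, 'dm, 'do, 'dm) ftor) \<times>
    ('co, 'cm, 'do, 'dm) xconn) cat" where
  "CC = \<lparr>Obj = {X. cross_connection X},
     Mor = {(X, (F, G), X'). cross_connection X \<and> cross_connection X' \<and> xconn_morphism X X' F G},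
     Dom = (\<lambda>(X, m, X'). X), Cod = (\<lambda>(X, m, X'). X'),
     idm = (\<lambda>X. (X, (id_ftor (Ccat X), id_ftor (Dcat X)), X)),
     Comp = (\<lambda>(X, (F, G), X') (X'', (F', G'), X''').
       (X, (comp_ftor (Ccat X) F F', comp_ftor (Dcat X) G G'), X'''))\<rparr>"


section \<open>From cross-connections to inductive groupoids\<close>

definition biord_of :: "('co, 'cm, 'do, 'dm) xconn \<Rightarrow> ('co \<times> 'do) biord" where
  "biord_of X = (let C = Ccat X; D = Dcat X in
     \<lparr>elems = Eset X,
      bdom = {((c, d), (c', d')). (c, d) \<in> Eset X \<and> (c', d') \<in> Eset X \<and>
        (subobj C c c' \<or> subobj C c' c \<or> subobj D d' d \<or> subobj D d d')},
      bprod = (\<lambda>(c, d) (c', d').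
        if subobj C c c' then (c, d)
        else if subobj C c' c then (c', im D (del_cone X (c, d) d'))
        else if subobj D d' d then (c', d')
        else if subobj D d d' then (im C (gam_cone X (c', d') c), d)
        else undefined)\<rparr>)"

definition gpd_mor :: "('co, 'cm, 'do, 'dm) xconn \<Rightarrow> ('cm \<times> 'dm) set" where
  "gpd_mor X = {(f, g). \<exists>c d c' d'. (c, d) \<in> Eset X \<and> (c', d') \<in> Eset X \<and>
     f \<in> Hom (Ccat X) c c' \<and> is_iso (Ccat X) f \<and>
     g = transpose X (c', d') (c, d) (inv_mor (Ccat X) f)}"

definition gpd_of :: "('co, 'cm, 'do, 'dm) xconn \<Rightarrow> ('co \<times> 'do, 'cm \<times> 'dm) ogpd" where
  "gpd_of X = (let C = Ccat X; D = Dcat X in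
     \<lparr>Obj = Eset X, Mor = gpd_mor X,
      Dom = (\<lambda>(f, g). (Dom C f, Dom D g)), Cod = (\<lambda>(f, g). (Cod C f, Cod D g)),
      idm = (\<lambda>(c, d). (idm C c, idm D d)),
      Comp = (\<lambda>(f, g) (f', g'). (f \<cdot>\<^bsub>C\<^esub> f', g \<cdot>\<^bsub>D\<^esub> g')),
      Ord = {((f, g), (f1, g1)). (f, g) \<in> gpd_mor X \<and> (f1, g1) \<in> gpd_mor X \<and>
        subobj C (Dom C f) (Dom C f1) \<and> subobj D (Dom D g) (Dom D g1) \<and>
        subobj C (Cod C f) (Cod C f1) \<and> subobj D (Cod D g) (Cod D g1) \<and>
        f = epi C (incl C (Dom C f) (Dom C f1) \<cdot>\<^bsub>C\<^esub> f1) \<and>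
        g = epi D (incl D (Dom D g) (Dom D g1) \<cdot>\<^bsub>D\<^esub> g1)}\<rparr>)"

fun cone_prod :: "('o, 'm) scat \<Rightarrow> ('o, 'm) cone list \<Rightarrow> ('o, 'm) cone" where
  "cone_prod C (\<gamma> # \<gamma>s) = foldl (cone_mult C) \<gamma> \<gamma>s"
| "cone_prod C [] = undefined"

definition ev_path :: "('co, 'cm, 'do, 'dm) xconn \<Rightarrow> ('co \<times> 'do) list \<Rightarrow> 'cm \<times> 'dm" where
  "ev_path X p = (cone_prod (Ccat X) (map (gam_cone X) p) (fst (hd p)),
                  cone_prod (Dcat X) (map (del_cone X) p) (snd (hd p)))"

definition ev_of ::
  "('co, 'cm, 'do, 'dm) xconn \<Rightarrow> ('co \<times> 'do, ('co \<times> 'do) list set, 'co \<times> 'do, 'cm \<times> 'dm) ftor" where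
  "ev_of X = \<lparr>fobj = (\<lambda>e\<in>Eset X. e),
     fmor = (\<lambda>Y\<in>chains (biord_of X). ev_path X (SOME p. p \<in> Y))\<rparr>"

definition igpd_of :: "('co, 'cm, 'do, 'dm) xconn \<Rightarrow> ('co \<times> 'do, 'cm \<times> 'dm) igpd" where
  "igpd_of X = \<lparr>ibi = biord_of X, igp = gpd_of X, iev = ev_of X\<rparr>"

definition restrict_mor ::
  "('co, 'cm, 'do, 'dm) xconn \<Rightarrow> ('co, 'cm, 'co', 'cm') ftor \<times> ('do, 'dm, 'do', 'dm') ftor \<Rightarrow>
     ('co \<times> 'do, 'cm \<times> 'dm, 'co' \<times> 'do', 'cm' \<times> 'dm') ftor" where
  "restrict_mor X = (\<lambda>(F, G).
     \<lparr>fobj = (\<lambda>(c, d)\<in>Eset X. (fobj F c, fobj G d)),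
      fmor = (\<lambda>(f, g)\<in>gpd_mor X. (fmor F f, fmor G g))\<rparr>)"

definition I_functor where
  "I_functor =
     \<lparr>fobj = (\<lambda>X\<in>Obj CC. igpd_of X),
      fmor = (\<lambda>(X, m, X')\<in>Mor CC. (igpd_of X, restrict_mor X m, igpd_of X'))\<rparr>"

end

theory Submission
  imports Defs
begin

text \<open>
  The proof passes through regular semigroups.  A regular semigroup \<open>S\<close> has an inductive groupoid: the
  objects are the idempotents, a morphism is a pair \<open>(a, b)\<close> of mutually inverse elements, from \<open>a b\<close> to
  \<open>b a\<close>, the pair \<open>(e a, b e)\<close> is the restriction of \<open>(a, b)\<close> to an idempotent \<open>e\<close> below \<open>a b\<close>, and a path
  of idempotents is evaluated to its product, paired with the product of the reversed path.  The axioms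
  of biordered sets, of ordered groupoids and of inductive groupoids are then short equational
  computations in \<open>S\<close>.  The locales \<open>biordered_representation\<close> and \<open>inductive_representation\<close> carry them
  out for any structures that are in bijection with the idempotents and with the inverse pairs of some
  regular semigroup.

  For a cross-connection \<open>\<Gamma>\<close> this semigroup consists of the pairs \<open>(\<gamma>, d)\<close> of a cone \<open>\<gamma>\<close> in \<open>\<C>\<close> and an
  object \<open>d\<close> of \<open>\<D>\<close> with \<open>H(\<gamma>;-) = \<Gamma>(d)\<close>.  In the product \<open>(\<gamma>, d) (\<sigma>, d') = (\<gamma> \<sigma>, d'')\<close> the object \<open>d''\<close> is
  the unique subobject of \<open>d\<close> with \<open>\<Gamma>(d'') = H(\<gamma> \<sigma>;-)\<close>; it exists because \<open>\<Gamma>\<close> maps the ideal of \<open>d\<close>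
  isomorphically onto that of \<open>\<Gamma>(d)\<close> (lemma \<open>lift_unique\<close>).  The idempotents are the pairs
  \<open>(\<gamma>(c,d), d)\<close> with \<open>(c,d)\<close> in \<open>E\<^sub>\<Gamma>\<close> (lemma \<open>idempotent_xidem\<close>), and an isomorphism \<open>f\<close> from \<open>c\<close> to \<open>c'\<close>
  stands for the inverse pair with the members \<open>(\<gamma>(c,d) * f, d)\<close> and \<open>(\<gamma>(c',d') * f\<inverse>, d')\<close>.

  What remains is that the data on the side of \<open>\<D>\<close> agree with this picture.  Transposition is
  contravariantly functorial and injective; it turns the epimorphism that carries \<open>\<gamma>(e)\<close> to a cone
  \<open>\<gamma>(e')\<close> below it into an inclusion (lemma \<open>transpose_incl\<close>), and the image of a transpose is the lift of
  the corresponding product (lemma \<open>im_transpose\<close>).  These facts identify the basic products (lemma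
  \<open>bprod_biord_of\<close>), the order (lemma \<open>gpd_Ord\<close>) and the evaluation of paths by the cones \<open>\<delta>\<close> (lemma
  \<open>path_value\<close>) with their counterparts in the semigroup.

  A morphism of cross-connections preserves inclusions, split epimorphisms and isomorphisms, hence
  epimorphic components and images.  By definition it also preserves the cones \<open>\<gamma>\<close> and the
  transposes, and basic products, sandwich sets, the order and the evaluation are all expressed by
  these.  So its restriction to groupoids is an inductive functor, and functoriality is a comparison of
  components.
\<close>

section \<open>Biordered sets and chains\<close>

context biordered_set
begin

lemma Rrel_refl: "e \<in> elems E \<Longrightarrow> Rrel E e e"
  by (simp add: Rrel_def B1_refl_r)

lemma Lrel_refl: "e \<in> elems E \<Longrightarrow> Lrel E e e"
  by (simp add: Lrel_def B1_refl_l)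

lemma Rrel_trans: "Rrel E e f \<Longrightarrow> Rrel E f g \<Longrightarrow> Rrel E e g"
  unfolding Rrel_def by (meson B1_trans_r)

lemma Lrel_trans: "Lrel E e f \<Longrightarrow> Lrel E f g \<Longrightarrow> Lrel E e g"
  unfolding Lrel_def by (meson B1_trans_l)

lemma chain_step_epath:
  assumes "chain_step E p q"
  shows "epath E p \<and> epath E q \<and> hd p = hd q \<and> last p = last q"
  using assms
proof cases
  case (inessential xs a b c ys)
  have "Rrel E a c \<or> Lrel E a c"
    using inessential(4) Rrel_trans Lrel_trans by blast
  then have "epath E q"
    using inessential unfolding epath_def by (auto simp: successively_append_iff)
  moreover have "hd p = hd q" "last p = last q"
    using inessential by (cases xs; simp)+
  ultimately show ?thesis using inessential by auto
next
  case (doubled e)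
  then show ?thesis by (auto simp: epath_def Rrel_refl)
qed

lemma chain_eq_epath:
  assumes "equivclp (chain_step E) p q" and "epath E p"
  shows "epath E q \<and> hd p = hd q \<and> last p = last q"
  using assms by (induction rule: equivclp_induct) (auto dest: chain_step_epath)

lemma epath_append:
  assumes "epath E p" and "epath E q" and "last p = hd q"
  shows "epath E (p @ tl q) \<and> hd (p @ tl q) = hd p \<and> last (p @ tl q) = last q"
proof (cases q)
  case Nil
  then show ?thesis using assms by (simp add: epath_def)
next
  case (Cons e q')
  then show ?thesis
    using assms by (cases q') (auto simp: epath_def successively_append_iff)
qed

text \<open>
  The step from \<open>[e, e]\<close> to \<open>[e]\<close> removes no inessential vertex.  Behind another vertex \<open>a\<close>, however, the
  first \<open>e\<close> is inessential, because \<open>e\<close> is both \<open>\<R>\<close>- and \<open>\<L>\<close>-related to itself.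
\<close>

lemma chain_step_append_left:
  assumes "chain_step E p p'" and r: "epath E r" "last r = hd p"
  shows "equivclp (chain_step E) (r @ tl p) (r @ tl p')"
proof -
  have app: "epath E (r @ tl p)"
    using epath_append chain_step_epath[OF assms(1)] r by blast
  obtain r0 where r0: "r = r0 @ [hd p]"
    using r by (metis append_butlast_last_id epath_def)
  show ?thesis using assms(1)
  proof cases
    case (inessential xs a b c ys)
    show ?thesis
    proof (cases xs)
      case Nil
      then have "r @ tl p = r0 @ [a, b, c] @ ys" "r @ tl p' = r0 @ [a, c] @ ys"
        using inessential r0 by auto
      then show ?thesis
        using chain_step.inessential[of E r0 a b c ys] inessential app by (simp add: r_into_equivclp)
    next
      case (Cons x xs')
      then have "r @ tl p = (r @ xs') @ [a, b, c] @ ys" "r @ tl p' = (r @ xs') @ [a, c] @ ys"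
        using inessential by auto
      then show ?thesis
        using chain_step.inessential[of E "r @ xs'" a b c ys] inessential app
        by (simp add: r_into_equivclp)
    qed
  next
    case (doubled e)
    show ?thesis
    proof (cases r0 rule: rev_cases)
      case Nil
      then show ?thesis
        using doubled r0 chain_step.doubled[of e E] by (simp add: r_into_equivclp)
    next
      case (snoc r1 a)
      have "Rrel E a e \<or> Lrel E a e"
        using r snoc r0 doubled by (auto simp: epath_def successively_append_iff)
      then have "chain_step E (r1 @ [a, e, e] @ []) (r1 @ [a, e] @ [])"
        using app snoc r0 doubled Rrel_refl Lrel_refl
        by (intro chain_step.inessential) auto
      then show ?thesis
        using snoc r0 doubled by (simp add: r_into_equivclp)
    qed
  qed
qed

lemma chain_step_append_right:
  assumes "chain_step E p p'" and r: "epath E r" "last p = hd r"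
  shows "equivclp (chain_step E) (p @ tl r) (p' @ tl r)"
proof -
  have app: "epath E (p @ tl r)"
    using epath_append chain_step_epath[OF assms(1)] r by blast
  show ?thesis using assms(1)
  proof cases
    case (inessential xs a b c ys)
    then show ?thesis
      using chain_step.inessential[of E xs a b c "ys @ tl r"] app by (simp add: r_into_equivclp)
  next
    case (doubled e)
    obtain r0 where r0: "r = e # r0"
      using r doubled by (cases r) (auto simp: epath_def)
    show ?thesis
    proof (cases r0)
      case Nil
      then show ?thesis
        using doubled r0 chain_step.doubled[of e E] by (simp add: r_into_equivclp)
    next
      case (Cons a r1)
      have "Rrel E e a \<or> Lrel E e a"
        using r r0 Cons by (auto simp: epath_def)
      then have "chain_step E ([] @ [e, e, a] @ r1) ([] @ [e, a] @ r1)"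
        using app Cons r0 doubled Rrel_refl Lrel_refl
        by (intro chain_step.inessential) auto
      then show ?thesis
        using Cons r0 doubled by (simp add: r_into_equivclp)
    qed
  qed
qed

text \<open>
  Hence the composite of two chains is independent of the representing paths.
\<close>

lemma chain_eq_append:
  assumes p: "epath E p" "equivclp (chain_step E) p p'"
    and q: "epath E q" "equivclp (chain_step E) q q'" and pq: "last p = hd q"
  shows "equivclp (chain_step E) (p @ tl q) (p' @ tl q')"
proof -
  have "equivclp (chain_step E) (p @ tl q) (p' @ tl q)"
    using p(2)
  proof (induction rule: equivclp_induct)
    case base
    show ?case by simp
  next
    case (step y z)
    have "last y = hd q" "last z = hd q"
      using step chain_eq_epath[OF step(1) p(1)] pq chain_step_epath by metis+
    then have "equivclp (chain_step E) (y @ tl q) (z @ tl q)"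
      using step(2) chain_step_append_right q(1) by (metis equivclp_sym)
    then show ?case using step.IH equivclp_trans by metis
  qed
  moreover have "equivclp (chain_step E) (p' @ tl q) (p' @ tl q')"
    using q(2)
  proof (induction rule: equivclp_induct)
    case base
    show ?case by simp
  next
    case (step y z)
    have p': "epath E p'" "last p' = last p"
      using chain_eq_epath p by auto
    have "last p' = hd y" "last p' = hd z"
      using step chain_eq_epath[OF step(1) q(1)] pq p' chain_step_epath by metis+
    then have "equivclp (chain_step E) (p' @ tl y) (p' @ tl z)"
      using step(2) chain_step_append_left p'(1) by (metis equivclp_sym)
    then show ?case using step.IH equivclp_trans by metis
  qed
  ultimately show ?thesis using equivclp_trans by metis
qed

lemma self_in_chain_of: "p \<in> chain_of E p"
  by (simp add: chain_of_def)

lemma chain_of_eq_iff: "chain_of E p = chain_of E q \<longleftrightarrow> equivclp (chain_step E) p q"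
proof
  assume "chain_of E p = chain_of E q"
  then have "q \<in> chain_of E p"
    using self_in_chain_of[of q] by simp
  then show "equivclp (chain_step E) p q"
    by (simp add: chain_of_def)
next
  assume "equivclp (chain_step E) p q"
  then show "chain_of E p = chain_of E q"
    unfolding chain_of_def
    by (intro Collect_cong iffI) (metis equivclp_sym equivclp_trans, metis equivclp_trans)
qed

lemma in_chain_of: "q \<in> chain_of E p \<Longrightarrow> chain_of E q = chain_of E p"
  using chain_of_eq_iff[of p q] by (simp add: chain_of_def)

lemma in_chainsD:
  assumes "X \<in> chains E" and "p \<in> X"
  shows "epath E p" and "X = chain_of E p"
  using assms in_chain_of chain_eq_epath unfolding chains_def by (auto simp: chain_of_def)

lemma chainsE:
  assumes "X \<in> chains E"
  obtains p where "epath E p" and "X = chain_of E p"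
  using assms unfolding chains_def by blast

lemma chain_of_in_chains: "epath E p \<Longrightarrow> chain_of E p \<in> chains E"
  unfolding chains_def by blast

lemma some_in_chain_of:
  assumes "epath E p"
  shows "epath E (SOME q. q \<in> chain_of E p)"
    and "equivclp (chain_step E) p (SOME q. q \<in> chain_of E p)"
    and "hd (SOME q. q \<in> chain_of E p) = hd p" and "last (SOME q. q \<in> chain_of E p) = last p"
proof -
  have "(SOME q. q \<in> chain_of E p) \<in> chain_of E p"
    by (rule someI, rule self_in_chain_of)
  then show eq: "equivclp (chain_step E) p (SOME q. q \<in> chain_of E p)"
    by (simp add: chain_of_def)
  show "epath E (SOME q. q \<in> chain_of E p)" "hd (SOME q. q \<in> chain_of E p) = hd p"
    "last (SOME q. q \<in> chain_of E p) = last p"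
    using chain_eq_epath[OF eq assms] by auto
qed

lemma chain_gpd_simps:
  "Obj (chain_gpd E) = elems E" "Mor (chain_gpd E) = chains E"
  "idm (chain_gpd E) e = chain_of E [e]"
  by (simp_all add: chain_gpd_def)

lemma Dom_chain_of: "epath E p \<Longrightarrow> Dom (chain_gpd E) (chain_of E p) = hd p"
  by (simp add: chain_gpd_def some_in_chain_of)

lemma Cod_chain_of: "epath E p \<Longrightarrow> Cod (chain_gpd E) (chain_of E p) = last p"
  by (simp add: chain_gpd_def some_in_chain_of)

lemma Comp_chain_of:
  assumes "epath E p" and "epath E q" and "last p = hd q"
  shows "chain_of E p \<cdot>\<^bsub>chain_gpd E\<^esub> chain_of E q = chain_of E (p @ tl q)"
proof -
  have "chain_of E (p' @ tl q') = chain_of E (p @ tl q)"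
    if "p' \<in> chain_of E p" "q' \<in> chain_of E q" for p' q'
  proof -
    have "equivclp (chain_step E) p p'" "equivclp (chain_step E) q q'"
      using that by (auto simp: chain_of_def)
    from chain_eq_append[OF assms(1) this(1) assms(2) this(2) assms(3)] show ?thesis
      by (simp add: chain_of_eq_iff equivclp_sym)
  qed
  then have "(\<Union>p'\<in>chain_of E p. \<Union>q'\<in>chain_of E q. chain_of E (p' @ tl q')) = chain_of E (p @ tl q)"
    using self_in_chain_of by blast
  then show ?thesis by (simp add: chain_gpd_def)
qed

lemma epath_single: "e \<in> elems E \<Longrightarrow> epath E [e]"
  by (simp add: epath_def)

lemma epath_ends: "epath E p \<Longrightarrow> p \<noteq> [] \<and> hd p \<in> elems E \<and> last p \<in> elems E"
  by (auto simp: epath_def)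

lemma category_chain_gpd: "category (chain_gpd E)"
proof
  fix X assume "X \<in> Mor (chain_gpd E)"
  then obtain p where p: "epath E p" "X = chain_of E p"
    by (auto simp: chain_gpd_simps elim: chainsE)
  show "Dom (chain_gpd E) X \<in> Obj (chain_gpd E)" "Cod (chain_gpd E) X \<in> Obj (chain_gpd E)"
    using p epath_ends by (auto simp: Dom_chain_of Cod_chain_of chain_gpd_simps)
  show "idm (chain_gpd E) (Dom (chain_gpd E) X) \<cdot>\<^bsub>chain_gpd E\<^esub> X = X"
    using p epath_ends by (auto simp: Dom_chain_of chain_gpd_simps Comp_chain_of epath_single)
  show "X \<cdot>\<^bsub>chain_gpd E\<^esub> idm (chain_gpd E) (Cod (chain_gpd E) X) = X"
    using p epath_ends by (auto simp: Cod_chain_of chain_gpd_simps Comp_chain_of epath_single)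
  fix Y assume Y: "Y \<in> Mor (chain_gpd E)" and XY: "Cod (chain_gpd E) X = Dom (chain_gpd E) Y"
  then obtain q where q: "epath E q" "Y = chain_of E q"
    by (auto simp: chain_gpd_simps elim: chainsE)
  have pq: "last p = hd q"
    using XY p q by (simp add: Dom_chain_of Cod_chain_of)
  note app = epath_append[OF p(1) q(1) pq]
  show "X \<cdot>\<^bsub>chain_gpd E\<^esub> Y \<in> Mor (chain_gpd E)"
    "Dom (chain_gpd E) (X \<cdot>\<^bsub>chain_gpd E\<^esub> Y) = Dom (chain_gpd E) X"
    "Cod (chain_gpd E) (X \<cdot>\<^bsub>chain_gpd E\<^esub> Y) = Cod (chain_gpd E) Y"
    using p q pq app
    by (auto simp: Dom_chain_of Cod_chain_of Comp_chain_of chain_gpd_simps chain_of_in_chains)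
  fix Z assume Z: "Z \<in> Mor (chain_gpd E)" and YZ: "Cod (chain_gpd E) Y = Dom (chain_gpd E) Z"
  then obtain r where r: "epath E r" "Z = chain_of E r"
    by (auto simp: chain_gpd_simps elim: chainsE)
  have qr: "last q = hd r"
    using YZ r q by (simp add: Dom_chain_of Cod_chain_of)
  have "(p @ tl q) @ tl r = p @ tl (q @ tl r)"
    using epath_ends[OF q(1)] by simp
  then show "X \<cdot>\<^bsub>chain_gpd E\<^esub> Y \<cdot>\<^bsub>chain_gpd E\<^esub> Z = X \<cdot>\<^bsub>chain_gpd E\<^esub> (Y \<cdot>\<^bsub>chain_gpd E\<^esub> Z)"
    using p q r pq qr app epath_append[OF q(1) r(1) qr] by (simp add: Comp_chain_of)
next
  fix e assume e: "e \<in> Obj (chain_gpd E)"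
  then show "idm (chain_gpd E) e \<in> Mor (chain_gpd E)" "Dom (chain_gpd E) (idm (chain_gpd E) e) = e"
    "Cod (chain_gpd E) (idm (chain_gpd E) e) = e"
    by (auto simp: chain_gpd_simps Dom_chain_of Cod_chain_of chain_of_in_chains epath_single)
qed

end

section \<open>Bimorphisms act on chains\<close>

lemma bimorphism_rel:
  assumes "bimorphism E E' \<theta>"
  shows "lel E e f \<Longrightarrow> lel E' (\<theta> e) (\<theta> f)" and "ler E e f \<Longrightarrow> ler E' (\<theta> e) (\<theta> f)"
    and "Lrel E e f \<Longrightarrow> Lrel E' (\<theta> e) (\<theta> f)" and "Rrel E e f \<Longrightarrow> Rrel E' (\<theta> e) (\<theta> f)"
proof -
  have l: "lel E e f \<Longrightarrow> lel E' (\<theta> e) (\<theta> f)" for e f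
    using assms unfolding bimorphism_def lel_def by fastforce
  have r: "ler E e f \<Longrightarrow> ler E' (\<theta> e) (\<theta> f)" for e f
    using assms unfolding bimorphism_def ler_def by fastforce
  show "lel E e f \<Longrightarrow> lel E' (\<theta> e) (\<theta> f)" by (rule l)
  show "ler E e f \<Longrightarrow> ler E' (\<theta> e) (\<theta> f)" by (rule r)
  show "Lrel E e f \<Longrightarrow> Lrel E' (\<theta> e) (\<theta> f)" "Rrel E e f \<Longrightarrow> Rrel E' (\<theta> e) (\<theta> f)"
    unfolding Lrel_def Rrel_def using l r by auto
qed

lemma bimorphism_epath:
  assumes b: "bimorphism E E' \<theta>" and "epath E p"
  shows "epath E' (map \<theta> p)"
proof -
  have "successively (\<lambda>e f. Rrel E' (\<theta> e) (\<theta> f) \<or> Lrel E' (\<theta> e) (\<theta> f)) p"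
    using assms(2) bimorphism_rel(3,4)[OF b] unfolding epath_def
    by (metis (mono_tags, lifting) successively_mono)
  then show ?thesis
    using assms by (auto simp: epath_def successively_map bimorphism_def)
qed

lemma bimorphism_chain_eq:
  assumes b: "bimorphism E E' \<theta>" and "equivclp (chain_step E) p q"
  shows "equivclp (chain_step E') (map \<theta> p) (map \<theta> q)"
proof -
  have image_step: "chain_step E' (map \<theta> p) (map \<theta> q)" if "chain_step E p q" for p q
    using that
  proof cases
    case (inessential xs a b c ys)
    have "epath E' (map \<theta> xs @ [\<theta> a, \<theta> b, \<theta> c] @ map \<theta> ys)"
      using bimorphism_epath[OF b inessential(3)] by simp
    then show ?thesis
      using inessential(1,2,4) bimorphism_rel(3,4)[OF b]
        chain_step.inessential[of E' "map \<theta> xs" "\<theta> a" "\<theta> b" "\<theta> c" "map \<theta> ys"] by auto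
  next
    case (doubled e)
    then show ?thesis
      using b chain_step.doubled[of "\<theta> e" E'] by (auto simp: bimorphism_def)
  qed
  show ?thesis using assms(2)
  proof (induction rule: equivclp_induct)
    case base
    show ?case by simp
  next
    case (step y z)
    then show ?case
      by (metis image_step equivclp_sym equivclp_trans r_into_equivclp)
  qed
qed

lemma chain_map_chain_of:
  assumes "biordered_set E'" and "bimorphism E E' \<theta>"
  shows "chain_map E' \<theta> (chain_of E p) = chain_of E' (map \<theta> p)"
proof -
  have "chain_of E' (map \<theta> q) = chain_of E' (map \<theta> p)" if "q \<in> chain_of E p" for q
    using that bimorphism_chain_eq[OF assms(2), of p q]
      biordered_set.chain_of_eq_iff[OF assms(1), of "map \<theta> p" "map \<theta> q"]
    by (simp add: chain_of_def)
  moreover have "p \<in> chain_of E p"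
    by (simp add: chain_of_def)
  ultimately show ?thesis unfolding chain_map_def by blast
qed

section \<open>The biordered set of a regular semigroup\<close>

text \<open>
  Associativity is required of all elements of the type, not only of those of \<open>S\<close>: it is then a rewrite
  rule without premises.
\<close>

locale regular_semigroup =
  fixes S :: "'s set" and mult :: "'s \<Rightarrow> 's \<Rightarrow> 's" (infixl "\<odot>" 70)
  assumes assoc: "(a \<odot> b) \<odot> c = a \<odot> (b \<odot> c)"
    and closed: "\<lbrakk>a \<in> S; b \<in> S\<rbrakk> \<Longrightarrow> a \<odot> b \<in> S"
    and regular: "a \<in> S \<Longrightarrow> \<exists>b\<in>S. a \<odot> b \<odot> a = a"
begin

text \<open>
  The form of an equation \<open>a b = c\<close> that applies inside right-associated products.
\<close>

lemma absorb: "a \<odot> b = c \<Longrightarrow> a \<odot> (b \<odot> x) = c \<odot> x"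
  by (metis assoc)

lemma inverse_exists:
  assumes "a \<in> S"
  obtains b where "b \<in> S" and "a \<odot> b \<odot> a = a" and "b \<odot> a \<odot> b = b"
proof -
  obtain c where c: "c \<in> S" "a \<odot> c \<odot> a = a"
    using regular[OF assms] by blast
  show thesis
    by (rule that[of "c \<odot> a \<odot> c"]) (use c assms closed assoc in auto, (metis assoc)+)
qed

end

text \<open>
  Here \<open>E\<close> is a copy, along \<open>\<phi>\<close>, of the set of idempotents of \<open>S\<close> with the products \<open>e f\<close> of those pairs for
  which \<open>e f\<close> or \<open>f e\<close> is one of the two factors.
\<close>

locale biordered_representation = regular_semigroup S mult
  for S :: "'s set" and mult :: "'s \<Rightarrow> 's \<Rightarrow> 's" (infixl "\<odot>" 70) +
  fixes E :: "'e biord" (structure) and \<phi> :: "'e \<Rightarrow> 's"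
  assumes phi_inj: "inj_on \<phi> (elems E)"
    and phi_image: "\<phi> ` elems E = {s \<in> S. s \<odot> s = s}"
    and bdom_iff: "(e, f) \<in> bdom E \<longleftrightarrow> e \<in> elems E \<and> f \<in> elems E \<and>
      (\<phi> e \<odot> \<phi> f = \<phi> e \<or> \<phi> e \<odot> \<phi> f = \<phi> f \<or> \<phi> f \<odot> \<phi> e = \<phi> e \<or> \<phi> f \<odot> \<phi> e = \<phi> f)"
    and bprod_in: "(e, f) \<in> bdom E \<Longrightarrow> e \<star> f \<in> elems E"
    and phi_bprod: "(e, f) \<in> bdom E \<Longrightarrow> \<phi> (e \<star> f) = \<phi> e \<odot> \<phi> f"
begin

lemma phi_in: "e \<in> elems E \<Longrightarrow> \<phi> e \<in> S"
  using phi_image by auto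

lemma phi_idem: "e \<in> elems E \<Longrightarrow> \<phi> e \<odot> \<phi> e = \<phi> e"
  using phi_image by auto

lemma phi_eqD: "\<lbrakk>\<phi> e = \<phi> f; e \<in> elems E; f \<in> elems E\<rbrakk> \<Longrightarrow> e = f"
  using phi_inj by (auto dest: inj_onD)

lemma idempotentE:
  assumes "s \<in> S" and "s \<odot> s = s"
  obtains e where "e \<in> elems E" and "\<phi> e = s"
  using assms phi_image by (metis (mono_tags, lifting) imageE mem_Collect_eq)

lemma lel_iff: "lel E e f \<longleftrightarrow> e \<in> elems E \<and> f \<in> elems E \<and> \<phi> e \<odot> \<phi> f = \<phi> e"
  unfolding lel_def by (metis bdom_iff phi_bprod phi_eqD bprod_in)

lemma ler_iff: "ler E e f \<longleftrightarrow> e \<in> elems E \<and> f \<in> elems E \<and> \<phi> f \<odot> \<phi> e = \<phi> e"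
  unfolding ler_def by (metis bdom_iff phi_bprod phi_eqD bprod_in)

lemma bprod_eqI:
  "\<lbrakk>(e, f) \<in> bdom E; (e', f') \<in> bdom E; \<phi> e \<odot> \<phi> f = \<phi> e' \<odot> \<phi> f'\<rbrakk> \<Longrightarrow> e \<star> f = e' \<star> f'"
  by (metis bprod_in phi_bprod phi_eqD)

lemmas rel_iff = lel_iff ler_iff Lrel_def Rrel_def nle_def

lemma biordered_set: "biordered_set E"
proof
  show "bdom E \<subseteq> elems E \<times> elems E"
    using bdom_iff by auto
  show "\<And>e f. (e, f) \<in> bdom E \<Longrightarrow> e \<star> f \<in> elems E"
    by (rule bprod_in)
  show "\<And>e. e \<in> elems E \<Longrightarrow> lel E e e" "\<And>e. e \<in> elems E \<Longrightarrow> ler E e e"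
    by (simp_all add: rel_iff phi_idem)
  show "\<And>e f g. \<lbrakk>lel E e f; lel E f g\<rbrakk> \<Longrightarrow> lel E e g"
    "\<And>e f g. \<lbrakk>ler E e f; ler E f g\<rbrakk> \<Longrightarrow> ler E e g"
    unfolding rel_iff by (metis assoc)+
  show "bdom E = {(e, f). lel E e f \<or> ler E e f \<or> lel E f e \<or> ler E f e}"
    using bdom_iff by (auto simp: rel_iff)
next
  fix e f assume "lel E e f"
  then have e: "e \<in> elems E" and f: "f \<in> elems E" and ef: "\<phi> e \<odot> \<phi> f = \<phi> e"
    by (simp_all add: rel_iff)
  then have fe: "(f, e) \<in> bdom E" by (simp add: bdom_iff)
  show "Lrel E e (f \<star> e) \<and> nle E (f \<star> e) f"
    using e f ef by (simp add: rel_iff bprod_in[OF fe] phi_bprod[OF fe] assoc absorb[OF ef]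
        phi_idem absorb[OF phi_idem])
next
  fix e f assume "ler E e f"
  then have e: "e \<in> elems E" and f: "f \<in> elems E" and fe: "\<phi> f \<odot> \<phi> e = \<phi> e"
    by (simp_all add: rel_iff)
  then have ef: "(e, f) \<in> bdom E" by (simp add: bdom_iff)
  show "Rrel E e (e \<star> f) \<and> nle E (e \<star> f) f"
    using e f fe by (simp add: rel_iff bprod_in[OF ef] phi_bprod[OF ef] assoc absorb[OF fe]
        phi_idem absorb[OF phi_idem])
next
  fix e f g assume "ler E f e" "ler E g e" "lel E f g"
  then have mem: "e \<in> elems E" "f \<in> elems E" "g \<in> elems E"
    and ef: "\<phi> e \<odot> \<phi> f = \<phi> f" and eg: "\<phi> e \<odot> \<phi> g = \<phi> g" and fg: "\<phi> f \<odot> \<phi> g = \<phi> f"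
    by (simp_all add: rel_iff)
  have d: "(f, e) \<in> bdom E" "(g, e) \<in> bdom E" "(g, f) \<in> bdom E"
    using mem ef eg fg by (simp_all add: bdom_iff)
  have "\<phi> e \<odot> (\<phi> g \<odot> \<phi> f) = \<phi> g \<odot> \<phi> f"
    by (simp add: absorb[OF eg])
  then have d1: "(g \<star> f, e) \<in> bdom E"
    using mem by (simp add: bdom_iff d[THEN bprod_in] d[THEN phi_bprod])
  have l: "\<phi> f \<odot> \<phi> e \<odot> (\<phi> g \<odot> \<phi> e) = \<phi> f \<odot> \<phi> e"
    by (simp add: assoc absorb[OF eg] absorb[OF fg])
  have d2: "(g \<star> e, f \<star> e) \<in> bdom E"
    using mem l by (simp add: bdom_iff d[THEN bprod_in] d[THEN phi_bprod])
  show "lel E (f \<star> e) (g \<star> e) \<and> g \<star> f \<star> e = g \<star> e \<star> (f \<star> e)"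
  proof
    show "lel E (f \<star> e) (g \<star> e)"
      using mem l by (simp add: rel_iff d[THEN bprod_in] d[THEN phi_bprod])
    show "g \<star> f \<star> e = g \<star> e \<star> (f \<star> e)"
      by (rule bprod_eqI[OF d1 d2]) (simp add: d[THEN phi_bprod] assoc absorb[OF ef])
  qed
next
  fix e f g assume "lel E f e" "lel E g e" "ler E f g"
  then have mem: "e \<in> elems E" "f \<in> elems E" "g \<in> elems E"
    and fe: "\<phi> f \<odot> \<phi> e = \<phi> f" and ge: "\<phi> g \<odot> \<phi> e = \<phi> g" and gf: "\<phi> g \<odot> \<phi> f = \<phi> f"
    by (simp_all add: rel_iff)
  have d: "(e, f) \<in> bdom E" "(e, g) \<in> bdom E" "(f, g) \<in> bdom E"
    using mem fe ge gf by (simp_all add: bdom_iff)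
  have "\<phi> f \<odot> \<phi> g \<odot> \<phi> e = \<phi> f \<odot> \<phi> g"
    by (simp add: assoc ge)
  then have d1: "(e, f \<star> g) \<in> bdom E"
    using mem by (simp add: bdom_iff d[THEN bprod_in] d[THEN phi_bprod])
  have l: "\<phi> e \<odot> \<phi> g \<odot> (\<phi> e \<odot> \<phi> f) = \<phi> e \<odot> \<phi> f"
    by (simp add: assoc absorb[OF ge] gf)
  have d2: "(e \<star> f, e \<star> g) \<in> bdom E"
    using mem l by (simp add: bdom_iff d[THEN bprod_in] d[THEN phi_bprod])
  show "ler E (e \<star> f) (e \<star> g) \<and> e \<star> (f \<star> g) = e \<star> f \<star> (e \<star> g)"
  proof
    show "ler E (e \<star> f) (e \<star> g)"
      using mem l by (simp add: rel_iff d[THEN bprod_in] d[THEN phi_bprod])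
    show "e \<star> (f \<star> g) = e \<star> f \<star> (e \<star> g)"
      by (rule bprod_eqI[OF d1 d2]) (simp add: d[THEN phi_bprod] assoc absorb[OF fe])
  qed
next
  fix e f g assume "lel E e f" "lel E f g"
  then have mem: "e \<in> elems E" "f \<in> elems E" "g \<in> elems E"
    and ef: "\<phi> e \<odot> \<phi> f = \<phi> e" and fg: "\<phi> f \<odot> \<phi> g = \<phi> f"
    by (simp_all add: rel_iff)
  have eg: "\<phi> e \<odot> \<phi> g = \<phi> e"
    using ef fg by (metis assoc)
  have d: "(g, e) \<in> bdom E" "(f, e) \<in> bdom E"
    using mem ef eg by (simp_all add: bdom_iff)
  have "\<phi> (g \<star> e) \<odot> \<phi> f = \<phi> (g \<star> e)"
    by (simp add: d[THEN phi_bprod] assoc ef)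
  then have d1: "(f, g \<star> e) \<in> bdom E"
    using mem by (simp add: bdom_iff d[THEN bprod_in])
  show "f \<star> (g \<star> e) = f \<star> e"
    by (rule bprod_eqI[OF d1 d(2)]) (simp add: d[THEN phi_bprod] absorb[OF fg])
next
  fix e f g assume "ler E e f" "ler E f g"
  then have mem: "e \<in> elems E" "f \<in> elems E" "g \<in> elems E"
    and fe: "\<phi> f \<odot> \<phi> e = \<phi> e" and gf: "\<phi> g \<odot> \<phi> f = \<phi> f"
    by (simp_all add: rel_iff)
  have ge: "\<phi> g \<odot> \<phi> e = \<phi> e"
    using fe gf by (metis assoc)
  have d: "(e, g) \<in> bdom E" "(e, f) \<in> bdom E"
    using mem fe ge by (simp_all add: bdom_iff)
  have "\<phi> f \<odot> \<phi> (e \<star> g) = \<phi> (e \<star> g)"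
    by (simp add: d[THEN phi_bprod] absorb[OF fe])
  then have d1: "(e \<star> g, f) \<in> bdom E"
    using mem by (simp add: bdom_iff d[THEN bprod_in])
  show "e \<star> g \<star> f = e \<star> f"
    by (rule bprod_eqI[OF d1 d(2)]) (simp add: d[THEN phi_bprod] assoc gf)
next
  fix e f g assume a: "lel E f e" "lel E g e" "ler E (e \<star> f) (e \<star> g)"
  then have mem: "e \<in> elems E" "f \<in> elems E" "g \<in> elems E"
    and fe: "\<phi> f \<odot> \<phi> e = \<phi> f" and ge: "\<phi> g \<odot> \<phi> e = \<phi> g"
    by (simp_all add: rel_iff)
  have d: "(e, f) \<in> bdom E" "(e, g) \<in> bdom E"
    using mem fe ge by (simp_all add: bdom_iff)
  have egf: "\<phi> e \<odot> (\<phi> g \<odot> \<phi> f) = \<phi> e \<odot> \<phi> f"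
    using a(3) by (simp add: rel_iff d[THEN phi_bprod] assoc absorb[OF ge])
  \<comment> \<open>The required element is \<open>g f\<close>.\<close>
  have "\<phi> f \<odot> (\<phi> g \<odot> \<phi> f) = \<phi> f"
    by (metis assoc egf fe phi_idem mem(2))
  then have "\<phi> g \<odot> \<phi> f \<odot> (\<phi> g \<odot> \<phi> f) = \<phi> g \<odot> \<phi> f"
    by (simp add: assoc)
  then obtain f' where f': "f' \<in> elems E" "\<phi> f' = \<phi> g \<odot> \<phi> f"
    using idempotentE closed phi_in mem by metis
  have "(e, f') \<in> bdom E"
    using mem f' fe by (simp add: bdom_iff assoc)
  then show "\<exists>f'\<in>elems E. ler E f' g \<and> lel E f' e \<and> e \<star> f' = e \<star> f"
    using f' mem fe egf
    by (intro bexI[OF _ f'(1)]) (auto simp: rel_iff assoc absorb[OF phi_idem] d intro!: bprod_eqI)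
next
  fix e f g assume a: "ler E f e" "ler E g e" "lel E (f \<star> e) (g \<star> e)"
  then have mem: "e \<in> elems E" "f \<in> elems E" "g \<in> elems E"
    and ef: "\<phi> e \<odot> \<phi> f = \<phi> f" and eg: "\<phi> e \<odot> \<phi> g = \<phi> g"
    by (simp_all add: rel_iff)
  have d: "(f, e) \<in> bdom E" "(g, e) \<in> bdom E"
    using mem ef eg by (simp_all add: bdom_iff)
  have fge: "\<phi> f \<odot> (\<phi> g \<odot> \<phi> e) = \<phi> f \<odot> \<phi> e"
    using a(3) by (simp add: rel_iff d[THEN phi_bprod] assoc absorb[OF eg])
  have "\<phi> f \<odot> (\<phi> g \<odot> \<phi> f) = \<phi> f"
    by (metis assoc fge ef phi_idem mem(2))
  then have "\<phi> f \<odot> \<phi> g \<odot> (\<phi> f \<odot> \<phi> g) = \<phi> f \<odot> \<phi> g"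
    by (metis assoc)
  then obtain f' where f': "f' \<in> elems E" "\<phi> f' = \<phi> f \<odot> \<phi> g"
    using idempotentE closed phi_in mem by metis
  have "(f', e) \<in> bdom E"
    using mem f' ef by (simp add: bdom_iff absorb)
  then show "\<exists>f'\<in>elems E. lel E f' g \<and> ler E f' e \<and> f' \<star> e = f \<star> e"
    using f' mem ef fge
    by (intro bexI[OF _ f'(1)]) (auto simp: rel_iff assoc phi_idem absorb[OF ef] d intro!: bprod_eqI)
qed

text \<open>
  The element is \<open>f b e\<close> for an inverse \<open>b\<close> of \<open>e f\<close>.
\<close>

lemma sandwich_element:
  assumes mem: "e \<in> elems E" "f \<in> elems E"
  obtains h where "h \<in> elems E" and "\<phi> h \<odot> \<phi> e = \<phi> h" and "\<phi> f \<odot> \<phi> h = \<phi> h"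
    and "\<phi> e \<odot> \<phi> h \<odot> \<phi> f = \<phi> e \<odot> \<phi> f"
proof -
  obtain b where b: "b \<in> S" "\<phi> e \<odot> \<phi> f \<odot> b \<odot> (\<phi> e \<odot> \<phi> f) = \<phi> e \<odot> \<phi> f"
    "b \<odot> (\<phi> e \<odot> \<phi> f) \<odot> b = b"
    using inverse_exists closed phi_in mem by metis
  have "\<phi> f \<odot> b \<odot> \<phi> e \<odot> (\<phi> f \<odot> b \<odot> \<phi> e) = \<phi> f \<odot> b \<odot> \<phi> e"
    using b(3) by (metis assoc)
  then obtain h where h: "h \<in> elems E" "\<phi> h = \<phi> f \<odot> b \<odot> \<phi> e"
    using idempotentE closed phi_in mem b(1) by metis
  have "\<phi> e \<odot> \<phi> h \<odot> \<phi> f = \<phi> e \<odot> \<phi> f"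
    using b(2) h(2) by (metis assoc)
  then show thesis
    using that[OF h(1)] h(2) mem by (simp add: assoc phi_idem absorb[OF phi_idem])
qed

lemma lel_mult_sandwich:
  assumes "g \<in> elems E" "h \<in> elems E" and mem: "e \<in> elems E" "f \<in> elems E"
    and g: "\<phi> g \<odot> \<phi> e = \<phi> g" "\<phi> f \<odot> \<phi> g = \<phi> g"
    and h: "\<phi> h \<odot> \<phi> e = \<phi> h" "\<phi> f \<odot> \<phi> h = \<phi> h"
  shows "lel E (g \<star> f) (h \<star> f) \<longleftrightarrow> \<phi> g \<odot> \<phi> h \<odot> \<phi> f = \<phi> g \<odot> \<phi> f"
    and "ler E (e \<star> g) (e \<star> h) \<longleftrightarrow> \<phi> e \<odot> \<phi> h \<odot> \<phi> g = \<phi> e \<odot> \<phi> g"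
proof -
  have d: "(g, f) \<in> bdom E" "(h, f) \<in> bdom E" "(e, g) \<in> bdom E" "(e, h) \<in> bdom E"
    using assms by (simp_all add: bdom_iff)
  show "lel E (g \<star> f) (h \<star> f) \<longleftrightarrow> \<phi> g \<odot> \<phi> h \<odot> \<phi> f = \<phi> g \<odot> \<phi> f"
    by (simp add: rel_iff d[THEN phi_bprod] d[THEN bprod_in] assoc absorb[OF h(2)])
  show "ler E (e \<star> g) (e \<star> h) \<longleftrightarrow> \<phi> e \<odot> \<phi> h \<odot> \<phi> g = \<phi> e \<odot> \<phi> g"
    by (simp add: rel_iff d[THEN phi_bprod] d[THEN bprod_in] assoc absorb[OF h(1)])
qed

text \<open>
  The maximality condition in the definition of the sandwich set amounts to the single equation
  \<open>e h f = e f\<close>: multiplied by \<open>g\<close> it gives maximality, and conversely a maximal \<open>h\<close> can be compared with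
  one element that is known to satisfy the equation.
\<close>

lemma sandwich_iff:
  assumes mem: "e \<in> elems E" "f \<in> elems E"
  shows "h \<in> sandwich E e f \<longleftrightarrow> h \<in> elems E \<and> \<phi> h \<odot> \<phi> e = \<phi> h \<and> \<phi> f \<odot> \<phi> h = \<phi> h \<and>
     \<phi> e \<odot> \<phi> h \<odot> \<phi> f = \<phi> e \<odot> \<phi> f"
proof
  assume "h \<in> sandwich E e f"
  then have h: "h \<in> elems E" "\<phi> h \<odot> \<phi> e = \<phi> h" "\<phi> f \<odot> \<phi> h = \<phi> h"
    and max: "\<And>g. \<lbrakk>g \<in> elems E; \<phi> g \<odot> \<phi> e = \<phi> g; \<phi> f \<odot> \<phi> g = \<phi> g\<rbrakk>
      \<Longrightarrow> \<phi> g \<odot> \<phi> h \<odot> \<phi> f = \<phi> g \<odot> \<phi> f \<and> \<phi> e \<odot> \<phi> h \<odot> \<phi> g = \<phi> e \<odot> \<phi> g"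
  proof -
    show "h \<in> elems E" "\<phi> h \<odot> \<phi> e = \<phi> h" "\<phi> f \<odot> \<phi> h = \<phi> h"
      using \<open>h \<in> sandwich E e f\<close> unfolding sandwich_def by (auto simp: rel_iff)
    then show "\<phi> g \<odot> \<phi> h \<odot> \<phi> f = \<phi> g \<odot> \<phi> f \<and> \<phi> e \<odot> \<phi> h \<odot> \<phi> g = \<phi> e \<odot> \<phi> g"
      if "g \<in> elems E" "\<phi> g \<odot> \<phi> e = \<phi> g" "\<phi> f \<odot> \<phi> g = \<phi> g" for g
      using that mem lel_mult_sandwich[of g h e f] \<open>h \<in> sandwich E e f\<close>
      unfolding sandwich_def by (simp add: lel_iff ler_iff)
  qed
  obtain k where k: "k \<in> elems E" "\<phi> k \<odot> \<phi> e = \<phi> k" "\<phi> f \<odot> \<phi> k = \<phi> k"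
    "\<phi> e \<odot> \<phi> k \<odot> \<phi> f = \<phi> e \<odot> \<phi> f"
    using sandwich_element[OF mem] .
  have khf: "\<phi> k \<odot> \<phi> h \<odot> \<phi> f = \<phi> k \<odot> \<phi> f" and ehk: "\<phi> e \<odot> \<phi> h \<odot> \<phi> k = \<phi> e \<odot> \<phi> k"
    using max[OF k(1-3)] by auto
  \<comment> \<open>\<open>e h f = e h k h f\<close> is reduced to \<open>e k f = e f\<close> by the maximality of \<open>h\<close>.\<close>
  have "\<phi> h \<odot> \<phi> k \<odot> \<phi> h = \<phi> h \<odot> \<phi> e \<odot> \<phi> k \<odot> (\<phi> f \<odot> \<phi> h)"
    by (simp only: h(2,3))
  also have "\<dots> = \<phi> h \<odot> (\<phi> e \<odot> \<phi> k \<odot> \<phi> f) \<odot> \<phi> h"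
    by (simp add: assoc)
  also have "\<dots> = (\<phi> h \<odot> \<phi> e) \<odot> (\<phi> f \<odot> \<phi> h)"
    by (simp only: k(4)) (simp add: assoc)
  finally have hkh: "\<phi> h \<odot> \<phi> k \<odot> \<phi> h = \<phi> h"
    by (simp only: h(2,3) phi_idem[OF h(1)])
  have "\<phi> e \<odot> \<phi> h \<odot> \<phi> f = \<phi> e \<odot> (\<phi> h \<odot> \<phi> k \<odot> \<phi> h) \<odot> \<phi> f"
    by (simp only: hkh)
  also have "\<dots> = \<phi> e \<odot> \<phi> h \<odot> \<phi> k \<odot> \<phi> h \<odot> \<phi> f"
    by (simp add: assoc)
  also have "\<dots> = \<phi> e \<odot> \<phi> k \<odot> \<phi> f"
    by (simp only: ehk) (metis assoc khf)
  finally show "h \<in> elems E \<and> \<phi> h \<odot> \<phi> e = \<phi> h \<and> \<phi> f \<odot> \<phi> h = \<phi> h \<and>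
     \<phi> e \<odot> \<phi> h \<odot> \<phi> f = \<phi> e \<odot> \<phi> f"
    using h k by simp
next
  assume h: "h \<in> elems E \<and> \<phi> h \<odot> \<phi> e = \<phi> h \<and> \<phi> f \<odot> \<phi> h = \<phi> h \<and>
     \<phi> e \<odot> \<phi> h \<odot> \<phi> f = \<phi> e \<odot> \<phi> f"
  have "lel E (g \<star> f) (h \<star> f) \<and> ler E (e \<star> g) (e \<star> h)"
    if g: "g \<in> elems E" "lel E g e" "ler E g f" for g
  proof -
    have ge: "\<phi> g \<odot> \<phi> e = \<phi> g" and fg: "\<phi> f \<odot> \<phi> g = \<phi> g"
      using g by (simp_all add: rel_iff)
    have "\<phi> g \<odot> \<phi> h \<odot> \<phi> f = \<phi> g \<odot> \<phi> f"
      using h ge by (metis assoc)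
    moreover have "\<phi> e \<odot> \<phi> h \<odot> \<phi> g = \<phi> e \<odot> \<phi> g"
      using h fg by (metis assoc)
    ultimately show ?thesis
      using lel_mult_sandwich g h mem ge fg by blast
  qed
  then show "h \<in> sandwich E e f"
    using h mem unfolding sandwich_def by (auto simp: rel_iff)
qed

lemma regular_biordered_set: "regular_biordered_set E"
proof -
  have "sandwich E e f \<noteq> {}" if mem: "e \<in> elems E" "f \<in> elems E" for e f
  proof -
    obtain h where "h \<in> sandwich E e f"
      using sandwich_element[OF mem] unfolding sandwich_iff[OF mem] by blast
    then show ?thesis by blast
  qed
  then show ?thesis
    using biordered_set unfolding regular_biordered_set_def by blast
qed

end

section \<open>The inductive groupoid of a regular semigroup\<close>

fun word_product :: "('s \<Rightarrow> 's \<Rightarrow> 's) \<Rightarrow> 's list \<Rightarrow> 's" where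
  "word_product m [] = undefined"
| "word_product m [a] = a"
| "word_product m (a # b # as) = m a (word_product m (b # as))"

lemma (in regular_semigroup) word_product_append:
  "\<lbrakk>as \<noteq> []; bs \<noteq> []\<rbrakk>
    \<Longrightarrow> word_product (\<odot>) (as @ bs) = word_product (\<odot>) as \<odot> word_product (\<odot>) bs"
proof (induction as rule: induct_list012)
  case (2 a)
  then show ?case by (cases bs) auto
next
  case (3 a b as)
  then show ?case by (simp add: assoc)
qed simp

lemma (in regular_semigroup) absorb3: "a \<odot> (b \<odot> c) = d \<Longrightarrow> a \<odot> (b \<odot> (c \<odot> x)) = d \<odot> x"
  by (metis assoc)

text \<open>
  The morphism \<open>x\<close> of \<open>G\<close> stands for the inverse pair \<open>(\<psi> x, \<psi>' x)\<close>, and \<open>\<pi> p\<close> is the value of the path \<open>p\<close>.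
\<close>

locale inductive_representation = biordered_representation S mult E \<phi>
  for S :: "'s set" and mult :: "'s \<Rightarrow> 's \<Rightarrow> 's" (infixl "\<odot>" 70)
    and E :: "'e biord" and \<phi> :: "'e \<Rightarrow> 's" +
  fixes G :: "('e, 'm) ogpd" (structure) and \<psi> \<psi>' :: "'m \<Rightarrow> 's"
    and \<epsilon> :: "('e, 'e list set, 'e, 'm) ftor" and \<pi> :: "'e list \<Rightarrow> 'm"
  assumes Obj_G: "Obj G = elems E"
    and psi_inverse: "x \<in> Mor G \<Longrightarrow> \<psi> x \<in> S \<and> \<psi>' x \<in> S \<and>
      \<psi> x \<odot> \<psi>' x \<odot> \<psi> x = \<psi> x \<and> \<psi>' x \<odot> \<psi> x \<odot> \<psi>' x = \<psi>' x"
    and psi_inj: "\<lbrakk>x \<in> Mor G; y \<in> Mor G; \<psi> x = \<psi> y; \<psi>' x = \<psi>' y\<rbrakk> \<Longrightarrow> x = y"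
    and psi_surj: "\<lbrakk>a \<in> S; b \<in> S; a \<odot> b \<odot> a = a; b \<odot> a \<odot> b = b\<rbrakk>
      \<Longrightarrow> \<exists>x\<in>Mor G. \<psi> x = a \<and> \<psi>' x = b"
    and Dom_G: "x \<in> Mor G \<Longrightarrow> Dom G x \<in> elems E \<and> \<phi> (Dom G x) = \<psi> x \<odot> \<psi>' x"
    and Cod_G: "x \<in> Mor G \<Longrightarrow> Cod G x \<in> elems E \<and> \<phi> (Cod G x) = \<psi>' x \<odot> \<psi> x"
    and idm_G: "e \<in> elems E \<Longrightarrow> idm G e \<in> Mor G \<and> \<psi> (idm G e) = \<phi> e \<and> \<psi>' (idm G e) = \<phi> e"
    and Comp_G: "\<lbrakk>x \<in> Mor G; y \<in> Mor G; Cod G x = Dom G y\<rbrakk>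
      \<Longrightarrow> x \<cdot> y \<in> Mor G \<and> \<psi> (x \<cdot> y) = \<psi> x \<odot> \<psi> y \<and> \<psi>' (x \<cdot> y) = \<psi>' y \<odot> \<psi>' x"
    and Ord_G: "(x, y) \<in> Ord G \<longleftrightarrow> x \<in> Mor G \<and> y \<in> Mor G \<and> nle E (Dom G x) (Dom G y) \<and>
      \<psi> x = \<phi> (Dom G x) \<odot> \<psi> y \<and> \<psi>' x = \<psi>' y \<odot> \<phi> (Dom G x)"
    and fobj_ev: "fobj \<epsilon> = (\<lambda>e\<in>elems E. e)"
    and fmor_ev: "fmor \<epsilon> = (\<lambda>X\<in>chains E. \<pi> (SOME p. p \<in> X))"
    and path_ev: "epath E p \<Longrightarrow> \<pi> p \<in> Mor G \<and> \<psi> (\<pi> p) = word_product (\<odot>) (map \<phi> p) \<and>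
      \<psi>' (\<pi> p) = word_product (\<odot>) (map \<phi> (rev p))"
begin

sublocale biord: biordered_set E
  by (rule biordered_set)

lemma psi_absorb:
  assumes "x \<in> Mor G"
  shows "\<psi> x \<odot> (\<psi>' x \<odot> \<psi> x) = \<psi> x" "\<psi> x \<odot> (\<psi>' x \<odot> (\<psi> x \<odot> c)) = \<psi> x \<odot> c"
    "\<psi>' x \<odot> (\<psi> x \<odot> \<psi>' x) = \<psi>' x" "\<psi>' x \<odot> (\<psi> x \<odot> (\<psi>' x \<odot> c)) = \<psi>' x \<odot> c"
  using psi_inverse[OF assms] by (metis assoc)+

lemma DomI: "\<lbrakk>x \<in> Mor G; e \<in> elems E; \<psi> x \<odot> \<psi>' x = \<phi> e\<rbrakk> \<Longrightarrow> Dom G x = e"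
  using Dom_G phi_eqD by metis

lemma CodI: "\<lbrakk>x \<in> Mor G; e \<in> elems E; \<psi>' x \<odot> \<psi> x = \<phi> e\<rbrakk> \<Longrightarrow> Cod G x = e"
  using Cod_G phi_eqD by metis

lemma Dom_eq_Cod_iff:
  "\<lbrakk>x \<in> Mor G; y \<in> Mor G\<rbrakk> \<Longrightarrow> Cod G x = Dom G y \<longleftrightarrow> \<psi>' x \<odot> \<psi> x = \<psi> y \<odot> \<psi>' y"
  using Dom_G Cod_G phi_eqD by metis

lemma category_G: "category G"
proof
  fix x assume x: "x \<in> Mor G"
  note xa = psi_absorb[OF x]
  show "Dom G x \<in> Obj G" "Cod G x \<in> Obj G"
    using x Dom_G Cod_G by (auto simp: Obj_G)
  then have dom: "Dom G x \<in> elems E" and cod: "Cod G x \<in> elems E"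
    by (simp_all add: Obj_G)
  have "Cod G (idm G (Dom G x)) = Dom G x"
    using idm_G[OF dom] dom by (intro CodI) (auto simp: phi_idem)
  then show "idm G (Dom G x) \<cdot> x = x"
    using x idm_G[OF dom] Comp_G[of "idm G (Dom G x)" x] Dom_G[OF x]
    by (intro psi_inj) (auto simp: assoc xa)
  have "Dom G (idm G (Cod G x)) = Cod G x"
    using idm_G[OF cod] cod by (intro DomI) (auto simp: phi_idem)
  then show "x \<cdot> idm G (Cod G x) = x"
    using x idm_G[OF cod] Comp_G[of x "idm G (Cod G x)"] Cod_G[OF x]
    by (intro psi_inj) (auto simp: assoc xa)
  fix y assume y: "y \<in> Mor G" and xy: "Cod G x = Dom G y"
  note ya = psi_absorb[OF y]
  have eq: "\<psi>' x \<odot> \<psi> x = \<psi> y \<odot> \<psi>' y"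
    using Dom_eq_Cod_iff x y xy by blast
  note c = Comp_G[OF x y xy]
  show "x \<cdot> y \<in> Mor G" using c by blast
  have "\<psi> x \<odot> \<psi> y \<odot> (\<psi>' y \<odot> \<psi>' x) = \<psi> x \<odot> \<psi>' x"
    using eq xa(1) by (metis assoc)
  then show "Dom G (x \<cdot> y) = Dom G x"
    using c Dom_G[OF x] by (intro DomI) auto
  have "\<psi>' y \<odot> \<psi>' x \<odot> (\<psi> x \<odot> \<psi> y) = \<psi>' y \<odot> \<psi> y"
    using eq ya(1) by (metis assoc)
  then show cxy: "Cod G (x \<cdot> y) = Cod G y"
    using c Cod_G[OF y] by (intro CodI) auto
  fix z assume z: "z \<in> Mor G" and yz: "Cod G y = Dom G z"
  note c' = Comp_G[OF y z yz]
  have "Dom G (y \<cdot> z) = Dom G y"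
  proof -
    have "\<psi> y \<odot> \<psi> z \<odot> (\<psi>' z \<odot> \<psi>' y) = \<psi> y \<odot> \<psi>' y"
      using Dom_eq_Cod_iff y z yz ya(1) by (metis assoc)
    then show ?thesis
      using c' Dom_G[OF y] by (intro DomI) auto
  qed
  then show "x \<cdot> y \<cdot> z = x \<cdot> (y \<cdot> z)"
    using c c' Comp_G[of "x \<cdot> y" z] Comp_G[of x "y \<cdot> z"] x y z xy yz cxy
    by (intro psi_inj) (auto simp: assoc)
next
  fix e assume "e \<in> Obj G"
  then have e: "e \<in> elems E" by (simp add: Obj_G)
  show "idm G e \<in> Mor G" "Dom G (idm G e) = e" "Cod G (idm G e) = e"
    using idm_G[OF e] e by (auto simp: phi_idem intro: DomI CodI)
qed

sublocale cat: category G
  by (rule category_G)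

lemma inverse_morphism:
  assumes x: "x \<in> Mor G"
  shows "inverses G x (inv_mor G x)" and "\<psi> (inv_mor G x) = \<psi>' x" and "\<psi>' (inv_mor G x) = \<psi> x"
proof -
  obtain y where y: "y \<in> Mor G" "\<psi> y = \<psi>' x" "\<psi>' y = \<psi> x"
    using psi_surj psi_inverse[OF x] by blast
  have xy: "Cod G x = Dom G y" and yx: "Cod G y = Dom G x"
    using Dom_eq_Cod_iff x y by auto
  have inv: "inverses G x y"
    unfolding inverses_def
  proof (intro conjI)
    show "x \<cdot> y = idm G (Dom G x)"
      using Comp_G[OF x y(1) xy] Dom_G[OF x] idm_G[of "Dom G x"] y by (intro psi_inj) auto
    show "y \<cdot> x = idm G (Cod G x)"
      using Comp_G[OF y(1) x yx] Cod_G[OF x] idm_G[of "Cod G x"] y by (intro psi_inj) auto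
  qed (use x y xy yx in auto)
  have "z = y" if z: "inverses G x z" for z
  proof -
    have "z = z \<cdot> (x \<cdot> y)"
      using z inv cat.idm_right[of z] unfolding inverses_def by metis
    also have "\<dots> = (z \<cdot> x) \<cdot> y"
      using z inv cat.Comp_assoc[of z x y] unfolding inverses_def by metis
    also have "\<dots> = y"
      using z inv cat.idm_left[of y] unfolding inverses_def by metis
    finally show ?thesis .
  qed
  then have "inv_mor G x = y"
    using inv unfolding inv_mor_def by blast
  then show "inverses G x (inv_mor G x)" "\<psi> (inv_mor G x) = \<psi>' x" "\<psi>' (inv_mor G x) = \<psi> x"
    using inv y by auto
qed

lemma nle_iff: "nle E e f \<longleftrightarrow> e \<in> elems E \<and> f \<in> elems E \<and> \<phi> e \<odot> \<phi> f = \<phi> e \<and> \<phi> f \<odot> \<phi> e = \<phi> e"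
  by (auto simp: rel_iff)

lemma vle_iff: "vle G e f \<longleftrightarrow> nle E e f" if "e \<in> elems E" "f \<in> elems E"
proof -
  have "Dom G (idm G e) = e" "Dom G (idm G f) = f"
    using that cat.Dom_idm by (auto simp: Obj_G)
  then show ?thesis
    using idm_G that unfolding vle_def Ord_G by (auto simp: nle_iff)
qed

lemma nle_Dom_absorb:
  assumes x: "x \<in> Mor G" and e: "nle E e (Dom G x)"
  shows "\<phi> e \<odot> \<phi> e = \<phi> e" "\<phi> e \<odot> (\<phi> e \<odot> c) = \<phi> e \<odot> c"
    "\<phi> e \<odot> (\<psi> x \<odot> \<psi>' x) = \<phi> e" "\<phi> e \<odot> (\<psi> x \<odot> (\<psi>' x \<odot> c)) = \<phi> e \<odot> c"
    "\<psi> x \<odot> (\<psi>' x \<odot> \<phi> e) = \<phi> e" "\<psi> x \<odot> (\<psi>' x \<odot> (\<phi> e \<odot> c)) = \<phi> e \<odot> c"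
  using e phi_idem Dom_G[OF x] unfolding nle_iff by (metis assoc)+

lemma restriction_exists:
  assumes x: "x \<in> Mor G" and e: "nle E e (Dom G x)"
  obtains y where "(y, x) \<in> Ord G" and "Dom G y = e" and "\<psi> y = \<phi> e \<odot> \<psi> x"
    and "\<psi>' y = \<psi>' x \<odot> \<phi> e"
proof -
  note a = psi_absorb[OF x] nle_Dom_absorb[OF x e]
  have eE: "e \<in> elems E" using e by (simp add: nle_iff)
  obtain y where y: "y \<in> Mor G" "\<psi> y = \<phi> e \<odot> \<psi> x" "\<psi>' y = \<psi>' x \<odot> \<phi> e"
    using psi_surj[of "\<phi> e \<odot> \<psi> x" "\<psi>' x \<odot> \<phi> e"] psi_inverse[OF x] closed phi_in[OF eE]
    by (auto simp: assoc a)
  have "Dom G y = e"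
    using y eE by (intro DomI) (auto simp: assoc a)
  then show thesis
    using that[of y] y x e unfolding Ord_G by auto
qed

lemma Ord_Dom_unique: "\<lbrakk>(y, x) \<in> Ord G; (z, x) \<in> Ord G; Dom G y = Dom G z\<rbrakk> \<Longrightarrow> y = z"
  unfolding Ord_G by (auto intro: psi_inj)

lemma grestrict:
  assumes x: "x \<in> Mor G" and e: "nle E e (Dom G x)"
  shows "grestrict G e x \<in> Mor G" and "Dom G (grestrict G e x) = e"
    and "\<psi> (grestrict G e x) = \<phi> e \<odot> \<psi> x" and "\<psi>' (grestrict G e x) = \<psi>' x \<odot> \<phi> e"
    and "\<phi> (Cod G (grestrict G e x)) = \<psi>' x \<odot> \<phi> e \<odot> \<psi> x"
proof -
  obtain y where y: "(y, x) \<in> Ord G" "Dom G y = e" "\<psi> y = \<phi> e \<odot> \<psi> x" "\<psi>' y = \<psi>' x \<odot> \<phi> e"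
    using restriction_exists[OF assms] .
  have "grestrict G e x = y"
    unfolding grestrict_def using y Ord_Dom_unique by blast
  moreover have "y \<in> Mor G" using y(1) by (simp add: Ord_G)
  ultimately show "grestrict G e x \<in> Mor G" "Dom G (grestrict G e x) = e"
    "\<psi> (grestrict G e x) = \<phi> e \<odot> \<psi> x" "\<psi>' (grestrict G e x) = \<psi>' x \<odot> \<phi> e"
    "\<phi> (Cod G (grestrict G e x)) = \<psi>' x \<odot> \<phi> e \<odot> \<psi> x"
    using y Cod_G[of y] by (auto simp: assoc nle_Dom_absorb[OF x e])
qed

text \<open>
  Conjugation by \<open>\<psi> y\<close> moves the idempotent that defines the restriction from the domain of \<open>y\<close> to its
  codomain, so the order can be read off at either end.
\<close>

lemma Ord_Cod:
  assumes "(x, y) \<in> Ord G"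
  shows "\<phi> (Cod G x) = \<psi>' y \<odot> \<phi> (Dom G x) \<odot> \<psi> y" and "nle E (Cod G x) (Cod G y)"
    and "\<psi> x = \<psi> y \<odot> \<phi> (Cod G x)" and "\<psi>' x = \<phi> (Cod G x) \<odot> \<psi>' y"
proof -
  have x: "x \<in> Mor G" and y: "y \<in> Mor G" and d: "nle E (Dom G x) (Dom G y)"
    and p: "\<psi> x = \<phi> (Dom G x) \<odot> \<psi> y" "\<psi>' x = \<psi>' y \<odot> \<phi> (Dom G x)"
    using assms unfolding Ord_G by blast+
  note a = psi_absorb[OF y] nle_Dom_absorb[OF y d]
  show c: "\<phi> (Cod G x) = \<psi>' y \<odot> \<phi> (Dom G x) \<odot> \<psi> y"
    using Cod_G[OF x] p by (simp add: assoc a)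
  show "nle E (Cod G x) (Cod G y)"
    using Cod_G[OF x, THEN conjunct1] Cod_G[OF y] by (simp add: nle_iff c assoc a)
  show "\<psi> x = \<psi> y \<odot> \<phi> (Cod G x)" "\<psi>' x = \<phi> (Cod G x) \<odot> \<psi>' y"
    using p c by (simp_all add: assoc a)
qed

lemma ordered_groupoid_G: "ordered_groupoid G"
proof
  fix x assume x: "x \<in> Mor G"
  show "is_iso G x" using inverse_morphism(1)[OF x] unfolding is_iso_def by blast
  show "(x, x) \<in> Ord G"
    using x Dom_G[OF x] unfolding Ord_G
    by (auto simp: nle_iff phi_idem) (simp_all add: assoc psi_absorb)
next
  show "Ord G \<subseteq> Mor G \<times> Mor G" using Ord_G by auto
next
  fix x y assume xy: "(x, y) \<in> Ord G" and yx: "(y, x) \<in> Ord G"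
  have "Dom G x = Dom G y"
    using xy yx phi_eqD unfolding Ord_G nle_iff by metis
  moreover have "(y, y) \<in> Ord G"
    using xy Dom_G[of y] unfolding Ord_G
    by (auto simp: nle_iff phi_idem) (simp_all add: assoc psi_absorb)
  ultimately show "x = y" using xy Ord_Dom_unique by blast
next
  fix x y z assume xy: "(x, y) \<in> Ord G" and yz: "(y, z) \<in> Ord G"
  then have n: "nle E (Dom G x) (Dom G y)" "nle E (Dom G y) (Dom G z)"
    unfolding Ord_G by blast+
  then have "nle E (Dom G x) (Dom G z)"
    unfolding nle_iff by (metis assoc)
  moreover have "\<psi> x = \<phi> (Dom G x) \<odot> \<psi> z" "\<psi>' x = \<psi>' z \<odot> \<phi> (Dom G x)"
    using xy yz n unfolding Ord_G nle_iff by (metis assoc)+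
  ultimately show "(x, z) \<in> Ord G"
    using xy yz unfolding Ord_G by blast
next
  fix u x v y assume ux: "(u, x) \<in> Ord G" and vy: "(v, y) \<in> Ord G"
    and uv: "Cod G u = Dom G v" and xy: "Cod G x = Dom G y"
  have mem: "u \<in> Mor G" "v \<in> Mor G" "x \<in> Mor G" "y \<in> Mor G"
    using ux vy unfolding Ord_G by blast+
  note c = Comp_G[OF mem(1,2) uv] Comp_G[OF mem(3,4) xy]
  have d: "Dom G (u \<cdot> v) = Dom G u" "Dom G (x \<cdot> y) = Dom G x"
    using cat.Dom_Comp mem uv xy by auto
  have u: "\<psi> u = \<phi> (Dom G u) \<odot> \<psi> x" "\<psi>' u = \<psi>' x \<odot> \<phi> (Dom G u)"
    and n: "nle E (Dom G u) (Dom G x)"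
    using ux unfolding Ord_G by blast+
  have v: "\<psi> v = \<phi> (Cod G u) \<odot> \<psi> y" "\<psi>' v = \<psi>' y \<odot> \<phi> (Cod G u)"
    using vy uv unfolding Ord_G by auto
  have "\<psi> u \<odot> \<phi> (Cod G u) = \<psi> u" "\<phi> (Cod G u) \<odot> \<psi>' u = \<psi>' u"
    using Cod_G[OF mem(1)] psi_absorb[OF mem(1)] by (simp_all add: assoc)
  then have "\<psi> u \<odot> \<psi> v = \<phi> (Dom G u) \<odot> (\<psi> x \<odot> \<psi> y)"
    "\<psi>' v \<odot> \<psi>' u = \<psi>' y \<odot> \<psi>' x \<odot> \<phi> (Dom G u)"
    using u v by (metis assoc)+
  then show "(u \<cdot> v, x \<cdot> y) \<in> Ord G"
    unfolding Ord_G using c d n by auto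
next
  fix x y assume xy: "(x, y) \<in> Ord G"
  then have x: "x \<in> Mor G" and y: "y \<in> Mor G" unfolding Ord_G by blast+
  have m: "inv_mor G x \<in> Mor G" "inv_mor G y \<in> Mor G"
    and d: "Dom G (inv_mor G x) = Cod G x" "Dom G (inv_mor G y) = Cod G y"
    using inverse_morphism(1) x y unfolding inverses_def by metis+
  show "(inv_mor G x, inv_mor G y) \<in> Ord G"
    unfolding Ord_G using m d Ord_Cod[OF xy] inverse_morphism(2,3)[OF x] inverse_morphism(2,3)[OF y]
    by simp
next
  fix x e assume x: "x \<in> Mor G" and e: "e \<in> Obj G" "(idm G e, idm G (Dom G x)) \<in> Ord G"
  then have "nle E e (Dom G x)"
    using vle_iff[of e "Dom G x"] Dom_G[OF x] by (simp add: vle_def Obj_G)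
  then obtain y where "(y, x) \<in> Ord G" "Dom G y = e"
    using restriction_exists[OF x] by metis
  then show "\<exists>!y. (y, x) \<in> Ord G \<and> Dom G y = e"
    using Ord_Dom_unique by blast
next
  fix x f assume x: "x \<in> Mor G" and f: "f \<in> Obj G" "(idm G f, idm G (Cod G x)) \<in> Ord G"
  then have "nle E f (Cod G x)"
    using vle_iff[of f "Cod G x"] Cod_G[OF x] by (simp add: vle_def Obj_G)
  then have fE: "f \<in> elems E" and fx: "\<phi> f \<odot> (\<psi>' x \<odot> \<psi> x) = \<phi> f" "\<psi>' x \<odot> (\<psi> x \<odot> \<phi> f) = \<phi> f"
    using Cod_G[OF x] by (simp_all add: nle_iff assoc)
  note a = psi_absorb[OF x] fx absorb3[OF fx(1)] absorb3[OF fx(2)] phi_idem[OF fE]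
    absorb[OF phi_idem[OF fE]]
  obtain e where e: "e \<in> elems E" "\<phi> e = \<psi> x \<odot> \<phi> f \<odot> \<psi>' x"
    using idempotentE[of "\<psi> x \<odot> \<phi> f \<odot> \<psi>' x"] psi_inverse[OF x] phi_in[OF fE] closed
    by (auto simp: assoc a)
  have "nle E e (Dom G x)"
    using e Dom_G[OF x] by (simp add: nle_iff assoc a)
  then obtain y where y: "(y, x) \<in> Ord G" "\<psi> y = \<phi> e \<odot> \<psi> x" "\<psi>' y = \<psi>' x \<odot> \<phi> e"
    using restriction_exists[OF x] by metis
  have "Cod G y = f"
    using y(1)[unfolded Ord_G, THEN conjunct1] fE by (intro CodI) (simp_all add: y(2,3) e assoc a)
  moreover have "z = y" if z: "(z, x) \<in> Ord G" "Cod G z = f" for z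
    using Ord_Cod(3,4)[OF z(1)] Ord_Cod(3,4)[OF y(1)] z \<open>Cod G y = f\<close> y(1) unfolding Ord_G
    by (intro psi_inj) auto
  ultimately show "\<exists>!y. (y, x) \<in> Ord G \<and> Cod G y = f"
    using y(1) by blast
qed

lemma path_step:
  assumes "chain_step E p q"
  shows "\<pi> p = \<pi> q"
proof -
  have ep: "epath E p" and eq: "epath E q"
    using biord.chain_step_epath[OF assms] by auto
  have "word_product (\<odot>) (map \<phi> p) = word_product (\<odot>) (map \<phi> q) \<and>
    word_product (\<odot>) (map \<phi> (rev p)) = word_product (\<odot>) (map \<phi> (rev q))"
    using assms
  proof cases
    case (inessential xs a b c ys)
    have "\<phi> a \<odot> (\<phi> b \<odot> \<phi> c) = \<phi> a \<odot> \<phi> c" "\<phi> c \<odot> (\<phi> b \<odot> \<phi> a) = \<phi> c \<odot> \<phi> a"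
      using inessential(4) unfolding rel_iff by (metis assoc)+
    then have mid: "word_product (\<odot>) [\<phi> a, \<phi> b, \<phi> c] = word_product (\<odot>) [\<phi> a, \<phi> c]"
      "word_product (\<odot>) [\<phi> c, \<phi> b, \<phi> a] = word_product (\<odot>) [\<phi> c, \<phi> a]"
      by simp_all
    have ctx: "word_product (\<odot>) (us @ m @ vs) = word_product (\<odot>) (us @ m' @ vs)"
      if "word_product (\<odot>) m = word_product (\<odot>) m'" "m \<noteq> []" "m' \<noteq> []" for us vs m m'
      using that by (cases "us = []"; cases "vs = []") (simp_all add: word_product_append)
    show ?thesis
      using ctx[OF mid(1), of "map \<phi> xs" "map \<phi> ys"]
        ctx[OF mid(2), of "map \<phi> (rev ys)" "map \<phi> (rev xs)"]
      unfolding inessential(1,2) by (simp add: rev_map)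
  next
    case (doubled e)
    then show ?thesis by (simp add: phi_idem)
  qed
  then show ?thesis
    using path_ev[OF ep] path_ev[OF eq] by (intro psi_inj) auto
qed

lemma path_chain_eq: "equivclp (chain_step E) p q \<Longrightarrow> \<pi> p = \<pi> q"
  by (induction rule: equivclp_induct) (auto dest: path_step)

lemma ev_chain_of: "epath E p \<Longrightarrow> fmor \<epsilon> (chain_of E p) = \<pi> p"
  using biord.some_in_chain_of(2)[of p] path_chain_eq biord.chain_of_in_chains
  by (simp add: fmor_ev)

lemma path_mult_ends:
  assumes "epath E p"
  shows "\<phi> (hd p) \<odot> word_product (\<odot>) (map \<phi> p) = word_product (\<odot>) (map \<phi> p)"
    and "word_product (\<odot>) (map \<phi> (rev p)) \<odot> \<phi> (hd p) = word_product (\<odot>) (map \<phi> (rev p))"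
proof -
  obtain e p' where p: "p = e # p'" and e: "e \<in> elems E"
    using assms by (cases p) (auto simp: epath_def)
  show "\<phi> (hd p) \<odot> word_product (\<odot>) (map \<phi> p) = word_product (\<odot>) (map \<phi> p)"
    using p e by (cases p') (simp_all add: phi_idem absorb[OF phi_idem])
  show "word_product (\<odot>) (map \<phi> (rev p)) \<odot> \<phi> (hd p) = word_product (\<odot>) (map \<phi> (rev p))"
    using p e word_product_append[of "map \<phi> (rev p')" "[\<phi> e]"]
    by (cases p' rule: rev_cases) (simp_all add: phi_idem assoc)
qed

lemma path_Dom_Cod:
  assumes "epath E p"
  shows "Dom G (\<pi> p) = hd p" and "Cod G (\<pi> p) = last p"
proof -
  have "word_product (\<odot>) (map \<phi> p) \<odot> word_product (\<odot>) (map \<phi> (rev p)) = \<phi> (hd p) \<and>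
    word_product (\<odot>) (map \<phi> (rev p)) \<odot> word_product (\<odot>) (map \<phi> p) = \<phi> (last p)"
    if "epath E p" for p
    using that
  proof (induction p rule: rev_induct)
    case (snoc e p)
    show ?case
    proof (cases "p = []")
      case True
      then show ?thesis using snoc by (simp add: epath_def phi_idem)
    next
      case False
      have p: "epath E p" and e: "e \<in> elems E" and rel: "Rrel E (last p) e \<or> Lrel E (last p) e"
        using snoc.prems False by (auto simp: epath_def successively_append_iff)
      define s where "s = word_product (\<odot>) (map \<phi> p)"
      define t where "t = word_product (\<odot>) (map \<phi> (rev p))"
      have st: "s \<odot> t = \<phi> (hd p)" "t \<odot> s = \<phi> (last p)"
        using snoc.IH[OF p] by (simp_all add: s_def t_def)
      have w: "word_product (\<odot>) (map \<phi> (p @ [e])) = s \<odot> \<phi> e"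
        "word_product (\<odot>) (map \<phi> (rev (p @ [e]))) = \<phi> e \<odot> t"
        using False word_product_append[of "map \<phi> p" "[\<phi> e]"]
          word_product_append[of "[\<phi> e]" "map \<phi> (rev p)"] by (simp_all add: s_def t_def)
      have hp: "\<phi> (hd p) \<odot> s = s" "t \<odot> \<phi> (hd p) = t"
        using path_mult_ends[OF p] by (simp_all add: s_def t_def)
      have a: "\<phi> (last p) \<odot> t = t" "s \<odot> \<phi> (last p) = s"
        using st hp by (metis assoc)+
      have "s \<odot> (\<phi> e \<odot> t) = s \<odot> t" "\<phi> e \<odot> (\<phi> (last p) \<odot> \<phi> e) = \<phi> e"
        using rel a phi_idem[OF e] unfolding rel_iff by (metis assoc)+
      then show ?thesis
        using False by (simp only: w assoc absorb[OF phi_idem[OF e]] absorb[OF st(2)] st)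
          (simp add: st)
    qed
  qed (simp add: epath_def)
  from this[OF assms] show "Dom G (\<pi> p) = hd p" "Cod G (\<pi> p) = last p"
    using path_ev[OF assms] biord.epath_ends[OF assms] by (auto intro: DomI CodI)
qed

lemma path_append:
  assumes p: "epath E p" and q: "epath E q" and pq: "last p = hd q"
  shows "\<pi> (p @ tl q) = \<pi> p \<cdot> \<pi> q"
proof -
  have "Cod G (\<pi> p) = Dom G (\<pi> q)"
    using path_Dom_Cod p q pq by simp
  note c = Comp_G[OF _ _ this]
  have pq': "epath E (p @ tl q)"
    using biord.epath_append[OF assms] by blast
  obtain e q' where q': "q = e # q'" and e: "e \<in> elems E"
    using q by (cases q) (auto simp: epath_def)
  obtain p' where p': "p = p' @ [e]"
    using p pq q' by (metis append_butlast_last_id epath_def list.sel(1))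
  have "word_product (\<odot>) (map \<phi> (p @ tl q)) = word_product (\<odot>) (map \<phi> p) \<odot> word_product (\<odot>) (map \<phi> q)"
  proof (cases "q' = []")
    case True
    then show ?thesis
      using q' p' e word_product_append[of "map \<phi> p'" "[\<phi> e]"]
      by (cases "p' = []") (simp_all add: phi_idem assoc)
  next
    case False
    then show ?thesis
      using q' p' e word_product_append[of "map \<phi> p'" "[\<phi> e]"]
        word_product_append[of "[\<phi> e]" "map \<phi> q'"]
        word_product_append[of "map \<phi> p' @ [\<phi> e]" "map \<phi> q'"]
      by (cases "p' = []") (simp_all add: phi_idem assoc absorb[OF phi_idem])
  qed
  moreover have "word_product (\<odot>) (map \<phi> (rev (p @ tl q))) =
    word_product (\<odot>) (map \<phi> (rev q)) \<odot> word_product (\<odot>) (map \<phi> (rev p))"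
  proof (cases "q' = []")
    case True
    then show ?thesis
      using q' p' e word_product_append[of "[\<phi> e]" "map \<phi> (rev p')"]
      by (cases "p' = []") (simp_all add: phi_idem absorb[OF phi_idem])
  next
    case False
    then show ?thesis
      using q' p' e word_product_append[of "[\<phi> e]" "map \<phi> (rev p')"]
        word_product_append[of "map \<phi> (rev q')" "[\<phi> e]"]
        word_product_append[of "map \<phi> (rev q')" "\<phi> e # map \<phi> (rev p')"]
      by (cases "p' = []") (simp_all add: phi_idem assoc absorb[OF phi_idem])
  qed
  ultimately show ?thesis
    using path_ev[OF p] path_ev[OF q] path_ev[OF pq'] c by (intro psi_inj) auto
qed

lemma is_functor_ev: "is_functor (chain_gpd E) G \<epsilon>"
  unfolding is_functor_def
proof (intro conjI ballI impI)
  show "category (chain_gpd E)" by (rule biord.category_chain_gpd)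
  show "category G" by (rule category_G)
  show "fobj \<epsilon> \<in> Obj (chain_gpd E) \<rightarrow>\<^sub>E Obj G"
    by (simp add: fobj_ev biord.chain_gpd_simps Obj_G)
  show "fmor \<epsilon> \<in> Mor (chain_gpd E) \<rightarrow>\<^sub>E Mor G"
  proof (rule PiE_I)
    fix X assume "X \<in> Mor (chain_gpd E)"
    then obtain p where "epath E p" "X = chain_of E p"
      by (auto simp: biord.chain_gpd_simps elim: biord.chainsE)
    then show "fmor \<epsilon> X \<in> Mor G" using ev_chain_of path_ev by simp
  qed (simp add: fmor_ev biord.chain_gpd_simps)
next
  fix X assume "X \<in> Mor (chain_gpd E)"
  then obtain p where p: "epath E p" "X = chain_of E p"
    by (auto simp: biord.chain_gpd_simps elim: biord.chainsE)
  then show "Dom G (fmor \<epsilon> X) = fobj \<epsilon> (Dom (chain_gpd E) X)"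
    "Cod G (fmor \<epsilon> X) = fobj \<epsilon> (Cod (chain_gpd E) X)"
    using biord.epath_ends[OF p(1)]
    by (simp_all add: ev_chain_of path_Dom_Cod fobj_ev biord.Dom_chain_of biord.Cod_chain_of)
  fix Y assume Y: "Y \<in> Mor (chain_gpd E)" and XY: "Cod (chain_gpd E) X = Dom (chain_gpd E) Y"
  then obtain q where q: "epath E q" "Y = chain_of E q"
    by (auto simp: biord.chain_gpd_simps elim: biord.chainsE)
  have pq: "last p = hd q"
    using XY p q by (simp add: biord.Dom_chain_of biord.Cod_chain_of)
  then show "fmor \<epsilon> (X \<cdot>\<^bsub>chain_gpd E\<^esub> Y) = fmor \<epsilon> X \<cdot> fmor \<epsilon> Y"
    using p q biord.Comp_chain_of[OF p(1) q(1) pq] biord.epath_append[OF p(1) q(1) pq]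
    by (simp add: ev_chain_of path_append)
next
  fix e assume "e \<in> Obj (chain_gpd E)"
  then have e: "e \<in> elems E" by (simp add: biord.chain_gpd_simps)
  have "\<pi> [e] = idm G e"
    using path_ev[OF biord.epath_single[OF e]] idm_G[OF e] by (intro psi_inj) auto
  then show "fmor \<epsilon> (idm (chain_gpd E) e) = idm G (fobj \<epsilon> e)"
    using e by (simp add: biord.chain_gpd_simps ev_chain_of biord.epath_single fobj_ev)
qed

text \<open>
  The \<open>i\<close>-th vertex of the restricted path is the conjugate of \<open>h\<close> by the product of the first \<open>i\<close> vertices
  of \<open>q\<close>.  In the product of the restricted path these conjugates telescope, and one factor \<open>h\<close> is left.
\<close>

lemma restrict_path_product:
  assumes "epath E q" and "nle E h (hd q)"
  shows "set (restrict_path E h q) \<subseteq> elems E \<and> restrict_path E h q \<noteq> [] \<and>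
    word_product (\<odot>) (map \<phi> (restrict_path E h q)) = \<phi> h \<odot> word_product (\<odot>) (map \<phi> q) \<and>
    word_product (\<odot>) (map \<phi> (rev (restrict_path E h q))) = word_product (\<odot>) (map \<phi> (rev q)) \<odot> \<phi> h"
  using assms
proof (induction q arbitrary: h rule: induct_list012[case_names empty single longer])
  case empty
  then show ?case by (simp add: epath_def)
next
  case (single f)
  then show ?case by (simp add: nle_iff)
next
  case (longer f f' fs)
  have hE: "h \<in> elems E" and hf: "\<phi> h \<odot> \<phi> f = \<phi> h" and fh: "\<phi> f \<odot> \<phi> h = \<phi> h"
    using longer.prems(2) by (simp_all add: nle_iff)
  have q': "epath E (f' # fs)" and f: "f \<in> elems E" "f' \<in> elems E"
    and rel: "Rrel E f f' \<or> Lrel E f f'"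
    using longer.prems(1) by (auto simp: epath_def)
  have hh: "\<phi> h \<odot> \<phi> h = \<phi> h" and f'f': "\<phi> f' \<odot> \<phi> f' = \<phi> f'"
    using hE f by (simp_all add: phi_idem)
  define h' where "h' = f' \<star>\<^bsub>E\<^esub> h \<star>\<^bsub>E\<^esub> f'"
  \<comment> \<open>The basic products in \<open>h'\<close> are defined because \<open>h\<close> lies below \<open>f\<close> and \<open>f\<close> is related to \<open>f'\<close>.\<close>
  have or: "\<phi> h \<odot> \<phi> f' = \<phi> h \<or> \<phi> f' \<odot> \<phi> h = \<phi> h"
    using rel hf fh unfolding rel_iff by (metis assoc)
  then have d1: "(f', h) \<in> bdom E"
    using hE f by (auto simp: bdom_iff)
  have "\<phi> f' \<odot> \<phi> h \<odot> \<phi> f' = \<phi> f' \<odot> \<phi> h \<or> \<phi> f' \<odot> (\<phi> f' \<odot> \<phi> h) = \<phi> f' \<odot> \<phi> h"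
    using f'f' by (metis assoc)
  then have d2: "(f' \<star>\<^bsub>E\<^esub> h, f') \<in> bdom E"
    using f bprod_in[OF d1] phi_bprod[OF d1] by (auto simp: bdom_iff)
  have h'E: "h' \<in> elems E" and h': "\<phi> h' = \<phi> f' \<odot> \<phi> h \<odot> \<phi> f'"
    using bprod_in[OF d2] phi_bprod[OF d2] phi_bprod[OF d1] by (simp_all add: h'_def)
  have nle: "nle E h' f'"
    using h'E h' f f'f' by (simp add: nle_iff assoc absorb[OF f'f'])
  have h1: "\<phi> h \<odot> \<phi> h' = \<phi> h \<odot> \<phi> f'" and h2: "\<phi> h' \<odot> \<phi> h = \<phi> f' \<odot> \<phi> h"
    using or h' hh by (metis assoc)+
  have h3: "\<phi> h \<odot> \<phi> f = \<phi> h" "\<phi> f \<odot> \<phi> h = \<phi> h"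
    by (rule hf, rule fh)
  have IH: "set (restrict_path E h' (f' # fs)) \<subseteq> elems E" "restrict_path E h' (f' # fs) \<noteq> []"
    "word_product (\<odot>) (map \<phi> (restrict_path E h' (f' # fs))) = \<phi> h' \<odot> word_product (\<odot>) (map \<phi> (f' # fs))"
    "word_product (\<odot>) (map \<phi> (rev (restrict_path E h' (f' # fs)))) =
      word_product (\<odot>) (map \<phi> (rev (f' # fs))) \<odot> \<phi> h'"
    using longer.IH(2)[OF q'] nle by simp_all
  have P: "\<phi> f' \<odot> word_product (\<odot>) (map \<phi> (f' # fs)) = word_product (\<odot>) (map \<phi> (f' # fs))"
    "word_product (\<odot>) (map \<phi> (rev (f' # fs))) \<odot> \<phi> f' = word_product (\<odot>) (map \<phi> (rev (f' # fs)))"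
    using path_mult_ends[OF q'] by simp_all
  define R where "R = restrict_path E h' (f' # fs)"
  define P1 where "P1 = word_product (\<odot>) (map \<phi> (f' # fs))"
  define P2 where "P2 = word_product (\<odot>) (map \<phi> (rev (f' # fs)))"
  have rp: "restrict_path E h (f # f' # fs) = h # R"
    by (simp add: R_def h'_def)
  have "word_product (\<odot>) (map \<phi> (h # R)) = \<phi> h \<odot> word_product (\<odot>) (map \<phi> R)"
    using word_product_append[of "[\<phi> h]" "map \<phi> R"] IH(2) by (simp add: R_def)
  also have "\<dots> = \<phi> h \<odot> P1"
    using IH(3) P(1) h1 unfolding R_def[symmetric] P1_def[symmetric] by (metis assoc)
  also have "\<dots> = \<phi> h \<odot> (\<phi> f \<odot> P1)"
    by (simp add: absorb[OF hf])
  finally have w1: "word_product (\<odot>) (map \<phi> (h # R)) = \<phi> h \<odot> word_product (\<odot>) (map \<phi> (f # f' # fs))"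
    by (simp add: P1_def)
  have "word_product (\<odot>) (map \<phi> (rev (h # R))) = word_product (\<odot>) (map \<phi> (rev R)) \<odot> \<phi> h"
    using word_product_append[of "map \<phi> (rev R)" "[\<phi> h]"] IH(2) by (simp add: R_def)
  also have "\<dots> = P2 \<odot> \<phi> h"
    using IH(4) P(2) h2 unfolding R_def[symmetric] P2_def[symmetric] by (metis assoc)
  also have "\<dots> = P2 \<odot> \<phi> f \<odot> \<phi> h"
    by (simp add: assoc fh)
  also have "P2 \<odot> \<phi> f = word_product (\<odot>) (map \<phi> (rev (f # f' # fs)))"
    using word_product_append[of "map \<phi> (rev (f' # fs))" "[\<phi> f]"] by (simp add: P2_def)
  finally show ?case
    using w1 IH(1) hE unfolding rp R_def[symmetric] by simp
qed

lemma v_isomorphism_ev: "v_isomorphism (chain_gpd E) G \<epsilon>"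
  unfolding v_isomorphism_def
proof (intro conjI ballI)
  show "is_functor (chain_gpd E) G \<epsilon>" by (rule is_functor_ev)
  show "bij_betw (fobj \<epsilon>) (Obj (chain_gpd E)) (Obj G)"
    by (simp add: fobj_ev biord.chain_gpd_simps Obj_G bij_betw_def)
  have ord: "\<exists>p q. epath E p \<and> epath E q \<and> X = chain_of E p \<and> Y = chain_of E q \<and>
      nle E (hd p) (hd q) \<and> X = chain_of E (restrict_path E (hd p) q)"
    if "(X, Y) \<in> Ord (chain_gpd E)" for X Y
  proof -
    have "X \<in> chains E" "Y \<in> chains E"
      and "\<exists>p\<in>X. \<exists>q\<in>Y. nle E (hd p) (hd q) \<and> X = chain_of E (restrict_path E (hd p) q)"
      using that by (simp_all add: chain_gpd_def)
    then show ?thesis using biord.in_chainsD by metis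
  qed
  show "order_preserving (chain_gpd E) G \<epsilon>"
    unfolding order_preserving_def
  proof (intro ballI, clarify)
    fix X Y assume "(X, Y) \<in> Ord (chain_gpd E)"
    then obtain p q where p: "epath E p" and q: "epath E q"
      and XY: "X = chain_of E p" "Y = chain_of E q" "X = chain_of E (restrict_path E (hd p) q)"
      and n: "nle E (hd p) (hd q)"
      using ord by metis
    have r: "epath E (restrict_path E (hd p) q)"
      using XY(1,3) p biord.chain_eq_epath biord.chain_of_eq_iff by metis
    have "hd (restrict_path E (hd p) q) = hd p"
      using q by (cases "(E, hd p, q)" rule: restrict_path.cases) (auto simp: epath_def)
    then show "(fmor \<epsilon> X, fmor \<epsilon> Y) \<in> Ord G"
      unfolding Ord_G XY(2,3) using restrict_path_product[OF q n] n q r path_ev[OF q] path_ev[OF r]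
      by (simp add: ev_chain_of path_Dom_Cod)
  qed
  fix e f assume "e \<in> Obj (chain_gpd E)" "f \<in> Obj (chain_gpd E)"
  then have e: "e \<in> elems E" and f: "f \<in> elems E"
    by (simp_all add: biord.chain_gpd_simps)
  have "vle (chain_gpd E) e f \<longleftrightarrow> nle E e f"
  proof
    assume "vle (chain_gpd E) e f"
    then obtain p q where pq: "epath E p" "epath E q" "chain_of E [e] = chain_of E p"
      "chain_of E [f] = chain_of E q" "nle E (hd p) (hd q)"
      using ord unfolding vle_def by (metis biord.chain_gpd_simps(3))
    have "hd p = e" "hd q = f"
      using pq(3,4) e f biord.chain_eq_epath biord.epath_single biord.chain_of_eq_iff
      by (metis list.sel(1))+
    then show "nle E e f" using pq(5) by simp
  next
    assume "nle E e f"
    then have "\<exists>p\<in>chain_of E [e]. \<exists>q\<in>chain_of E [f]. nle E (hd p) (hd q) \<and>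
      chain_of E [e] = chain_of E (restrict_path E (hd p) q)"
      by (intro bexI[of _ "[e]"] bexI[of _ "[f]"]) (simp_all add: biord.self_in_chain_of)
    then show "vle (chain_gpd E) e f"
      using e f biord.chain_of_in_chains biord.epath_single
      unfolding vle_def biord.chain_gpd_simps by (simp add: chain_gpd_def)
  qed
  then show "vle (chain_gpd E) e f \<longleftrightarrow> vle G (fobj \<epsilon> e) (fobj \<epsilon> f)"
    using vle_iff[OF e f] e f by (simp add: fobj_ev)
qed

lemma ev_pair:
  assumes "Rrel E e f \<or> Lrel E e f"
  shows "fmor \<epsilon> (chain_of E [e, f]) \<in> Mor G" and "\<psi> (fmor \<epsilon> (chain_of E [e, f])) = \<phi> e \<odot> \<phi> f"
    and "\<psi>' (fmor \<epsilon> (chain_of E [e, f])) = \<phi> f \<odot> \<phi> e"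
    and "Dom G (fmor \<epsilon> (chain_of E [e, f])) = e" and "Cod G (fmor \<epsilon> (chain_of E [e, f])) = f"
proof -
  have "epath E [e, f]"
    using assms by (auto simp: epath_def rel_iff)
  then show "fmor \<epsilon> (chain_of E [e, f]) \<in> Mor G" "\<psi> (fmor \<epsilon> (chain_of E [e, f])) = \<phi> e \<odot> \<phi> f"
    "\<psi>' (fmor \<epsilon> (chain_of E [e, f])) = \<phi> f \<odot> \<phi> e"
    "Dom G (fmor \<epsilon> (chain_of E [e, f])) = e" "Cod G (fmor \<epsilon> (chain_of E [e, f])) = f"
    using path_ev[of "[e, f]"] path_Dom_Cod[of "[e, f]"] by (simp_all add: ev_chain_of)
qed

lemma IG1_representation: "IG1 \<lparr>ibi = E, igp = G, iev = \<epsilon>\<rparr>"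
  unfolding IG1_def Let_def igpd.simps
proof (intro ballI impI, elim conjE, intro conjI impI)
  fix x e1 e2 f1 f2
  assume x: "x \<in> Mor G" and e: "e1 \<in> elems E" "e2 \<in> elems E" and f: "f1 \<in> elems E" "f2 \<in> elems E"
    and n: "nle E e1 (Dom G x)" "nle E e2 (Dom G x)"
    and f1: "f1 = Cod G (grestrict G e1 x)" and f2: "f2 = Cod G (grestrict G e2 x)"
  note g1 = grestrict[OF x n(1)] and g2 = grestrict[OF x n(2)]
  note a = psi_absorb[OF x] nle_Dom_absorb[OF x n(1)] nle_Dom_absorb[OF x n(2)]
  have \<phi>f: "\<phi> f1 = \<psi>' x \<odot> (\<phi> e1 \<odot> \<psi> x)" "\<phi> f2 = \<psi>' x \<odot> (\<phi> e2 \<odot> \<psi> x)"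
    using g1(5) g2(5) f1 f2 by (simp_all add: assoc)
  {
    assume "ler E e1 e2"
    then have r: "\<phi> e2 \<odot> \<phi> e1 = \<phi> e1"
      by (simp add: rel_iff)
    note b = a r absorb[OF r]
    show f12: "ler E f1 f2"
      using f by (simp add: rel_iff \<phi>f assoc b)
    have d: "(e1, e2) \<in> bdom E" "(f1, f2) \<in> bdom E"
      using \<open>ler E e1 e2\<close> f12 e f by (auto simp: bdom_iff rel_iff)
    note p = d[THEN bprod_in] d[THEN phi_bprod]
    have R: "Rrel E e1 (e1 \<star>\<^bsub>E\<^esub> e2)" "Rrel E f1 (f1 \<star>\<^bsub>E\<^esub> f2)"
      using biord.B2_r \<open>ler E e1 e2\<close> f12 by auto
    have n12: "nle E (e1 \<star>\<^bsub>E\<^esub> e2) (Dom G x)"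
      using n p by (simp add: nle_iff assoc) (metis assoc)
    note g12 = grestrict[OF x n12]
    note ev1 = ev_pair[OF disjI1[OF R(1)]] and ev2 = ev_pair[OF disjI1[OF R(2)]]
    note c1 = Comp_G[OF ev1(1) g12(1)] and c2 = Comp_G[OF g1(1) ev2(1)]
    show "fmor \<epsilon> (chain_of E [e1, e1 \<star>\<^bsub>E\<^esub> e2]) \<cdot> grestrict G (e1 \<star>\<^bsub>E\<^esub> e2) x =
      grestrict G e1 x \<cdot> fmor \<epsilon> (chain_of E [f1, f1 \<star>\<^bsub>E\<^esub> f2])"
      using c1 c2 ev1 ev2 g12 g1 f1 p
      by (intro psi_inj) (auto simp: \<phi>f assoc b)
  }
  {
    assume "lel E e1 e2"
    then have l: "\<phi> e1 \<odot> \<phi> e2 = \<phi> e1"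
      by (simp add: rel_iff)
    note b = a l absorb[OF l]
    show f12: "lel E f1 f2"
      using f by (simp add: rel_iff \<phi>f assoc b)
    have d: "(e2, e1) \<in> bdom E" "(f2, f1) \<in> bdom E"
      using \<open>lel E e1 e2\<close> f12 e f by (auto simp: bdom_iff rel_iff)
    note p = d[THEN bprod_in] d[THEN phi_bprod]
    have L: "Lrel E e1 (e2 \<star>\<^bsub>E\<^esub> e1)" "Lrel E f1 (f2 \<star>\<^bsub>E\<^esub> f1)"
      using biord.B2_l \<open>lel E e1 e2\<close> f12 by auto
    have n12: "nle E (e2 \<star>\<^bsub>E\<^esub> e1) (Dom G x)"
      using n p by (simp add: nle_iff assoc) (metis assoc)
    note g12 = grestrict[OF x n12]
    note ev1 = ev_pair[OF disjI2[OF L(1)]] and ev2 = ev_pair[OF disjI2[OF L(2)]]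
    note c1 = Comp_G[OF ev1(1) g12(1)] and c2 = Comp_G[OF g1(1) ev2(1)]
    show "fmor \<epsilon> (chain_of E [e1, e2 \<star>\<^bsub>E\<^esub> e1]) \<cdot> grestrict G (e2 \<star>\<^bsub>E\<^esub> e1) x =
      grestrict G e1 x \<cdot> fmor \<epsilon> (chain_of E [f1, f2 \<star>\<^bsub>E\<^esub> f1])"
      using c1 c2 ev1 ev2 g12 g1 f1 p
      by (intro psi_inj) (auto simp: \<phi>f assoc b)
  }
qed

lemma IG2_representation: "IG2 \<lparr>ibi = E, igp = G, iev = \<epsilon>\<rparr>"
  unfolding IG2_def igpd.simps
proof (intro allI impI)
  fix e f g h assume sq: "row_singular E e f g h \<or> column_singular E e f g h"
  then have "E_square E e f g h"
    unfolding row_singular_def column_singular_def by blast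
  then have rel: "Rrel E e f" "Lrel E f h" "Lrel E e g" "Rrel E g h"
    unfolding E_square_def Rrel_def Lrel_def by auto
  note ev1 = ev_pair[OF disjI1[OF rel(1)]] and ev2 = ev_pair[OF disjI2[OF rel(2)]]
    and ev3 = ev_pair[OF disjI2[OF rel(3)]] and ev4 = ev_pair[OF disjI1[OF rel(4)]]
  have q: "\<phi> e \<odot> \<phi> f = \<phi> f" "\<phi> f \<odot> \<phi> e = \<phi> e" "\<phi> f \<odot> \<phi> h = \<phi> f" "\<phi> h \<odot> \<phi> f = \<phi> h"
    "\<phi> e \<odot> \<phi> g = \<phi> e" "\<phi> g \<odot> \<phi> e = \<phi> g" "\<phi> g \<odot> \<phi> h = \<phi> h" "\<phi> h \<odot> \<phi> g = \<phi> g"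
    "\<phi> f \<odot> \<phi> f = \<phi> f" "\<phi> g \<odot> \<phi> g = \<phi> g"
    using rel phi_idem unfolding rel_iff by auto
  \<comment> \<open>Singular squares are rectangular bands: the two products of \<open>e\<close> and \<open>h\<close> are the other two corners.\<close>
  have "\<phi> e \<odot> \<phi> h = \<phi> f \<and> \<phi> h \<odot> \<phi> e = \<phi> g"
    using sq
  proof
    assume "row_singular E e f g h"
    then obtain k where k: "k \<in> elems E" "lel E e k" "lel E f k" "g = k \<star>\<^bsub>E\<^esub> e" "h = k \<star>\<^bsub>E\<^esub> f"
      unfolding row_singular_def by blast
    have ek: "\<phi> e \<odot> \<phi> k = \<phi> e" and fk: "\<phi> f \<odot> \<phi> k = \<phi> f"
      using k by (simp_all add: rel_iff)
    have d: "(k, e) \<in> bdom E" "(k, f) \<in> bdom E"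
      using k by (auto simp: bdom_iff rel_iff)
    show ?thesis
      using q by (simp add: k(4,5) d[THEN phi_bprod] assoc absorb[OF ek] q)
  next
    assume "column_singular E e f g h"
    then obtain k where k: "k \<in> elems E" "ler E e k" "ler E g k" "f = e \<star>\<^bsub>E\<^esub> k" "h = g \<star>\<^bsub>E\<^esub> k"
      unfolding column_singular_def by blast
    have ke: "\<phi> k \<odot> \<phi> e = \<phi> e" and kg: "\<phi> k \<odot> \<phi> g = \<phi> g"
      using k by (simp_all add: rel_iff)
    have d: "(e, k) \<in> bdom E" "(g, k) \<in> bdom E"
      using k by (auto simp: bdom_iff rel_iff)
    show ?thesis
      using q by (simp add: k(4,5) d[THEN phi_bprod] assoc ke absorb[OF q(5)] q)
  qed
  then show "fmor \<epsilon> (chain_of E [e, f]) \<cdot> fmor \<epsilon> (chain_of E [f, h]) =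
    fmor \<epsilon> (chain_of E [e, g]) \<cdot> fmor \<epsilon> (chain_of E [g, h])"
    using Comp_G[OF ev1(1) ev2(1)] Comp_G[OF ev3(1) ev4(1)] ev1 ev2 ev3 ev4 q
    by (intro psi_inj) (auto simp: assoc)
qed

theorem inductive_groupoid: "inductive_groupoid \<lparr>ibi = E, igp = G, iev = \<epsilon>\<rparr>"
  unfolding inductive_groupoid_def igpd.simps
  using regular_biordered_set ordered_groupoid_G v_isomorphism_ev Obj_G fobj_ev
    IG1_representation IG2_representation by simp

end

section \<open>Isomorphisms and epimorphic components\<close>

context category
begin

declare Dom_in [simp] Cod_in [simp] idm_in [simp] Dom_idm [simp] Cod_idm [simp]
  Comp_in [simp] Dom_Comp [simp] Cod_Comp [simp] idm_left [simp] idm_right [simp]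

lemma idm_left': "\<lbrakk>f \<in> Mor C; Dom C f = c\<rbrakk> \<Longrightarrow> idm C c \<cdot> f = f"
  using idm_left by blast

lemma idm_right': "\<lbrakk>f \<in> Mor C; Cod C f = c\<rbrakk> \<Longrightarrow> f \<cdot> idm C c = f"
  using idm_right by blast

lemma inverses_unique: "\<lbrakk>inverses C f g; inverses C f h\<rbrakk> \<Longrightarrow> g = h"
  unfolding inverses_def by (metis Comp_assoc idm_left idm_right)

lemma inverses_inv_mor: "inverses C f g \<Longrightarrow> inv_mor C f = g"
  unfolding inv_mor_def using inverses_unique by blast

lemma iso_inverse: "is_iso C f \<Longrightarrow> inverses C f (inv_mor C f)"
  unfolding is_iso_def using inverses_inv_mor by blast

lemma iso_inv_simps:
  assumes "is_iso C f"
  shows "f \<in> Mor C" "inv_mor C f \<in> Mor C" "Dom C (inv_mor C f) = Cod C f"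
    "Cod C (inv_mor C f) = Dom C f" "f \<cdot> inv_mor C f = idm C (Dom C f)"
    "inv_mor C f \<cdot> f = idm C (Cod C f)"
  using iso_inverse[OF assms] unfolding inverses_def by auto

lemma inverses_sym: "inverses C f g \<Longrightarrow> inverses C g f"
  unfolding inverses_def by auto

lemma iso_inv_mor: "is_iso C f \<Longrightarrow> is_iso C (inv_mor C f) \<and> inv_mor C (inv_mor C f) = f"
  using iso_inverse inverses_sym inverses_inv_mor unfolding is_iso_def by blast

lemma inverses_idm: "c \<in> Obj C \<Longrightarrow> inverses C (idm C c) (idm C c)"
  unfolding inverses_def by (simp add: idm_left')

lemma iso_idm: "c \<in> Obj C \<Longrightarrow> is_iso C (idm C c) \<and> inv_mor C (idm C c) = idm C c"
  using inverses_idm inverses_inv_mor unfolding is_iso_def by blast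

lemma inverses_Comp:
  assumes "inverses C f f'" and "inverses C g g'" and "Cod C f = Dom C g"
  shows "inverses C (f \<cdot> g) (g' \<cdot> f')"
proof -
  have m: "f \<in> Mor C" "g \<in> Mor C" "f' \<in> Mor C" "g' \<in> Mor C"
    and d: "Cod C f = Dom C g" "Dom C f' = Dom C g" "Cod C f' = Dom C f" "Dom C g' = Cod C g"
      "Cod C g' = Dom C g"
    and e: "f \<cdot> f' = idm C (Dom C f)" "g' \<cdot> g = idm C (Cod C g)" "g \<cdot> g' = idm C (Dom C g)"
      "f' \<cdot> f = idm C (Dom C g)"
    using assms unfolding inverses_def by auto
  have "(f \<cdot> g) \<cdot> (g' \<cdot> f') = f \<cdot> ((g \<cdot> g') \<cdot> f')"
    using m d by (simp add: Comp_assoc)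
  moreover have "(g' \<cdot> f') \<cdot> (f \<cdot> g) = g' \<cdot> ((f' \<cdot> f) \<cdot> g)"
    using m d by (simp add: Comp_assoc)
  ultimately show ?thesis
    using m d e unfolding inverses_def by (simp add: idm_left')
qed

lemma iso_Comp:
  assumes "is_iso C f" and "is_iso C g" and "Cod C f = Dom C g"
  shows "is_iso C (f \<cdot> g)" and "inv_mor C (f \<cdot> g) = inv_mor C g \<cdot> inv_mor C f"
  using inverses_Comp[OF iso_inverse[OF assms(1)] iso_inverse[OF assms(2)] assms(3)]
    inverses_inv_mor unfolding is_iso_def by blast+

end

text \<open>
  In a normal category these are the morphisms of the form \<open>q u\<close> with a retraction \<open>q\<close> and an isomorphism
  \<open>u\<close>, that is, the epimorphic components.  Unlike that form, the existence of a section visibly survives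
  composition and functors.
\<close>

definition split_epi :: "('o, 'm, 'z) cat_scheme \<Rightarrow> 'm \<Rightarrow> bool" where
  "split_epi C p \<longleftrightarrow> p \<in> Mor C \<and>
     (\<exists>s\<in>Mor C. Dom C s = Cod C p \<and> Cod C s = Dom C p \<and> s \<cdot>\<^bsub>C\<^esub> p = idm C (Cod C p))"

lemma (in category) split_epi_in: "split_epi C p \<Longrightarrow> p \<in> Mor C"
  by (simp add: split_epi_def)

context category
begin

lemma iso_split_epi: "is_iso C p \<Longrightarrow> split_epi C p"
  using iso_inv_simps[of p] unfolding split_epi_def by metis

lemma split_epi_idm: "c \<in> Obj C \<Longrightarrow> split_epi C (idm C c)"
  using iso_idm iso_split_epi by blast

lemma split_epi_Comp:
  assumes "split_epi C p" and "split_epi C q" and pq: "Cod C p = Dom C q"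
  shows "split_epi C (p \<cdot> q)"
proof -
  obtain s t where p: "p \<in> Mor C" and q: "q \<in> Mor C"
    and s: "s \<in> Mor C" "Dom C s = Cod C p" "Cod C s = Dom C p" "s \<cdot> p = idm C (Cod C p)"
    and t: "t \<in> Mor C" "Dom C t = Cod C q" "Cod C t = Dom C q" "t \<cdot> q = idm C (Cod C q)"
    using assms unfolding split_epi_def by blast
  have "(t \<cdot> s) \<cdot> (p \<cdot> q) = t \<cdot> ((s \<cdot> p) \<cdot> q)"
    using p q s(1-3) t(1-3) pq by (simp add: Comp_assoc)
  also have "\<dots> = idm C (Cod C q)"
    using p q s t pq by (simp add: idm_left')
  finally show ?thesis
    using p q s(1-3) t(1-3) pq unfolding split_epi_def by (intro conjI bexI[of _ "t \<cdot> s"]) simp_all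
qed

lemma split_epi_cancel:
  assumes "split_epi C p" and f: "f \<in> Mor C" "Dom C f = Cod C p"
    and g: "g \<in> Mor C" "Dom C g = Cod C p" and "p \<cdot> f = p \<cdot> g"
  shows "f = g"
proof -
  obtain s where p: "p \<in> Mor C" and s: "s \<in> Mor C" "Dom C s = Cod C p" "Cod C s = Dom C p"
    "s \<cdot> p = idm C (Cod C p)"
    using assms unfolding split_epi_def by blast
  have "f = s \<cdot> (p \<cdot> f)"
    using f p s Comp_assoc[of s p f] by (simp add: idm_left')
  also have "\<dots> = g"
    using assms(6) g p s Comp_assoc[of s p g] by (simp add: idm_left')
  finally show ?thesis .
qed

end

context category_with_subobjects
begin

lemma incl_idm: "c \<in> Obj C \<Longrightarrow> idm C c \<in> Incl C"
  using category.idm_in[OF incl_category] by (simp add: incl_cat_def)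

lemma incl_Comp: "\<lbrakk>j \<in> Incl C; k \<in> Incl C; Cod C j = Dom C k\<rbrakk> \<Longrightarrow> j \<cdot> k \<in> Incl C"
  using category.Comp_in[OF incl_category] by (simp add: incl_cat_def)

lemma incl_in_Mor: "j \<in> Incl C \<Longrightarrow> j \<in> Mor C"
  using Incl_subset by blast

lemma incl_eq: "j \<in> Incl C \<Longrightarrow> incl C (Dom C j) (Cod C j) = j"
  unfolding incl_def using incl_unique by blast

lemma subobj_incl:
  assumes "subobj C a b"
  shows "incl C a b \<in> Incl C" "incl C a b \<in> Mor C" "Dom C (incl C a b) = a"
    "Cod C (incl C a b) = b" "a \<in> Obj C" "b \<in> Obj C"
proof -
  obtain j where j: "j \<in> Incl C" "Dom C j = a" "Cod C j = b"
    using assms unfolding subobj_def by blast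
  then have "incl C a b = j"
    using incl_eq by blast
  then show "incl C a b \<in> Incl C" "incl C a b \<in> Mor C" "Dom C (incl C a b) = a"
    "Cod C (incl C a b) = b" "a \<in> Obj C" "b \<in> Obj C"
    using j incl_in_Mor[OF j(1)] Dom_in[of j] Cod_in[of j] by auto
qed

lemma subobj_refl: "a \<in> Obj C \<Longrightarrow> subobj C a a"
  using incl_idm unfolding subobj_def by (metis Dom_idm Cod_idm)

lemma incl_refl: "a \<in> Obj C \<Longrightarrow> incl C a a = idm C a"
  using incl_eq[OF incl_idm] by simp

lemma subobj_trans: "\<lbrakk>subobj C a b; subobj C b c\<rbrakk> \<Longrightarrow> subobj C a c"
  using incl_Comp[of "incl C a b" "incl C b c"] subobj_incl[of a b] subobj_incl[of b c]
  unfolding subobj_def by (intro bexI[of _ "incl C a b \<cdot> incl C b c"]) auto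

lemma incl_trans: "\<lbrakk>subobj C a b; subobj C b c\<rbrakk> \<Longrightarrow> incl C a b \<cdot> incl C b c = incl C a c"
  using incl_Comp[of "incl C a b" "incl C b c"] subobj_incl[of a b] subobj_incl[of b c]
    incl_eq[of "incl C a b \<cdot> incl C b c"] by simp

lemma subobj_antisym:
  assumes ab: "subobj C a b" and ba: "subobj C b a"
  shows "a = b"
proof -
  have "inverses (incl_cat C) (incl C a b) (incl C b a)"
    using subobj_incl[OF ab] subobj_incl[OF ba] incl_trans[OF ab ba] incl_trans[OF ba ab] incl_refl
    unfolding inverses_def by (simp add: incl_cat_def)
  then have "incl C a b = idm C a"
    using incl_strict[of "incl C a b"] subobj_incl[OF ab] unfolding is_iso_def by auto
  then show ?thesis
    using subobj_incl[OF ab] by (metis Cod_idm)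
qed

text \<open>
  A morphism factors in at most one way as a split epimorphism followed by an inclusion: a section of
  one of the epimorphisms exhibits each inclusion as a factor of the other.
\<close>

lemma split_epi_incl_unique:
  assumes p: "split_epi C p" "Cod C p = Dom C j" and j: "j \<in> Incl C"
    and q: "split_epi C q" "Cod C q = Dom C k" and k: "k \<in> Incl C"
    and jk: "Cod C j = Cod C k" and eq: "p \<cdot> j = q \<cdot> k"
  shows "p = q \<and> j = k"
proof -
  have below: "subobj C (Dom C j) (Dom C k)"
    if p: "split_epi C p" "Cod C p = Dom C j" and j: "j \<in> Incl C"
      and q: "split_epi C q" "Cod C q = Dom C k" and k: "k \<in> Incl C"
      and jk: "Cod C j = Cod C k" and eq: "p \<cdot> j = q \<cdot> k"
    for p q j k
  proof -
    obtain s where s: "p \<in> Mor C" "s \<in> Mor C" "Dom C s = Cod C p" "Cod C s = Dom C p"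
      "s \<cdot> p = idm C (Cod C p)"
      using p unfolding split_epi_def by blast
    have m: "q \<in> Mor C" "j \<in> Mor C" "k \<in> Mor C"
      using q j k incl_in_Mor split_epi_in by auto
    have pq: "Dom C p = Dom C q"
      using eq s(1) m p(2) q(2) Dom_Comp by metis
    have "j = (s \<cdot> p) \<cdot> j"
      using s m p(2) by (simp add: idm_left')
    also have "\<dots> = (s \<cdot> q) \<cdot> k"
      using s(1-4) m p(2) q(2) pq eq by (simp add: Comp_assoc)
    finally have "s \<cdot> q \<in> Incl C"
      using incl_cancel[OF j k, of "s \<cdot> q"] s(1-4) m p(2) q(2) pq by simp
    then show ?thesis
      unfolding subobj_def using s(1-4) m p(2) q(2) pq
      by (intro bexI[of _ "s \<cdot> q"]) simp_all
  qed
  have "Dom C j = Dom C k"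
    using below[OF assms] below[OF q k p j jk[symmetric] eq[symmetric]] subobj_antisym by blast
  then have "j = k" using incl_unique j k jk by blast
  moreover have "p = q"
  proof -
    have m: "p \<in> Mor C" "q \<in> Mor C" "j \<in> Mor C"
      using p q j incl_in_Mor split_epi_in by auto
    have "Dom C p = Dom C q"
      using eq \<open>j = k\<close> m p(2) q(2) Dom_Comp by metis
    then show ?thesis
      using incl_mono[OF j] eq \<open>j = k\<close> m p(2) q(2) unfolding is_mono_def by metis
  qed
  ultimately show ?thesis by blast
qed

lemma retraction_split_epi:
  assumes "is_retraction C c c' q"
  shows "split_epi C q" and "Dom C q = c" and "Cod C q = c'"
  using assms subobj_incl[of c' c] unfolding is_retraction_def split_epi_def Hom_def by auto

end

context normal_category
begin

lemma factorization_split_epi: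
  assumes "normal_factorization C f q u j"
  shows "split_epi C (q \<cdot> u)" "Cod C (q \<cdot> u) = Dom C j" "Dom C (q \<cdot> u) = Dom C f"
    "j \<in> Incl C" "Cod C j = Cod C f" "f = q \<cdot> u \<cdot> j"
proof -
  have q: "is_retraction C (Dom C f) (Dom C u) q" and u: "is_iso C u"
    and j: "j \<in> Incl C" "Dom C j = Cod C u" "Cod C j = Cod C f" and f: "f = q \<cdot> u \<cdot> j"
    using assms unfolding normal_factorization_def by blast+
  note r = retraction_split_epi[OF q]
  show "split_epi C (q \<cdot> u)"
    using r u by (simp add: split_epi_Comp iso_split_epi)
  show "Cod C (q \<cdot> u) = Dom C j" "Dom C (q \<cdot> u) = Dom C f"
    using r u j by (simp_all add: split_epi_in iso_inv_simps(1))
  show "j \<in> Incl C" "Cod C j = Cod C f" "f = q \<cdot> u \<cdot> j"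
    by fact+
qed

text \<open>
  By the uniqueness of such factorizations, any factorization into a split epimorphism and an inclusion
  may serve to compute the epimorphic component and the image.
\<close>

lemma epi_im_eqI:
  assumes p: "split_epi C p" "Cod C p = Dom C j" and j: "j \<in> Incl C" and f: "f = p \<cdot> j"
  shows "epi C f = p" and "im C f = Dom C j"
proof -
  have fM: "f \<in> Mor C" and fC: "Cod C f = Cod C j"
    using p j f incl_in_Mor split_epi_in by auto
  have unique: "q \<cdot> u = p \<and> k = j" if "normal_factorization C f q u k" for q u k
  proof -
    note n = factorization_split_epi[OF that]
    have "Cod C k = Cod C j" using n(5) fC by simp
    moreover have "q \<cdot> u \<cdot> k = p \<cdot> j" using n(6) f by (rule subst)
    ultimately show ?thesis
      using split_epi_incl_unique[OF n(1,2,4) p j] by blast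
  qed
  obtain q u k where nf: "normal_factorization C f q u k"
    using has_factorization[OF fM] by blast
  show "epi C f = p"
    unfolding epi_def by (rule the_equality) (use nf unique in blast)+
  show "im C f = Dom C j"
    unfolding im_def by (rule the_equality) (use nf unique in blast)+
qed

lemma epi_props:
  assumes "f \<in> Mor C"
  shows "split_epi C (epi C f)" "epi C f \<in> Mor C" "Dom C (epi C f) = Dom C f"
    "Cod C (epi C f) = im C f" "subobj C (im C f) (Cod C f)" "im C f \<in> Obj C"
    "epi C f \<cdot> incl C (im C f) (Cod C f) = f"
proof -
  obtain q u j where nf: "normal_factorization C f q u j"
    using has_factorization[OF assms] by blast
  note n = factorization_split_epi[OF nf]
  have e: "epi C f = q \<cdot> u" "im C f = Dom C j"
    using epi_im_eqI[OF n(1,2,4,6)] by auto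
  have "incl C (im C f) (Cod C f) = j"
    using e n incl_eq by metis
  then show "split_epi C (epi C f)" "epi C f \<in> Mor C" "Dom C (epi C f) = Dom C f"
    "Cod C (epi C f) = im C f" "epi C f \<cdot> incl C (im C f) (Cod C f) = f"
    using e n split_epi_in by auto
  show "subobj C (im C f) (Cod C f)" using e n unfolding subobj_def by auto
  then show "im C f \<in> Obj C" using subobj_incl by blast
qed

lemma epi_split_epi:
  assumes "split_epi C p"
  shows "epi C p = p" and "im C p = Cod C p"
proof -
  have p: "p \<in> Mor C" using assms by (rule split_epi_in)
  show "epi C p = p" "im C p = Cod C p"
    using epi_im_eqI[OF assms, of "idm C (Cod C p)", OF _ incl_idm] p
    by (simp_all only: idm_right Dom_idm Cod_in)
qed

lemma epi_Comp_split_epi: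
  assumes p: "split_epi C p" and g: "g \<in> Mor C" "Cod C p = Dom C g"
  shows "epi C (p \<cdot> g) = p \<cdot> epi C g" and "im C (p \<cdot> g) = im C g"
proof -
  note e = epi_props[OF g(1)] and i = subobj_incl[OF epi_props(5)[OF g(1)]]
  have "p \<cdot> g = (p \<cdot> epi C g) \<cdot> incl C (im C g) (Cod C g)"
    using Comp_assoc[OF split_epi_in[OF p] e(2) i(2)] g(2) e(3,4,7) i(3) by simp
  moreover have "split_epi C (p \<cdot> epi C g)"
    using split_epi_Comp[OF p e(1)] g(2) e(3) by simp
  moreover have "Cod C (p \<cdot> epi C g) = im C g"
    using split_epi_in[OF p] g(2) e(2-4) by simp
  ultimately show "epi C (p \<cdot> g) = p \<cdot> epi C g" "im C (p \<cdot> g) = im C g"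
    using epi_im_eqI[OF _ _ i(1)] i(3) by metis+
qed

lemma epi_Comp_incl:
  assumes f: "f \<in> Mor C" and j: "j \<in> Incl C" "Cod C f = Dom C j"
  shows "epi C (f \<cdot> j) = epi C f" and "im C (f \<cdot> j) = im C f"
proof -
  note e = epi_props[OF f] and i = subobj_incl[OF epi_props(5)[OF f]]
  have "f \<cdot> j = epi C f \<cdot> (incl C (im C f) (Cod C f) \<cdot> j)"
    using f j e i incl_in_Mor by (metis Comp_assoc)
  then show "epi C (f \<cdot> j) = epi C f" "im C (f \<cdot> j) = im C f"
    using epi_im_eqI[of "epi C f" "incl C (im C f) (Cod C f) \<cdot> j" "f \<cdot> j"] j e i incl_in_Mor
    by (simp_all add: incl_Comp)
qed

lemma epi_Comp:
  assumes f: "f \<in> Mor C" and g: "g \<in> Mor C" "Cod C f = Dom C g"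
  shows "epi C (f \<cdot> g) = epi C f \<cdot> epi C (incl C (im C f) (Cod C f) \<cdot> g)"
    and "im C (f \<cdot> g) = im C (incl C (im C f) (Cod C f) \<cdot> g)"
proof -
  note e = epi_props[OF f] and i = subobj_incl[OF epi_props(5)[OF f]]
  have "f \<cdot> g = epi C f \<cdot> (incl C (im C f) (Cod C f) \<cdot> g)"
    using f g e i by (metis Comp_assoc)
  then show "epi C (f \<cdot> g) = epi C f \<cdot> epi C (incl C (im C f) (Cod C f) \<cdot> g)"
    "im C (f \<cdot> g) = im C (incl C (im C f) (Cod C f) \<cdot> g)"
    using epi_Comp_split_epi[OF e(1), of "incl C (im C f) (Cod C f) \<cdot> g"] g e i by simp_all
qed

lemma split_epi_iso_left:
  assumes p: "split_epi C p" and t: "t \<in> Mor C" "Dom C t = Cod C p" "Cod C t = Dom C p"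
    "p \<cdot> t = idm C (Dom C p)"
  shows "is_iso C p"
proof -
  obtain s where s: "p \<in> Mor C" "s \<in> Mor C" "Dom C s = Cod C p" "Cod C s = Dom C p"
    "s \<cdot> p = idm C (Cod C p)"
    using p unfolding split_epi_def by blast
  have "s = s \<cdot> (p \<cdot> t)"
    using s t by (simp add: idm_right')
  also have "\<dots> = t"
    using s t Comp_assoc[of s p t] by (simp add: idm_left')
  finally show ?thesis
    using s t unfolding is_iso_def inverses_def by metis
qed

section \<open>The semigroup of cones\<close>

abbreviation "cone \<gamma> \<equiv> is_cone C (apex C \<gamma>) \<gamma>"

lemma cone_apex:
  assumes "is_cone C d \<gamma>"
  shows "apex C \<gamma> = d"
proof -
  obtain c where c: "c \<in> Obj C" "Cod C (\<gamma> c) = d"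
    using assms unfolding is_cone_def Hom_def by blast
  have "d' = d" if "is_cone C d' \<gamma>" for d'
    using that c unfolding is_cone_def Hom_def by auto
  then show ?thesis
    using assms unfolding apex_def by blast
qed

lemma is_cone_cone: "is_cone C d \<gamma> \<Longrightarrow> cone \<gamma>"
  using cone_apex by metis

lemma cone_at:
  assumes "cone \<gamma>"
  shows "apex C \<gamma> \<in> Obj C" and "c \<in> Obj C \<Longrightarrow> \<gamma> c \<in> Mor C"
    and "c \<in> Obj C \<Longrightarrow> Dom C (\<gamma> c) = c" and "c \<in> Obj C \<Longrightarrow> Cod C (\<gamma> c) = apex C \<gamma>"
  using assms unfolding is_cone_def Hom_def by auto

lemma cone_incl: "\<lbrakk>cone \<gamma>; subobj C c c'\<rbrakk> \<Longrightarrow> incl C c c' \<cdot> \<gamma> c' = \<gamma> c"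
  using subobj_incl(5,6)[of c c'] unfolding is_cone_def by blast

lemma cone_iso:
  assumes "cone \<gamma>"
  obtains c where "c \<in> Obj C" and "is_iso C (\<gamma> c)"
  using assms unfolding is_cone_def by blast

lemma cone_star_at: "a \<in> Obj C \<Longrightarrow> cone_star C \<gamma> p a = \<gamma> a \<cdot> p"
  by (simp add: cone_star_def)

text \<open>
  The isomorphism among the components of \<open>\<gamma> * p\<close>: if \<open>\<gamma>(a)\<close> is invertible, a section of \<open>p\<close> followed
  by \<open>\<gamma>(a)\<inverse>\<close> embeds the new apex in \<open>a\<close>, and \<open>\<gamma> * p\<close> is invertible at the image of this embedding.
\<close>

lemma cone_star_cone:
  assumes g: "cone \<gamma>" and p: "split_epi C p" "Dom C p = apex C \<gamma>"
  shows "is_cone C (Cod C p) (cone_star C \<gamma> p)" and "cone (cone_star C \<gamma> p)"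
    and "apex C (cone_star C \<gamma> p) = Cod C p"
proof -
  note ga = cone_at[OF g]
  have pM: "p \<in> Mor C" using p split_epi_in by blast
  obtain s where s: "s \<in> Mor C" "Dom C s = Cod C p" "Cod C s = Dom C p" "s \<cdot> p = idm C (Cod C p)"
    using p unfolding split_epi_def by blast
  obtain a where a: "a \<in> Obj C" "is_iso C (\<gamma> a)"
    using cone_iso[OF g] .
  define k where "k = s \<cdot> inv_mor C (\<gamma> a)"
  note i = iso_inv_simps[OF a(2)]
  have k: "k \<in> Mor C" "Dom C k = Cod C p" "Cod C k = a"
    using s i ga(3,4)[OF a(1)] p(2) by (simp_all add: k_def)
  note e = epi_props[OF k(1)] and j = subobj_incl[OF epi_props(5)[OF k(1)]]
  have km: "k \<cdot> (\<gamma> a \<cdot> p) = idm C (Cod C p)"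
  proof -
    have "k \<cdot> (\<gamma> a \<cdot> p) = s \<cdot> ((inv_mor C (\<gamma> a) \<cdot> \<gamma> a) \<cdot> p)"
      using s(1-3) i(1-4) ga(3,4)[OF a(1)] p(2) pM by (simp add: k_def Comp_assoc)
    then show ?thesis
      using s i ga(3,4)[OF a(1)] p(2) pM by (simp add: idm_left')
  qed
  have imk: "subobj C (im C k) a" "im C k \<in> Obj C" using e(5,6) k by auto
  have part: "incl C (im C k) a \<cdot> (\<gamma> a \<cdot> p) = cone_star C \<gamma> p (im C k)"
  proof -
    have "incl C (im C k) a \<cdot> (\<gamma> a \<cdot> p) = (incl C (im C k) a \<cdot> \<gamma> a) \<cdot> p"
      using subobj_incl[OF imk(1)] ga a(1) p(2) pM by (simp add: Comp_assoc)
    then show ?thesis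
      using cone_incl[OF g imk(1)] imk(2) by (simp add: cone_star_def)
  qed
  define m where "m = cone_star C \<gamma> p (im C k)"
  have m: "m \<in> Mor C" "Dom C m = im C k" "Cod C m = Cod C p"
    using ga(1) ga(2-4)[of "im C k"] imk(2) p pM by (simp_all add: m_def cone_star_def)
  have "epi C k \<cdot> m = k \<cdot> (\<gamma> a \<cdot> p)"
  proof -
    have "epi C k \<cdot> m = (epi C k \<cdot> incl C (im C k) a) \<cdot> (\<gamma> a \<cdot> p)"
      using part[folded m_def, symmetric] e(1-4) k subobj_incl[OF imk(1)] ga a(1) p(2) pM
      by (simp add: Comp_assoc)
    then show ?thesis using e(7) k(3) by simp
  qed
  then have em: "epi C k \<cdot> m = idm C (Dom C (epi C k))"
    using km e(3) k(2) by simp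
  have "is_iso C (epi C k)"
    by (rule split_epi_iso_left[OF e(1), of m]) (use m e k em in auto)
  then have inv: "inverses C (epi C k) (inv_mor C (epi C k))"
    by (rule iso_inverse)
  have "m = inv_mor C (epi C k)"
  proof -
    note v = iso_inv_simps[OF \<open>is_iso C (epi C k)\<close>]
    have "inv_mor C (epi C k) = inv_mor C (epi C k) \<cdot> (epi C k \<cdot> m)"
      using em v by (simp add: idm_right')
    also have "\<dots> = m"
      using v m e(2,4) Comp_assoc[of "inv_mor C (epi C k)" "epi C k" m] by (simp add: idm_left')
    finally show ?thesis by simp
  qed
  then have "is_iso C m"
    using iso_inv_mor[OF \<open>is_iso C (epi C k)\<close>] by simp
  moreover have "incl C c c' \<cdot> (\<gamma> c' \<cdot> p) = \<gamma> c \<cdot> p" if "subobj C c c'" for c c'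
    using cone_incl[OF g that] subobj_incl[OF that] ga(2-4)[of c'] p(2) pM
      Comp_assoc[of "incl C c c'" "\<gamma> c'" p] by simp
  ultimately show c: "is_cone C (Cod C p) (cone_star C \<gamma> p)"
    unfolding is_cone_def using ga p(2) pM imk(2)
    by (auto simp: Hom_def cone_star_def m_def)
  show "cone (cone_star C \<gamma> p)" "apex C (cone_star C \<gamma> p) = Cod C p"
    using is_cone_cone[OF c] cone_apex[OF c] by auto
qed

lemma cone_star_star:
  assumes g: "cone \<gamma>" and p: "p \<in> Mor C" "Dom C p = apex C \<gamma>" and q: "q \<in> Mor C" "Cod C p = Dom C q"
  shows "cone_star C (cone_star C \<gamma> p) q = cone_star C \<gamma> (p \<cdot> q)"
  using cone_at[OF g] p q by (auto simp: cone_star_def Comp_assoc intro!: restrict_ext)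

lemma cone_star_idm: "cone \<gamma> \<Longrightarrow> cone_star C \<gamma> (idm C (apex C \<gamma>)) = \<gamma>"
  using cone_at[of \<gamma>] unfolding is_cone_def
  by (auto simp: cone_star_def idm_right' intro!: extensionalityI[of _ "Obj C"])

lemma cone_star_cancel:
  assumes g: "cone \<gamma>" and f: "f \<in> Mor C" "Dom C f = apex C \<gamma>" and h: "h \<in> Mor C" "Dom C h = apex C \<gamma>"
    and eq: "cone_star C \<gamma> f = cone_star C \<gamma> h"
  shows "f = h"
proof -
  obtain a where a: "a \<in> Obj C" "is_iso C (\<gamma> a)"
    using cone_iso[OF g] .
  have "\<gamma> a \<cdot> f = \<gamma> a \<cdot> h"
    using fun_cong[OF eq, of a] a(1) by (simp add: cone_star_def)
  then show ?thesis
    using split_epi_cancel[OF iso_split_epi[OF a(2)]] f h cone_at[OF g] a(1) by metis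
qed

lemma cone_mult_eq: "cone_mult C \<gamma> \<sigma> = cone_star C \<gamma> (epi C (\<sigma> (apex C \<gamma>)))"
  by (simp add: cone_mult_def)

lemma cone_mult_cone:
  assumes "cone \<gamma>" and "cone \<sigma>"
  shows "cone (cone_mult C \<gamma> \<sigma>)" and "apex C (cone_mult C \<gamma> \<sigma>) = im C (\<sigma> (apex C \<gamma>))"
  using cone_star_cone[OF assms(1), of "epi C (\<sigma> (apex C \<gamma>))"] epi_props[of "\<sigma> (apex C \<gamma>)"]
    cone_at[OF assms(1)] cone_at[OF assms(2)] by (simp_all add: cone_mult_eq)

text \<open>
  Both products are \<open>\<gamma> * f\<degree>\<close> for the composite \<open>f\<close> of \<open>\<sigma>(c)\<close> and \<open>\<tau>(c')\<close>, where \<open>c\<close> and \<open>c'\<close> are the apexes of \<open>\<gamma>\<close> and \<open>\<sigma>\<close>: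
  neither the restriction of \<open>\<tau>(c')\<close> to the image of \<open>\<sigma>(c)\<close> nor the passage to \<open>\<tau>(c')\<degree>\<close> changes the
  epimorphic component of the composite.
\<close>

lemma cone_mult_assoc:
  assumes g: "cone \<gamma>" and s: "cone \<sigma>" and t: "cone \<tau>"
  shows "cone_mult C (cone_mult C \<gamma> \<sigma>) \<tau> = cone_mult C \<gamma> (cone_mult C \<sigma> \<tau>)"
proof -
  define f where "f = \<sigma> (apex C \<gamma>)"
  have f: "f \<in> Mor C" "Dom C f = apex C \<gamma>" "Cod C f = apex C \<sigma>"
    using cone_at[OF s] cone_at[OF g] by (simp_all add: f_def)
  note e = epi_props[OF f(1)]
  have i: "im C f \<in> Obj C" "subobj C (im C f) (apex C \<sigma>)" using e f by auto
  note ta = cone_at[OF t] and sa = cone_at[OF s]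
  define h where "h = \<tau> (apex C \<sigma>)"
  have h: "h \<in> Mor C" "Dom C h = apex C \<sigma>" using ta sa by (simp_all add: h_def)
  note eh = epi_props[OF h(1)]
  have \<tau>i: "\<tau> (im C f) \<in> Mor C" "Dom C (\<tau> (im C f)) = im C f" using ta i by auto
  have "cone_mult C (cone_mult C \<gamma> \<sigma>) \<tau> = cone_star C (cone_star C \<gamma> (epi C f)) (epi C (\<tau> (im C f)))"
    using cone_mult_cone[OF g s] by (simp add: cone_mult_eq f_def)
  also have "\<dots> = cone_star C \<gamma> (epi C f \<cdot> epi C (\<tau> (im C f)))"
    using cone_star_star[OF g, of "epi C f" "epi C (\<tau> (im C f))"] e f epi_props[OF \<tau>i(1)] \<tau>i(2) by simp
  also have "\<tau> (im C f) = incl C (im C f) (Cod C f) \<cdot> h"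
    using cone_incl[OF t i(2)] f by (simp add: h_def)
  also have "epi C f \<cdot> epi C (incl C (im C f) (Cod C f) \<cdot> h) = epi C (f \<cdot> h)"
    using epi_Comp[OF f(1) h(1)] f h by simp
  also have "f \<cdot> h = (f \<cdot> epi C h) \<cdot> incl C (im C h) (Cod C h)"
    using f h eh subobj_incl[OF eh(5)] by (simp add: Comp_assoc)
  also have "epi C \<dots> = epi C (f \<cdot> epi C h)"
    using epi_Comp_incl[of "f \<cdot> epi C h"] f h eh subobj_incl[OF eh(5)] by simp
  also have "f \<cdot> epi C h = cone_mult C \<sigma> \<tau> (apex C \<gamma>)"
    using cone_at(1)[OF g] by (simp add: cone_mult_eq cone_star_def f_def h_def)
  finally show ?thesis by (simp add: cone_mult_eq)
qed

end

section \<open>The normal dual\<close>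

lemma category_set_cat: "category set_cat"
  by unfold_locales
    (auto simp: set_cat_def PiE_iff extensional_def fun_eq_iff split: prod.splits, metis)

text \<open>
  The relation that \<open>\<sigma>\<close> is a right multiple of \<open>\<gamma>\<close> in the semigroup of cones.  It corresponds to the inclusion
  of \<open>H\<close>-functors.
\<close>

definition below_cone :: "('o, 'm) scat \<Rightarrow> ('o, 'm) cone \<Rightarrow> ('o, 'm) cone \<Rightarrow> bool" where
  "below_cone C \<sigma> \<gamma> \<longleftrightarrow> (\<exists>p. split_epi C p \<and> Dom C p = apex C \<gamma> \<and> \<sigma> = cone_star C \<gamma> p)"

text \<open>
  The transformation of \<open>H\<close>-functors that corresponds under the Yoneda lemma to the morphism \<open>f\<close> between
  the apexes.
\<close>

definition H_nat :: "('o, 'm) scat \<Rightarrow> ('o, 'm) cone \<Rightarrow> ('o, 'm) cone \<Rightarrow> 'm \<Rightarrow> ('o, 'm) set_nat" where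
  "H_nat C \<gamma> \<gamma>' f = (Hfun C \<gamma>',
     \<lambda>x\<in>Obj C. (Hset C \<gamma>' x, \<lambda>\<kappa>\<in>Hset C \<gamma>' x. eta_inv C \<gamma> (f \<cdot>\<^bsub>C\<^esub> eta C \<gamma>' x \<kappa>), Hset C \<gamma> x),
     Hfun C \<gamma>)"

context normal_category
begin

lemma below_cone_cone: "\<lbrakk>cone \<gamma>; below_cone C \<sigma> \<gamma>\<rbrakk> \<Longrightarrow> cone \<sigma>"
  using cone_star_cone unfolding below_cone_def by blast

lemma eta_inv_cone: "\<lbrakk>cone \<gamma>; f \<in> Mor C; Dom C f = apex C \<gamma>\<rbrakk>
    \<Longrightarrow> cone (eta_inv C \<gamma> f) \<and> apex C (eta_inv C \<gamma> f) = im C f"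
  using cone_star_cone[of \<gamma> "epi C f"] epi_props[of f] by (simp add: eta_inv_def)

lemma eta_inv_idm: "cone \<gamma> \<Longrightarrow> eta_inv C \<gamma> (idm C (apex C \<gamma>)) = \<gamma>"
  using epi_split_epi[OF split_epi_idm] cone_at(1) cone_star_idm by (simp add: eta_inv_def)

lemma eta_inv_inj:
  assumes g: "cone \<gamma>" and f: "f \<in> Hom C (apex C \<gamma>) c" and h: "h \<in> Hom C (apex C \<gamma>) c"
    and eq: "eta_inv C \<gamma> f = eta_inv C \<gamma> h"
  shows "f = h"
proof -
  have m: "f \<in> Mor C" "Dom C f = apex C \<gamma>" "Cod C f = c" "h \<in> Mor C" "Dom C h = apex C \<gamma>" "Cod C h = c"
    using f h by (auto simp: Hom_def)
  have e: "epi C f = epi C h"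
    using cone_star_cancel[OF g, of "epi C f" "epi C h"] eq m epi_props(2,3)
    by (simp add: eta_inv_def)
  then have "im C f = im C h"
    using epi_props(4) m by metis
  then show ?thesis
    using e epi_props(7)[OF m(1)] epi_props(7)[OF m(4)] m by metis
qed

lemma eta_eta_inv: "\<lbrakk>cone \<gamma>; f \<in> Hom C (apex C \<gamma>) c\<rbrakk> \<Longrightarrow> eta C \<gamma> c (eta_inv C \<gamma> f) = f"
  unfolding eta_def by (intro the_inv_into_f_f inj_onI) (auto intro: eta_inv_inj)

lemma in_HsetE:
  assumes "cone \<gamma>" and "\<kappa> \<in> Hset C \<gamma> c"
  obtains f where "f \<in> Mor C" and "Dom C f = apex C \<gamma>" and "Cod C f = c"
    and "\<kappa> = eta_inv C \<gamma> f" and "eta C \<gamma> c \<kappa> = f"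
  using assms eta_eta_inv unfolding Hset_def Hom_def by auto

lemma eta_inv_in_Hset: "\<lbrakk>f \<in> Mor C; Dom C f = apex C \<gamma>; Cod C f = c\<rbrakk> \<Longrightarrow> eta_inv C \<gamma> f \<in> Hset C \<gamma> c"
  by (auto simp: Hset_def Hom_def)

lemma eta_in: "\<lbrakk>cone \<gamma>; \<kappa> \<in> Hset C \<gamma> c\<rbrakk>
    \<Longrightarrow> eta C \<gamma> c \<kappa> \<in> Mor C \<and> Dom C (eta C \<gamma> c \<kappa>) = apex C \<gamma> \<and> Cod C (eta C \<gamma> c \<kappa>) = c \<and>
      eta_inv C \<gamma> (eta C \<gamma> c \<kappa>) = \<kappa>"
  using in_HsetE by metis

lemma functor_Hfun:
  assumes g: "cone \<gamma>"
  shows "is_functor C set_cat (Hfun C \<gamma>)"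
  unfolding is_functor_def
proof (intro conjI ballI impI)
  show "category C" by unfold_locales
  show "category set_cat" by (rule category_set_cat)
  show "fobj (Hfun C \<gamma>) \<in> Obj C \<rightarrow>\<^sub>E Obj set_cat"
    by (auto simp: Hfun_def set_cat_def)
  show "fmor (Hfun C \<gamma>) \<in> Mor C \<rightarrow>\<^sub>E Mor set_cat"
    using eta_in[OF g] by (auto simp: Hfun_def set_cat_def intro!: eta_inv_in_Hset)
next
  fix f assume f: "f \<in> Mor C"
  then show "Dom set_cat (fmor (Hfun C \<gamma>) f) = fobj (Hfun C \<gamma>) (Dom C f)"
    "Cod set_cat (fmor (Hfun C \<gamma>) f) = fobj (Hfun C \<gamma>) (Cod C f)"
    by (simp_all add: Hfun_def set_cat_def)
  fix h assume h: "h \<in> Mor C" "Cod C f = Dom C h"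
  have "eta_inv C \<gamma> (eta C \<gamma> (Dom C f) \<kappa> \<cdot> (f \<cdot> h)) =
    eta_inv C \<gamma> (eta C \<gamma> (Dom C h) (eta_inv C \<gamma> (eta C \<gamma> (Dom C f) \<kappa> \<cdot> f)) \<cdot> h)"
    if \<kappa>: "\<kappa> \<in> Hset C \<gamma> (Dom C f)" for \<kappa>
    using eta_in[OF g \<kappa>] f h eta_eta_inv[OF g, of "eta C \<gamma> (Dom C f) \<kappa> \<cdot> f" "Dom C h"]
    by (simp add: Hom_def Comp_assoc)
  moreover have "eta_inv C \<gamma> (eta C \<gamma> (Dom C f) \<kappa> \<cdot> f) \<in> Hset C \<gamma> (Dom C h)"
    if \<kappa>: "\<kappa> \<in> Hset C \<gamma> (Dom C f)" for \<kappa>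
    using eta_in[OF g \<kappa>] f h by (intro eta_inv_in_Hset) auto
  ultimately show "fmor (Hfun C \<gamma>) (f \<cdot> h) = fmor (Hfun C \<gamma>) f \<cdot>\<^bsub>set_cat\<^esub> fmor (Hfun C \<gamma>) h"
    using f h by (auto simp: Hfun_def set_cat_def intro!: restrict_ext)
next
  fix c assume c: "c \<in> Obj C"
  have "eta_inv C \<gamma> (eta C \<gamma> c \<kappa> \<cdot> idm C c) = \<kappa>" if "\<kappa> \<in> Hset C \<gamma> c" for \<kappa>
    using eta_in[OF g that] by (simp add: idm_right')
  then show "fmor (Hfun C \<gamma>) (idm C c) = idm set_cat (fobj (Hfun C \<gamma>) c)"
    using c by (auto simp: Hfun_def set_cat_def intro!: restrict_ext)
qed

lemma below_cone_eta:
  assumes g: "cone \<gamma>" and p: "split_epi C p" "Dom C p = apex C \<gamma>" and s: "\<sigma> = cone_star C \<gamma> p"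
  shows "f \<in> Mor C \<Longrightarrow> Dom C f = Cod C p \<Longrightarrow> eta_inv C \<sigma> f = eta_inv C \<gamma> (p \<cdot> f)"
    and "Hset C \<sigma> c \<subseteq> Hset C \<gamma> c"
    and "\<kappa> \<in> Hset C \<sigma> c \<Longrightarrow> eta C \<gamma> c \<kappa> = p \<cdot> eta C \<sigma> c \<kappa>"
proof -
  have pM: "p \<in> Mor C" using p split_epi_in by blast
  have \<sigma>: "cone \<sigma>" "apex C \<sigma> = Cod C p"
    using cone_star_cone[OF g p] s by auto
  show e: "eta_inv C \<sigma> f = eta_inv C \<gamma> (p \<cdot> f)" if "f \<in> Mor C" "Dom C f = Cod C p" for f
    using cone_star_star[OF g pM p(2), of "epi C f"] epi_Comp_split_epi[OF p(1)] epi_props[of f] that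
    by (simp add: eta_inv_def s)
  have eta: "\<kappa> \<in> Hset C \<gamma> c \<and> eta C \<gamma> c \<kappa> = p \<cdot> eta C \<sigma> c \<kappa>" if \<kappa>: "\<kappa> \<in> Hset C \<sigma> c" for \<kappa>
  proof -
    obtain f where f: "f \<in> Mor C" "Dom C f = apex C \<sigma>" "Cod C f = c" "\<kappa> = eta_inv C \<sigma> f"
      "eta C \<sigma> c \<kappa> = f"
      using in_HsetE[OF \<sigma>(1) \<kappa>] .
    have "\<kappa> = eta_inv C \<gamma> (p \<cdot> f)" using e f \<sigma> by simp
    then show ?thesis
      using f \<sigma> pM p(2) eta_eta_inv[OF g, of "p \<cdot> f" c] eta_inv_in_Hset[of "p \<cdot> f" \<gamma> c]
      by (simp add: Hom_def)
  qed
  then show "Hset C \<sigma> c \<subseteq> Hset C \<gamma> c" "\<kappa> \<in> Hset C \<sigma> c \<Longrightarrow> eta C \<gamma> c \<kappa> = p \<cdot> eta C \<sigma> c \<kappa>"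
    by auto
qed

lemma below_cone_Hset: "\<lbrakk>cone \<gamma>; below_cone C \<sigma> \<gamma>\<rbrakk> \<Longrightarrow> Hset C \<sigma> c \<subseteq> Hset C \<gamma> c"
  unfolding below_cone_def using below_cone_eta(2) by blast

text \<open>
  The cone \<open>\<sigma>\<close> itself belongs to \<open>H(\<sigma>;c)\<close>, where \<open>c\<close> is its apex.  So the inclusion needs to be known at
  \<open>c\<close> only.
\<close>

lemma Hset_below_cone:
  assumes g: "cone \<gamma>" and s: "cone \<sigma>" and sub: "Hset C \<sigma> (apex C \<sigma>) \<subseteq> Hset C \<gamma> (apex C \<sigma>)"
  shows "below_cone C \<sigma> \<gamma>"
proof -
  have "\<sigma> \<in> Hset C \<sigma> (apex C \<sigma>)"
    using eta_inv_in_Hset[of "idm C (apex C \<sigma>)" \<sigma> "apex C \<sigma>"] eta_inv_idm[OF s] cone_at(1)[OF s] by simp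
  then have "\<sigma> \<in> Hset C \<gamma> (apex C \<sigma>)"
    using sub by blast
  then obtain f where "f \<in> Mor C" "Dom C f = apex C \<gamma>" "\<sigma> = eta_inv C \<gamma> f"
    using in_HsetE[OF g] by metis
  then show ?thesis
    unfolding below_cone_def using epi_props(1,3)[of f] by (intro exI[of _ "epi C f"]) (simp add: eta_inv_def)
qed

lemma Hset_eq_Hfun: "c \<in> Obj C \<Longrightarrow> fobj (Hfun C \<gamma>) c = Hset C \<gamma> c"
  by (simp add: Hfun_def)

lemma Hfun_eq_below:
  assumes g: "cone \<gamma>" and s: "cone \<sigma>" and eq: "Hfun C \<sigma> = Hfun C \<gamma>"
  shows "below_cone C \<sigma> \<gamma>"
  using Hset_below_cone[OF g s] Hset_eq_Hfun[of "apex C \<sigma>"] cone_at(1)[OF s] eq by (metis subset_refl)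

lemma below_Hfun_eq:
  assumes g: "cone \<gamma>" and sg: "below_cone C \<sigma> \<gamma>" and gs: "below_cone C \<gamma> \<sigma>"
  shows "Hfun C \<sigma> = Hfun C \<gamma>"
proof -
  obtain p where p: "split_epi C p" "Dom C p = apex C \<gamma>" "\<sigma> = cone_star C \<gamma> p"
    using sg unfolding below_cone_def by blast
  have s: "cone \<sigma>" "apex C \<sigma> = Cod C p"
    using cone_star_cone[OF g p(1,2)] p(3) by auto
  have pM: "p \<in> Mor C" using p split_epi_in by blast
  have H: "Hset C \<sigma> c = Hset C \<gamma> c" for c
    using below_cone_Hset[OF g sg] below_cone_Hset[OF s(1) gs] by blast
  have "eta_inv C \<sigma> (eta C \<sigma> (Dom C h) \<kappa> \<cdot> h) = eta_inv C \<gamma> (eta C \<gamma> (Dom C h) \<kappa> \<cdot> h)"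
    if h: "h \<in> Mor C" and \<kappa>: "\<kappa> \<in> Hset C \<gamma> (Dom C h)" for h \<kappa>
  proof -
    have \<kappa>': "\<kappa> \<in> Hset C \<sigma> (Dom C h)" using \<kappa> H by simp
    note e = eta_in[OF s(1) \<kappa>']
    have "eta_inv C \<sigma> (eta C \<sigma> (Dom C h) \<kappa> \<cdot> h) = eta_inv C \<gamma> (p \<cdot> (eta C \<sigma> (Dom C h) \<kappa> \<cdot> h))"
      using below_cone_eta(1)[OF g p] e h s by simp
    also have "p \<cdot> (eta C \<sigma> (Dom C h) \<kappa> \<cdot> h) = eta C \<gamma> (Dom C h) \<kappa> \<cdot> h"
      using below_cone_eta(3)[OF g p \<kappa>'] e h s pM by (simp add: Comp_assoc)
    finally show ?thesis .
  qed
  then show ?thesis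
    unfolding Hfun_def H by (auto intro!: restrict_ext)
qed

lemma below_cone_iso:
  assumes g: "cone \<gamma>" and u: "is_iso C u" "Dom C u = apex C \<gamma>"
  shows "cone (cone_star C \<gamma> u)" and "apex C (cone_star C \<gamma> u) = Cod C u"
    and "Hfun C (cone_star C \<gamma> u) = Hfun C \<gamma>"
proof -
  note i = iso_inv_simps[OF u(1)] and se = iso_split_epi[OF u(1)]
  show c: "cone (cone_star C \<gamma> u)" "apex C (cone_star C \<gamma> u) = Cod C u"
    using cone_star_cone[OF g se u(2)] by auto
  have "cone_star C (cone_star C \<gamma> u) (inv_mor C u) = \<gamma>"
    using cone_star_star[OF g i(1) u(2) i(2)] i u cone_star_idm[OF g] by simp
  then have "below_cone C \<gamma> (cone_star C \<gamma> u)"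
    unfolding below_cone_def using c i iso_split_epi iso_inv_mor[OF u(1)]
    by (intro exI[of _ "inv_mor C u"]) auto
  then show "Hfun C (cone_star C \<gamma> u) = Hfun C \<gamma>"
    using below_Hfun_eq[OF g] se u(2) unfolding below_cone_def by blast
qed

lemma mutually_below_iso:
  assumes g: "cone \<gamma>" and s: "cone \<sigma>" and eq: "Hfun C \<sigma> = Hfun C \<gamma>"
  obtains u where "is_iso C u" and "Dom C u = apex C \<gamma>" and "Cod C u = apex C \<sigma>"
    and "\<sigma> = cone_star C \<gamma> u"
proof -
  obtain p where p: "split_epi C p" "Dom C p = apex C \<gamma>" "\<sigma> = cone_star C \<gamma> p"
    using Hfun_eq_below[OF g s eq] unfolding below_cone_def by blast
  obtain q where q: "split_epi C q" "Dom C q = apex C \<sigma>" "\<gamma> = cone_star C \<sigma> q"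
    using Hfun_eq_below[OF s g eq[symmetric]] unfolding below_cone_def by blast
  have a: "apex C \<sigma> = Cod C p" using cone_star_cone[OF g p(1,2)] p(3) by simp
  have b: "apex C \<gamma> = Cod C q" using cone_star_cone[OF s q(1,2)] q(3) by simp
  have m: "p \<in> Mor C" "q \<in> Mor C" using p(1) q(1) split_epi_in by auto
  have "cone_star C \<gamma> (p \<cdot> q) = cone_star C \<gamma> (idm C (apex C \<gamma>))"
    using cone_star_star[OF g m(1) p(2) m(2)] a q(2) cone_star_idm[OF g] p(3) q(3) by metis
  then have "p \<cdot> q = idm C (apex C \<gamma>)"
    using cone_star_cancel[OF g] m a b p(2) q(2) cone_at(1)[OF g] by simp
  then have "is_iso C p"
    using split_epi_iso_left[OF p(1) m(2)] a b p(2) q(2) by simp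
  then show thesis using that p(2,3) a by simp
qed

lemma Obj_normal_dual: "F \<in> Obj (normal_dual C) \<longleftrightarrow> (\<exists>\<gamma>. cone \<gamma> \<and> F = Hfun C \<gamma>)"
  using functor_Hfun cone_apex
  by (auto simp: normal_dual_def Let_def full_subcat_def functor_cat_def)

lemma H_nat_Mor:
  assumes g: "cone \<gamma>" and g': "cone \<gamma>'" and f: "f \<in> Mor C" "Dom C f = apex C \<gamma>" "Cod C f = apex C \<gamma>'"
  shows "H_nat C \<gamma> \<gamma>' f \<in> Hom (normal_dual C) (Hfun C \<gamma>') (Hfun C \<gamma>)"
proof -
  let ?\<theta> = "\<lambda>x. \<lambda>\<kappa>\<in>Hset C \<gamma>' x. eta_inv C \<gamma> (f \<cdot> eta C \<gamma>' x \<kappa>)"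
  have \<theta>: "eta_inv C \<gamma> (f \<cdot> eta C \<gamma>' x \<kappa>) \<in> Hset C \<gamma> x \<and>
      eta C \<gamma> x (eta_inv C \<gamma> (f \<cdot> eta C \<gamma>' x \<kappa>)) = f \<cdot> eta C \<gamma>' x \<kappa>" if "\<kappa> \<in> Hset C \<gamma>' x" for x \<kappa>
    using eta_in[OF g' that] f eta_eta_inv[OF g, of "f \<cdot> eta C \<gamma>' x \<kappa>" x]
    by (auto intro!: eta_inv_in_Hset simp: Hom_def)
  have nat: "fmor (Hfun C \<gamma>') h \<cdot>\<^bsub>set_cat\<^esub> (Hset C \<gamma>' (Cod C h), ?\<theta> (Cod C h), Hset C \<gamma> (Cod C h)) =
    (Hset C \<gamma>' (Dom C h), ?\<theta> (Dom C h), Hset C \<gamma> (Dom C h)) \<cdot>\<^bsub>set_cat\<^esub> fmor (Hfun C \<gamma>) h"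
    if h: "h \<in> Mor C" for h
  proof -
    have "eta_inv C \<gamma>' (eta C \<gamma>' (Dom C h) \<kappa> \<cdot> h) \<in> Hset C \<gamma>' (Cod C h) \<and>
      eta_inv C \<gamma> (f \<cdot> eta C \<gamma>' (Cod C h) (eta_inv C \<gamma>' (eta C \<gamma>' (Dom C h) \<kappa> \<cdot> h))) =
      eta_inv C \<gamma> (eta C \<gamma> (Dom C h) (eta_inv C \<gamma> (f \<cdot> eta C \<gamma>' (Dom C h) \<kappa>)) \<cdot> h)"
      if \<kappa>: "\<kappa> \<in> Hset C \<gamma>' (Dom C h)" for \<kappa>
      using eta_in[OF g' \<kappa>] h f \<theta>[OF \<kappa>] eta_eta_inv[OF g', of "eta C \<gamma>' (Dom C h) \<kappa> \<cdot> h" "Cod C h"]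
      by (auto intro!: eta_inv_in_Hset simp: Hom_def Comp_assoc)
    then show ?thesis
      using h \<theta> by (auto simp: set_cat_def Hfun_def intro!: restrict_ext)
  qed
  have "nat_trans C set_cat (Hfun C \<gamma>') (Hfun C \<gamma>) (\<lambda>x\<in>Obj C. (Hset C \<gamma>' x, ?\<theta> x, Hset C \<gamma> x))"
    unfolding nat_trans_def
  proof (intro conjI ballI)
    fix x assume "x \<in> Obj C"
    then show "(\<lambda>x\<in>Obj C. (Hset C \<gamma>' x, ?\<theta> x, Hset C \<gamma> x)) x \<in>
        Hom set_cat (fobj (Hfun C \<gamma>') x) (fobj (Hfun C \<gamma>) x)"
      using \<theta> by (auto simp: Hom_def set_cat_def Hfun_def)
  next
    fix h assume h: "h \<in> Mor C"
    then show "fmor (Hfun C \<gamma>') h \<cdot>\<^bsub>set_cat\<^esub> (\<lambda>x\<in>Obj C. (Hset C \<gamma>' x, ?\<theta> x, Hset C \<gamma> x)) (Cod C h) =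
      (\<lambda>x\<in>Obj C. (Hset C \<gamma>' x, ?\<theta> x, Hset C \<gamma> x)) (Dom C h) \<cdot>\<^bsub>set_cat\<^esub> fmor (Hfun C \<gamma>) h"
      using nat[OF h] by simp
  qed (use functor_Hfun g g' in auto)
  then show ?thesis
    using g g' unfolding H_nat_def
    by (auto simp: Hom_def normal_dual_def Let_def full_subcat_def functor_cat_def)
qed

lemma Dom_H_nat: "Dom (normal_dual C) (H_nat C \<gamma> \<gamma>' f) = Hfun C \<gamma>'"
  and Cod_H_nat: "Cod (normal_dual C) (H_nat C \<gamma> \<gamma>' f) = Hfun C \<gamma>"
  by (simp_all add: H_nat_def normal_dual_def Let_def full_subcat_def functor_cat_def)

lemma H_nat_Comp:
  assumes g: "cone \<gamma>" "cone \<gamma>'" "cone \<gamma>''" and f: "f \<in> Mor C" "Dom C f = apex C \<gamma>" "Cod C f = apex C \<gamma>'"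
    and h: "h \<in> Mor C" "Dom C h = apex C \<gamma>'" "Cod C h = apex C \<gamma>''"
  shows "H_nat C \<gamma>' \<gamma>'' h \<cdot>\<^bsub>normal_dual C\<^esub> H_nat C \<gamma> \<gamma>' f = H_nat C \<gamma> \<gamma>'' (f \<cdot> h)"
proof -
  have "eta_inv C \<gamma>' (h \<cdot> eta C \<gamma>'' x \<kappa>) \<in> Hset C \<gamma>' x \<and>
    eta_inv C \<gamma> (f \<cdot> eta C \<gamma>' x (eta_inv C \<gamma>' (h \<cdot> eta C \<gamma>'' x \<kappa>))) =
    eta_inv C \<gamma> (f \<cdot> h \<cdot> eta C \<gamma>'' x \<kappa>)" if \<kappa>: "\<kappa> \<in> Hset C \<gamma>'' x" for x \<kappa>
    using eta_in[OF g(3) \<kappa>] f h eta_eta_inv[OF g(2), of "h \<cdot> eta C \<gamma>'' x \<kappa>" x]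
    by (auto intro!: eta_inv_in_Hset simp: Hom_def Comp_assoc)
  then show ?thesis
    by (auto simp: H_nat_def normal_dual_def Let_def full_subcat_def functor_cat_def set_cat_def
        intro!: restrict_ext)
qed

text \<open>
  As in the Yoneda lemma, \<open>f\<close> is recovered from the value at the generic element, here \<open>\<gamma>'\<close>.
\<close>

lemma H_nat_inj:
  assumes g: "cone \<gamma>" and g': "cone \<gamma>'" and f: "f \<in> Mor C" "Dom C f = apex C \<gamma>" "Cod C f = apex C \<gamma>'"
    and h: "h \<in> Mor C" "Dom C h = apex C \<gamma>" "Cod C h = apex C \<gamma>'"
    and eq: "H_nat C \<gamma> \<gamma>' f = H_nat C \<gamma> \<gamma>' h"
  shows "f = h"
proof -
  let ?a = "apex C \<gamma>'"
  have a: "?a \<in> Obj C" "\<gamma>' \<in> Hset C \<gamma>' ?a" "eta C \<gamma>' ?a \<gamma>' = idm C ?a"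
    using eta_inv_in_Hset[of "idm C ?a" \<gamma>' ?a] eta_eta_inv[OF g', of "idm C ?a" ?a] eta_inv_idm[OF g']
      cone_at(1)[OF g'] by (auto simp: Hom_def)
  have "(Hset C \<gamma>' ?a, \<lambda>\<kappa>\<in>Hset C \<gamma>' ?a. eta_inv C \<gamma> (f \<cdot> eta C \<gamma>' ?a \<kappa>), Hset C \<gamma> ?a) =
    (Hset C \<gamma>' ?a, \<lambda>\<kappa>\<in>Hset C \<gamma>' ?a. eta_inv C \<gamma> (h \<cdot> eta C \<gamma>' ?a \<kappa>), Hset C \<gamma> ?a)"
    using eq a(1) unfolding H_nat_def by (auto dest!: fun_cong[of _ _ ?a])
  then have "(\<lambda>\<kappa>\<in>Hset C \<gamma>' ?a. eta_inv C \<gamma> (f \<cdot> eta C \<gamma>' ?a \<kappa>)) \<gamma>' =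
    (\<lambda>\<kappa>\<in>Hset C \<gamma>' ?a. eta_inv C \<gamma> (h \<cdot> eta C \<gamma>' ?a \<kappa>)) \<gamma>'"
    by (metis Pair_inject)
  then have "eta_inv C \<gamma> f = eta_inv C \<gamma> h"
    using a f h by (simp add: idm_right')
  then show ?thesis
    using eta_inv_inj[OF g, of f ?a h] f h by (simp add: Hom_def)
qed

text \<open>
  Inclusions of the normal dual are transformations with inclusions as components, and between
  two given \<open>H\<close>-functors there is only one candidate; the split epimorphism \<open>p\<close> with \<open>\<sigma> = \<gamma> * p\<close>
  induces it.
\<close>

lemma H_nat_incl:
  assumes g: "cone \<gamma>" and p: "split_epi C p" "Dom C p = apex C \<gamma>" and s: "\<sigma> = cone_star C \<gamma> p"
  shows "H_nat C \<gamma> \<sigma> p \<in> Incl (normal_dual C)"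
    and "\<lbrakk>k \<in> Incl (normal_dual C); Dom (normal_dual C) k = Hfun C \<sigma>; Cod (normal_dual C) k = Hfun C \<gamma>\<rbrakk>
      \<Longrightarrow> k = H_nat C \<gamma> \<sigma> p"
proof -
  have c: "cone \<sigma>" "apex C \<sigma> = Cod C p"
    using cone_star_cone[OF g p] s by auto
  have pM: "p \<in> Mor C" using p split_epi_in by blast
  have comp: "eta_inv C \<gamma> (p \<cdot> eta C \<sigma> x \<kappa>) = \<kappa>" if \<kappa>: "\<kappa> \<in> Hset C \<sigma> x" for x \<kappa>
  proof -
    have "\<kappa> \<in> Hset C \<gamma> x" using below_cone_eta(2)[OF g p s] \<kappa> by blast
    then show ?thesis
      using below_cone_eta(3)[OF g p s \<kappa>] eta_in[OF g] by metis
  qed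
  have H: "H_nat C \<gamma> \<sigma> p = (Hfun C \<sigma>, \<lambda>x\<in>Obj C. (Hset C \<sigma> x, \<lambda>\<kappa>\<in>Hset C \<sigma> x. \<kappa>, Hset C \<gamma> x), Hfun C \<gamma>)"
    using comp unfolding H_nat_def by (auto intro!: restrict_ext)
  have "H_nat C \<gamma> \<sigma> p \<in> Mor (normal_dual C)"
    using H_nat_Mor[OF g c(1) pM p(2)] c(2) by (simp add: Hom_def)
  then show "H_nat C \<gamma> \<sigma> p \<in> Incl (normal_dual C)"
    using below_cone_eta(2)[OF g p s]
    unfolding H by (auto simp: normal_dual_def Let_def set_inclusion_def)
  assume k: "k \<in> Incl (normal_dual C)" "Dom (normal_dual C) k = Hfun C \<sigma>" "Cod (normal_dual C) k = Hfun C \<gamma>"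
  then obtain \<theta> where k': "k = (Hfun C \<sigma>, \<theta>, Hfun C \<gamma>)"
    and nat: "nat_trans C set_cat (Hfun C \<sigma>) (Hfun C \<gamma>) \<theta>"
    and inc: "\<And>x. x \<in> Obj C \<Longrightarrow> set_inclusion (\<theta> x)"
    by (auto simp: normal_dual_def Let_def full_subcat_def functor_cat_def)
  have "\<theta> x = (Hset C \<sigma> x, \<lambda>\<kappa>\<in>Hset C \<sigma> x. \<kappa>, Hset C \<gamma> x)" if x: "x \<in> Obj C" for x
  proof -
    have "\<theta> x \<in> Hom set_cat (Hset C \<sigma> x) (Hset C \<gamma> x)"
      using nat x Hset_eq_Hfun unfolding nat_trans_def by metis
    then show ?thesis
      using inc[OF x] by (auto simp: set_inclusion_def Hom_def set_cat_def)
  qed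
  moreover have "\<theta> \<in> extensional (Obj C)"
    using nat unfolding nat_trans_def by blast
  ultimately have "\<theta> = (\<lambda>x\<in>Obj C. (Hset C \<sigma> x, \<lambda>\<kappa>\<in>Hset C \<sigma> x. \<kappa>, Hset C \<gamma> x))"
    by (auto intro!: extensionalityI[of _ "Obj C"])
  then show "k = H_nat C \<gamma> \<sigma> p" by (simp add: k' H)
qed

lemma subobj_normal_dual_iff:
  assumes g: "cone \<gamma>" and s: "cone \<sigma>"
  shows "subobj (normal_dual C) (Hfun C \<sigma>) (Hfun C \<gamma>) \<longleftrightarrow> below_cone C \<sigma> \<gamma>"
proof
  assume "below_cone C \<sigma> \<gamma>"
  then show "subobj (normal_dual C) (Hfun C \<sigma>) (Hfun C \<gamma>)"
    unfolding below_cone_def subobj_def using H_nat_incl(1)[OF g] Dom_H_nat Cod_H_nat by metis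
next
  assume "subobj (normal_dual C) (Hfun C \<sigma>) (Hfun C \<gamma>)"
  then obtain k where k: "k \<in> Incl (normal_dual C)" "Dom (normal_dual C) k = Hfun C \<sigma>"
    "Cod (normal_dual C) k = Hfun C \<gamma>"
    unfolding subobj_def by blast
  then obtain \<theta> where nat: "nat_trans C set_cat (Hfun C \<sigma>) (Hfun C \<gamma>) \<theta>"
    and inc: "\<And>x. x \<in> Obj C \<Longrightarrow> set_inclusion (\<theta> x)"
    by (auto simp: normal_dual_def Let_def full_subcat_def functor_cat_def)
  have a: "apex C \<sigma> \<in> Obj C" using cone_at(1)[OF s] .
  have "\<theta> (apex C \<sigma>) \<in> Hom set_cat (Hset C \<sigma> (apex C \<sigma>)) (Hset C \<gamma> (apex C \<sigma>))"
    using nat a Hset_eq_Hfun unfolding nat_trans_def by metis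
  then have "Hset C \<sigma> (apex C \<sigma>) \<subseteq> Hset C \<gamma> (apex C \<sigma>)"
    using inc[OF a] by (auto simp: set_inclusion_def Hom_def set_cat_def)
  then show "below_cone C \<sigma> \<gamma>" using Hset_below_cone[OF g s] by blast
qed

end

section \<open>Transposes in a cross-connection\<close>

locale cross_conn =
  fixes X :: "('co, 'cm, 'do, 'dm) xconn"
  assumes cross_connection: "cross_connection X"
begin

abbreviation (input) "C \<equiv> Ccat X"
abbreviation (input) "D \<equiv> Dcat X"
abbreviation (input) "\<gamma> \<equiv> gam_cone X"
abbreviation (input) "\<delta> \<equiv> del_cone X"

sublocale C: normal_category "Ccat X"
  using cross_connection by (simp add: cross_connection_def)

sublocale D: normal_category "Dcat X"
  using cross_connection by (simp add: cross_connection_def)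

text \<open>
  The cones that represent \<open>d\<close> are those whose \<open>H\<close>-functor is \<open>\<Gamma>(d)\<close>; they form one \<open>\<R>\<close>-class of the
  semigroup of cones.
\<close>

definition represents :: "('co, 'cm) cone \<Rightarrow> 'do \<Rightarrow> bool" where
  "represents \<sigma> d \<longleftrightarrow> C.cone \<sigma> \<and> d \<in> Obj D \<and> Hfun C \<sigma> = fobj (Gam X) d"

lemma functor_Gam: "is_functor D (normal_dual C) (Gam X)"
  and inclusion_preserving_Gam: "inclusion_preserving D (normal_dual C) (Gam X)"
  and fully_faithful_Gam: "fully_faithful D (normal_dual C) (Gam X)"
  and ideal_Gam: "d \<in> Obj D \<Longrightarrow> cat_isomorphism (ideal D d) (ideal (normal_dual C) (fobj (Gam X) d))
    (restrict_ftor (ideal D d) (Gam X))"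
  using cross_connection unfolding cross_connection_def local_isomorphism_def by auto

lemma Gam_Obj: "d \<in> Obj D \<Longrightarrow> fobj (Gam X) d \<in> Obj (normal_dual C)"
  using functor_Gam unfolding is_functor_def by auto

lemma represented:
  assumes "d \<in> Obj D"
  obtains \<sigma> where "represents \<sigma> d"
  using Gam_Obj[OF assms] C.Obj_normal_dual assms unfolding represents_def by metis

lemma Gam_incl:
  assumes "subobj D d' d"
  shows "fmor (Gam X) (incl D d' d) \<in> Incl (normal_dual C)"
    and "Dom (normal_dual C) (fmor (Gam X) (incl D d' d)) = fobj (Gam X) d'"
    and "Cod (normal_dual C) (fmor (Gam X) (incl D d' d)) = fobj (Gam X) d"
  using D.subobj_incl[OF assms] functor_Gam inclusion_preserving_Gam
  unfolding is_functor_def inclusion_preserving_def by auto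

lemma subobj_below:
  assumes "represents \<sigma> d" "represents \<tau> d'" "subobj D d' d"
  shows "below_cone C \<tau> \<sigma>"
proof -
  have "subobj (normal_dual C) (Hfun C \<tau>) (Hfun C \<sigma>)"
    using Gam_incl[OF assms(3)] assms(1,2) unfolding subobj_def represents_def by auto
  then show ?thesis
    using C.subobj_normal_dual_iff assms(1,2) unfolding represents_def by blast
qed

text \<open>A local isomorphism lifts each subobject of \<open>\<Gamma>(d)\<close> to a unique subobject of \<open>d\<close>.\<close>

lemma lift_unique:
  assumes s: "represents \<sigma> d" and t: "below_cone C \<tau> \<sigma>"
  shows "\<exists>!d'. subobj D d' d \<and> fobj (Gam X) d' = Hfun C \<tau>"
proof -
  have d: "d \<in> Obj D" and \<sigma>: "C.cone \<sigma>" "Hfun C \<sigma> = fobj (Gam X) d"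
    using s unfolding represents_def by auto
  have \<tau>: "C.cone \<tau>" using C.below_cone_cone[OF \<sigma>(1) t] .
  have "bij_betw (fobj (restrict_ftor (ideal D d) (Gam X))) (Obj (ideal D d))
      (Obj (ideal (normal_dual C) (fobj (Gam X) d)))"
    using ideal_Gam[OF d] unfolding cat_isomorphism_def by blast
  moreover have "Obj (ideal D d) = {d'. subobj D d' d}"
    using D.subobj_incl(5) by (auto simp: ideal_def full_subcat_def)
  moreover have "Obj (ideal (normal_dual C) (fobj (Gam X) d)) =
      Obj (normal_dual C) \<inter> {F. subobj (normal_dual C) F (fobj (Gam X) d)}"
    by (simp add: ideal_def full_subcat_def)
  ultimately have bij: "bij_betw (\<lambda>d'\<in>{d'. subobj D d' d}. fobj (Gam X) d') {d'. subobj D d' d}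
      (Obj (normal_dual C) \<inter> {F. subobj (normal_dual C) F (fobj (Gam X) d)})"
    by (simp add: restrict_ftor_def)
  have "Hfun C \<tau> \<in> Obj (normal_dual C) \<inter> {F. subobj (normal_dual C) F (fobj (Gam X) d)}"
    using C.Obj_normal_dual \<tau> C.subobj_normal_dual_iff[OF \<sigma>(1) \<tau>] t \<sigma>(2) by auto
  then obtain d' where d': "subobj D d' d" "fobj (Gam X) d' = Hfun C \<tau>"
    using bij unfolding bij_betw_def by (metis (no_types, lifting) imageE mem_Collect_eq restrict_apply')
  moreover have "d'' = d'" if "subobj D d'' d" "fobj (Gam X) d'' = Hfun C \<tau>" for d''
    using bij that d' unfolding bij_betw_def inj_on_def by auto
  ultimately show ?thesis by blast
qed

lemma subobj_eqI: "\<lbrakk>subobj D a d; subobj D b d; fobj (Gam X) a = fobj (Gam X) b\<rbrakk> \<Longrightarrow> a = b"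
proof -
  assume a: "subobj D a d" "subobj D b d" "fobj (Gam X) a = fobj (Gam X) b"
  obtain \<sigma> \<tau> where s: "represents \<sigma> d" and t: "represents \<tau> a"
    using represented D.subobj_incl(5,6)[OF a(1)] by metis
  show "a = b"
    using lift_unique[OF s subobj_below[OF s t a(1)]] a t unfolding represents_def by metis
qed

lemma in_Eset_iff: "(c, d) \<in> Eset X \<longleftrightarrow> c \<in> Obj C \<and> (\<exists>\<sigma>. represents \<sigma> d \<and> is_iso C (\<sigma> c))"
proof -
  have "represents \<sigma> d \<longleftrightarrow> d \<in> Obj D \<and> (\<exists>a. is_cone C a \<sigma>) \<and> fobj (Gam X) d = Hfun C \<sigma>" for \<sigma>
    using C.is_cone_cone unfolding represents_def by metis
  then show ?thesis
    by (auto simp: Eset_def Mset_def)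
qed

lemma represents_iso_unique:
  "\<lbrakk>represents \<sigma> d; represents \<tau> d\<rbrakk> \<Longrightarrow> \<exists>u. is_iso C u \<and> Dom C u = apex C \<sigma> \<and> Cod C u = apex C \<tau> \<and>
    \<tau> = cone_star C \<sigma> u"
  unfolding represents_def using C.mutually_below_iso by metis

lemma represents_star_iso:
  assumes "represents \<sigma> d" "is_iso C u" "Dom C u = apex C \<sigma>"
  shows "represents (cone_star C \<sigma> u) d" "apex C (cone_star C \<sigma> u) = Cod C u"
  using C.below_cone_iso[of \<sigma> u] assms unfolding represents_def by auto

lemma idempotent_cone_unique:
  assumes s: "represents \<sigma> d" "apex C \<sigma> = c" "\<sigma> c = idm C c"
    and t: "represents \<tau> d" "apex C \<tau> = c" "\<tau> c = idm C c"
  shows "\<sigma> = \<tau>"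
proof -
  obtain u where u: "is_iso C u" "Dom C u = c" "\<tau> = cone_star C \<sigma> u"
    using represents_iso_unique[OF s(1) t(1)] s(2) by auto
  have c: "c \<in> Obj C" and \<sigma>: "C.cone \<sigma>"
    using s C.cone_at(1) unfolding represents_def by auto
  have uM: "u \<in> Mor C" using C.iso_inv_simps(1)[OF u(1)] .
  have "\<tau> c = u"
    using u(2,3) c s(3) uM by (simp add: cone_star_def C.idm_left')
  then have "u = idm C c" using t(3) by simp
  then show ?thesis
    using u(3) C.cone_star_idm[OF \<sigma>] s(2) by simp
qed

lemma gam_cone_eqI:
  assumes s: "represents \<sigma> d" "apex C \<sigma> = c" "\<sigma> c = idm C c"
  shows "(c, d) \<in> Eset X" and "\<gamma> (c, d) = \<sigma>"
proof -
  have c: "c \<in> Obj C" and \<sigma>: "C.cone \<sigma>"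
    using s C.cone_at(1) unfolding represents_def by auto
  show "(c, d) \<in> Eset X"
    using in_Eset_iff s c C.iso_idm[OF c] by metis
  have ic: "idempotent_cone C c \<sigma>"
    using s \<sigma> unfolding idempotent_cone_def by auto
  have "\<tau> = \<sigma>" if "idempotent_cone C c \<tau> \<and> Hfun C \<tau> = fobj (Gam X) d" for \<tau>
    using idempotent_cone_unique[OF _ _ _ s, of \<tau>] that C.cone_apex[of c \<tau>] s(1)
    unfolding idempotent_cone_def represents_def by auto
  then show "\<gamma> (c, d) = \<sigma>"
    using ic s(1) unfolding gam_cone_def represents_def by (auto intro: the_equality)
qed

text \<open>
  Composition with the inverse of the component \<open>\<sigma>(c)\<close> turns \<open>\<sigma>\<close> into an idempotent cone with apex \<open>c\<close>
  and the same \<open>H\<close>-functor.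
\<close>

lemma cone_factor:
  assumes s: "represents \<sigma> d" and c: "c \<in> Obj C" "is_iso C (\<sigma> c)"
  shows "(c, d) \<in> Eset X" and "represents (\<gamma> (c, d)) d" and "apex C (\<gamma> (c, d)) = c"
    and "\<gamma> (c, d) c = idm C c" and "\<sigma> = cone_star C (\<gamma> (c, d)) (\<sigma> c)"
proof -
  have \<sigma>: "C.cone \<sigma>" using s unfolding represents_def by blast
  note a = C.cone_at[OF \<sigma>] and i = C.iso_inv_simps[OF c(2)] and v = C.iso_inv_mor[OF c(2)]
  let ?t = "cone_star C \<sigma> (inv_mor C (\<sigma> c))"
  have t: "represents ?t d" "apex C ?t = c" "?t c = idm C c"
    using represents_star_iso[OF s, of "inv_mor C (\<sigma> c)"] v i a c(1) by (auto simp: cone_star_def)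
  note g = gam_cone_eqI[OF t]
  show "(c, d) \<in> Eset X" "represents (\<gamma> (c, d)) d" "apex C (\<gamma> (c, d)) = c" "\<gamma> (c, d) c = idm C c"
    using g t by auto
  show "\<sigma> = cone_star C (\<gamma> (c, d)) (\<sigma> c)"
    using g(2) C.cone_star_star[OF \<sigma> i(2) _ i(1)] i a c(1) C.cone_star_idm[OF \<sigma>] by simp
qed

lemma gam:
  assumes "e \<in> Eset X"
  shows "represents (\<gamma> e) (snd e)" and "C.cone (\<gamma> e)" and "apex C (\<gamma> e) = fst e"
    and "\<gamma> e (fst e) = idm C (fst e)" and "Hfun C (\<gamma> e) = fobj (Gam X) (snd e)"
    and "fst e \<in> Obj C" and "snd e \<in> Obj D"
proof -
  obtain c d where e: "e = (c, d)" by (cases e)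
  obtain \<sigma> where "represents \<sigma> d" "c \<in> Obj C" "is_iso C (\<sigma> c)"
    using assms in_Eset_iff e by auto
  from cone_factor[OF this] \<open>c \<in> Obj C\<close>
  show "represents (\<gamma> e) (snd e)" "C.cone (\<gamma> e)" "apex C (\<gamma> e) = fst e"
    "\<gamma> e (fst e) = idm C (fst e)" "Hfun C (\<gamma> e) = fobj (Gam X) (snd e)"
    "fst e \<in> Obj C" "snd e \<in> Obj D"
    unfolding represents_def e by auto
qed

lemma gam_at:
  assumes "e \<in> Eset X" "c \<in> Obj C"
  shows "\<gamma> e c \<in> Mor C" "Dom C (\<gamma> e c) = c" "Cod C (\<gamma> e c) = fst e"
  using C.cone_at[OF gam(2)[OF assms(1)]] gam(3)[OF assms(1)] assms(2) by auto

lemma ex_Eset_snd: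
  assumes "d \<in> Obj D"
  obtains e where "e \<in> Eset X" and "snd e = d"
proof -
  obtain \<sigma> where s: "represents \<sigma> d" using represented[OF assms] .
  then obtain c where "c \<in> Obj C" "is_iso C (\<sigma> c)"
    using C.cone_iso unfolding represents_def by blast
  then show thesis
    using that[of "(c, d)"] cone_factor(1)[OF s] by simp
qed

lemma ex_Eset_fst:
  assumes "c \<in> Obj C"
  obtains e where "e \<in> Eset X" and "fst e = c"
proof -
  obtain d where "d \<in> Obj D" "c \<in> Mset C (fobj (Gam X) d)"
    using cross_connection assms unfolding cross_connection_def by blast
  then have "(c, d) \<in> Eset X" using assms by (simp add: Eset_def)
  then show thesis using that[of "(c, d)"] by simp
qed

lemma represents_factor:
  assumes e: "e \<in> Eset X" and s: "represents \<sigma> (snd e)"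
  shows "is_iso C (\<sigma> (fst e))" and "\<sigma> = cone_star C (\<gamma> e) (\<sigma> (fst e))"
proof -
  obtain u where u: "is_iso C u" "Dom C u = fst e" "\<sigma> = cone_star C (\<gamma> e) u"
    using represents_iso_unique[OF gam(1)[OF e] s] gam(3)[OF e] by auto
  then have "\<sigma> (fst e) = u"
    using gam(4,6)[OF e] C.iso_inv_simps(1)[OF u(1)] by (simp add: cone_star_def C.idm_left')
  then show "is_iso C (\<sigma> (fst e))" "\<sigma> = cone_star C (\<gamma> e) (\<sigma> (fst e))"
    using u by auto
qed

text \<open>
  Since \<open>\<gamma> e\<close> is the identity at its apex, the epimorphism that carries it to a cone \<open>\<sigma>\<close> below it is the
  component of \<open>\<sigma>\<close> there.
\<close>

lemma Eset_factor:
  assumes e: "e \<in> Eset X" and b: "below_cone C \<sigma> (\<gamma> e)"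
  shows "split_epi C (\<sigma> (fst e))" and "Dom C (\<sigma> (fst e)) = fst e"
    and "\<sigma> = cone_star C (\<gamma> e) (\<sigma> (fst e))"
proof -
  obtain p where p: "split_epi C p" "Dom C p = fst e" "\<sigma> = cone_star C (\<gamma> e) p"
    using b gam(3)[OF e] unfolding below_cone_def by auto
  then have "\<sigma> (fst e) = p"
    using gam(4,6)[OF e] C.split_epi_in[OF p(1)] by (simp add: cone_star_def C.idm_left')
  then show "split_epi C (\<sigma> (fst e))" "Dom C (\<sigma> (fst e)) = fst e"
    "\<sigma> = cone_star C (\<gamma> e) (\<sigma> (fst e))"
    using p by auto
qed

lemma subobj_factor:
  assumes e: "e \<in> Eset X" and e': "e' \<in> Eset X" and sub: "subobj D (snd e') (snd e)"
  shows "split_epi C (\<gamma> e' (fst e))" and "\<gamma> e' = cone_star C (\<gamma> e) (\<gamma> e' (fst e))"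
    and "c \<in> Obj C \<Longrightarrow> \<gamma> e' c = \<gamma> e c \<cdot>\<^bsub>C\<^esub> \<gamma> e' (fst e)"
proof -
  note f = Eset_factor[OF e subobj_below[OF gam(1)[OF e] gam(1)[OF e'] sub]]
  show "split_epi C (\<gamma> e' (fst e))" "\<gamma> e' = cone_star C (\<gamma> e) (\<gamma> e' (fst e))"
    using f by auto
  show "\<gamma> e' c = \<gamma> e c \<cdot>\<^bsub>C\<^esub> \<gamma> e' (fst e)" if "c \<in> Obj C"
    using fun_cong[OF f(3), of c] that by (simp add: cone_star_def)
qed

lemma transpose_nat_eq:
  assumes "e \<in> Eset X" and "e' \<in> Eset X"
  shows "transpose_nat X e e' f = H_nat C (\<gamma> e) (\<gamma> e') f"
  using gam(5) assms by (simp add: transpose_nat_def H_nat_def Let_def)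

lemma transpose:
  assumes e: "e \<in> Eset X" and e': "e' \<in> Eset X"
    and f: "f \<in> Mor C" "Dom C f = fst e" "Cod C f = fst e'"
  shows "transpose X e e' f \<in> Mor D" and "Dom D (transpose X e e' f) = snd e'"
    and "Cod D (transpose X e e' f) = snd e"
    and "fmor (Gam X) (transpose X e e' f) = H_nat C (\<gamma> e) (\<gamma> e') f"
    and "\<lbrakk>g \<in> Mor D; Dom D g = snd e'; Cod D g = snd e; fmor (Gam X) g = H_nat C (\<gamma> e) (\<gamma> e') f\<rbrakk>
      \<Longrightarrow> g = transpose X e e' f"
proof -
  have "H_nat C (\<gamma> e) (\<gamma> e') f \<in> Hom (normal_dual C) (fobj (Gam X) (snd e')) (fobj (Gam X) (snd e))"
    using C.H_nat_Mor[OF gam(2)[OF e] gam(2)[OF e'], of f] gam(3,5)[OF e] gam(3,5)[OF e'] f by simp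
  moreover have bij: "bij_betw (fmor (Gam X)) (Hom D (snd e') (snd e))
      (Hom (normal_dual C) (fobj (Gam X) (snd e')) (fobj (Gam X) (snd e)))"
    using fully_faithful_Gam gam(7)[OF e] gam(7)[OF e'] unfolding fully_faithful_def by blast
  ultimately have "H_nat C (\<gamma> e) (\<gamma> e') f \<in> fmor (Gam X) ` Hom D (snd e') (snd e)"
    by (simp only: bij_betw_imp_surj_on)
  then obtain h where h: "h \<in> Hom D (snd e') (snd e)" "fmor (Gam X) h = H_nat C (\<gamma> e) (\<gamma> e') f"
    by auto
  have u: "g = h" if "g \<in> Hom D (snd e') (snd e)" "fmor (Gam X) g = H_nat C (\<gamma> e) (\<gamma> e') f" for g
    using inj_onD[OF bij_betw_imp_inj_on[OF bij], of g h] that h by simp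
  have t: "transpose X e e' f = h"
    unfolding transpose_def transpose_nat_eq[OF e e'] using h u by blast
  show "transpose X e e' f \<in> Mor D" "Dom D (transpose X e e' f) = snd e'"
    "Cod D (transpose X e e' f) = snd e"
    "fmor (Gam X) (transpose X e e' f) = H_nat C (\<gamma> e) (\<gamma> e') f"
    using t h by (auto simp: Hom_def)
  show "\<lbrakk>g \<in> Mor D; Dom D g = snd e'; Cod D g = snd e; fmor (Gam X) g = H_nat C (\<gamma> e) (\<gamma> e') f\<rbrakk>
      \<Longrightarrow> g = transpose X e e' f"
    using u t by (simp add: Hom_def)
qed

lemma transpose_Comp:
  assumes e: "e \<in> Eset X" "e' \<in> Eset X" "e'' \<in> Eset X"
    and f: "f \<in> Mor C" "Dom C f = fst e" "Cod C f = fst e'"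
    and h: "h \<in> Mor C" "Dom C h = fst e'" "Cod C h = fst e''"
  shows "transpose X e e'' (f \<cdot>\<^bsub>C\<^esub> h) = transpose X e' e'' h \<cdot>\<^bsub>D\<^esub> transpose X e e' f"
proof -
  note t = transpose[OF e(1,2) f] and s = transpose[OF e(2,3) h]
  have "fmor (Gam X) (transpose X e' e'' h \<cdot>\<^bsub>D\<^esub> transpose X e e' f) =
      H_nat C (\<gamma> e') (\<gamma> e'') h \<cdot>\<^bsub>normal_dual C\<^esub> H_nat C (\<gamma> e) (\<gamma> e') f"
    using functor_Gam t(1-4) s(1-4) unfolding is_functor_def by simp
  also have "\<dots> = H_nat C (\<gamma> e) (\<gamma> e'') (f \<cdot>\<^bsub>C\<^esub> h)"
    using C.H_nat_Comp[of "\<gamma> e" "\<gamma> e'" "\<gamma> e''" f h] gam(2,3)[OF e(1)] gam(2,3)[OF e(2)]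
      gam(2,3)[OF e(3)] f h by simp
  finally show ?thesis
    using transpose(5)[OF e(1,3), of "f \<cdot>\<^bsub>C\<^esub> h" "transpose X e' e'' h \<cdot>\<^bsub>D\<^esub> transpose X e e' f"]
      t(1-3) s(1-3) f h by simp
qed

lemma transpose_inj:
  assumes e: "e \<in> Eset X" "e' \<in> Eset X"
    and f: "f \<in> Mor C" "Dom C f = fst e" "Cod C f = fst e'"
    and h: "h \<in> Mor C" "Dom C h = fst e" "Cod C h = fst e'"
    and eq: "transpose X e e' f = transpose X e e' h"
  shows "f = h"
  using C.H_nat_inj[OF gam(2)[OF e(1)] gam(2)[OF e(2)], of f h] gam(3)[OF e(1)] gam(3)[OF e(2)]
    transpose(4)[OF e f] transpose(4)[OF e h] f h eq by simp

text \<open>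
  The inclusion \<open>\<Gamma>(d') \<subseteq> \<Gamma>(d)\<close> is induced by the epimorphism from \<open>\<gamma>(e)\<close> to \<open>\<gamma>(e')\<close>, so that
  epimorphism transposes to the inclusion of \<open>d'\<close> in \<open>d\<close>.
\<close>

lemma transpose_incl:
  assumes e: "e \<in> Eset X" "e' \<in> Eset X" and sub: "subobj D (snd e') (snd e)"
  shows "transpose X e e' (\<gamma> e' (fst e)) = incl D (snd e') (snd e)"
proof -
  note f = subobj_factor[OF e sub] and i = D.subobj_incl[OF sub] and g = Gam_incl[OF sub]
  note at = gam_at[OF e(2) gam(6)[OF e(1)]]
  have "fmor (Gam X) (incl D (snd e') (snd e)) = H_nat C (\<gamma> e) (\<gamma> e') (\<gamma> e' (fst e))"
    using C.H_nat_incl(2)[OF gam(2)[OF e(1)] f(1) _ f(2) g(1)] at gam(3,5)[OF e(1)] gam(5)[OF e(2)] g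
    by simp
  then show ?thesis
    using transpose(5)[OF e at i(2-4)] by simp
qed

lemma transpose_idm: "e \<in> Eset X \<Longrightarrow> transpose X e e (idm C (fst e)) = idm D (snd e)"
  using transpose_incl[of e e] gam(4,7)[of e] D.subobj_refl D.incl_refl by simp

lemma transpose_inverse:
  assumes e: "e \<in> Eset X" "e' \<in> Eset X"
    and f: "f \<in> Mor C" "Dom C f = fst e" "Cod C f = fst e'"
    and h: "h \<in> Mor C" "Dom C h = fst e'" "Cod C h = fst e"
    and fh: "f \<cdot>\<^bsub>C\<^esub> h = idm C (fst e)"
  shows "transpose X e' e h \<cdot>\<^bsub>D\<^esub> transpose X e e' f = idm D (snd e)"
  using transpose_Comp[OF e e(1) f h] fh transpose_idm[OF e(1)] by simp

lemma transpose_iso: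
  assumes e: "e \<in> Eset X" "e' \<in> Eset X" and f: "is_iso C f" "Dom C f = fst e" "Cod C f = fst e'"
  shows "inverses D (transpose X e e' f) (transpose X e' e (inv_mor C f))"
proof -
  note i = C.iso_inv_simps[OF f(1), unfolded f(2,3)]
  note t = transpose(1-3)[OF e i(1) f(2,3)] and s = transpose(1-3)[OF e(2,1) i(2-4)]
  show ?thesis
    unfolding inverses_def t(2,3) s(2,3)
    using transpose_inverse[OF e i(1) f(2,3) i(2-5)] transpose_inverse[OF e(2,1) i(2-4) i(1) f(2,3) i(6)]
      t(1) s(1) by blast
qed

text \<open>
  Factor \<open>f\<close> through its image and, on the other side, through an object whose cone represents the
  lift \<open>d\<close> of \<open>\<gamma>(e) * f\<degree>\<close>: the transpose becomes a split epimorphism followed by an inclusion of \<open>d\<close>.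
\<close>

lemma im_transpose:
  assumes e: "e \<in> Eset X" "e' \<in> Eset X"
    and f: "f \<in> Mor C" "Dom C f = fst e" "Cod C f = fst e'"
    and d: "subobj D d (snd e)" "fobj (Gam X) d = Hfun C (eta_inv C (\<gamma> e) f)"
  shows "im D (transpose X e e' f) = d"
proof -
  note ep = C.epi_props[OF f(1)]
  let ?\<sigma> = "eta_inv C (\<gamma> e) f"
  have \<sigma>: "C.cone ?\<sigma>" "apex C ?\<sigma> = im C f"
    using C.eta_inv_cone[OF gam(2)[OF e(1)] f(1)] gam(3)[OF e(1)] f by auto
  have dO: "d \<in> Obj D" using D.subobj_incl[OF d(1)] by simp
  have r: "represents ?\<sigma> d" using \<sigma> d dO unfolding represents_def by simp
  obtain a where a: "a \<in> Eset X" "snd a = d"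
    using ex_Eset_snd[OF dO] .
  define u where "u = ?\<sigma> (fst a)"
  have u: "is_iso C u" "?\<sigma> = cone_star C (\<gamma> a) u"
    using represents_factor[OF a(1), of ?\<sigma>] r a(2) by (simp_all add: u_def)
  note i = C.iso_inv_simps[OF u(1)]
  have du: "Dom C u = fst a" "Cod C u = im C f"
    using C.cone_at[OF \<sigma>(1)] gam(6)[OF a(1)] \<sigma>(2) by (simp_all add: u_def)
  define p where "p = \<gamma> a (fst e)"
  have p: "p \<in> Mor C" "Dom C p = fst e" "Cod C p = fst a"
    using gam_at[OF a(1) gam(6)[OF e(1)]] by (simp_all add: p_def)
  have pu: "p \<cdot>\<^bsub>C\<^esub> u = epi C f"
  proof -
    have "?\<sigma> (fst e) = p \<cdot>\<^bsub>C\<^esub> u"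
      using fun_cong[OF u(2), of "fst e"] gam(6)[OF e(1)] by (simp add: cone_star_def p_def)
    moreover have "?\<sigma> (fst e) = epi C f"
      using gam(4,6)[OF e(1)] ep(2,3) f by (simp add: eta_inv_def cone_star_def C.idm_left')
    ultimately show ?thesis by simp
  qed
  obtain q where q: "is_retraction C (Cod C f) (im C f) q"
    using C.incl_splits[OF ep(5)] by blast
  note j = C.subobj_incl[OF ep(5)]
  have q': "q \<in> Mor C" "Dom C q = Cod C f" "Cod C q = im C f"
    "incl C (im C f) (Cod C f) \<cdot>\<^bsub>C\<^esub> q = idm C (im C f)"
    using q unfolding is_retraction_def Hom_def by auto
  define m where "m = u \<cdot>\<^bsub>C\<^esub> incl C (im C f) (Cod C f)"
  define n where "n = q \<cdot>\<^bsub>C\<^esub> inv_mor C u"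
  have m: "m \<in> Mor C" "Dom C m = fst a" "Cod C m = fst e'"
    using i j du f by (simp_all add: m_def)
  have n: "n \<in> Mor C" "Dom C n = fst e'" "Cod C n = fst a"
    using i q' du f by (simp_all add: n_def)
  have fm: "f = p \<cdot>\<^bsub>C\<^esub> m"
  proof -
    have "p \<cdot>\<^bsub>C\<^esub> m = epi C f \<cdot>\<^bsub>C\<^esub> incl C (im C f) (Cod C f)"
      using C.Comp_assoc[OF p(1) i(1) j(2)] p(3) du j(3) pu by (simp add: m_def)
    then show ?thesis using ep(7) by simp
  qed
  have mn: "m \<cdot>\<^bsub>C\<^esub> n = idm C (fst a)"
  proof -
    have "m \<cdot>\<^bsub>C\<^esub> n = u \<cdot>\<^bsub>C\<^esub> ((incl C (im C f) (Cod C f) \<cdot>\<^bsub>C\<^esub> q) \<cdot>\<^bsub>C\<^esub> inv_mor C u)"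
      using i(1-4) j(1-6) q'(1-3) du by (simp add: m_def n_def C.Comp_assoc)
    also have "\<dots> = idm C (fst a)"
      using i q'(4) du by (simp add: C.idm_left')
    finally show ?thesis .
  qed
  note tm = transpose[OF a(1) e(2) m] and tn = transpose[OF e(2) a(1) n]
  have "transpose X e' a n \<cdot>\<^bsub>D\<^esub> transpose X a e' m = idm D d"
    using transpose_Comp[OF a(1) e(2) a(1) m n] mn transpose_idm[OF a(1)] a(2) by simp
  then have se: "split_epi D (transpose X a e' m)"
    unfolding split_epi_def using tm(1-3) tn(1-3) a(2)
    by (intro conjI bexI[of _ "transpose X e' a n"]) auto
  have "transpose X e e' f = transpose X a e' m \<cdot>\<^bsub>D\<^esub> incl D d (snd e)"
    using transpose_Comp[OF e(1) a(1) e(2) p m] transpose_incl[OF e(1) a(1)] fm d(1) a(2) p_def by simp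
  then show ?thesis
    using D.epi_im_eqI(2)[OF se, of "incl D d (snd e)"] D.subobj_incl[OF d(1)] tm(3) a(2) by simp
qed

text \<open>
  The component of \<open>\<delta>(e)\<close> at \<open>d'\<close> may be computed with any \<open>c'\<close>: the cones for two choices differ by an
  isomorphism, and this isomorphism transposes to the identity of \<open>d'\<close>.
\<close>

lemma del_cone_eq:
  assumes e: "e \<in> Eset X" "e' \<in> Eset X"
  shows "\<delta> e (snd e') = transpose X e e' (\<gamma> e' (fst e))"
proof -
  define a where "a = (SOME c'. (c', snd e') \<in> Eset X, snd e')"
  have "(SOME c'. (c', snd e') \<in> Eset X, snd e') \<in> Eset X"
    by (rule someI2[of _ "fst e'"]) (use e in auto)
  then have a: "a \<in> Eset X" "snd a = snd e'" by (simp_all add: a_def)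
  have sub: "subobj D (snd e') (snd a)"
    using D.subobj_refl gam(7)[OF e(2)] a by simp
  have "\<delta> e (snd e') = transpose X e a (\<gamma> a (fst e))"
    using gam(7)[OF e(2)] by (simp add: del_cone_def a_def Let_def)
  moreover have "transpose X e e' (\<gamma> e' (fst e)) =
      transpose X a e' (\<gamma> e' (fst a)) \<cdot>\<^bsub>D\<^esub> transpose X e a (\<gamma> a (fst e))"
    using transpose_Comp[OF e(1) a(1) e(2) gam_at[OF a(1) gam(6)[OF e(1)]] gam_at[OF e(2) gam(6)[OF a(1)]]]
      subobj_factor(3)[OF a(1) e(2) sub gam(6)[OF e(1)]] by simp
  moreover have "transpose X a e' (\<gamma> e' (fst a)) = idm D (snd e')"
    using transpose_incl[OF a(1) e(2) sub] a(2) D.incl_refl gam(7)[OF e(2)] by simp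
  moreover have "transpose X e a (\<gamma> a (fst e)) \<in> Mor D" "Dom D (transpose X e a (\<gamma> a (fst e))) = snd e'"
    using transpose(1,2)[OF e(1) a(1) gam_at[OF a(1) gam(6)[OF e(1)]]] a(2) by auto
  ultimately show ?thesis by (simp add: D.idm_left')
qed

lemma del_cone_at:
  assumes e: "e \<in> Eset X" and d: "d \<in> Obj D"
  shows "\<delta> e d \<in> Mor D" "Dom D (\<delta> e d) = d" "Cod D (\<delta> e d) = snd e"
proof -
  obtain a where a: "a \<in> Eset X" "snd a = d" using ex_Eset_snd[OF d] .
  show "\<delta> e d \<in> Mor D" "Dom D (\<delta> e d) = d" "Cod D (\<delta> e d) = snd e"
    using transpose(1-3)[OF e a(1) gam_at[OF a(1) gam(6)[OF e]]] del_cone_eq[OF e a(1)] a(2) by auto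
qed

text \<open>
  Compatibility with an inclusion of \<open>d\<^sub>1\<close> in \<open>d\<^sub>2\<close> is the transpose of the equation
  \<open>\<gamma>(e\<^sub>1)(c) = \<gamma>(e\<^sub>2)(c) \<gamma>(e\<^sub>1)(c\<^sub>2)\<close>, which holds because \<open>\<gamma>(e\<^sub>1)\<close> lies below \<open>\<gamma>(e\<^sub>2)\<close>.
\<close>

lemma del_cone:
  assumes e: "e \<in> Eset X"
  shows "D.cone (\<delta> e)" and "apex D (\<delta> e) = snd e" and "\<delta> e (snd e) = idm D (snd e)"
proof -
  show idm: "\<delta> e (snd e) = idm D (snd e)"
    using del_cone_eq[OF e e] gam(4)[OF e] transpose_idm[OF e] by simp
  have nat: "incl D a b \<cdot>\<^bsub>D\<^esub> \<delta> e b = \<delta> e a" if sub: "subobj D a b" for a b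
  proof -
    obtain e1 e2 where e12: "e1 \<in> Eset X" "snd e1 = a" "e2 \<in> Eset X" "snd e2 = b"
      using ex_Eset_snd D.subobj_incl(5,6)[OF sub] by metis
    have sub': "subobj D (snd e1) (snd e2)" using sub e12 by simp
    have "incl D a b \<cdot>\<^bsub>D\<^esub> \<delta> e b =
        transpose X e2 e1 (\<gamma> e1 (fst e2)) \<cdot>\<^bsub>D\<^esub> transpose X e e2 (\<gamma> e2 (fst e))"
      using transpose_incl[OF e12(3,1) sub'] del_cone_eq[OF e e12(3)] e12 by simp
    also have "\<dots> = transpose X e e1 (\<gamma> e2 (fst e) \<cdot>\<^bsub>C\<^esub> \<gamma> e1 (fst e2))"
      using transpose_Comp[OF e e12(3,1) gam_at[OF e12(3) gam(6)[OF e]] gam_at[OF e12(1) gam(6)[OF e12(3)]]]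
      by simp
    also have "\<dots> = \<delta> e a"
      using subobj_factor(3)[OF e12(3,1) sub' gam(6)[OF e]] del_cone_eq[OF e e12(1)] e12 by simp
    finally show ?thesis .
  qed
  have "is_cone D (snd e) (\<delta> e)"
    unfolding is_cone_def
  proof (intro conjI ballI impI)
    show "snd e \<in> Obj D" using gam(7)[OF e] .
    show "\<delta> e \<in> extensional (Obj D)" by (simp add: del_cone_def)
    show "\<exists>c\<in>Obj D. is_iso D (\<delta> e c)"
      using D.iso_idm[OF gam(7)[OF e]] idm gam(7)[OF e] by metis
  qed (use del_cone_at[OF e] nat in \<open>auto simp: Hom_def\<close>)
  then show "D.cone (\<delta> e)" "apex D (\<delta> e) = snd e"
    using D.is_cone_cone D.cone_apex by auto
qed

end

section \<open>The regular semigroup of a cross-connection\<close>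

lemma biord_of_simps:
  "elems (biord_of X) = Eset X"
  "(e, f) \<in> bdom (biord_of X) \<longleftrightarrow> e \<in> Eset X \<and> f \<in> Eset X \<and>
    (subobj (Ccat X) (fst e) (fst f) \<or> subobj (Ccat X) (fst f) (fst e) \<or> subobj (Dcat X) (snd f) (snd e) \<or> subobj (Dcat X) (snd e) (snd f))"
  "e \<star>\<^bsub>biord_of X\<^esub> f =
    (if subobj (Ccat X) (fst e) (fst f) then e
     else if subobj (Ccat X) (fst f) (fst e) then (fst f, im (Dcat X) (del_cone X e (snd f)))
     else if subobj (Dcat X) (snd f) (snd e) then f
     else if subobj (Dcat X) (snd e) (snd f) then (im (Ccat X) (gam_cone X f (fst e)), snd e) else undefined)"
  by (cases e; cases f; simp add: biord_of_def Let_def)+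

context cross_conn
begin

definition lift :: "'do \<Rightarrow> ('co, 'cm) cone \<Rightarrow> 'do" where
  "lift d \<tau> = (THE d'. subobj D d' d \<and> fobj (Gam X) d' = Hfun C \<tau>)"

definition xsgp :: "(('co, 'cm) cone \<times> 'do) option set" where
  "xsgp = {Some (\<sigma>, d) | \<sigma> d. represents \<sigma> d}"

text \<open>
  The value \<open>None\<close> serves as a zero: it is the product whenever a factor lies outside the semigroup, and so
  the multiplication is associative on the whole type.
\<close>

definition xmult ::
  "(('co, 'cm) cone \<times> 'do) option \<Rightarrow> (('co, 'cm) cone \<times> 'do) option \<Rightarrow> (('co, 'cm) cone \<times> 'do) option"
  (infixl "\<odot>" 70) where
  "s \<odot> t = (if s \<in> xsgp \<and> t \<in> xsgp then
     let \<tau> = cone_mult C (fst (the s)) (fst (the t)) in Some (\<tau>, lift (snd (the s)) \<tau>) else None)"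

text \<open>
  For an isomorphism \<open>f\<close> from the first component of \<open>e\<close> this is the general form of an element whose second
  component is that of \<open>e\<close>.
\<close>

definition xelem :: "'co \<times> 'do \<Rightarrow> 'cm \<Rightarrow> (('co, 'cm) cone \<times> 'do) option" where
  "xelem e f = Some (cone_star C (\<gamma> e) f, snd e)"

definition xidem :: "'co \<times> 'do \<Rightarrow> (('co, 'cm) cone \<times> 'do) option" where
  "xidem e = Some (\<gamma> e, snd e)"

lemma in_xsgp: "Some (\<sigma>, d) \<in> xsgp \<longleftrightarrow> represents \<sigma> d"
  by (simp add: xsgp_def)

lemma lift:
  assumes "represents \<sigma> d" "below_cone C \<tau> \<sigma>"
  shows "subobj D (lift d \<tau>) d" "fobj (Gam X) (lift d \<tau>) = Hfun C \<tau>" "represents \<tau> (lift d \<tau>)"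
proof -
  show l: "subobj D (lift d \<tau>) d" "fobj (Gam X) (lift d \<tau>) = Hfun C \<tau>"
    using theI'[OF lift_unique[OF assms]] unfolding lift_def by auto
  then show "represents \<tau> (lift d \<tau>)"
    using C.below_cone_cone assms D.subobj_incl(5) unfolding represents_def by auto
qed

lemma lift_eqI: "\<lbrakk>subobj D d' d; represents \<tau> d'\<rbrakk> \<Longrightarrow> lift d \<tau> = d'"
proof -
  assume a: "subobj D d' d" "represents \<tau> d'"
  obtain \<sigma> where s: "represents \<sigma> d"
    using represented D.subobj_incl(6)[OF a(1)] by blast
  note b = subobj_below[OF s a(2,1)]
  show "lift d \<tau> = d'"
    using subobj_eqI[OF lift(1)[OF s b] a(1)] lift(2)[OF s b] a(2) unfolding represents_def by simp
qed

lemma lift_same: "represents \<tau> d \<Longrightarrow> lift d \<tau> = d"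
  using lift_eqI D.subobj_refl unfolding represents_def by blast

lemma below_cone_mult:
  assumes "C.cone \<sigma>" "C.cone \<tau>"
  shows "below_cone C (cone_mult C \<sigma> \<tau>) \<sigma>"
  unfolding below_cone_def C.cone_mult_eq
  using C.epi_props[of "\<tau> (apex C \<sigma>)"] C.cone_at[OF assms(1)] C.cone_at[OF assms(2)]
  by (intro exI[of _ "epi C (\<tau> (apex C \<sigma>))"]) simp

lemma xmult_Some:
  assumes s: "represents \<sigma> a" and t: "represents \<tau> b"
  shows "Some (\<sigma>, a) \<odot> Some (\<tau>, b) = Some (cone_mult C \<sigma> \<tau>, lift a (cone_mult C \<sigma> \<tau>))"
    and "represents (cone_mult C \<sigma> \<tau>) (lift a (cone_mult C \<sigma> \<tau>))"
    and "subobj D (lift a (cone_mult C \<sigma> \<tau>)) a"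
proof -
  show "Some (\<sigma>, a) \<odot> Some (\<tau>, b) = Some (cone_mult C \<sigma> \<tau>, lift a (cone_mult C \<sigma> \<tau>))"
    using s t by (simp add: xmult_def in_xsgp Let_def)
  have "below_cone C (cone_mult C \<sigma> \<tau>) \<sigma>"
    using below_cone_mult s t unfolding represents_def by blast
  then show "represents (cone_mult C \<sigma> \<tau>) (lift a (cone_mult C \<sigma> \<tau>))"
    "subobj D (lift a (cone_mult C \<sigma> \<tau>)) a"
    using lift[OF s] by auto
qed

lemma xmult_closed: "\<lbrakk>s \<in> xsgp; t \<in> xsgp\<rbrakk> \<Longrightarrow> s \<odot> t \<in> xsgp"
  using xmult_Some unfolding xsgp_def by auto

text \<open>
  In the second component both bracketings give a subobject of the same object with the same image under
  \<open>\<Gamma>\<close>, so uniqueness of lifts applies.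
\<close>

lemma xmult_assoc: "s \<odot> t \<odot> r = s \<odot> (t \<odot> r)"
proof (cases "s \<in> xsgp \<and> t \<in> xsgp \<and> r \<in> xsgp")
  case True
  then obtain \<sigma> a \<tau> b \<rho> c where str: "s = Some (\<sigma>, a)" "t = Some (\<tau>, b)" "r = Some (\<rho>, c)"
    and rep: "represents \<sigma> a" "represents \<tau> b" "represents \<rho> c"
    unfolding xsgp_def by blast
  note st = xmult_Some[OF rep(1,2)] and tr = xmult_Some[OF rep(2,3)]
  note st_r = xmult_Some[OF st(2) rep(3)] and s_tr = xmult_Some[OF rep(1) tr(2)]
  have a: "cone_mult C (cone_mult C \<sigma> \<tau>) \<rho> = cone_mult C \<sigma> (cone_mult C \<tau> \<rho>)"
    using C.cone_mult_assoc rep unfolding represents_def by blast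
  have "lift a (cone_mult C \<sigma> (cone_mult C \<tau> \<rho>)) =
      lift (lift a (cone_mult C \<sigma> \<tau>)) (cone_mult C (cone_mult C \<sigma> \<tau>) \<rho>)"
    using lift_eqI[OF D.subobj_trans[OF st_r(3) st(3)] st_r(2)] a by simp
  then show ?thesis
    unfolding str st(1) tr(1) st_r(1) s_tr(1) a by simp
next
  case False
  have "None \<notin> xsgp" by (simp add: xsgp_def)
  then show ?thesis
    using False by (auto simp: xmult_def)
qed

lemma xidem_in: "e \<in> Eset X \<Longrightarrow> xidem e \<in> xsgp"
  by (simp add: xidem_def in_xsgp gam)

lemma xelem_in:
  assumes "e \<in> Eset X" "is_iso C f" "Dom C f = fst e"
  shows "represents (cone_star C (\<gamma> e) f) (snd e)" "apex C (cone_star C (\<gamma> e) f) = Cod C f"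
    "xelem e f \<in> xsgp"
  using represents_star_iso[OF gam(1)[OF assms(1)] assms(2)] assms(3) gam(3)[OF assms(1)]
  by (simp_all add: xelem_def in_xsgp)

lemma xidem_xelem: "e \<in> Eset X \<Longrightarrow> xidem e = xelem e (idm C (fst e))"
  using C.cone_star_idm[OF gam(2), of e] gam(3)[of e] by (simp add: xidem_def xelem_def)

lemma xelem_inj:
  assumes e: "e \<in> Eset X" and f: "f \<in> Mor C" "Dom C f = fst e" and g: "g \<in> Mor C" "Dom C g = fst e"
    and eq: "xelem e f = xelem e g"
  shows "f = g"
  using C.cone_star_cancel[OF gam(2)[OF e], of f g] gam(3)[OF e] f g eq by (simp add: xelem_def)

lemma xelem_mult:
  assumes e: "e \<in> Eset X" "e' \<in> Eset X" and f: "is_iso C f" "Dom C f = fst e"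
    and g: "is_iso C g" "Dom C g = fst e'" and m: "is_iso C (\<gamma> e' (Cod C f) \<cdot>\<^bsub>C\<^esub> g)"
  shows "xelem e f \<odot> xelem e' g = xelem e (f \<cdot>\<^bsub>C\<^esub> (\<gamma> e' (Cod C f) \<cdot>\<^bsub>C\<^esub> g))"
proof -
  note s = xelem_in[OF e(1) f] and t = xelem_in[OF e(2) g]
  have fM: "f \<in> Mor C" "Cod C f \<in> Obj C" and gM: "g \<in> Mor C"
    using C.iso_inv_simps(1) f(1) g(1) by auto
  let ?m = "\<gamma> e' (Cod C f) \<cdot>\<^bsub>C\<^esub> g"
  have dm: "Dom C ?m = Cod C f" "?m \<in> Mor C"
    using gam_at[OF e(2) fM(2)] g gM by auto
  have "epi C ?m = ?m"
    using C.epi_split_epi(1)[OF C.iso_split_epi[OF m]] .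
  then have c: "cone_mult C (cone_star C (\<gamma> e) f) (cone_star C (\<gamma> e') g) = cone_star C (\<gamma> e) (f \<cdot>\<^bsub>C\<^esub> ?m)"
    using C.cone_star_star[OF gam(2)[OF e(1)] fM(1) _ dm(2)] dm f(2) gam(3)[OF e(1)] s(2) fM(2)
    by (simp add: C.cone_mult_eq C.cone_star_at)
  have "is_iso C (f \<cdot>\<^bsub>C\<^esub> ?m)"
    using C.iso_Comp(1)[OF f(1) m] dm by simp
  then have r: "represents (cone_star C (\<gamma> e) (f \<cdot>\<^bsub>C\<^esub> ?m)) (snd e)"
    using xelem_in(1)[OF e(1), of "f \<cdot>\<^bsub>C\<^esub> ?m"] fM dm f(2) by simp
  show ?thesis
    using xmult_Some(1)[OF s(1) t(1)] lift_same[OF r] unfolding xelem_def c by simp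
qed

lemma xelem_mult_composable:
  assumes e: "e \<in> Eset X" "e' \<in> Eset X" and f: "is_iso C f" "Dom C f = fst e" "Cod C f = fst e'"
    and g: "is_iso C g" "Dom C g = fst e'"
  shows "xelem e f \<odot> xelem e' g = xelem e (f \<cdot>\<^bsub>C\<^esub> g)"
  using xelem_mult[OF e f(1,2) g] gam(4)[OF e(2)] f(3) g C.iso_inv_simps(1)[OF g(1)]
  by (simp add: C.idm_left')

lemma xelem_inverse:
  assumes e: "e \<in> Eset X" "e' \<in> Eset X" and f: "is_iso C f" "Dom C f = fst e" "Cod C f = fst e'"
  shows "xelem e f \<odot> xelem e' (inv_mor C f) = xidem e"
  using xelem_mult_composable[OF e f, of "inv_mor C f"] C.iso_inv_mor[OF f(1)] C.iso_inv_simps[OF f(1)]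
    f xidem_xelem[OF e(1)] by simp

lemma xsgp_xelem:
  assumes "Some (\<sigma>, d) \<in> xsgp" and "e \<in> Eset X" and "snd e = d"
  shows "Some (\<sigma>, d) = xelem e (\<sigma> (fst e))" and "is_iso C (\<sigma> (fst e))" and "Dom C (\<sigma> (fst e)) = fst e"
    and "Cod C (\<sigma> (fst e)) = apex C \<sigma>"
proof -
  have r: "represents \<sigma> (snd e)" and \<sigma>: "C.cone \<sigma>" using assms by (simp_all add: in_xsgp represents_def)
  show "Some (\<sigma>, d) = xelem e (\<sigma> (fst e))" "is_iso C (\<sigma> (fst e))"
    using represents_factor[OF assms(2) r] assms(3) by (simp_all add: xelem_def)
  show "Dom C (\<sigma> (fst e)) = fst e" "Cod C (\<sigma> (fst e)) = apex C \<sigma>"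
    using C.cone_at(3,4)[OF \<sigma> gam(6)[OF assms(2)]] by auto
qed

text \<open>
  An inverse of \<open>\<gamma>(e) * f\<close> is \<open>\<gamma>(e') * f\<inverse>\<close> for any \<open>e'\<close> over the codomain of \<open>f\<close>.
\<close>

sublocale sgp: regular_semigroup xsgp xmult
proof
  show "a \<odot> b \<odot> c = a \<odot> (b \<odot> c)" for a b c by (rule xmult_assoc)
  show "a \<odot> b \<in> xsgp" if "a \<in> xsgp" "b \<in> xsgp" for a b using that by (rule xmult_closed)
  fix a assume a: "a \<in> xsgp"
  then obtain \<sigma> d where s: "a = Some (\<sigma>, d)" "represents \<sigma> d" unfolding xsgp_def by blast
  obtain e where e: "e \<in> Eset X" "snd e = d"
    using ex_Eset_snd s(2) unfolding represents_def by blast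
  note f = xsgp_xelem[OF a[unfolded s(1)] e]
  let ?f = "\<sigma> (fst e)"
  have "apex C \<sigma> \<in> Obj C" using C.cone_at(1) s(2) unfolding represents_def by blast
  then obtain e' where e': "e' \<in> Eset X" "fst e' = apex C \<sigma>"
    using ex_Eset_fst by metis
  note i = C.iso_inv_simps[OF f(2)]
  have "xelem e ?f \<odot> xelem e' (inv_mor C ?f) = xidem e"
    using xelem_inverse[OF e(1) e'(1) f(2,3)] f(4) e'(2) by simp
  moreover have "xidem e \<odot> xelem e ?f = xelem e ?f"
    using xelem_mult_composable[OF e(1,1), of "idm C (fst e)" ?f] xidem_xelem[OF e(1)] f i(1)
      C.iso_idm[OF gam(6)[OF e(1)]] gam(6)[OF e(1)] by (simp add: C.idm_left')
  moreover have "xelem e' (inv_mor C ?f) \<in> xsgp"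
    using xelem_in(3)[OF e'(1), of "inv_mor C ?f"] C.iso_inv_mor[OF f(2)] i f(4) e'(2) by simp
  ultimately show "\<exists>b\<in>xsgp. a \<odot> b \<odot> a = a"
    using f(1) s(1) by metis
qed

section \<open>Idempotents are the pairs of the cross-connection\<close>

lemma xmult_subobj:
  assumes "Some (\<sigma>, a) \<in> xsgp" "t \<in> xsgp" "Some (\<sigma>, a) \<odot> t = Some (\<tau>, b)"
  shows "subobj D b a"
proof -
  obtain \<rho> c where t: "t = Some (\<rho>, c)" "represents \<rho> c" using assms(2) unfolding xsgp_def by blast
  show ?thesis
    using xmult_Some(1,3)[of \<sigma> a \<rho> c] assms t by (auto simp: in_xsgp)
qed

lemma xmult_apex:
  assumes "s \<in> xsgp" "Some (\<rho>, c) \<in> xsgp" "s \<odot> Some (\<rho>, c) = Some (\<tau>, b)"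
  shows "subobj C (apex C \<tau>) (apex C \<rho>)"
proof -
  obtain \<sigma> a where s: "s = Some (\<sigma>, a)" "represents \<sigma> a" using assms(1) unfolding xsgp_def by blast
  have c: "C.cone \<sigma>" "C.cone \<rho>" using s assms(2) by (auto simp: in_xsgp represents_def)
  have "\<tau> = cone_mult C \<sigma> \<rho>"
    using xmult_Some(1)[of \<sigma> a \<rho> c] assms s by (auto simp: in_xsgp)
  then show ?thesis
    using C.cone_mult_cone(2)[OF c] C.epi_props(5)[of "\<rho> (apex C \<sigma>)"] C.cone_at[OF c(2)] C.cone_at(1)[OF c(1)]
    by simp
qed

text \<open>
  If \<open>\<sigma> \<sigma> = \<sigma>\<close>, the epimorphic component of \<open>\<sigma>\<close> at its apex can be cancelled against the identity, hence
  \<open>\<sigma>\<close> is an idempotent cone and equals the cone \<open>\<gamma>(c,d)\<close> of its apex \<open>c\<close>.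
\<close>

lemma idempotent_xidem:
  assumes s: "Some (\<sigma>, d) \<in> xsgp" and idem: "Some (\<sigma>, d) \<odot> Some (\<sigma>, d) = Some (\<sigma>, d)"
  shows "(apex C \<sigma>, d) \<in> Eset X" and "xidem (apex C \<sigma>, d) = Some (\<sigma>, d)"
proof -
  have r: "represents \<sigma> d" and \<sigma>: "C.cone \<sigma>" using s by (auto simp: in_xsgp represents_def)
  note a = C.cone_at[OF \<sigma>]
  let ?f = "\<sigma> (apex C \<sigma>)"
  note f = C.epi_props[OF a(2)[OF a(1)]]
  have "cone_mult C \<sigma> \<sigma> = \<sigma>"
    using xmult_Some(1)[OF r r] idem by simp
  then have "cone_star C \<sigma> (epi C ?f) = cone_star C \<sigma> (idm C (apex C \<sigma>))"
    using C.cone_star_idm[OF \<sigma>] by (simp add: C.cone_mult_eq)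
  then have e: "epi C ?f = idm C (apex C \<sigma>)"
    using C.cone_star_cancel[OF \<sigma>] f(2,3) a by simp
  have "im C ?f = apex C \<sigma>"
    using f(4) e a(1) by simp
  then have "?f = idm C (apex C \<sigma>)"
    using f(7) e a C.incl_refl by (simp add: C.idm_left')
  then show "(apex C \<sigma>, d) \<in> Eset X" "xidem (apex C \<sigma>, d) = Some (\<sigma>, d)"
    using gam_cone_eqI[OF r refl] by (auto simp: xidem_def)
qed

text \<open>
  The component of the product in \<open>\<C>\<close> is computed by \<open>\<gamma>\<close> and that in \<open>\<D>\<close> by \<open>\<delta>\<close>: the subobject of \<open>d\<close> that
  lifts the product of the cones is the image of the transpose of \<open>\<gamma>(f)(c)\<close>, for \<open>e = (c,d)\<close>.
\<close>

lemma xidem_mult: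
  assumes e: "e \<in> Eset X" "f \<in> Eset X"
  shows "xidem e \<odot> xidem f = Some (eta_inv C (\<gamma> e) (\<gamma> f (fst e)), im D (\<delta> e (snd f)))"
    and "apex C (eta_inv C (\<gamma> e) (\<gamma> f (fst e))) = im C (\<gamma> f (fst e))"
    and "represents (eta_inv C (\<gamma> e) (\<gamma> f (fst e))) (im D (\<delta> e (snd f)))"
    and "subobj D (im D (\<delta> e (snd f))) (snd e)"
proof -
  note at = gam_at[OF e(2) gam(6)[OF e(1)]]
  have c: "cone_mult C (\<gamma> e) (\<gamma> f) = eta_inv C (\<gamma> e) (\<gamma> f (fst e))"
    using gam(3)[OF e(1)] by (simp add: C.cone_mult_eq eta_inv_def)
  note p = xmult_Some[OF gam(1)[OF e(1)] gam(1)[OF e(2)], unfolded c]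
  have "im D (\<delta> e (snd f)) = lift (snd e) (eta_inv C (\<gamma> e) (\<gamma> f (fst e)))"
    using im_transpose[OF e at p(3)] p(2) del_cone_eq[OF e] unfolding represents_def by simp
  then show "xidem e \<odot> xidem f = Some (eta_inv C (\<gamma> e) (\<gamma> f (fst e)), im D (\<delta> e (snd f)))"
    "represents (eta_inv C (\<gamma> e) (\<gamma> f (fst e))) (im D (\<delta> e (snd f)))"
    "subobj D (im D (\<delta> e (snd f))) (snd e)"
    using p by (simp_all add: xidem_def)
  show "apex C (eta_inv C (\<gamma> e) (\<gamma> f (fst e))) = im C (\<gamma> f (fst e))"
    using C.eta_inv_cone[OF gam(2)[OF e(1)] at(1)] at(2) gam(3)[OF e(1)] by simp
qed

lemma xidem_idem: "e \<in> Eset X \<Longrightarrow> xidem e \<odot> xidem e = xidem e"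
  using xelem_mult_composable[of e e "idm C (fst e)" "idm C (fst e)"] xidem_xelem[of e] gam(6)[of e]
    C.iso_idm[of "fst e"] by (simp add: C.idm_left')

lemma xidem_inj: "\<lbrakk>e \<in> Eset X; f \<in> Eset X; xidem e = xidem f\<rbrakk> \<Longrightarrow> e = f"
  using gam(3) unfolding xidem_def by (metis Pair_inject option.inject prod.collapse)

lemma subobj_C_iff:
  assumes e: "e \<in> Eset X" "f \<in> Eset X"
  shows "subobj C (fst e) (fst f) \<longleftrightarrow> xidem e \<odot> xidem f = xidem e"
    and "subobj C (fst e) (fst f) \<Longrightarrow> \<gamma> f (fst e) = incl C (fst e) (fst f)"
proof -
  note at = gam_at[OF e(2) gam(6)[OF e(1)]]
  show g: "\<gamma> f (fst e) = incl C (fst e) (fst f)" if sub: "subobj C (fst e) (fst f)"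
    using C.cone_incl[OF gam(2)[OF e(2)] sub] gam(4)[OF e(2)] C.subobj_incl[OF sub]
    by (simp add: C.idm_right')
  show "subobj C (fst e) (fst f) \<longleftrightarrow> xidem e \<odot> xidem f = xidem e"
  proof
    assume sub: "subobj C (fst e) (fst f)"
    note i = C.subobj_incl[OF sub]
    have "incl C (fst e) (fst f) = idm C (fst e) \<cdot>\<^bsub>C\<^esub> incl C (fst e) (fst f)"
      using i by (simp add: C.idm_left')
    then have "epi C (\<gamma> f (fst e)) = idm C (fst e)"
      using C.epi_im_eqI(1)[OF C.split_epi_idm[OF i(5)] _ i(1)] i g[OF sub] by simp
    then have "eta_inv C (\<gamma> e) (\<gamma> f (fst e)) = \<gamma> e"
      using C.cone_star_idm[OF gam(2)[OF e(1)]] gam(3)[OF e(1)] by (simp add: eta_inv_def)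
    moreover from this have "im D (\<delta> e (snd f)) = snd e"
      using xidem_mult(3)[OF e] gam(5)[OF e(1)] unfolding represents_def
      by (intro subobj_eqI[OF xidem_mult(4)[OF e] D.subobj_refl[OF gam(7)[OF e(1)]]]) simp
    ultimately show "xidem e \<odot> xidem f = xidem e"
      unfolding xidem_mult(1)[OF e] by (simp only: xidem_def)
  next
    assume "xidem e \<odot> xidem f = xidem e"
    then have "subobj C (apex C (\<gamma> e)) (apex C (\<gamma> f))"
      using xmult_apex[OF xidem_in[OF e(1)] xidem_in[OF e(2), unfolded xidem_def]] by (simp add: xidem_def)
    then show "subobj C (fst e) (fst f)" using gam(3) e by simp
  qed
qed

lemma subobj_D_iff:
  assumes e: "e \<in> Eset X" "f \<in> Eset X"
  shows "subobj D (snd f) (snd e) \<longleftrightarrow> xidem e \<odot> xidem f = xidem f"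
proof
  assume sub: "subobj D (snd f) (snd e)"
  note s = subobj_factor[OF e sub]
  have c: "eta_inv C (\<gamma> e) (\<gamma> f (fst e)) = \<gamma> f"
    using s(2) C.epi_split_epi(1)[OF s(1)] by (simp add: eta_inv_def)
  have "im D (\<delta> e (snd f)) = snd f"
    using xidem_mult(3)[OF e] gam(5)[OF e(2)] c unfolding represents_def
    by (intro subobj_eqI[OF xidem_mult(4)[OF e] sub]) simp
  then show "xidem e \<odot> xidem f = xidem f"
    unfolding xidem_mult(1)[OF e] c by (simp only: xidem_def)
next
  assume "xidem e \<odot> xidem f = xidem f"
  then show "subobj D (snd f) (snd e)"
    using xidem_mult(1,4)[OF e] by (simp add: xidem_def)
qed

lemma xidem_surj:
  assumes "s \<in> xsgp" "s \<odot> s = s"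
  obtains e where "e \<in> Eset X" and "xidem e = s"
  using assms idempotent_xidem unfolding xsgp_def by blast

lemma bprod_biord_of:
  assumes "(e, f) \<in> bdom (biord_of X)"
  shows "e \<star>\<^bsub>biord_of X\<^esub> f \<in> Eset X \<and> xidem (e \<star>\<^bsub>biord_of X\<^esub> f) = xidem e \<odot> xidem f"
proof -
  have e: "e \<in> Eset X" "f \<in> Eset X"
    and cases: "subobj C (fst e) (fst f) \<or> subobj C (fst f) (fst e) \<or> subobj D (snd f) (snd e) \<or>
      subobj D (snd e) (snd f)"
    using assms by (simp_all add: biord_of_simps)
  note p = xidem_mult[OF e] and at = gam_at[OF e(2) gam(6)[OF e(1)]]
  \<comment> \<open>Whenever \<open>e f\<close> is idempotent, it is the pair of its apex and its lifted subobject.\<close>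
  have idem: "(im C (\<gamma> f (fst e)), im D (\<delta> e (snd f))) \<in> Eset X \<and>
      xidem (im C (\<gamma> f (fst e)), im D (\<delta> e (snd f))) = xidem e \<odot> xidem f"
    if "xidem e \<odot> xidem f \<odot> (xidem e \<odot> xidem f) = xidem e \<odot> xidem f"
    using idempotent_xidem[of "eta_inv C (\<gamma> e) (\<gamma> f (fst e))" "im D (\<delta> e (snd f))"] that p
    by (simp add: in_xsgp)
  consider "subobj C (fst e) (fst f)"
    | "\<not> subobj C (fst e) (fst f)" "subobj C (fst f) (fst e)"
    | "\<not> subobj C (fst e) (fst f)" "\<not> subobj C (fst f) (fst e)" "subobj D (snd f) (snd e)"
    | "\<not> subobj C (fst e) (fst f)" "\<not> subobj C (fst f) (fst e)" "\<not> subobj D (snd f) (snd e)"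
      "subobj D (snd e) (snd f)"
    using cases by blast
  then show ?thesis
  proof cases
    case 1
    then show ?thesis using subobj_C_iff(1)[OF e] e by (simp add: biord_of_simps)
  next
    case 2
    note i = C.subobj_incl[OF 2(2)]
    have "xidem f \<odot> xidem e = xidem f"
      using subobj_C_iff(1)[OF e(2,1)] 2(2) by simp
    then have "xidem e \<odot> xidem f \<odot> (xidem e \<odot> xidem f) = xidem e \<odot> xidem f"
      using xidem_idem[OF e(2)] by (metis xmult_assoc)
    moreover have "im C (\<gamma> f (fst e)) = fst f"
    proof -
      have "incl C (fst f) (fst e) \<cdot>\<^bsub>C\<^esub> \<gamma> f (fst e) = idm C (fst f)"
        using C.cone_incl[OF gam(2)[OF e(2)] 2(2)] gam(4)[OF e(2)] by simp
      then have "split_epi C (\<gamma> f (fst e))"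
        unfolding split_epi_def using at i by (intro conjI bexI[of _ "incl C (fst f) (fst e)"]) simp_all
      then show ?thesis using C.epi_split_epi(2) at by simp
    qed
    ultimately show ?thesis using idem 2 by (simp add: biord_of_simps)
  next
    case 3
    then show ?thesis using subobj_D_iff[OF e] e by (simp add: biord_of_simps)
  next
    case 4
    have fe: "xidem f \<odot> xidem e = xidem e"
      using subobj_D_iff[OF e(2,1)] 4(4) by simp
    then have "xidem e \<odot> xidem f \<odot> (xidem e \<odot> xidem f) = xidem e \<odot> xidem f"
      using xidem_idem[OF e(1)] by (metis xmult_assoc)
    moreover have "im D (\<delta> e (snd f)) = snd e"
    proof -
      have "xidem e \<odot> xidem f \<odot> xidem e = xidem e"
        using fe xidem_idem[OF e(1)] by (metis xmult_assoc)
      then have "subobj D (snd e) (im D (\<delta> e (snd f)))"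
        using xmult_subobj[of "eta_inv C (\<gamma> e) (\<gamma> f (fst e))" "im D (\<delta> e (snd f))" "xidem e" "\<gamma> e" "snd e"]
          p xidem_in[OF e(1)] by (simp add: in_xsgp xidem_def)
      then show ?thesis using D.subobj_antisym p(4) by blast
    qed
    ultimately show ?thesis using idem 4 by (simp add: biord_of_simps)
  qed
qed

sublocale biord: biordered_representation xsgp xmult "biord_of X" xidem
proof
  show "inj_on xidem (elems (biord_of X))"
    using xidem_inj by (auto simp: biord_of_simps inj_on_def)
  show "xidem ` elems (biord_of X) = {s \<in> xsgp. s \<odot> s = s}"
  proof (intro equalityI subsetI)
    fix s assume "s \<in> {s \<in> xsgp. s \<odot> s = s}"
    then obtain e where "e \<in> Eset X" "xidem e = s" using xidem_surj by blast
    then show "s \<in> xidem ` elems (biord_of X)" by (auto simp: biord_of_simps)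
  qed (auto simp: biord_of_simps xidem_in xidem_idem)
  show "(e, f) \<in> bdom (biord_of X) \<longleftrightarrow> e \<in> elems (biord_of X) \<and> f \<in> elems (biord_of X) \<and>
      (xidem e \<odot> xidem f = xidem e \<or> xidem e \<odot> xidem f = xidem f \<or> xidem f \<odot> xidem e = xidem e \<or>
       xidem f \<odot> xidem e = xidem f)" for e f
    using subobj_C_iff(1)[of e f] subobj_C_iff(1)[of f e] subobj_D_iff[of e f] subobj_D_iff[of f e]
    unfolding biord_of_simps by blast
  show "e \<star>\<^bsub>biord_of X\<^esub> f \<in> elems (biord_of X)" if "(e, f) \<in> bdom (biord_of X)" for e f
    using bprod_biord_of[OF that] by (simp add: biord_of_simps)
  show "xidem (e \<star>\<^bsub>biord_of X\<^esub> f) = xidem e \<odot> xidem f" if "(e, f) \<in> bdom (biord_of X)" for e f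
    using bprod_biord_of[OF that] by simp
qed

end

section \<open>The groupoid of a cross-connection\<close>

lemma gpd_of_simps:
  "Obj (gpd_of X) = Eset X" "Mor (gpd_of X) = gpd_mor X"
  "Dom (gpd_of X) x = (Dom (Ccat X) (fst x), Dom (Dcat X) (snd x))"
  "Cod (gpd_of X) x = (Cod (Ccat X) (fst x), Cod (Dcat X) (snd x))"
  "idm (gpd_of X) e = (idm (Ccat X) (fst e), idm (Dcat X) (snd e))"
  "x \<cdot>\<^bsub>gpd_of X\<^esub> y = (fst x \<cdot>\<^bsub>Ccat X\<^esub> fst y, snd x \<cdot>\<^bsub>Dcat X\<^esub> snd y)"
  by (cases x; cases y; cases e; simp add: gpd_of_def Let_def)+

lemma Ord_gpd_of: "(x, y) \<in> Ord (gpd_of X) \<longleftrightarrow> x \<in> gpd_mor X \<and> y \<in> gpd_mor X \<and>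
    subobj (Ccat X) (Dom (Ccat X) (fst x)) (Dom (Ccat X) (fst y)) \<and>
    subobj (Dcat X) (Dom (Dcat X) (snd x)) (Dom (Dcat X) (snd y)) \<and>
    subobj (Ccat X) (Cod (Ccat X) (fst x)) (Cod (Ccat X) (fst y)) \<and>
    subobj (Dcat X) (Cod (Dcat X) (snd x)) (Cod (Dcat X) (snd y)) \<and>
    fst x = epi (Ccat X) (incl (Ccat X) (Dom (Ccat X) (fst x)) (Dom (Ccat X) (fst y)) \<cdot>\<^bsub>Ccat X\<^esub> fst y) \<and>
    snd x = epi (Dcat X) (incl (Dcat X) (Dom (Dcat X) (snd x)) (Dom (Dcat X) (snd y)) \<cdot>\<^bsub>Dcat X\<^esub> snd y)"
  by (cases x; cases y; simp add: gpd_of_def Let_def)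

context cross_conn
begin

text \<open>
  The two members of the inverse pair that represents the morphism \<open>x\<close>.
\<close>

definition gpd_fwd :: "'cm \<times> 'dm \<Rightarrow> (('co, 'cm) cone \<times> 'do) option" where
  "gpd_fwd x = xelem (Dom (gpd_of X) x) (fst x)"

definition gpd_bwd :: "'cm \<times> 'dm \<Rightarrow> (('co, 'cm) cone \<times> 'do) option" where
  "gpd_bwd x = xelem (Cod (gpd_of X) x) (inv_mor C (fst x))"

lemma gpd_morI:
  assumes e: "e \<in> Eset X" "e' \<in> Eset X" and f: "is_iso C f" "Dom C f = fst e" "Cod C f = fst e'"
  shows "(f, transpose X e' e (inv_mor C f)) \<in> gpd_mor X"
    and "Dom (gpd_of X) (f, transpose X e' e (inv_mor C f)) = e"
    and "Cod (gpd_of X) (f, transpose X e' e (inv_mor C f)) = e'"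
proof -
  note i = C.iso_inv_simps[OF f(1), unfolded f(2,3)]
  show "(f, transpose X e' e (inv_mor C f)) \<in> gpd_mor X"
    using e f i(1) unfolding gpd_mor_def mem_Collect_eq prod.case
    by (intro exI[of _ "fst e"] exI[of _ "snd e"] exI[of _ "fst e'"] exI[of _ "snd e'"]) (simp add: Hom_def)
  show "Dom (gpd_of X) (f, transpose X e' e (inv_mor C f)) = e"
    "Cod (gpd_of X) (f, transpose X e' e (inv_mor C f)) = e'"
    using transpose(2,3)[OF e(2,1) i(2-4)] f by (simp_all add: gpd_of_simps)
qed

lemma gpd_morE:
  assumes "x \<in> gpd_mor X"
  shows "Dom (gpd_of X) x \<in> Eset X" and "Cod (gpd_of X) x \<in> Eset X" and "is_iso C (fst x)"
    and "Dom C (fst x) = fst (Dom (gpd_of X) x)" and "Cod C (fst x) = fst (Cod (gpd_of X) x)"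
    and "snd x = transpose X (Cod (gpd_of X) x) (Dom (gpd_of X) x) (inv_mor C (fst x))"
proof -
  obtain f c d c' d' where x: "(c, d) \<in> Eset X" "(c', d') \<in> Eset X" "f \<in> Hom C c c'" "is_iso C f"
    "x = (f, transpose X (c', d') (c, d) (inv_mor C f))"
    using assms unfolding gpd_mor_def by blast
  have f: "Dom C f = fst (c, d)" "Cod C f = fst (c', d')"
    using x(3) by (simp_all add: Hom_def)
  note g = gpd_morI[OF x(1,2,4) f, folded x(5)]
  show "Dom (gpd_of X) x \<in> Eset X" "Cod (gpd_of X) x \<in> Eset X" "is_iso C (fst x)"
    "Dom C (fst x) = fst (Dom (gpd_of X) x)" "Cod C (fst x) = fst (Cod (gpd_of X) x)"
    "snd x = transpose X (Cod (gpd_of X) x) (Dom (gpd_of X) x) (inv_mor C (fst x))"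
    unfolding g using x f by auto
qed

lemma gpd_inverse:
  assumes x: "x \<in> gpd_mor X"
  shows "gpd_fwd x \<in> xsgp" "gpd_bwd x \<in> xsgp"
    and "gpd_fwd x \<odot> gpd_bwd x = xidem (Dom (gpd_of X) x)"
    and "gpd_bwd x \<odot> gpd_fwd x = xidem (Cod (gpd_of X) x)"
    and "gpd_fwd x \<odot> gpd_bwd x \<odot> gpd_fwd x = gpd_fwd x"
    and "gpd_bwd x \<odot> gpd_fwd x \<odot> gpd_bwd x = gpd_bwd x"
proof -
  note g = gpd_morE[OF x]
  note i = C.iso_inv_simps[OF g(3), unfolded g(4,5)] and v = C.iso_inv_mor[OF g(3)]
  show "gpd_fwd x \<in> xsgp" "gpd_bwd x \<in> xsgp"
    using xelem_in(3)[OF g(1,3,4)] xelem_in(3)[OF g(2) _ i(3)] v by (simp_all add: gpd_fwd_def gpd_bwd_def)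
  show d: "gpd_fwd x \<odot> gpd_bwd x = xidem (Dom (gpd_of X) x)"
    using xelem_inverse[OF g(1-5)] by (simp add: gpd_fwd_def gpd_bwd_def)
  show c: "gpd_bwd x \<odot> gpd_fwd x = xidem (Cod (gpd_of X) x)"
    using xelem_inverse[OF g(2,1) _ i(3,4)] v by (simp add: gpd_fwd_def gpd_bwd_def)
  have "xidem (Dom (gpd_of X) x) \<odot> gpd_fwd x = gpd_fwd x"
    using xelem_mult_composable[OF g(1,1) _ _ _ g(3,4), of "idm C (fst (Dom (gpd_of X) x))"]
      C.iso_idm[OF gam(6)[OF g(1)]] gam(6)[OF g(1)] xidem_xelem[OF g(1)] i(1) g(4)
    by (simp add: gpd_fwd_def C.idm_left')
  then show "gpd_fwd x \<odot> gpd_bwd x \<odot> gpd_fwd x = gpd_fwd x"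
    using d by simp
  have "xidem (Cod (gpd_of X) x) \<odot> gpd_bwd x = gpd_bwd x"
    using xelem_mult_composable[OF g(2,2) _ _ _ v[THEN conjunct1] i(3), of "idm C (fst (Cod (gpd_of X) x))"]
      C.iso_idm[OF gam(6)[OF g(2)]] gam(6)[OF g(2)] xidem_xelem[OF g(2)] i(2,3)
    by (simp add: gpd_bwd_def C.idm_left')
  then show "gpd_bwd x \<odot> gpd_fwd x \<odot> gpd_bwd x = gpd_bwd x"
    using c by simp
qed

lemma gpd_mor_eqI:
  assumes x: "x \<in> gpd_mor X" and y: "y \<in> gpd_mor X" and "Dom (gpd_of X) x = Dom (gpd_of X) y"
    "Cod (gpd_of X) x = Cod (gpd_of X) y" "fst x = fst y"
  shows "x = y"
  using gpd_morE(6)[OF x] gpd_morE(6)[OF y] assms(3-5) by (simp add: prod_eq_iff)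

lemma gpd_inj:
  assumes x: "x \<in> gpd_mor X" and y: "y \<in> gpd_mor X" and eq: "gpd_fwd x = gpd_fwd y" "gpd_bwd x = gpd_bwd y"
  shows "x = y"
proof -
  note gx = gpd_morE[OF x] and gy = gpd_morE[OF y]
  have d: "Dom (gpd_of X) x = Dom (gpd_of X) y"
    using gpd_inverse(3)[OF x] gpd_inverse(3)[OF y] eq xidem_inj[OF gx(1) gy(1)] by simp
  have c: "Cod (gpd_of X) x = Cod (gpd_of X) y"
    using gpd_inverse(4)[OF x] gpd_inverse(4)[OF y] eq xidem_inj[OF gx(2) gy(2)] by simp
  have "fst x = fst y"
    using xelem_inj[OF gx(1), of "fst x" "fst y"] gx(3,4) gy(3,4) d eq(1) C.iso_inv_simps(1)
    unfolding gpd_fwd_def by simp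
  then show ?thesis using gpd_mor_eqI[OF x y d c] by blast
qed

lemma gpd_surj:
  assumes a: "a \<in> xsgp" and b: "b \<in> xsgp" and aba: "a \<odot> b \<odot> a = a" and bab: "b \<odot> a \<odot> b = b"
  shows "\<exists>x\<in>gpd_mor X. gpd_fwd x = a \<and> gpd_bwd x = b"
proof -
  \<comment> \<open>An element with left identity \<open>s t\<close> and right identity \<open>t s\<close> is given by an isomorphism between the
    apexes of the two idempotents.\<close>
  have half: "\<exists>u. is_iso C u \<and> Dom C u = fst e \<and> Cod C u = fst e' \<and> s = xelem e u"
    if st: "s \<in> xsgp" "t \<in> xsgp" "s \<odot> t \<odot> s = s"
      and e: "e \<in> Eset X" "xidem e = s \<odot> t" "e' \<in> Eset X" "xidem e' = t \<odot> s" for s t e e'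
  proof -
    obtain \<sigma> d where s: "s = Some (\<sigma>, d)" using st(1) unfolding xsgp_def by blast
    have "subobj D (snd e) d"
      using xmult_subobj[of \<sigma> d t "\<gamma> e" "snd e"] st(1,2) e(2) s by (simp add: xidem_def)
    moreover have "subobj D d (snd e)"
      using xmult_subobj[of "\<gamma> e" "snd e" s \<sigma> d] xidem_in[OF e(1)] st(1,3) e(2) s by (simp add: xidem_def)
    ultimately have d: "snd e = d" using D.subobj_antisym by blast
    have "subobj C (fst e') (apex C \<sigma>)"
      using xmult_apex[of t \<sigma> d "\<gamma> e'" "snd e'"] st(1,2) e(3,4) s gam(3) by (simp add: xidem_def)
    moreover have "subobj C (apex C \<sigma>) (fst e')"
      using xmult_apex[of s "\<gamma> e'" "snd e'" \<sigma> d] xidem_in[OF e(3)] st(1,3) e(4) s gam(3)[OF e(3)] xmult_assoc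
      by (simp add: xidem_def)
    ultimately have "apex C \<sigma> = fst e'" using C.subobj_antisym by blast
    then show ?thesis
      using xsgp_xelem[OF st(1)[unfolded s] e(1) d] s by auto
  qed
  obtain e where e: "e \<in> Eset X" "xidem e = a \<odot> b"
    using xidem_surj[of "a \<odot> b"] xmult_closed[OF a b] aba by (metis xmult_assoc)
  obtain e' where e': "e' \<in> Eset X" "xidem e' = b \<odot> a"
    using xidem_surj[of "b \<odot> a"] xmult_closed[OF b a] bab by (metis xmult_assoc)
  obtain u where u: "is_iso C u" "Dom C u = fst e" "Cod C u = fst e'" "a = xelem e u"
    using half[OF a b aba e e'] by blast
  obtain v where v: "is_iso C v" "Dom C v = fst e'" "Cod C v = fst e" "b = xelem e' v"
    using half[OF b a bab e' e] by blast
  have "xelem e (u \<cdot>\<^bsub>C\<^esub> v) = xelem e (idm C (fst e))"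
    using xelem_mult_composable[OF e(1) e'(1) u(1-3) v(1,2)] e(2) u(4) v(4) xidem_xelem[OF e(1)] by simp
  then have "u \<cdot>\<^bsub>C\<^esub> v = idm C (fst e)"
    using xelem_inj[OF e(1), of "u \<cdot>\<^bsub>C\<^esub> v" "idm C (fst e)"] u(1-3) v(1-3) C.iso_inv_simps(1) gam(6)[OF e(1)]
    by simp
  moreover have "xelem e' (v \<cdot>\<^bsub>C\<^esub> u) = xelem e' (idm C (fst e'))"
    using xelem_mult_composable[OF e'(1) e(1) v(1-3) u(1,2)] e'(2) u(4) v(4) xidem_xelem[OF e'(1)] by simp
  then have "v \<cdot>\<^bsub>C\<^esub> u = idm C (fst e')"
    using xelem_inj[OF e'(1), of "v \<cdot>\<^bsub>C\<^esub> u" "idm C (fst e')"] u(1-3) v(1-3) C.iso_inv_simps(1) gam(6)[OF e'(1)]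
    by simp
  ultimately have "inverses C u v"
    using u(1-3) v(1-3) C.iso_inv_simps(1) unfolding inverses_def by simp
  then have "inv_mor C u = v" by (rule C.inverses_inv_mor)
  then show ?thesis
    using gpd_morI[OF e(1) e'(1) u(1-3)] u(4) v(4)
    by (intro bexI[of _ "(u, transpose X e' e (inv_mor C u))"]) (simp_all add: gpd_fwd_def gpd_bwd_def)
qed

lemma gpd_Comp:
  assumes x: "x \<in> gpd_mor X" and y: "y \<in> gpd_mor X" and xy: "Cod (gpd_of X) x = Dom (gpd_of X) y"
  shows "x \<cdot>\<^bsub>gpd_of X\<^esub> y \<in> gpd_mor X" and "gpd_fwd (x \<cdot>\<^bsub>gpd_of X\<^esub> y) = gpd_fwd x \<odot> gpd_fwd y"
    and "gpd_bwd (x \<cdot>\<^bsub>gpd_of X\<^esub> y) = gpd_bwd y \<odot> gpd_bwd x"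
proof -
  note gx = gpd_morE[OF x] and gy = gpd_morE[OF y]
  note ix = C.iso_inv_simps[OF gx(3), unfolded gx(4,5)] and vx = C.iso_inv_mor[OF gx(3)]
  note iy = C.iso_inv_simps[OF gy(3), unfolded gy(4,5)] and vy = C.iso_inv_mor[OF gy(3)]
  let ?a = "Dom (gpd_of X) x" and ?b = "Dom (gpd_of X) y" and ?c = "Cod (gpd_of X) y"
  have cd: "Cod C (fst x) = Dom C (fst y)" using gx(5) gy(4) xy by simp
  note co = C.iso_Comp[OF gx(3) gy(3) cd]
  have dc: "Dom C (fst x \<cdot>\<^bsub>C\<^esub> fst y) = fst ?a" "Cod C (fst x \<cdot>\<^bsub>C\<^esub> fst y) = fst ?c"
    using ix(1) iy(1) cd gx(4) gy(5) by simp_all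
  have "snd x \<cdot>\<^bsub>D\<^esub> snd y = transpose X ?b ?a (inv_mor C (fst x)) \<cdot>\<^bsub>D\<^esub> transpose X ?c ?b (inv_mor C (fst y))"
    using gx(6) gy(6) xy by simp
  also have "\<dots> = transpose X ?c ?a (inv_mor C (fst x \<cdot>\<^bsub>C\<^esub> fst y))"
    using transpose_Comp[OF gy(2,1) gx(1) iy(2-4) ix(2)] ix(3,4) co(2) xy by simp
  finally have eq: "x \<cdot>\<^bsub>gpd_of X\<^esub> y = (fst x \<cdot>\<^bsub>C\<^esub> fst y, transpose X ?c ?a (inv_mor C (fst x \<cdot>\<^bsub>C\<^esub> fst y)))"
    by (simp add: gpd_of_simps)
  note g = gpd_morI[OF gx(1) gy(2) co(1) dc, folded eq]
  show "x \<cdot>\<^bsub>gpd_of X\<^esub> y \<in> gpd_mor X" by (rule g(1))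
  show "gpd_fwd (x \<cdot>\<^bsub>gpd_of X\<^esub> y) = gpd_fwd x \<odot> gpd_fwd y"
    using xelem_mult_composable[OF gx(1) gy(1) gx(3,4) _ gy(3,4)] gx(5) xy
    unfolding gpd_fwd_def g by (simp add: eq)
  show "gpd_bwd (x \<cdot>\<^bsub>gpd_of X\<^esub> y) = gpd_bwd y \<odot> gpd_bwd x"
    using xelem_mult_composable[OF gy(2) gx(2) _ iy(3) _ _ ix(3)] vx vy iy(4) xy
    unfolding gpd_bwd_def g by (simp add: eq co(2))
qed

lemma gpd_idm:
  assumes e: "e \<in> Eset X"
  shows "idm (gpd_of X) e \<in> gpd_mor X" and "gpd_fwd (idm (gpd_of X) e) = xidem e"
    and "gpd_bwd (idm (gpd_of X) e) = xidem e"
proof -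
  note c = gam(6)[OF e] and i = C.iso_idm[OF gam(6)[OF e]]
  have eq: "idm (gpd_of X) e = (idm C (fst e), transpose X e e (inv_mor C (idm C (fst e))))"
    using i transpose_idm[OF e] by (simp add: gpd_of_simps)
  note g = gpd_morI[OF e e, of "idm C (fst e)", folded eq]
  show "idm (gpd_of X) e \<in> gpd_mor X" using g(1) i c by simp
  show "gpd_fwd (idm (gpd_of X) e) = xidem e" "gpd_bwd (idm (gpd_of X) e) = xidem e"
    using g(2,3) i c xidem_xelem[OF e] unfolding gpd_fwd_def gpd_bwd_def by (simp_all add: eq)
qed

text \<open>
  The equation \<open>f = (j f\<^sub>1)\<degree>\<close> in \<open>\<C>\<close> says that the forward element of \<open>x\<close> is a restriction of that of \<open>y\<close>.
  The equation for the second components says that \<open>g\<close> followed by an inclusion is an inclusion followed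
  by \<open>g\<^sub>1\<close>; both composites are transposes, and by injectivity of transposition the equation becomes the
  restriction of the backward elements.
\<close>

lemma gpd_Ord:
  "(x, y) \<in> Ord (gpd_of X) \<longleftrightarrow> x \<in> gpd_mor X \<and> y \<in> gpd_mor X \<and>
     nle (biord_of X) (Dom (gpd_of X) x) (Dom (gpd_of X) y) \<and>
     gpd_fwd x = xidem (Dom (gpd_of X) x) \<odot> gpd_fwd y \<and> gpd_bwd x = gpd_bwd y \<odot> xidem (Dom (gpd_of X) x)"
proof (cases "x \<in> gpd_mor X \<and> y \<in> gpd_mor X")
  case True
  then have x: "x \<in> gpd_mor X" and y: "y \<in> gpd_mor X" by auto
  note gx = gpd_morE[OF x] and gy = gpd_morE[OF y]
  note ix = C.iso_inv_simps[OF gx(3), unfolded gx(4,5)] and vx = C.iso_inv_mor[OF gx(3)]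
  note iy = C.iso_inv_simps[OF gy(3), unfolded gy(4,5)] and vy = C.iso_inv_mor[OF gy(3)]
  define a where "a = Dom (gpd_of X) x"
  define b where "b = Cod (gpd_of X) x"
  define a1 where "a1 = Dom (gpd_of X) y"
  define b1 where "b1 = Cod (gpd_of X) y"
  note fold = a_def[symmetric] b_def[symmetric] a1_def[symmetric] b1_def[symmetric]
  have E: "a \<in> Eset X" "b \<in> Eset X" "a1 \<in> Eset X" "b1 \<in> Eset X"
    using gx(1,2) gy(1,2) by (simp_all add: a_def b_def a1_def b1_def)
  define f where "f = fst x"
  define f1 where "f1 = fst y"
  define f' where "f' = inv_mor C f"
  define f1' where "f1' = inv_mor C f1"
  have f: "is_iso C f" "f \<in> Mor C" "Dom C f = fst a" "Cod C f = fst b"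
    and f1: "is_iso C f1" "f1 \<in> Mor C" "Dom C f1 = fst a1" "Cod C f1 = fst b1"
    and f': "is_iso C f'" "f' \<in> Mor C" "Dom C f' = fst b" "Cod C f' = fst a"
    and f1': "is_iso C f1'" "f1' \<in> Mor C" "Dom C f1' = fst b1" "Cod C f1' = fst a1"
    using gx gy ix iy vx vy unfolding f_def f1_def f'_def f1'_def fold by auto
  have sx: "snd x = transpose X b a f'" and sy: "snd y = transpose X b1 a1 f1'"
    using gx(6) gy(6) unfolding f_def f1_def f'_def f1'_def fold by auto
  have fwd: "gpd_fwd x = xelem a f" "gpd_fwd y = xelem a1 f1"
    and bwd: "gpd_bwd x = xelem b f'" "gpd_bwd y = xelem b1 f1'"
    unfolding gpd_fwd_def gpd_bwd_def f_def f1_def f'_def f1'_def fold by auto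
  have dc: "Dom C (fst x) = fst a" "Dom D (snd x) = snd a" "Cod C (fst x) = fst b" "Cod D (snd x) = snd b"
    "Dom C (fst y) = fst a1" "Dom D (snd y) = snd a1" "Cod C (fst y) = fst b1" "Cod D (snd y) = snd b1"
    unfolding a_def b_def a1_def b1_def by (simp_all add: gpd_of_simps)
  have nle: "nle (biord_of X) a a1 \<longleftrightarrow> subobj C (fst a) (fst a1) \<and> subobj D (snd a) (snd a1)"
    using E subobj_C_iff(1)[OF E(1,3)] subobj_D_iff[OF E(3,1)]
    unfolding nle_def biord.lel_iff biord.ler_iff by (simp add: biord_of_simps)
  have equiv: "subobj C (fst b) (fst b1) \<and> subobj D (snd b) (snd b1) \<and>
      f = epi C (incl C (fst a) (fst a1) \<cdot>\<^bsub>C\<^esub> f1) \<and> snd x = epi D (incl D (snd a) (snd a1) \<cdot>\<^bsub>D\<^esub> snd y) \<longleftrightarrow>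
    xelem a f = xidem a \<odot> xelem a1 f1 \<and> xelem b f' = xelem b1 f1' \<odot> xidem a"
    if sub: "subobj C (fst a) (fst a1)" "subobj D (snd a) (snd a1)"
  proof -
    let ?j = "incl C (fst a) (fst a1)" and ?k = "incl D (snd a) (snd a1)"
    note j = C.subobj_incl[OF sub(1)] and k = D.subobj_incl[OF sub(2)]
    define p where "p = \<gamma> a (fst a1)"
    have p: "p \<in> Mor C" "Dom C p = fst a1" "Cod C p = fst a" "split_epi C p"
      using gam_at[OF E(1) gam(6)[OF E(3)]] subobj_factor(1)[OF E(3,1) sub(2)] by (simp_all add: p_def)
    have tk: "transpose X a1 a p = ?k"
      using transpose_incl[OF E(3,1) sub(2)] by (simp add: p_def)
    have fp: "f1' \<cdot>\<^bsub>C\<^esub> p \<in> Mor C" "Dom C (f1' \<cdot>\<^bsub>C\<^esub> p) = fst b1" "Cod C (f1' \<cdot>\<^bsub>C\<^esub> p) = fst a"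
      "split_epi C (f1' \<cdot>\<^bsub>C\<^esub> p)"
      using f1' p C.split_epi_Comp[OF C.iso_split_epi[OF f1'(1)] p(4)] by simp_all
    have c2: "cone_mult C (cone_star C (\<gamma> b1) f1') (\<gamma> a) = cone_star C (\<gamma> b1) (f1' \<cdot>\<^bsub>C\<^esub> p)"
      using C.cone_star_star[OF gam(2)[OF E(4)] f1'(2) _ p(1)] gam(3)[OF E(4)] f1' p
        xelem_in(2)[OF E(4) f1'(1)] C.epi_split_epi(1)[OF p(4)]
      by (simp add: C.cone_mult_eq p_def)
    note m2 = xmult_Some[OF xelem_in(1)[OF E(4) f1'(1,3)] gam(1)[OF E(1)], unfolded c2]
    have c1: "cone_mult C (\<gamma> a) (cone_star C (\<gamma> a1) f1) = cone_star C (\<gamma> a) (epi C (?j \<cdot>\<^bsub>C\<^esub> f1))"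
      using gam(3,6)[OF E(1)] subobj_C_iff(2)[OF E(1,3) sub(1)] by (simp add: C.cone_mult_eq C.cone_star_at)
    note m1 = xmult_Some(1)[OF gam(1)[OF E(1)] xelem_in(1)[OF E(3) f1(1,3)], unfolded c1]
    note rf = xelem_in(1)[OF E(1) f(1,3)] and rf' = xelem_in(1)[OF E(2) f'(1,3)]
    have A: "xelem a f = xidem a \<odot> xelem a1 f1 \<longleftrightarrow> f = epi C (?j \<cdot>\<^bsub>C\<^esub> f1)"
    proof
      assume "xelem a f = xidem a \<odot> xelem a1 f1"
      then have "cone_star C (\<gamma> a) f = cone_star C (\<gamma> a) (epi C (?j \<cdot>\<^bsub>C\<^esub> f1))"
        using m1 by (simp add: xelem_def xidem_def)
      then show "f = epi C (?j \<cdot>\<^bsub>C\<^esub> f1)"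
        using C.cone_star_cancel[OF gam(2)[OF E(1)] f(2) _ C.epi_props(2)] C.epi_props(3)[of "?j \<cdot>\<^bsub>C\<^esub> f1"]
          gam(3)[OF E(1)] f(3) j f1 by simp
    next
      assume "f = epi C (?j \<cdot>\<^bsub>C\<^esub> f1)"
      then show "xelem a f = xidem a \<odot> xelem a1 f1"
        using m1 lift_same[OF rf] by (simp add: xelem_def xidem_def)
    qed
    define q where "q = \<gamma> b (fst b1)"
    have q: "q \<in> Mor C" "Dom C q = fst b1" "Cod C q = fst b"
      using gam_at[OF E(2) gam(6)[OF E(4)]] by (simp_all add: q_def)
    have qf: "q \<cdot>\<^bsub>C\<^esub> f' \<in> Mor C" "Dom C (q \<cdot>\<^bsub>C\<^esub> f') = fst b1" "Cod C (q \<cdot>\<^bsub>C\<^esub> f') = fst a"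
      using q f' by simp_all
    have B: "snd x = epi D (?k \<cdot>\<^bsub>D\<^esub> snd y) \<longleftrightarrow> xelem b f' = xelem b1 f1' \<odot> xidem a"
      if subb: "subobj D (snd b) (snd b1)"
    proof -
      note l = D.subobj_incl[OF subb]
      have tl: "transpose X b1 b q = incl D (snd b) (snd b1)"
        using transpose_incl[OF E(4,2) subb] by (simp add: q_def)
      have kx: "?k \<cdot>\<^bsub>D\<^esub> snd y = transpose X b1 a (f1' \<cdot>\<^bsub>C\<^esub> p)"
        using transpose_Comp[OF E(4,3,1) f1'(2-4) p(1-3)] tk sy by simp
      have xl: "snd x \<cdot>\<^bsub>D\<^esub> incl D (snd b) (snd b1) = transpose X b1 a (q \<cdot>\<^bsub>C\<^esub> f')"
        using transpose_Comp[OF E(4,2,1) q f'(2-4)] tl sx by simp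
      note tx = transpose(1-3)[OF E(2,1) f'(2-4), folded sx] and ty = transpose(1-3)[OF E(4,3) f1'(2-4), folded sy]
      have isox: "split_epi D (snd x)"
        using transpose_iso[OF E(2,1) f'(1,3,4)] D.iso_split_epi sx unfolding is_iso_def by metis
      have "snd x = epi D (?k \<cdot>\<^bsub>D\<^esub> snd y) \<longleftrightarrow> snd x \<cdot>\<^bsub>D\<^esub> incl D (snd b) (snd b1) = ?k \<cdot>\<^bsub>D\<^esub> snd y"
      proof
        assume s: "snd x = epi D (?k \<cdot>\<^bsub>D\<^esub> snd y)"
        have ky: "?k \<cdot>\<^bsub>D\<^esub> snd y \<in> Mor D" "Cod D (?k \<cdot>\<^bsub>D\<^esub> snd y) = snd b1"
          using k ty by simp_all
        have "im D (?k \<cdot>\<^bsub>D\<^esub> snd y) = snd b"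
          using D.epi_props(4)[OF ky(1)] s tx(3) by simp
        then show "snd x \<cdot>\<^bsub>D\<^esub> incl D (snd b) (snd b1) = ?k \<cdot>\<^bsub>D\<^esub> snd y"
          using D.epi_props(7)[OF ky(1)] ky(2) s by simp
      next
        assume "snd x \<cdot>\<^bsub>D\<^esub> incl D (snd b) (snd b1) = ?k \<cdot>\<^bsub>D\<^esub> snd y"
        then show "snd x = epi D (?k \<cdot>\<^bsub>D\<^esub> snd y)"
          using D.epi_im_eqI(1)[OF isox _ l(1)] tx(3) l(3) by metis
      qed
      also have "\<dots> \<longleftrightarrow> q \<cdot>\<^bsub>C\<^esub> f' = f1' \<cdot>\<^bsub>C\<^esub> p"
        unfolding kx xl using transpose_inj[OF E(4,1) qf fp(1-3)] by metis
      also have "\<dots> \<longleftrightarrow> cone_star C (\<gamma> b) f' = cone_star C (\<gamma> b1) (f1' \<cdot>\<^bsub>C\<^esub> p)"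
      proof -
        have "cone_star C (\<gamma> b) f' = cone_star C (cone_star C (\<gamma> b1) q) f'"
          using subobj_factor(2)[OF E(4,2) subb] by (simp add: q_def)
        also have "\<dots> = cone_star C (\<gamma> b1) (q \<cdot>\<^bsub>C\<^esub> f')"
          using C.cone_star_star[OF gam(2)[OF E(4)] q(1) _ f'(2)] gam(3)[OF E(4)] q f' by simp
        finally show ?thesis
          using C.cone_star_cancel[OF gam(2)[OF E(4)] qf(1) _ fp(1)] gam(3)[OF E(4)] qf(2) fp(2) by auto
      qed
      also have "\<dots> \<longleftrightarrow> xelem b f' = xelem b1 f1' \<odot> xidem a"
      proof
        assume c: "cone_star C (\<gamma> b) f' = cone_star C (\<gamma> b1) (f1' \<cdot>\<^bsub>C\<^esub> p)"
        have "lift (snd b1) (cone_star C (\<gamma> b1) (f1' \<cdot>\<^bsub>C\<^esub> p)) = snd b"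
          by (rule lift_eqI[OF subb]) (use rf' c in simp)
        then show "xelem b f' = xelem b1 f1' \<odot> xidem a"
          using m2(1) c by (simp add: xelem_def xidem_def)
      next
        assume "xelem b f' = xelem b1 f1' \<odot> xidem a"
        then show "cone_star C (\<gamma> b) f' = cone_star C (\<gamma> b1) (f1' \<cdot>\<^bsub>C\<^esub> p)"
          using m2(1) by (simp add: xelem_def xidem_def)
      qed
      finally show ?thesis .
    qed
    have "subobj D (snd b) (snd b1)" if "xelem b f' = xelem b1 f1' \<odot> xidem a"
      using that m2(1,3) by (simp add: xelem_def xidem_def)
    moreover have "subobj C (fst b) (fst b1)" if "xelem a f = xidem a \<odot> xelem a1 f1"
      using xmult_apex[OF xidem_in[OF E(1)] xelem_in(3)[OF E(3) f1(1,3), unfolded xelem_def]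
          that[unfolded xelem_def, symmetric]] xelem_in(2)[OF E(1) f(1,3)] xelem_in(2)[OF E(3) f1(1,3)] f(4) f1(4)
      by simp
    ultimately show ?thesis using A B by blast
  qed
  show ?thesis
    unfolding Ord_gpd_of dc fold fwd bwd nle using True equiv by (auto simp: f_def f1_def)
next
  case False
  then show ?thesis unfolding Ord_gpd_of by blast
qed

section \<open>Evaluation of chains\<close>

text \<open>
  Along a step of a path the components \<open>\<gamma>(e')(c)\<close> and \<open>\<gamma>(e)(c')\<close> are mutually inverse: they are
  identities if \<open>c = c'\<close>, and otherwise \<open>\<gamma>(e)\<close> and \<open>\<gamma>(e')\<close> represent the same functor.
\<close>

lemma path_step_inverses:
  assumes e: "e \<in> Eset X" "e' \<in> Eset X" and rel: "Rrel (biord_of X) e e' \<or> Lrel (biord_of X) e e'"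
  shows "inverses C (\<gamma> e' (fst e)) (\<gamma> e (fst e'))"
proof -
  note at = gam_at[OF e(2) gam(6)[OF e(1)]] and at' = gam_at[OF e(1) gam(6)[OF e(2)]]
  from rel show ?thesis
  proof
    assume "Lrel (biord_of X) e e'"
    then have "subobj C (fst e) (fst e')" "subobj C (fst e') (fst e)"
      using subobj_C_iff(1)[OF e] subobj_C_iff(1)[OF e(2,1)] unfolding Lrel_def biord.lel_iff by auto
    then have "fst e = fst e'" by (rule C.subobj_antisym)
    then show ?thesis
      using gam(4)[OF e(1)] gam(4)[OF e(2)] C.inverses_idm[OF gam(6)[OF e(1)]] by simp
  next
    assume "Rrel (biord_of X) e e'"
    then have sub: "subobj D (snd e') (snd e)" "subobj D (snd e) (snd e')"
      using subobj_D_iff[OF e] subobj_D_iff[OF e(2,1)] unfolding Rrel_def biord.ler_iff by auto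
    have "\<gamma> e' (fst e) \<cdot>\<^bsub>C\<^esub> \<gamma> e (fst e') = idm C (fst e)"
      using subobj_factor(3)[OF e(2,1) sub(2) gam(6)[OF e(1)]] gam(4)[OF e(1)] by simp
    moreover have "\<gamma> e (fst e') \<cdot>\<^bsub>C\<^esub> \<gamma> e' (fst e) = idm C (fst e')"
      using subobj_factor(3)[OF e sub(1) gam(6)[OF e(2)]] gam(4)[OF e(2)] by simp
    ultimately show ?thesis
      using at at' unfolding inverses_def by simp
  qed
qed

text \<open>
  Each vertex that is appended contributes an isomorphism of \<open>\<C>\<close> to the product of the cones \<open>\<gamma>\<close>, and the
  transpose of its inverse to the product of the cones \<open>\<delta>\<close>.  Isomorphisms are their own epimorphic
  components, so the products of cones reduce to composites of these morphisms.
\<close>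

lemma path_value:
  assumes "epath (biord_of X) p"
  shows "\<exists>x. is_iso C x \<and> Dom C x = fst (hd p) \<and> Cod C x = fst (last p) \<and>
    foldl (cone_mult C) (\<gamma> (hd p)) (map \<gamma> (tl p)) = cone_star C (\<gamma> (hd p)) x \<and>
    foldl (cone_mult D) (\<delta> (hd p)) (map \<delta> (tl p)) =
      cone_star D (\<delta> (hd p)) (transpose X (last p) (hd p) (inv_mor C x)) \<and>
    word_product xmult (map xidem p) = xelem (hd p) x \<and>
    word_product xmult (map xidem (rev p)) = xelem (last p) (inv_mor C x)"
  using assms
proof (induction p rule: rev_induct)
  case Nil
  then show ?case by (simp add: epath_def)
next
  case (snoc e' p)
  show ?case
  proof (cases "p = []")
    case True
    then have e: "e' \<in> Eset X" using snoc.prems by (simp add: epath_def biord_of_simps)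
    note i = C.iso_idm[OF gam(6)[OF e]]
    have "cone_star C (\<gamma> e') (idm C (fst e')) = \<gamma> e'"
      using C.cone_star_idm[OF gam(2)[OF e]] gam(3)[OF e] by simp
    moreover have "cone_star D (\<delta> e') (idm D (snd e')) = \<delta> e'"
      using D.cone_star_idm[OF del_cone(1)[OF e]] del_cone(2)[OF e] by simp
    ultimately show ?thesis
      using True i gam(6)[OF e] transpose_idm[OF e] xidem_xelem[OF e]
      by (intro exI[of _ "idm C (fst e')"]) simp
  next
    case False
    define a where "a = hd p"
    define e where "e = last p"
    have p: "epath (biord_of X) p" and e': "e' \<in> Eset X"
      and rel: "Rrel (biord_of X) e e' \<or> Lrel (biord_of X) e e'"
      using snoc.prems False by (auto simp: epath_def successively_append_iff biord_of_simps e_def)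
    have a: "a \<in> Eset X" and e: "e \<in> Eset X"
      using p False by (auto simp: epath_def biord_of_simps a_def e_def)
    obtain x where x: "is_iso C x" "Dom C x = fst a" "Cod C x = fst e"
      and gp: "foldl (cone_mult C) (\<gamma> a) (map \<gamma> (tl p)) = cone_star C (\<gamma> a) x"
      and dp: "foldl (cone_mult D) (\<delta> a) (map \<delta> (tl p)) = cone_star D (\<delta> a) (transpose X e a (inv_mor C x))"
      and w: "word_product xmult (map xidem p) = xelem a x"
        "word_product xmult (map xidem (rev p)) = xelem e (inv_mor C x)"
      using snoc.IH[OF p] unfolding a_def e_def by blast
    note ix = C.iso_inv_simps[OF x(1), unfolded x(2,3)] and vx = C.iso_inv_mor[OF x(1)]
    define h where "h = \<gamma> e' (fst e)"
    define k where "k = \<gamma> e (fst e')"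
    have hk: "inverses C h k" using path_step_inverses[OF e e' rel] by (simp add: h_def k_def)
    have h: "is_iso C h" "inv_mor C h = k" "h \<in> Mor C" "Dom C h = fst e" "Cod C h = fst e'"
      and k: "is_iso C k" "k \<in> Mor C" "Dom C k = fst e'" "Cod C k = fst e"
      using hk C.inverses_inv_mor[OF hk] C.inverses_sym[OF hk] gam_at[OF e' gam(6)[OF e]]
        gam_at[OF e gam(6)[OF e']] unfolding is_iso_def by (auto simp: h_def k_def)
    have xh: "is_iso C (x \<cdot>\<^bsub>C\<^esub> h)" "inv_mor C (x \<cdot>\<^bsub>C\<^esub> h) = k \<cdot>\<^bsub>C\<^esub> inv_mor C x"
      "Dom C (x \<cdot>\<^bsub>C\<^esub> h) = fst a" "Cod C (x \<cdot>\<^bsub>C\<^esub> h) = fst e'"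
      using C.iso_Comp[OF x(1) h(1)] x h ix(1) by simp_all
    have g': "cone_mult C (cone_star C (\<gamma> a) x) (\<gamma> e') = cone_star C (\<gamma> a) (x \<cdot>\<^bsub>C\<^esub> h)"
      using C.cone_star_star[OF gam(2)[OF a] ix(1) _ h(3)] gam(3)[OF a] x h(4)
        xelem_in(2)[OF a x(1,2)] C.epi_split_epi(1)[OF C.iso_split_epi[OF h(1)]]
      by (simp add: C.cone_mult_eq h_def)
    have d': "cone_mult D (cone_star D (\<delta> a) (transpose X e a (inv_mor C x))) (\<delta> e') =
        cone_star D (\<delta> a) (transpose X e' a (k \<cdot>\<^bsub>C\<^esub> inv_mor C x))"
    proof -
      note ty = transpose(1-3)[OF e a ix(2-4)] and tk = transpose(1-3)[OF e' e k(2-4)]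
      have isoy: "is_iso D (transpose X e a (inv_mor C x))"
        using transpose_iso[OF e a vx[THEN conjunct1] ix(3,4)] unfolding is_iso_def by blast
      have isok: "is_iso D (transpose X e' e k)"
        using transpose_iso[OF e' e k(1,3,4)] unfolding is_iso_def by blast
      have ap: "apex D (cone_star D (\<delta> a) (transpose X e a (inv_mor C x))) = snd e"
        using D.below_cone_iso(2)[OF del_cone(1)[OF a] isoy] ty del_cone(2)[OF a] by simp
      have "\<delta> e' (snd e) = transpose X e' e k"
        using del_cone_eq[OF e' e] by (simp add: k_def)
      then show ?thesis
        using D.cone_star_star[OF del_cone(1)[OF a] ty(1) _ tk(1)] ty tk del_cone(2)[OF a] ap
          D.epi_split_epi(1)[OF D.iso_split_epi[OF isok]] transpose_Comp[OF e' e a k(2-4) ix(2-4)]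
        by (simp add: D.cone_mult_eq)
    qed
    have w1: "xelem a x \<odot> xidem e' = xelem a (x \<cdot>\<^bsub>C\<^esub> h)"
    proof -
      have m: "\<gamma> e' (Cod C x) \<cdot>\<^bsub>C\<^esub> idm C (fst e') = h"
        using x(3) h by (simp add: C.idm_right' h_def)
      show ?thesis
        using xelem_mult[OF a e' x(1,2), of "idm C (fst e')"] C.iso_idm[OF gam(6)[OF e']] gam(6)[OF e']
          h(1) xidem_xelem[OF e'] unfolding m by simp
    qed
    have w2: "xidem e' \<odot> xelem e (inv_mor C x) = xelem e' (k \<cdot>\<^bsub>C\<^esub> inv_mor C x)"
    proof -
      have i: "is_iso C (k \<cdot>\<^bsub>C\<^esub> inv_mor C x)"
        using C.iso_Comp(1)[OF k(1), of "inv_mor C x"] vx k(4) ix(3) by simp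
      have m: "\<gamma> e (Cod C (idm C (fst e'))) \<cdot>\<^bsub>C\<^esub> inv_mor C x = k \<cdot>\<^bsub>C\<^esub> inv_mor C x"
        using gam(6)[OF e'] by (simp add: k_def)
      have "idm C (fst e') \<cdot>\<^bsub>C\<^esub> (k \<cdot>\<^bsub>C\<^esub> inv_mor C x) = k \<cdot>\<^bsub>C\<^esub> inv_mor C x"
        using k ix by (simp add: C.idm_left')
      then show ?thesis
        using xelem_mult[OF e' e, of "idm C (fst e')" "inv_mor C x"] C.iso_idm[OF gam(6)[OF e']] gam(6)[OF e']
          i vx ix(3) xidem_xelem[OF e'] unfolding m by simp
    qed
    have hd: "hd (p @ [e']) = a" "tl (p @ [e']) = tl p @ [e']"
      using False by (simp_all add: a_def)
    have "word_product xmult (map xidem (p @ [e'])) = xelem a (x \<cdot>\<^bsub>C\<^esub> h)"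
      using sgp.word_product_append[of "map xidem p" "[xidem e']"] False w(1) w1 by simp
    moreover have "word_product xmult (map xidem (rev (p @ [e']))) = xelem e' (k \<cdot>\<^bsub>C\<^esub> inv_mor C x)"
      using sgp.word_product_append[of "[xidem e']" "map xidem (rev p)"] False w(2) w2 by simp
    ultimately show ?thesis
      unfolding hd using xh gp dp g' d' by (intro exI[of _ "x \<cdot>\<^bsub>C\<^esub> h"]) simp
  qed
qed

lemma ev_path_value:
  assumes "epath (biord_of X) p"
  shows "ev_path X p \<in> gpd_mor X" and "Dom (gpd_of X) (ev_path X p) = hd p"
    and "Cod (gpd_of X) (ev_path X p) = last p"
    and "gpd_fwd (ev_path X p) = word_product xmult (map xidem p)"
    and "gpd_bwd (ev_path X p) = word_product xmult (map xidem (rev p))"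
proof -
  obtain x where x: "is_iso C x" "Dom C x = fst (hd p)" "Cod C x = fst (last p)"
    "foldl (cone_mult C) (\<gamma> (hd p)) (map \<gamma> (tl p)) = cone_star C (\<gamma> (hd p)) x"
    "foldl (cone_mult D) (\<delta> (hd p)) (map \<delta> (tl p)) =
      cone_star D (\<delta> (hd p)) (transpose X (last p) (hd p) (inv_mor C x))"
    "word_product xmult (map xidem p) = xelem (hd p) x"
    "word_product xmult (map xidem (rev p)) = xelem (last p) (inv_mor C x)"
    using path_value[OF assms] by blast
  have ne: "p \<noteq> []" and e: "hd p \<in> Eset X" "last p \<in> Eset X"
    using assms by (auto simp: epath_def biord_of_simps)
  note ix = C.iso_inv_simps[OF x(1), unfolded x(2,3)]
  have prod: "cone_prod B (map F p) = foldl (cone_mult B) (F (hd p)) (map F (tl p))" for B F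
    using ne by (cases p) auto
  have "cone_prod C (map \<gamma> p) (fst (hd p)) = x"
    using x(4) gam(4,6)[OF e(1)] ix(1) x(2) by (simp add: prod C.cone_star_at C.idm_left')
  moreover have "cone_prod D (map \<delta> p) (snd (hd p)) = transpose X (last p) (hd p) (inv_mor C x)"
    using x(5) del_cone(3)[OF e(1)] gam(7)[OF e(1)] transpose(1,2)[OF e(2,1) ix(2-4)] transpose(3)[OF e(2,1) ix(2-4)]
    by (simp add: prod D.cone_star_at D.idm_left')
  ultimately have ev: "ev_path X p = (x, transpose X (last p) (hd p) (inv_mor C x))"
    by (simp add: ev_path_def)
  note g = gpd_morI[OF e x(1-3), folded ev]
  show "ev_path X p \<in> gpd_mor X" "Dom (gpd_of X) (ev_path X p) = hd p"
    "Cod (gpd_of X) (ev_path X p) = last p" "gpd_fwd (ev_path X p) = word_product xmult (map xidem p)"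
    "gpd_bwd (ev_path X p) = word_product xmult (map xidem (rev p))"
    using g x unfolding gpd_fwd_def gpd_bwd_def g by (simp_all add: ev)
qed

sublocale rep: inductive_representation xsgp xmult "biord_of X" xidem "gpd_of X" gpd_fwd gpd_bwd
  "ev_of X" "ev_path X"
proof
  show "Obj (gpd_of X) = elems (biord_of X)" by (simp add: gpd_of_simps biord_of_simps)
  show "fobj (ev_of X) = (\<lambda>e\<in>elems (biord_of X). e)" by (simp add: ev_of_def biord_of_simps)
  show "fmor (ev_of X) = (\<lambda>Y\<in>chains (biord_of X). ev_path X (SOME p. p \<in> Y))" by (simp add: ev_of_def)
  show "(x, y) \<in> Ord (gpd_of X) \<longleftrightarrow> x \<in> Mor (gpd_of X) \<and> y \<in> Mor (gpd_of X) \<and>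
      nle (biord_of X) (Dom (gpd_of X) x) (Dom (gpd_of X) y) \<and>
      gpd_fwd x = xidem (Dom (gpd_of X) x) \<odot> gpd_fwd y \<and>
      gpd_bwd x = gpd_bwd y \<odot> xidem (Dom (gpd_of X) x)" for x y
    unfolding gpd_of_simps(2) by (rule gpd_Ord)
qed (use gpd_inverse gpd_inj gpd_surj gpd_morE gpd_idm gpd_Comp ev_path_value in
    \<open>simp_all add: gpd_of_simps(2) biord_of_simps(1)\<close>)

lemma inductive_groupoid_igpd_of: "inductive_groupoid (igpd_of X)"
  using rep.inductive_groupoid by (simp add: igpd_of_def)

end

section \<open>Morphisms of cross-connections induce inductive functors\<close>

lemma is_functorD:
  assumes "is_functor A B K"
  shows "category A" "category B" "fobj K \<in> extensional (Obj A)" "fmor K \<in> extensional (Mor A)"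
    and "a \<in> Obj A \<Longrightarrow> fobj K a \<in> Obj B" and "f \<in> Mor A \<Longrightarrow> fmor K f \<in> Mor B"
    and "f \<in> Mor A \<Longrightarrow> Dom B (fmor K f) = fobj K (Dom A f)"
    and "f \<in> Mor A \<Longrightarrow> Cod B (fmor K f) = fobj K (Cod A f)"
    and "a \<in> Obj A \<Longrightarrow> fmor K (idm A a) = idm B (fobj K a)"
    and "\<lbrakk>f \<in> Mor A; g \<in> Mor A; Cod A f = Dom A g\<rbrakk> \<Longrightarrow> fmor K (f \<cdot>\<^bsub>A\<^esub> g) = fmor K f \<cdot>\<^bsub>B\<^esub> fmor K g"
  using assms unfolding is_functor_def PiE_def Pi_def by auto

lemma functor_inverses: "\<lbrakk>is_functor A B K; inverses A f g\<rbrakk> \<Longrightarrow> inverses B (fmor K f) (fmor K g)"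
  unfolding inverses_def
  by (auto simp: is_functorD category.Dom_in category.Cod_in simp flip: is_functorD(10))

lemma functor_iso:
  assumes "is_functor A B K" and "is_iso A f"
  shows "is_iso B (fmor K f)" and "inv_mor B (fmor K f) = fmor K (inv_mor A f)"
proof -
  have "inverses A f (inv_mor A f)"
    using category.iso_inverse[OF is_functorD(1)[OF assms(1)] assms(2)] .
  from functor_inverses[OF assms(1) this] show "is_iso B (fmor K f)" "inv_mor B (fmor K f) = fmor K (inv_mor A f)"
    using category.inverses_inv_mor[OF is_functorD(2)[OF assms(1)]] unfolding is_iso_def by auto
qed

lemma functor_split_epi:
  assumes K: "is_functor A B K" and p: "split_epi A p"
  shows "split_epi B (fmor K p)"
proof -
  obtain s where s: "p \<in> Mor A" "s \<in> Mor A" "Dom A s = Cod A p" "Cod A s = Dom A p"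
    "s \<cdot>\<^bsub>A\<^esub> p = idm A (Cod A p)"
    using p unfolding split_epi_def by blast
  have "Cod A p \<in> Obj A" using category.Cod_in[OF is_functorD(1)[OF K] s(1)] .
  then have "fmor K s \<cdot>\<^bsub>B\<^esub> fmor K p = idm B (Cod B (fmor K p))"
    using s is_functorD(8-10)[OF K] by metis
  then show ?thesis
    unfolding split_epi_def using s(1-4) is_functorD(6-8)[OF K]
    by (intro conjI bexI[of _ "fmor K s"]) simp_all
qed

locale normal_functor = A: normal_category A + B: normal_category B
  for A :: "('o, 'm) scat" and B :: "('p, 'n) scat" +
  fixes K :: "('o, 'm, 'p, 'n) ftor"
  assumes K_functor: "is_functor A B K" and K_incl: "inclusion_preserving A B K"
begin

lemmas K = is_functorD[OF K_functor]

lemma subobj_K: "subobj A a b \<Longrightarrow> subobj B (fobj K a) (fobj K b)"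
  and incl_K: "subobj A a b \<Longrightarrow> fmor K (incl A a b) = incl B (fobj K a) (fobj K b)"
proof -
  assume sub: "subobj A a b"
  note i = A.subobj_incl[OF sub]
  have k: "fmor K (incl A a b) \<in> Incl B" using K_incl i(1) unfolding inclusion_preserving_def by blast
  have d: "Dom B (fmor K (incl A a b)) = fobj K a" "Cod B (fmor K (incl A a b)) = fobj K b"
    using K(7,8)[OF i(2)] i by auto
  show "subobj B (fobj K a) (fobj K b)" using k d unfolding subobj_def by blast
  show "fmor K (incl A a b) = incl B (fobj K a) (fobj K b)" using B.incl_eq[OF k] d by simp
qed

text \<open>
  A functor that preserves inclusions and split epimorphisms carries the factorization of \<open>f\<close> to one of
  its image, and such factorizations are unique.
\<close>

lemma epi_K:
  assumes f: "f \<in> Mor A"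
  shows "fmor K (epi A f) = epi B (fmor K f)" and "fobj K (im A f) = im B (fmor K f)"
proof -
  note e = A.epi_props[OF f] and i = A.subobj_incl[OF A.epi_props(5)[OF f]]
  have j: "fmor K (incl A (im A f) (Cod A f)) \<in> Incl B"
    using K_incl i(1) unfolding inclusion_preserving_def by blast
  have eq: "fmor K f = fmor K (epi A f) \<cdot>\<^bsub>B\<^esub> fmor K (incl A (im A f) (Cod A f))"
    using K(10)[OF e(2) i(2)] e(4,7) i(3) by simp
  have c: "Cod B (fmor K (epi A f)) = Dom B (fmor K (incl A (im A f) (Cod A f)))"
    "Dom B (fmor K (incl A (im A f) (Cod A f))) = fobj K (im A f)"
    using K(8)[OF e(2)] K(7)[OF i(2)] e(4) i(3) by auto
  show "fmor K (epi A f) = epi B (fmor K f)" "fobj K (im A f) = im B (fmor K f)"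
    using B.epi_im_eqI[OF functor_split_epi[OF K_functor e(1)] c(1) j eq] c(2) by auto
qed

end

context cross_conn
begin

text \<open>
  This formula does not distinguish the cases of the definition of the basic product.  So it is preserved
  by a morphism even when the image of a pair falls under an earlier case than the pair itself.
\<close>

lemma bprod_components:
  assumes "(e, f) \<in> bdom (biord_of X)"
  shows "e \<star>\<^bsub>biord_of X\<^esub> f = (im C (\<gamma> f (fst e)), im D (\<delta> e (snd f)))"
proof -
  have e: "e \<in> Eset X" "f \<in> Eset X" using assms by (simp_all add: biord_of_simps)
  note b = bprod_biord_of[OF assms] and p = xidem_mult[OF e]
  have "\<gamma> (e \<star>\<^bsub>biord_of X\<^esub> f) = eta_inv C (\<gamma> e) (\<gamma> f (fst e))" "snd (e \<star>\<^bsub>biord_of X\<^esub> f) = im D (\<delta> e (snd f))"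
    using b p(1) by (simp_all add: xidem_def)
  then show ?thesis
    using p(2) gam(3)[OF b[THEN conjunct1]] by (simp add: prod_eq_iff)
qed

text \<open>
  The equation \<open>e h f = e f\<close> between idempotents of the semigroup, evaluated at the apex of \<open>\<gamma>(e)\<close>, involves
  components of the cones \<open>\<gamma>\<close> only; the second components of both sides are lifts to the same object.
\<close>

lemma sandwich_components:
  assumes e: "e \<in> Eset X" "f \<in> Eset X"
  shows "h \<in> sandwich (biord_of X) e f \<longleftrightarrow> h \<in> Eset X \<and> subobj C (fst h) (fst e) \<and>
    subobj D (snd h) (snd f) \<and> \<gamma> h (fst e) \<cdot>\<^bsub>C\<^esub> \<gamma> f (fst h) = \<gamma> f (fst e)"
proof (cases "h \<in> Eset X")
  case True
  note at = gam_at[OF True gam(6)[OF e(1)]] gam_at[OF e(2) gam(6)[OF True]] gam_at[OF e(2) gam(6)[OF e(1)]]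
  let ?m = "\<gamma> h (fst e) \<cdot>\<^bsub>C\<^esub> \<gamma> f (fst h)"
  have m: "?m \<in> Mor C" "Dom C ?m = fst e" "Cod C ?m = fst f" using at by simp_all
  note hf = xidem_mult[OF True e(2)] and ef = xidem_mult[OF e]
  let ?\<tau> = "eta_inv C (\<gamma> h) (\<gamma> f (fst h))"
  note ep = C.epi_props[OF at(4)]
  have \<tau>: "?\<tau> (fst e) = \<gamma> h (fst e) \<cdot>\<^bsub>C\<^esub> epi C (\<gamma> f (fst h))"
    using gam(6)[OF e(1)] by (simp add: eta_inv_def C.cone_star_at)
  have "?m = (\<gamma> h (fst e) \<cdot>\<^bsub>C\<^esub> epi C (\<gamma> f (fst h))) \<cdot>\<^bsub>C\<^esub> incl C (im C (\<gamma> f (fst h))) (Cod C (\<gamma> f (fst h)))"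
    using C.Comp_assoc[OF at(1) ep(2) C.subobj_incl(2)[OF ep(5)]] ep(3,4,7) at C.subobj_incl(3)[OF ep(5)] by simp
  then have "epi C ?m = epi C (?\<tau> (fst e))"
    unfolding \<tau> using C.epi_Comp_incl(1)[OF _ C.subobj_incl(1)[OF ep(5)]] at ep C.subobj_incl(3)[OF ep(5)]
    by simp
  then have c: "cone_mult C (\<gamma> e) ?\<tau> = eta_inv C (\<gamma> e) ?m"
    using gam(3)[OF e(1)] by (simp add: C.cone_mult_eq eta_inv_def)
  note ehf = xmult_Some[OF gam(1)[OF e(1)] hf(3), unfolded c]
  have eq1: "xidem e \<odot> xidem h \<odot> xidem f =
      Some (eta_inv C (\<gamma> e) ?m, lift (snd e) (eta_inv C (\<gamma> e) ?m))"
    unfolding xmult_assoc hf(1) using ehf(1) by (simp only: xidem_def)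
  have "xidem e \<odot> xidem h \<odot> xidem f = xidem e \<odot> xidem f \<longleftrightarrow> ?m = \<gamma> f (fst e)"
  proof
    assume "xidem e \<odot> xidem h \<odot> xidem f = xidem e \<odot> xidem f"
    then have "eta_inv C (\<gamma> e) ?m = eta_inv C (\<gamma> e) (\<gamma> f (fst e))"
      unfolding eq1 ef(1) by simp
    then show "?m = \<gamma> f (fst e)"
      using C.eta_inv_inj[OF gam(2)[OF e(1)], of ?m "fst f" "\<gamma> f (fst e)"] m at gam(3)[OF e(1)]
      by (simp add: Hom_def)
  next
    assume m: "?m = \<gamma> f (fst e)"
    show "xidem e \<odot> xidem h \<odot> xidem f = xidem e \<odot> xidem f"
      unfolding eq1 ef(1) m using lift_eqI[OF ef(4,3)] by simp
  qed
  then show ?thesis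
    using True e biord.sandwich_iff[of e f h] subobj_C_iff(1)[OF True e(1)] subobj_D_iff[OF e(2) True]
    by (simp add: biord_of_simps)
next
  case False
  then show ?thesis by (simp add: sandwich_def biord_of_simps)
qed

lemma ev_path_single:
  assumes "e \<in> Eset X"
  shows "fst (ev_path X [e]) = idm C (fst e)"
  using gam(4)[OF assms] by (simp add: ev_path_def)

lemma ev_path_pair:
  assumes "epath (biord_of X) [e, e']"
  shows "fst (ev_path X [e, e']) = \<gamma> e' (fst e)"
proof -
  have e: "e \<in> Eset X" "e' \<in> Eset X" and rel: "Rrel (biord_of X) e e' \<or> Lrel (biord_of X) e e'"
    using assms by (auto simp: epath_def biord_of_simps)
  note at = gam_at[OF e(2) gam(6)[OF e(1)]]
  have "is_iso C (\<gamma> e' (fst e))"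
    using path_step_inverses[OF e rel] unfolding is_iso_def by blast
  then have "epi C (\<gamma> e' (fst e)) = \<gamma> e' (fst e)"
    using C.epi_split_epi(1) C.iso_split_epi by blast
  then show ?thesis
    using gam(3,4,6)[OF e(1)] at by (simp add: ev_path_def C.cone_mult_eq C.cone_star_at C.idm_left')
qed

end

locale xconn_mor = S: cross_conn X + T: cross_conn X'
  for X :: "('co, 'cm, 'do, 'dm) xconn" and X' :: "('co', 'cm', 'do', 'dm') xconn" +
  fixes F :: "('co, 'cm, 'co', 'cm') ftor" and G :: "('do, 'dm, 'do', 'dm') ftor"
  assumes morphism: "xconn_morphism X X' F G"
begin

sublocale F: normal_functor "Ccat X" "Ccat X'" F
  using morphism unfolding xconn_morphism_def by unfold_locales auto

sublocale G: normal_functor "Dcat X" "Dcat X'" G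
  using morphism unfolding xconn_morphism_def by unfold_locales auto

abbreviation (input) "C \<equiv> Ccat X"
abbreviation (input) "D \<equiv> Dcat X"
abbreviation (input) "C' \<equiv> Ccat X'"
abbreviation (input) "D' \<equiv> Dcat X'"

abbreviation "\<theta> e \<equiv> (fobj F (fst e), fobj G (snd e))"

abbreviation "R \<equiv> restrict_mor X (F, G)"

lemma theta_Eset: "e \<in> Eset X \<Longrightarrow> \<theta> e \<in> Eset X'"
  using morphism unfolding xconn_morphism_def by (cases e) auto

lemma gam_theta:
  "\<lbrakk>e \<in> Eset X; c \<in> Obj C\<rbrakk> \<Longrightarrow> fmor F (gam_cone X e c) = gam_cone X' (\<theta> e) (fobj F c)"
  using morphism unfolding xconn_morphism_def by (cases e) auto

lemma transpose_theta:
  assumes "e \<in> Eset X" "e' \<in> Eset X" "f \<in> Mor C" "Dom C f = fst e" "Cod C f = fst e'"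
  shows "fmor G (transpose X e e' f) = transpose X' (\<theta> e) (\<theta> e') (fmor F f)"
proof -
  have "\<forall>f\<in>Hom C (fst e) (fst e'). fmor G (transpose X (fst e, snd e) (fst e', snd e') f) =
      transpose X' (\<theta> e) (\<theta> e') (fmor F f)"
    using morphism assms(1,2) unfolding xconn_morphism_def by fastforce
  then show ?thesis using assms by (simp add: Hom_def)
qed

lemma restrict_mor_simps:
  "e \<in> Eset X \<Longrightarrow> fobj R e = \<theta> e"
  "x \<in> gpd_mor X \<Longrightarrow> fmor R x = (fmor F (fst x), fmor G (snd x))"
  by (cases e; cases x; simp add: restrict_mor_def)+

lemma R_gpd_mor:
  assumes x: "x \<in> gpd_mor X"
  shows "fmor R x \<in> gpd_mor X'" and "Dom (gpd_of X') (fmor R x) = \<theta> (Dom (gpd_of X) x)"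
    and "Cod (gpd_of X') (fmor R x) = \<theta> (Cod (gpd_of X) x)"
proof -
  note g = S.gpd_morE[OF x] and i = S.C.iso_inv_simps[OF S.gpd_morE(3)[OF x], unfolded S.gpd_morE(4,5)[OF x]]
  note k = functor_iso[OF F.K_functor g(3)]
  have "fmor R x = (fmor F (fst x), transpose X' (\<theta> (Cod (gpd_of X) x)) (\<theta> (Dom (gpd_of X) x))
      (inv_mor C' (fmor F (fst x))))"
    using restrict_mor_simps(2)[OF x] transpose_theta[OF g(2,1) i(2-4)] g(6) k(2) by simp
  note eq = this
  have d: "Dom C' (fmor F (fst x)) = fst (\<theta> (Dom (gpd_of X) x))"
    "Cod C' (fmor F (fst x)) = fst (\<theta> (Cod (gpd_of X) x))"
    using F.K(7,8)[OF i(1)] g(4,5) by simp_all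
  show "fmor R x \<in> gpd_mor X'" "Dom (gpd_of X') (fmor R x) = \<theta> (Dom (gpd_of X) x)"
    "Cod (gpd_of X') (fmor R x) = \<theta> (Cod (gpd_of X) x)"
    using T.gpd_morI[OF theta_Eset[OF g(1)] theta_Eset[OF g(2)] k(1) d] unfolding eq by auto
qed

lemma gpd_mor_in: "x \<in> gpd_mor X \<Longrightarrow> fst x \<in> Mor C \<and> snd x \<in> Mor D"
  using S.gpd_morE[of x] S.transpose(1) S.C.iso_inv_simps by metis

lemma R_functor: "is_functor (gpd_of X) (gpd_of X') R"
  unfolding is_functor_def
proof (intro conjI ballI impI)
  show "category (gpd_of X)" "category (gpd_of X')"
    by (rule S.rep.category_G T.rep.category_G)+
  show "fobj R \<in> Obj (gpd_of X) \<rightarrow>\<^sub>E Obj (gpd_of X')"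
    using theta_Eset restrict_mor_simps(1) by (auto simp: gpd_of_simps restrict_mor_def)
  show "fmor R \<in> Mor (gpd_of X) \<rightarrow>\<^sub>E Mor (gpd_of X')"
  proof (rule PiE_I)
    show "fmor R x \<in> Mor (gpd_of X')" if "x \<in> Mor (gpd_of X)" for x
      using R_gpd_mor(1) that by (simp add: gpd_of_simps(2))
    show "fmor R x = undefined" if "x \<notin> Mor (gpd_of X)" for x
      using that by (simp add: gpd_of_simps(2) restrict_mor_def)
  qed
next
  fix x assume "x \<in> Mor (gpd_of X)"
  then have x: "x \<in> gpd_mor X" by (simp add: gpd_of_simps)
  show "Dom (gpd_of X') (fmor R x) = fobj R (Dom (gpd_of X) x)"
    "Cod (gpd_of X') (fmor R x) = fobj R (Cod (gpd_of X) x)"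
    using R_gpd_mor[OF x] restrict_mor_simps(1)[OF S.gpd_morE(1)[OF x]]
      restrict_mor_simps(1)[OF S.gpd_morE(2)[OF x]] by auto
  fix y assume y': "y \<in> Mor (gpd_of X)" and xy: "Cod (gpd_of X) x = Dom (gpd_of X) y"
  then have y: "y \<in> gpd_mor X" by (simp add: gpd_of_simps)
  have d: "Cod C (fst x) = Dom C (fst y)" "Cod D (snd x) = Dom D (snd y)"
    using xy by (simp_all add: gpd_of_simps)
  have "fmor R (x \<cdot>\<^bsub>gpd_of X\<^esub> y) = (fmor F (fst x \<cdot>\<^bsub>C\<^esub> fst y), fmor G (snd x \<cdot>\<^bsub>D\<^esub> snd y))"
    using restrict_mor_simps(2)[OF S.gpd_Comp(1)[OF x y xy]] by (simp add: gpd_of_simps)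
  also have "\<dots> = fmor R x \<cdot>\<^bsub>gpd_of X'\<^esub> fmor R y"
    using F.K(10)[OF _ _ d(1)] G.K(10)[OF _ _ d(2)] gpd_mor_in[OF x] gpd_mor_in[OF y]
      restrict_mor_simps(2)[OF x] restrict_mor_simps(2)[OF y] by (simp add: gpd_of_simps)
  finally show "fmor R (x \<cdot>\<^bsub>gpd_of X\<^esub> y) = fmor R x \<cdot>\<^bsub>gpd_of X'\<^esub> fmor R y" .
next
  fix e assume "e \<in> Obj (gpd_of X)"
  then have e: "e \<in> Eset X" by (simp add: gpd_of_simps)
  show "fmor R (idm (gpd_of X) e) = idm (gpd_of X') (fobj R e)"
    using restrict_mor_simps(2)[OF S.gpd_idm(1)[OF e]] restrict_mor_simps(1)[OF e]
      F.K(9)[OF S.gam(6)[OF e]] G.K(9)[OF S.gam(7)[OF e]] by (simp add: gpd_of_simps)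
qed

lemma R_order_preserving: "order_preserving (gpd_of X) (gpd_of X') R"
  unfolding order_preserving_def
proof (intro ballI, clarify)
  fix f g f1 g1 assume ord: "((f, g), (f1, g1)) \<in> Ord (gpd_of X)"
  then have x: "(f, g) \<in> gpd_mor X" and y: "(f1, g1) \<in> gpd_mor X" by (simp_all add: Ord_gpd_of)
  have m: "f \<in> Mor C" "g \<in> Mor D" "f1 \<in> Mor C" "g1 \<in> Mor D"
    using gpd_mor_in[OF x] gpd_mor_in[OF y] by auto
  have sub: "subobj C (Dom C f) (Dom C f1)" "subobj D (Dom D g) (Dom D g1)"
    "subobj C (Cod C f) (Cod C f1)" "subobj D (Cod D g) (Cod D g1)"
    and eq: "f = epi C (incl C (Dom C f) (Dom C f1) \<cdot>\<^bsub>C\<^esub> f1)"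
      "g = epi D (incl D (Dom D g) (Dom D g1) \<cdot>\<^bsub>D\<^esub> g1)"
    using ord by (simp_all add: Ord_gpd_of)
  note i = S.C.subobj_incl[OF sub(1)] and j = S.D.subobj_incl[OF sub(2)]
  have "fmor F f = epi C' (fmor F (incl C (Dom C f) (Dom C f1) \<cdot>\<^bsub>C\<^esub> f1))"
    using F.epi_K(1)[of "incl C (Dom C f) (Dom C f1) \<cdot>\<^bsub>C\<^esub> f1"] eq(1) i m by simp
  then have ef: "fmor F f = epi C' (incl C' (fobj F (Dom C f)) (fobj F (Dom C f1))
      \<cdot>\<^bsub>C'\<^esub> fmor F f1)"
    using F.K(10)[OF i(2) m(3) i(4)] F.incl_K[OF sub(1)] by simp
  have "fmor G g = epi D' (fmor G (incl D (Dom D g) (Dom D g1) \<cdot>\<^bsub>D\<^esub> g1))"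
    using G.epi_K(1)[of "incl D (Dom D g) (Dom D g1) \<cdot>\<^bsub>D\<^esub> g1"] eq(2) j m by simp
  then have eg: "fmor G g = epi D' (incl D' (fobj G (Dom D g)) (fobj G (Dom D g1))
      \<cdot>\<^bsub>D'\<^esub> fmor G g1)"
    using G.K(10)[OF j(2) m(4) j(4)] G.incl_K[OF sub(2)] by simp
  show "(fmor R (f, g), fmor R (f1, g1)) \<in> Ord (gpd_of X')"
    unfolding Ord_gpd_of
    unfolding restrict_mor_simps(2)[OF x] restrict_mor_simps(2)[OF y] fst_conv snd_conv
      F.K(7,8)[OF m(1)] F.K(7,8)[OF m(3)] G.K(7,8)[OF m(2)] G.K(7,8)[OF m(4)]
    using R_gpd_mor(1)[OF x, unfolded restrict_mor_simps(2)[OF x] fst_conv snd_conv]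
      R_gpd_mor(1)[OF y, unfolded restrict_mor_simps(2)[OF y] fst_conv snd_conv]
      ef eg F.subobj_K[OF sub(1)] F.subobj_K[OF sub(3)] G.subobj_K[OF sub(2)] G.subobj_K[OF sub(4)]
    by blast
qed

lemma del_theta:
  assumes e: "e \<in> Eset X" "f \<in> Eset X"
  shows "fmor G (del_cone X e (snd f)) = del_cone X' (\<theta> e) (snd (\<theta> f))"
  using S.del_cone_eq[OF e] T.del_cone_eq[OF theta_Eset[OF e(1)] theta_Eset[OF e(2)]]
    transpose_theta[OF e S.gam_at[OF e(2) S.gam(6)[OF e(1)]]] gam_theta[OF e(2) S.gam(6)[OF e(1)]]
  by simp

lemma R_regular_bimorphism: "regular_bimorphism (biord_of X) (biord_of X') (fobj R)"
  unfolding regular_bimorphism_def bimorphism_def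
proof (intro conjI ballI subsetI)
  fix h assume "h \<in> fobj R ` elems (biord_of X)"
  then show "h \<in> elems (biord_of X')"
    using theta_Eset restrict_mor_simps(1) by (auto simp: biord_of_simps)
next
  have "(\<theta> e, \<theta> f) \<in> bdom (biord_of X') \<and> \<theta> (e \<star>\<^bsub>biord_of X\<^esub> f) = \<theta> e \<star>\<^bsub>biord_of X'\<^esub> \<theta> f"
    if ef: "(e, f) \<in> bdom (biord_of X)" for e f
  proof
    have e: "e \<in> Eset X" "f \<in> Eset X" using ef by (simp_all add: biord_of_simps)
    show b: "(\<theta> e, \<theta> f) \<in> bdom (biord_of X')"
      using ef theta_Eset[OF e(1)] theta_Eset[OF e(2)] F.subobj_K G.subobj_K by (auto simp: biord_of_simps)
    show "\<theta> (e \<star>\<^bsub>biord_of X\<^esub> f) = \<theta> e \<star>\<^bsub>biord_of X'\<^esub> \<theta> f"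
      using S.bprod_components[OF ef] T.bprod_components[OF b] F.epi_K(2)[OF S.gam_at(1)[OF e(2) S.gam(6)[OF e(1)]]]
        G.epi_K(2)[OF S.del_cone_at(1)[OF e(1) S.gam(7)[OF e(2)]]] del_theta[OF e]
        gam_theta[OF e(2) S.gam(6)[OF e(1)]] by simp
  qed
  then show "case ef of (e, f) \<Rightarrow> (fobj R e, fobj R f) \<in> bdom (biord_of X') \<and>
      fobj R (e \<star>\<^bsub>biord_of X\<^esub> f) = fobj R e \<star>\<^bsub>biord_of X'\<^esub> fobj R f"
    if "ef \<in> bdom (biord_of X)" for ef
    using that restrict_mor_simps(1) S.bprod_biord_of S.biord.bdom_iff
    by (cases ef) (auto simp: biord_of_simps(1))
next
  fix e f h' assume "e \<in> elems (biord_of X)" "f \<in> elems (biord_of X)"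
    and h': "h' \<in> fobj R ` sandwich (biord_of X) e f"
  then have e: "e \<in> Eset X" "f \<in> Eset X" by (simp_all add: biord_of_simps)
  obtain h where "h \<in> sandwich (biord_of X) e f" and h'_eq: "h' = fobj R h" using h' by blast
  then have h: "h \<in> Eset X" "subobj C (fst h) (fst e)" "subobj D (snd h) (snd f)"
    "gam_cone X h (fst e) \<cdot>\<^bsub>C\<^esub> gam_cone X f (fst h) = gam_cone X f (fst e)"
    using S.sandwich_components[OF e] by auto
  note at = S.gam_at[OF h(1) S.gam(6)[OF e(1)]] S.gam_at[OF e(2) S.gam(6)[OF h(1)]]
  have "gam_cone X' (\<theta> h) (fst (\<theta> e)) \<cdot>\<^bsub>C'\<^esub> gam_cone X' (\<theta> f) (fst (\<theta> h)) = gam_cone X' (\<theta> f) (fst (\<theta> e))"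
    using F.K(10)[OF at(1,4)] at h(4) gam_theta[OF h(1) S.gam(6)[OF e(1)]] gam_theta[OF e(2) S.gam(6)[OF h(1)]]
      gam_theta[OF e(2) S.gam(6)[OF e(1)]] by simp
  then show "h' \<in> sandwich (biord_of X') (fobj R e) (fobj R f)"
    unfolding h'_eq restrict_mor_simps(1)[OF e(1)] restrict_mor_simps(1)[OF e(2)] restrict_mor_simps(1)[OF h(1)]
    using T.sandwich_components[OF theta_Eset[OF e(1)] theta_Eset[OF e(2)]] theta_Eset[OF h(1)]
      F.subobj_K[OF h(2)] G.subobj_K[OF h(3)] by simp
qed

lemma R_ev_path:
  assumes "epath (biord_of X) p"
  shows "fmor R (ev_path X p) = ev_path X' (map (fobj R) p)"
  using assms
proof (induction p rule: rev_induct)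
  case Nil
  then show ?case by (simp add: epath_def)
next
  case (snoc e' p)
  have b: "bimorphism (biord_of X) (biord_of X') (fobj R)"
    using R_regular_bimorphism unfolding regular_bimorphism_def by blast
  \<comment> \<open>A morphism of the groupoid is determined by its ends and its first component.\<close>
  have eqI: "fmor R (ev_path X q) = ev_path X' (map (fobj R) q)"
    if q: "epath (biord_of X) q" and f: "fmor F (fst (ev_path X q)) = fst (ev_path X' (map (fobj R) q))" for q
  proof -
    note v = S.ev_path_value[OF q] and v' = T.ev_path_value[OF bimorphism_epath[OF b q]]
    have ends: "hd q \<in> Eset X" "last q \<in> Eset X" "q \<noteq> []"
      using q by (auto simp: epath_def biord_of_simps)
    show ?thesis
      using R_gpd_mor[OF v(1)] v v' ends restrict_mor_simps f
      by (intro T.gpd_mor_eqI) (simp_all add: hd_map last_map)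
  qed
  have e': "e' \<in> Eset X" using snoc.prems by (simp add: epath_def biord_of_simps)
  show ?case
  proof (cases "p = []")
    case True
    then show ?thesis
      using eqI[OF snoc.prems] S.ev_path_single[OF e'] T.ev_path_single[OF theta_Eset[OF e']]
        F.K(9)[OF S.gam(6)[OF e']] restrict_mor_simps(1)[OF e'] by simp
  next
    case False
    define e where "e = last p"
    have p: "epath (biord_of X) p" and ee': "epath (biord_of X) [e, e']" and e: "e \<in> Eset X"
      using snoc.prems False by (auto simp: epath_def successively_append_iff biord_of_simps e_def)
    note bp = bimorphism_epath[OF b p] and be = bimorphism_epath[OF b ee']
    have pair: "fmor R (ev_path X [e, e']) = ev_path X' (map (fobj R) [e, e'])"
      using eqI[OF ee'] S.ev_path_pair[OF ee'] T.ev_path_pair[of "\<theta> e" "\<theta> e'"] be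
        gam_theta[OF e' S.gam(6)[OF e]] restrict_mor_simps(1)[OF e] restrict_mor_simps(1)[OF e'] by simp
    have "ev_path X (p @ [e']) = ev_path X p \<cdot>\<^bsub>gpd_of X\<^esub> ev_path X [e, e']"
      using S.rep.path_append[OF p ee'] by (simp add: e_def)
    moreover have "ev_path X' (map (fobj R) (p @ [e'])) =
        ev_path X' (map (fobj R) p) \<cdot>\<^bsub>gpd_of X'\<^esub> ev_path X' (map (fobj R) [e, e'])"
      using T.rep.path_append[OF bp be] False by (simp add: e_def last_map)
    moreover have "Cod (gpd_of X) (ev_path X p) = Dom (gpd_of X) (ev_path X [e, e'])"
      using S.ev_path_value(3)[OF p] S.ev_path_value(2)[OF ee'] by (simp add: e_def)
    ultimately show ?thesis
      using is_functorD(10)[OF R_functor, of "ev_path X p" "ev_path X [e, e']"] snoc.IH[OF p] pair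
        S.ev_path_value(1)[OF p] S.ev_path_value(1)[OF ee'] by (simp only: gpd_of_simps(2))
  qed
qed

lemma R_inductive_functor: "inductive_functor (igpd_of X) (igpd_of X') R"
  unfolding inductive_functor_def igpd_of_def igpd.simps
proof (intro conjI ballI)
  fix Y assume "Y \<in> chains (biord_of X)"
  then obtain p where p: "epath (biord_of X) p" "Y = chain_of (biord_of X) p"
    using S.rep.biord.chainsE by blast
  have b: "bimorphism (biord_of X) (biord_of X') (fobj R)"
    using R_regular_bimorphism unfolding regular_bimorphism_def by blast
  show "fmor R (fmor (ev_of X) Y) = fmor (ev_of X') (chain_map (biord_of X') (fobj R) Y)"
    using S.rep.ev_chain_of[OF p(1)] T.rep.ev_chain_of[OF bimorphism_epath[OF b p(1)]] R_ev_path[OF p(1)]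
      chain_map_chain_of[OF T.biord.biordered_set b] p(2) by simp
qed (rule R_functor R_order_preserving R_regular_bimorphism)+

end

section \<open>The categories of inductive groupoids and of cross-connections\<close>

lemma is_functor_id:
  assumes "category A"
  shows "is_functor A A (id_ftor A)"
proof -
  interpret category A by fact
  show ?thesis
    unfolding is_functor_def id_ftor_def using assms by auto
qed

lemma is_functor_comp:
  assumes K: "is_functor A B K" and L: "is_functor B C L"
  shows "is_functor A C (comp_ftor A K L)"
proof -
  interpret category A using is_functorD(1)[OF K] .
  show ?thesis
    unfolding is_functor_def comp_ftor_def using is_functorD[OF K] is_functorD[OF L] by auto
qed

lemma comp_ftor_simps:
  "a \<in> Obj A \<Longrightarrow> fobj (comp_ftor A K L) a = fobj L (fobj K a)"
  "f \<in> Mor A \<Longrightarrow> fmor (comp_ftor A K L) f = fmor L (fmor K f)"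
  by (simp_all add: comp_ftor_def)

lemma id_ftor_simps:
  "a \<in> Obj A \<Longrightarrow> fobj (id_ftor A) a = a" "f \<in> Mor A \<Longrightarrow> fmor (id_ftor A) f = f"
  by (simp_all add: id_ftor_def)

lemma ftor_eqI:
  assumes "is_functor A B K" "is_functor A B L"
    and "\<And>a. a \<in> Obj A \<Longrightarrow> fobj K a = fobj L a" "\<And>f. f \<in> Mor A \<Longrightarrow> fmor K f = fmor L f"
  shows "K = L"
proof -
  have "fobj K = fobj L"
    by (rule extensionalityI[OF is_functorD(3)[OF assms(1)] is_functorD(3)[OF assms(2)]]) (rule assms(3))
  moreover have "fmor K = fmor L"
    by (rule extensionalityI[OF is_functorD(4)[OF assms(1)] is_functorD(4)[OF assms(2)]]) (rule assms(4))
  ultimately show ?thesis by (cases K; cases L) simp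
qed

lemma comp_ftor_id:
  assumes K: "is_functor A B K"
  shows "comp_ftor A (id_ftor A) K = K" and "comp_ftor A K (id_ftor B) = K"
proof -
  note k = is_functorD[OF K]
  show "comp_ftor A (id_ftor A) K = K"
    by (rule ftor_eqI[OF is_functor_comp[OF is_functor_id[OF k(1)] K] K])
      (simp_all add: comp_ftor_simps id_ftor_simps)
  show "comp_ftor A K (id_ftor B) = K"
    by (rule ftor_eqI[OF is_functor_comp[OF K is_functor_id[OF k(2)]] K])
      (simp_all add: comp_ftor_simps id_ftor_simps k)
qed

lemma comp_ftor_assoc:
  assumes K: "is_functor A B K" and L: "is_functor B C L" and M: "is_functor C D M"
  shows "comp_ftor A (comp_ftor A K L) M = comp_ftor A K (comp_ftor B L M)"
  by (rule ftor_eqI[OF is_functor_comp[OF is_functor_comp[OF K L] M] is_functor_comp[OF K is_functor_comp[OF L M]]])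
    (simp_all add: comp_ftor_simps is_functorD[OF K])

lemma inductive_groupoidD:
  assumes "inductive_groupoid I"
  shows "biordered_set (ibi I)" "ordered_groupoid (igp I)" "category (igp I)" "Obj (igp I) = elems (ibi I)"
    and "is_functor (chain_gpd (ibi I)) (igp I) (iev I)"
  using assms ordered_groupoid.axioms(1)
  unfolding inductive_groupoid_def regular_biordered_set_def v_isomorphism_def by auto

lemma inductive_functorD:
  assumes "inductive_functor I I' K"
  shows "is_functor (igp I) (igp I') K" "order_preserving (igp I) (igp I') K"
    and "regular_bimorphism (ibi I) (ibi I') (fobj K)" "bimorphism (ibi I) (ibi I') (fobj K)"
    and "Y \<in> chains (ibi I) \<Longrightarrow> fmor K (fmor (iev I) Y) = fmor (iev I') (chain_map (ibi I') (fobj K) Y)"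
  using assms unfolding inductive_functor_def regular_bimorphism_def by auto

lemma inductive_functor_id:
  assumes I: "inductive_groupoid I"
  shows "inductive_functor I I (id_ftor (igp I))"
proof -
  note i = inductive_groupoidD[OF I]
  interpret B: biordered_set "ibi I" by (rule i(1))
  interpret G: ordered_groupoid "igp I" by (rule i(2))
  have id: "fobj (id_ftor (igp I)) e = e" if "e \<in> elems (ibi I)" for e
    using that i(4) by (simp add: id_ftor_def)
  have b: "bimorphism (ibi I) (ibi I) (fobj (id_ftor (igp I)))"
    unfolding bimorphism_def using id B.bdom_subset B.bprod_closed by (auto simp: subset_iff)
  show ?thesis
    unfolding inductive_functor_def regular_bimorphism_def
  proof (intro conjI ballI)
    show "is_functor (igp I) (igp I) (id_ftor (igp I))" by (rule is_functor_id[OF i(3)])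
    show "order_preserving (igp I) (igp I) (id_ftor (igp I))"
      unfolding order_preserving_def using G.Ord_subset by (auto simp: id_ftor_def)
    show "bimorphism (ibi I) (ibi I) (fobj (id_ftor (igp I)))" by (rule b)
    show "fobj (id_ftor (igp I)) ` sandwich (ibi I) e f \<subseteq>
        sandwich (ibi I) (fobj (id_ftor (igp I)) e) (fobj (id_ftor (igp I)) f)"
      if "e \<in> elems (ibi I)" "f \<in> elems (ibi I)" for e f
      using that id by (auto simp: sandwich_def)
    fix Y assume "Y \<in> chains (ibi I)"
    then obtain p where p: "epath (ibi I) p" "Y = chain_of (ibi I) p" using B.chainsE by blast
    have "map (fobj (id_ftor (igp I))) p = p"
      using p(1) id by (auto simp: epath_def intro!: map_idI)
    then have "chain_map (ibi I) (fobj (id_ftor (igp I))) Y = Y"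
      using chain_map_chain_of[OF i(1) b] p(2) by simp
    moreover have "fmor (iev I) Y \<in> Mor (igp I)"
      using is_functorD(6)[OF i(5)] \<open>Y \<in> chains (ibi I)\<close> by (simp add: B.chain_gpd_simps)
    ultimately show "fmor (id_ftor (igp I)) (fmor (iev I) Y) =
        fmor (iev I) (chain_map (ibi I) (fobj (id_ftor (igp I))) Y)"
      by (simp add: id_ftor_def)
  qed
qed

lemma inductive_functor_comp:
  assumes I: "inductive_groupoid I" "inductive_groupoid I'" "inductive_groupoid I''"
    and K: "inductive_functor I I' K" and L: "inductive_functor I' I'' L"
  shows "inductive_functor I I'' (comp_ftor (igp I) K L)"
proof -
  note i = inductive_groupoidD[OF I(1)] and i' = inductive_groupoidD[OF I(2)] and i'' = inductive_groupoidD[OF I(3)]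
  note k = inductive_functorD[OF K] and l = inductive_functorD[OF L]
  interpret B: biordered_set "ibi I" by (rule i(1))
  interpret B': biordered_set "ibi I'" by (rule i'(1))
  interpret G: ordered_groupoid "igp I" by (rule i(2))
  let ?M = "comp_ftor (igp I) K L"
  have M: "fobj ?M e = fobj L (fobj K e)" if "e \<in> elems (ibi I)" for e
    using that i(4) by (simp add: comp_ftor_def)
  have b: "bimorphism (ibi I) (ibi I'') (fobj ?M)"
    unfolding bimorphism_def
  proof (intro conjI subsetI ballI)
    fix e assume "e \<in> fobj ?M ` elems (ibi I)"
    then show "e \<in> elems (ibi I'')"
      using k(4) l(4) M unfolding bimorphism_def by (auto simp: image_subset_iff)
  next
    fix x assume x: "x \<in> bdom (ibi I)"
    obtain e f where ef: "x = (e, f)" by (cases x)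
    have "e \<in> elems (ibi I)" "f \<in> elems (ibi I)" "e \<star>\<^bsub>ibi I\<^esub> f \<in> elems (ibi I)"
      using x ef B.bdom_subset B.bprod_closed by auto
    moreover have "(fobj K e, fobj K f) \<in> bdom (ibi I')" "fobj K (e \<star>\<^bsub>ibi I\<^esub> f) = fobj K e \<star>\<^bsub>ibi I'\<^esub> fobj K f"
      using k(4) x ef unfolding bimorphism_def by auto
    moreover from this have "(fobj L (fobj K e), fobj L (fobj K f)) \<in> bdom (ibi I'')"
      "fobj L (fobj K e \<star>\<^bsub>ibi I'\<^esub> fobj K f) = fobj L (fobj K e) \<star>\<^bsub>ibi I''\<^esub> fobj L (fobj K f)"
      using l(4) unfolding bimorphism_def by auto
    ultimately show "case x of (e, f) \<Rightarrow> (fobj ?M e, fobj ?M f) \<in> bdom (ibi I'') \<and>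
        fobj ?M (e \<star>\<^bsub>ibi I\<^esub> f) = fobj ?M e \<star>\<^bsub>ibi I''\<^esub> fobj ?M f"
      using M ef by simp
  qed
  show ?thesis
    unfolding inductive_functor_def regular_bimorphism_def
  proof (intro conjI ballI)
    show "is_functor (igp I) (igp I'') ?M" by (rule is_functor_comp[OF k(1) l(1)])
    show "order_preserving (igp I) (igp I'') ?M"
      unfolding order_preserving_def
    proof (intro ballI, clarify)
      fix x y assume xy: "(x, y) \<in> Ord (igp I)"
      then have "x \<in> Mor (igp I)" "y \<in> Mor (igp I)" using G.Ord_subset by auto
      moreover have "(fmor L (fmor K x), fmor L (fmor K y)) \<in> Ord (igp I'')"
        using xy k(2) l(2) unfolding order_preserving_def by blast
      ultimately show "(fmor ?M x, fmor ?M y) \<in> Ord (igp I'')" by (simp add: comp_ftor_simps)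
    qed
    show "bimorphism (ibi I) (ibi I'') (fobj ?M)" by (rule b)
    show "fobj ?M ` sandwich (ibi I) e f \<subseteq> sandwich (ibi I'') (fobj ?M e) (fobj ?M f)"
      if ef: "e \<in> elems (ibi I)" "f \<in> elems (ibi I)" for e f
    proof
      fix h' assume "h' \<in> fobj ?M ` sandwich (ibi I) e f"
      then obtain h where h: "h \<in> sandwich (ibi I) e f" "h' = fobj ?M h" by blast
      have "h \<in> elems (ibi I)" using h(1) by (simp add: sandwich_def)
      moreover have "fobj K e \<in> elems (ibi I')" "fobj K f \<in> elems (ibi I')"
        using k(4) ef unfolding bimorphism_def by auto
      moreover have "fobj K h \<in> sandwich (ibi I') (fobj K e) (fobj K f)"
        using k(3) ef h(1) unfolding regular_bimorphism_def by blast
      ultimately have "fobj L (fobj K h) \<in> sandwich (ibi I'') (fobj L (fobj K e)) (fobj L (fobj K f))"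
        using l(3) unfolding regular_bimorphism_def by blast
      then show "h' \<in> sandwich (ibi I'') (fobj ?M e) (fobj ?M f)"
        using M ef h(2) \<open>h \<in> elems (ibi I)\<close> by simp
    qed
    fix Y assume Y: "Y \<in> chains (ibi I)"
    then obtain p where p: "epath (ibi I) p" "Y = chain_of (ibi I) p" using B.chainsE by blast
    have maps: "map (fobj ?M) p = map (fobj L) (map (fobj K) p)"
      using p(1) M by (auto simp: epath_def)
    have "chain_map (ibi I'') (fobj ?M) Y = chain_map (ibi I'') (fobj L) (chain_map (ibi I') (fobj K) Y)"
      by (simp only: p(2) chain_map_chain_of[OF i''(1) b] chain_map_chain_of[OF i''(1) l(4)]
          chain_map_chain_of[OF i'(1) k(4)] maps)
    moreover have "chain_map (ibi I') (fobj K) Y \<in> chains (ibi I')"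
      using chain_map_chain_of[OF i'(1) k(4)] p B'.chain_of_in_chains bimorphism_epath[OF k(4)] by simp
    moreover have "fmor (iev I) Y \<in> Mor (igp I)"
      using is_functorD(6)[OF i(5)] Y by (simp add: B.chain_gpd_simps)
    ultimately show "fmor ?M (fmor (iev I) Y) = fmor (iev I'') (chain_map (ibi I'') (fobj ?M) Y)"
      using k(5)[OF Y] l(5) by (simp add: comp_ftor_simps)
  qed
qed

lemma category_IG: "category IG"
proof
  fix f :: "('e, 'm) igpd \<times> ('e, 'm, 'e, 'm) ftor \<times> ('e, 'm) igpd" assume f: "f \<in> Mor IG"
  obtain I K I' where f': "f = (I, K, I')" by (cases f)
  have i: "inductive_groupoid I" "inductive_groupoid I'" and k: "inductive_functor I I' K"
    using f f' by (simp_all add: IG_def)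
  note K = inductive_functorD(1)[OF k]
  show "Dom IG f \<in> Obj IG" "Cod IG f \<in> Obj IG"
    using i f' by (simp_all add: IG_def)
  show "idm IG (Dom IG f) \<cdot>\<^bsub>IG\<^esub> f = f" "f \<cdot>\<^bsub>IG\<^esub> idm IG (Cod IG f) = f"
    using f' comp_ftor_id[OF K] by (simp_all add: IG_def)
  fix g :: "('e, 'm) igpd \<times> ('e, 'm, 'e, 'm) ftor \<times> ('e, 'm) igpd"
  assume g: "g \<in> Mor IG" and fg: "Cod IG f = Dom IG g"
  obtain L I'' where g': "g = (I', L, I'')" using fg f' by (cases g) (auto simp: IG_def)
  have i'': "inductive_groupoid I''" and l: "inductive_functor I' I'' L"
    using g g' by (simp_all add: IG_def)
  show "f \<cdot>\<^bsub>IG\<^esub> g \<in> Mor IG" "Dom IG (f \<cdot>\<^bsub>IG\<^esub> g) = Dom IG f" "Cod IG (f \<cdot>\<^bsub>IG\<^esub> g) = Cod IG g"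
    using f' g' i i'' inductive_functor_comp[OF i i'' k l] by (simp_all add: IG_def)
  fix h :: "('e, 'm) igpd \<times> ('e, 'm, 'e, 'm) ftor \<times> ('e, 'm) igpd"
  assume h: "h \<in> Mor IG" and gh: "Cod IG g = Dom IG h"
  obtain M I''' where h': "h = (I'', M, I''')" using gh g' by (cases h) (auto simp: IG_def)
  have "inductive_functor I'' I''' M" using h h' by (simp add: IG_def)
  then show "f \<cdot>\<^bsub>IG\<^esub> g \<cdot>\<^bsub>IG\<^esub> h = f \<cdot>\<^bsub>IG\<^esub> (g \<cdot>\<^bsub>IG\<^esub> h)"
    using f' g' h' comp_ftor_assoc[OF K inductive_functorD(1)[OF l] inductive_functorD(1)]
    by (simp add: IG_def)
next
  fix I :: "('e, 'm) igpd" assume "I \<in> Obj IG"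
  then show "idm IG I \<in> Mor IG" "Dom IG (idm IG I) = I" "Cod IG (idm IG I) = I"
    using inductive_functor_id by (simp_all add: IG_def)
qed

lemma xconn_morphism_id:
  assumes "cross_connection X"
  shows "xconn_morphism X X (id_ftor (Ccat X)) (id_ftor (Dcat X))"
proof -
  interpret cross_conn X using assms by unfold_locales
  have "(fobj (id_ftor (Ccat X)) (fst e), fobj (id_ftor (Dcat X)) (snd e)) = e" if "e \<in> Eset X" for e
    using gam(6,7)[OF that] by (simp add: id_ftor_simps)
  moreover have "fmor (id_ftor (Ccat X)) (gam_cone X e c) = gam_cone X e (fobj (id_ftor (Ccat X)) c)"
    if "e \<in> Eset X" "c \<in> Obj (Ccat X)" for e c
    using gam_at(1)[OF that] that by (simp add: id_ftor_simps)
  moreover have "fmor (id_ftor (Dcat X)) (transpose X e e' f) = transpose X e e' (fmor (id_ftor (Ccat X)) f)"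
    if "e \<in> Eset X" "e' \<in> Eset X" "f \<in> Hom (Ccat X) (fst e) (fst e')" for e e' f
    using transpose(1)[OF that(1,2), of f] that(3) by (simp add: id_ftor_simps Hom_def)
  moreover have "inclusion_preserving (Ccat X) (Ccat X) (id_ftor (Ccat X))"
    "inclusion_preserving (Dcat X) (Dcat X) (id_ftor (Dcat X))"
    using C.incl_in_Mor D.incl_in_Mor by (auto simp: inclusion_preserving_def id_ftor_simps)
  ultimately show ?thesis
    unfolding xconn_morphism_def
    using is_functor_id[OF C.category_axioms] is_functor_id[OF D.category_axioms] by fastforce
qed

lemma xconn_morphism_comp:
  assumes "cross_connection X" "cross_connection X'" "cross_connection X''"
    and "xconn_morphism X X' F G" "xconn_morphism X' X'' F' G'"
  shows "xconn_morphism X X'' (comp_ftor (Ccat X) F F') (comp_ftor (Dcat X) G G')"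
proof -
  interpret m: xconn_mor X X' F G using assms by unfold_locales
  interpret n: xconn_mor X' X'' F' G' using assms by unfold_locales
  let ?F = "comp_ftor (Ccat X) F F'" and ?G = "comp_ftor (Dcat X) G G'"
  have \<theta>: "(fobj ?F (fst e), fobj ?G (snd e)) = n.\<theta> (m.\<theta> e)" if "e \<in> Eset X" for e
    using m.S.gam(6,7)[OF that] by (simp add: comp_ftor_simps)
  have "(fobj ?F (fst e), fobj ?G (snd e)) \<in> Eset X''" if "e \<in> Eset X" for e
    unfolding \<theta>[OF that] by (rule n.theta_Eset[OF m.theta_Eset[OF that]])
  moreover have "fmor ?F (gam_cone X e c) = gam_cone X'' (fobj ?F (fst e), fobj ?G (snd e)) (fobj ?F c)"
    if "e \<in> Eset X" "c \<in> Obj (Ccat X)" for e c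
    unfolding \<theta>[OF that(1)] using m.S.gam_at(1)[OF that] that m.gam_theta[OF that]
      n.gam_theta[OF m.theta_Eset[OF that(1)] m.F.K(5)[OF that(2)]] by (simp add: comp_ftor_simps)
  moreover have "fmor ?G (transpose X e e' f) =
      transpose X'' (fobj ?F (fst e), fobj ?G (snd e)) (fobj ?F (fst e'), fobj ?G (snd e')) (fmor ?F f)"
    if e: "e \<in> Eset X" "e' \<in> Eset X" and "f \<in> Hom (Ccat X) (fst e) (fst e')" for e e' f
  proof -
    have f: "f \<in> Mor (Ccat X)" "Dom (Ccat X) f = fst e" "Cod (Ccat X) f = fst e'"
      using that(3) by (simp_all add: Hom_def)
    show ?thesis
      unfolding \<theta>[OF e(1)] \<theta>[OF e(2)]
      using m.transpose_theta[OF e f] m.S.transpose(1)[OF e f] m.F.K(6-8)[OF f(1)] f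
        n.transpose_theta[OF m.theta_Eset[OF e(1)] m.theta_Eset[OF e(2)], of "fmor F f"]
      by (simp add: comp_ftor_simps)
  qed
  moreover have "inclusion_preserving (Ccat X) (Ccat X'') ?F" "inclusion_preserving (Dcat X) (Dcat X'') ?G"
    using m.F.K_incl n.F.K_incl m.G.K_incl n.G.K_incl m.S.C.incl_in_Mor m.S.D.incl_in_Mor
    unfolding inclusion_preserving_def by (auto simp: comp_ftor_simps image_subset_iff)
  ultimately show ?thesis
    unfolding xconn_morphism_def
    using is_functor_comp[OF m.F.K_functor n.F.K_functor] is_functor_comp[OF m.G.K_functor n.G.K_functor]
    by fastforce
qed

lemma xconn_morphismD:
  assumes "xconn_morphism X X' F G"
  shows "is_functor (Ccat X) (Ccat X') F" "is_functor (Dcat X) (Dcat X') G"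
  using assms by (simp_all add: xconn_morphism_def)

lemma category_CC: "category CC"
proof
  fix f :: "('co, 'cm, 'do, 'dm) xconn \<times> (('co, 'cm, 'co, 'cm) ftor \<times> ('do, 'dm, 'do, 'dm) ftor) \<times>
    ('co, 'cm, 'do, 'dm) xconn"
  assume f: "f \<in> Mor CC"
  obtain X F G X' where f': "f = (X, (F, G), X')" by (cases f) auto
  have x: "cross_connection X" "cross_connection X'" and m: "xconn_morphism X X' F G"
    using f f' by (simp_all add: CC_def)
  note fg = xconn_morphismD[OF m]
  show "Dom CC f \<in> Obj CC" "Cod CC f \<in> Obj CC"
    using x f' by (simp_all add: CC_def)
  show "idm CC (Dom CC f) \<cdot>\<^bsub>CC\<^esub> f = f" "f \<cdot>\<^bsub>CC\<^esub> idm CC (Cod CC f) = f"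
    using f' comp_ftor_id[OF fg(1)] comp_ftor_id[OF fg(2)] by (simp_all add: CC_def)
  fix g :: "('co, 'cm, 'do, 'dm) xconn \<times> (('co, 'cm, 'co, 'cm) ftor \<times> ('do, 'dm, 'do, 'dm) ftor) \<times>
    ('co, 'cm, 'do, 'dm) xconn"
  assume g: "g \<in> Mor CC" and "Cod CC f = Dom CC g"
  then obtain F' G' X'' where g': "g = (X', (F', G'), X'')" using f' by (cases g) (auto simp: CC_def)
  have x'': "cross_connection X''" and m': "xconn_morphism X' X'' F' G'"
    using g g' by (simp_all add: CC_def)
  show "f \<cdot>\<^bsub>CC\<^esub> g \<in> Mor CC" "Dom CC (f \<cdot>\<^bsub>CC\<^esub> g) = Dom CC f" "Cod CC (f \<cdot>\<^bsub>CC\<^esub> g) = Cod CC g"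
    using f' g' x x'' xconn_morphism_comp[OF x x'' m m'] by (simp_all add: CC_def)
  fix h :: "('co, 'cm, 'do, 'dm) xconn \<times> (('co, 'cm, 'co, 'cm) ftor \<times> ('do, 'dm, 'do, 'dm) ftor) \<times>
    ('co, 'cm, 'do, 'dm) xconn"
  assume h: "h \<in> Mor CC" and "Cod CC g = Dom CC h"
  then obtain F'' G'' X''' where h': "h = (X'', (F'', G''), X''')" using g' by (cases h) (auto simp: CC_def)
  have m'': "xconn_morphism X'' X''' F'' G''" using h h' by (simp add: CC_def)
  show "f \<cdot>\<^bsub>CC\<^esub> g \<cdot>\<^bsub>CC\<^esub> h = f \<cdot>\<^bsub>CC\<^esub> (g \<cdot>\<^bsub>CC\<^esub> h)"
    using f' g' h' comp_ftor_assoc[OF fg(1) xconn_morphismD(1)[OF m'] xconn_morphismD(1)[OF m'']]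
      comp_ftor_assoc[OF fg(2) xconn_morphismD(2)[OF m'] xconn_morphismD(2)[OF m'']]
    by (simp add: CC_def)
next
  fix X :: "('co, 'cm, 'do, 'dm) xconn" assume "X \<in> Obj CC"
  then show "idm CC X \<in> Mor CC" "Dom CC (idm CC X) = X" "Cod CC (idm CC X) = X"
    using xconn_morphism_id by (simp_all add: CC_def)
qed

section \<open>Functoriality\<close>

lemma restrict_mor_id:
  assumes "cross_connection X"
  shows "restrict_mor X (id_ftor (Ccat X), id_ftor (Dcat X)) = id_ftor (gpd_of X)"
proof -
  interpret xconn_mor X X "id_ftor (Ccat X)" "id_ftor (Dcat X)"
    using assms xconn_morphism_id[OF assms] by unfold_locales
  show ?thesis
  proof (rule ftor_eqI[OF R_functor is_functor_id[OF S.rep.category_G]])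
    fix e assume "e \<in> Obj (gpd_of X)"
    then show "fobj R e = fobj (id_ftor (gpd_of X)) e"
      using restrict_mor_simps(1) S.gam(6,7) by (simp add: gpd_of_simps(1) id_ftor_simps)
  next
    fix x assume "x \<in> Mor (gpd_of X)"
    then show "fmor R x = fmor (id_ftor (gpd_of X)) x"
      using restrict_mor_simps(2) gpd_mor_in by (simp add: gpd_of_simps(2) id_ftor_simps)
  qed
qed

lemma restrict_mor_comp:
  assumes x: "cross_connection X" "cross_connection X'" "cross_connection X''"
    and m: "xconn_morphism X X' F G" "xconn_morphism X' X'' F' G'"
  shows "restrict_mor X (comp_ftor (Ccat X) F F', comp_ftor (Dcat X) G G') =
    comp_ftor (gpd_of X) (restrict_mor X (F, G)) (restrict_mor X' (F', G'))"
proof -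
  interpret m: xconn_mor X X' F G using x m by unfold_locales
  interpret n: xconn_mor X' X'' F' G' using x m by unfold_locales
  interpret c: xconn_mor X X'' "comp_ftor (Ccat X) F F'" "comp_ftor (Dcat X) G G'"
    using x xconn_morphism_comp[OF x m] by unfold_locales
  show ?thesis
  proof (rule ftor_eqI[OF c.R_functor is_functor_comp[OF m.R_functor n.R_functor]])
    fix e assume "e \<in> Obj (gpd_of X)"
    then have e: "e \<in> Eset X" by (simp add: gpd_of_simps(1))
    show "fobj c.R e = fobj (comp_ftor (gpd_of X) m.R n.R) e"
      using e c.restrict_mor_simps(1)[OF e] m.restrict_mor_simps(1)[OF e]
        n.restrict_mor_simps(1)[OF m.theta_Eset[OF e]] m.S.gam(6,7)[OF e]
      by (simp add: gpd_of_simps(1) comp_ftor_simps)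
  next
    fix x assume "x \<in> Mor (gpd_of X)"
    then have x: "x \<in> gpd_mor X" by (simp add: gpd_of_simps(2))
    show "fmor c.R x = fmor (comp_ftor (gpd_of X) m.R n.R) x"
      using x c.restrict_mor_simps(2)[OF x] m.restrict_mor_simps(2)[OF x]
        n.restrict_mor_simps(2)[OF m.R_gpd_mor(1)[OF x]] m.gpd_mor_in[OF x]
      by (simp add: gpd_of_simps(2) comp_ftor_simps)
  qed
qed

theorem theorem3p9:
  shows "is_functor
    (CC :: (('co, 'cm, 'do, 'dm) xconn,
       ('co, 'cm, 'do, 'dm) xconn \<times> (('co, 'cm, 'co, 'cm) ftor \<times> ('do, 'dm, 'do, 'dm) ftor) \<times>
       ('co, 'cm, 'do, 'dm) xconn) cat)
    (IG :: (('co \<times> 'do, 'cm \<times> 'dm) igpd,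
       ('co \<times> 'do, 'cm \<times> 'dm) igpd \<times> ('co \<times> 'do, 'cm \<times> 'dm, 'co \<times> 'do, 'cm \<times> 'dm) ftor \<times>
       ('co \<times> 'do, 'cm \<times> 'dm) igpd) cat)
    I_functor"
proof -
  let ?CC = "CC :: (('co, 'cm, 'do, 'dm) xconn, _) cat"
  let ?IG = "IG :: (('co \<times> 'do, 'cm \<times> 'dm) igpd, _) cat"
  \<comment> \<open>The object and the morphism component of \<open>I_functor\<close> are polymorphic independently of each other.\<close>
  let ?I = "I_functor :: (('co, 'cm, 'do, 'dm) xconn,
    ('co, 'cm, 'do, 'dm) xconn \<times> (('co, 'cm, 'co, 'cm) ftor \<times> ('do, 'dm, 'do, 'dm) ftor) \<times>
      ('co, 'cm, 'do, 'dm) xconn,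
    ('co \<times> 'do, 'cm \<times> 'dm) igpd,
    ('co \<times> 'do, 'cm \<times> 'dm) igpd \<times> ('co \<times> 'do, 'cm \<times> 'dm, 'co \<times> 'do, 'cm \<times> 'dm) ftor \<times>
      ('co \<times> 'do, 'cm \<times> 'dm) igpd) ftor"
  have ind: "inductive_groupoid (igpd_of X)" if "cross_connection X"
    for X :: "('co, 'cm, 'do, 'dm) xconn"
    using cross_conn.inductive_groupoid_igpd_of[OF cross_conn.intro[OF that]] .
  have mor: "inductive_functor (igpd_of X) (igpd_of X') (restrict_mor X (F, G))"
    if "cross_connection X" "cross_connection X'" "xconn_morphism X X' F G"
    for X X' :: "('co, 'cm, 'do, 'dm) xconn" and F G
  proof -
    interpret xconn_mor X X' F G using that by unfold_locales
    show ?thesis by (rule R_inductive_functor)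
  qed
  have obj: "fobj ?I X = igpd_of X" if "cross_connection X" for X :: "('co, 'cm, 'do, 'dm) xconn"
    using that by (simp add: I_functor_def CC_def)
  have arr: "fmor ?I (X, (F, G), X') = (igpd_of X, restrict_mor X (F, G), igpd_of X')"
    if "cross_connection X" "cross_connection X'" "xconn_morphism X X' F G"
    for X X' :: "('co, 'cm, 'do, 'dm) xconn" and F G
    using that by (simp add: I_functor_def CC_def)
  have igp: "igp (igpd_of X) = gpd_of X" for X :: "('co, 'cm, 'do, 'dm) xconn"
    by (simp add: igpd_of_def)
  have MorE: "\<exists>X F G X'. f = (X, (F, G), X') \<and> cross_connection X \<and> cross_connection X' \<and>
      xconn_morphism X X' F G"
    if "f \<in> Mor CC" for f :: "('co, 'cm, 'do, 'dm) xconn \<times>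
      (('co, 'cm, 'co, 'cm) ftor \<times> ('do, 'dm, 'do, 'dm) ftor) \<times> ('co, 'cm, 'do, 'dm) xconn"
    using that by (cases f) (auto simp: CC_def)
  show ?thesis
    unfolding is_functor_def
  proof (intro conjI ballI impI)
    show "category ?CC" by (rule category_CC)
    show "category ?IG" by (rule category_IG)
    show "fobj ?I \<in> Obj ?CC \<rightarrow>\<^sub>E Obj ?IG"
      using ind by (auto simp: I_functor_def CC_def IG_def)
    show "fmor ?I \<in> Mor ?CC \<rightarrow>\<^sub>E Mor ?IG"
    proof (rule PiE_I)
      fix f assume "f \<in> Mor ?CC"
      then obtain X F G X' where "f = (X, (F, G), X')" "cross_connection X" "cross_connection X'"
        "xconn_morphism X X' F G"
        using MorE by blast
      then show "fmor ?I f \<in> Mor ?IG"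
        using arr ind mor by (simp add: IG_def)
    qed (simp add: I_functor_def)
  next
    fix f assume "f \<in> Mor ?CC"
    then obtain X F G X' where f: "f = (X, (F, G), X')" and x: "cross_connection X" "cross_connection X'"
      and m: "xconn_morphism X X' F G"
      using MorE by blast
    show "Dom ?IG (fmor ?I f) = fobj ?I (Dom ?CC f)"
      "Cod ?IG (fmor ?I f) = fobj ?I (Cod ?CC f)"
      using f arr[OF x m] obj x by (simp_all add: IG_def CC_def)
    fix g assume "g \<in> Mor ?CC" and fg: "Cod ?CC f = Dom ?CC g"
    then obtain X1 F' G' X'' where g1: "g = (X1, (F', G'), X'')" and x1: "cross_connection X1" "cross_connection X''"
      and m1: "xconn_morphism X1 X'' F' G'"
      using MorE by blast
    have "X1 = X'" using fg f g1 by (simp add: CC_def)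
    note g = g1[unfolded this] and x'' = x1(2) and m' = m1[unfolded this]
    have "f \<cdot>\<^bsub>?CC\<^esub> g = (X, (comp_ftor (Ccat X) F F', comp_ftor (Dcat X) G G'), X'')"
      using f g by (simp add: CC_def)
    then show "fmor ?I (f \<cdot>\<^bsub>?CC\<^esub> g) = fmor ?I f \<cdot>\<^bsub>?IG\<^esub> fmor ?I g"
      using arr[OF x(1) x'' xconn_morphism_comp[OF x x'' m m']] arr[OF x m] arr[OF x(2) x'' m'] f g
        restrict_mor_comp[OF x x'' m m'] by (simp add: IG_def igp)
  next
    fix X assume "X \<in> Obj ?CC"
    then have x: "cross_connection X" by (simp add: CC_def)
    have "idm ?CC X = (X, (id_ftor (Ccat X), id_ftor (Dcat X)), X)"
      by (simp add: CC_def)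
    then show "fmor ?I (idm ?CC X) = idm ?IG (fobj ?I X)"
      using arr[OF x x xconn_morphism_id[OF x]] obj[OF x] restrict_mor_id[OF x] by (simp add: IG_def igp)
  qed
qed

end
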